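(* (1) Let $H\in\mathbb{R}$, $\alpha\in\{-1,1\}$, and let $u$ be a smooth function on an open simply connected set $\Omega\subseteq\mathbb{R}^2$ satisfying $$\Delta_0u=e^{-2u}(\alpha H+2e^{6u}),\qquad \Delta_0=\partial_1^2-\partial_2^2.$$ Then there exists an immersion $f_u:\Omega\to\mathbb{R}^3$ such that $(\Omega,f_u)$ is an affine sphere with affine mean curvature $H$ and indefinite affine metric $h$, and with $h(C,C)=16\alpha e^{6u}$. In the standard coordinates $(x_1,x_2)$ on $\Omega$ its affine metric $h$, difference tensor $K$ and Blaschke connection $\nabla$ are given by $$h=\alpha e^{-2u}\big((dx_1)^2-(dx_2)^2\big),$$ $$K(\partial_1,\partial_1)=e^{2u}\partial_1,\quad K(\partial_2,\partial_2)=e^{2u}\partial_1,\quad K(\partial_1,\partial_2)=-e^{2u}\partial_2,$$ $$\nabla_{\partial_1}\partial_1=(-\partial_1u+e^{2u})\partial_1-\partial_2u\,\partial_2,\quad \nabla_{\partial_1}\partial_2=-\partial_2u\,\partial_1-(\partial_1u+e^{2u})\partial_2,\quad \nabla_{\partial_2}\partial_2=(-\partial_1u+e^{2u})\partial_1-\partial_2u\,\partial_2.$$ (2) Let $(M,f)$ be an affine surface with indefinite affine metric, with its induced Blaschke structure, which is an affine sphere with affine mean curvature $H$. Then $M=U\cup\overline V=\overline U\cup V$, where $U,V$ are open subsets of $M$ such that $U\cap V=\emptyset$, $U\subseteq\{x:h(C,C)=0\}$ and $V=\{x:h(C,C)\neq0\}$. Around any point $x_0\in V$ there exists a local chart $(W,x_1,x_2)$,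 with $\gamma(p)=(x_1(p),x_2(p))$ and $\alpha=\mathrm{sgn}\,h(C,C)$, such that the function $u=\frac13\ln\lambda\circ\gamma^{-1}$, where $\lambda=\frac14\sqrt{\alpha h(C,C)}$, satisfies $\Delta_0u=e^{-2u}(\alpha H+2e^{6u})$ on $\gamma(W)$, and $(W,f)$ is equiaffinely equivalent to the affine sphere $(\gamma(W),f_u)$ described in (1). Moreover $U=U_0\cup U_1$, where $U_0=\mathrm{int}\{x:K_x=0\}$ and $U_1=\{x:K_x\neq0\}\cap\{x:h(C,C)=0\}$. The surface $(U_0,f)$ is a nonconvex quadric, and the surface $(U_1,f)$ is locally equiaffinely equivalent to one of the following surfaces: (a) (case $H\ne0$) $f(z_1,z_2)=\frac1H\big(\partial_2u(z_1,z_2)\,\xi(z_2)-\xi'(z_2)\big)$, where $u$ satisfies $\partial_1\partial_2u=He^{-u}$ and $\xi:\mathbb{R}\to\mathbb{R}^3$ is a smooth curve satisfying $\xi'''=a\xi'+b\xi$ with initial condition $\det(\xi,\xi',\xi'')_0=H$, for some smooth functions $a,b$ with $a'-2b=2H$; (b) (case $H=0$) the graph of a function $z(x,y)=xy+\varphi(y)$, where $\varphi$ is a smooth function with $\varphi'''\neq0$.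
   Context: Let $M$ be a smooth 2-dimensional manifold, $f:M\to\mathbb{R}^3$ a nondegenerate immersion, $D$ the standard flat connection on $\mathbb{R}^3$. For a transversal field $\xi$ write $D_Xf_*Y=f_*(\nabla_XY)+h(X,Y)\xi$; $\xi$ is equiaffine if $D_X\xi=-f_*(SX)$. Then $(\nabla,h,S)$ is the induced equiaffine structure, $h$ (nondegenerate) the affine metric, $S$ the shape operator. $\hat\nabla$ is the Levi-Civita connection of $h$, $K(X,Y)=\nabla_XY-\hat\nabla_XY$ the difference tensor, $C=\nabla h$ the cubic form, and $h(C,C)=\sum h^{ip}h^{jq}h^{kr}C_{ijk}C_{pqr}$. The Blaschke structure is the one induced by the affine normal; it is characterized by $\mathrm{tr}_hK=0$ together with $|\det(f_*X_1,f_*X_2,\xi)|=|\det(h(X_i,X_j))|^{1/2}$. The affine mean curvature is $H=\frac12\mathrm{tr}\,S$. $(M,f)$ is an affine sphere if its Blaschke shape operator is $S=H\,\mathrm{Id}$ with $H\in\mathbb{R}$ constant. A nonconvex quadric means (locally) an open part of a nondegenerate quadric surface in $\mathbb{R}^3$ with indefinite affine metric. Write $\partial_i=\partial/\partial x_i$ (or $\partial/\partial z_i$ when the coordinates are called $z_i$). In (2)(a) the letters $u,\xi$ denote a function and a curve, not the function $u$ of (1) or the affine normal. Surfaces $(M,f)$ and $(N,g)$ are equiaffinely equivalent if there exist a diffeomorphism $\phi:M\to N$ and an affine transformation $A\in\mathrm{ASL}(3)$ with $g\circ\phi=A\circ f$.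
   Formalization: The false clause that M is the closure of U together with V is dropped; U_1 is the interior of {K≠0}∩{h(C,C)=0}; U=U_0∪U_1 becomes U_0∪U_1 contained and dense in U; the equivalence of U_1 to (a) or (b) holds for f or its mirror image -f, as both families have one fixed chirality. *)

theory Defs
  imports "HOL-Analysis.Analysis"
begin

section \<open>Smooth maps and partial derivatives\<close>

text \<open>For open \<open>S\<close> in a finite-dimensional space, \<open>Ck_on k S f\<close> says that \<open>f\<close> is of class
  $C^k$ on \<open>S\<close>.\<close>

primrec Ck_on ::
  "nat \<Rightarrow> 'a::real_normed_vector set \<Rightarrow> ('a \<Rightarrow> 'b::real_normed_vector) \<Rightarrow> bool" where
  "Ck_on 0 S f \<longleftrightarrow> continuous_on S f"
| "Ck_on (Suc k) S f \<longleftrightarrow> (\<forall>x\<in>S. f differentiable (at x)) \<and>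
     (\<forall>v. Ck_on k S (\<lambda>x. frechet_derivative f (at x) v))"

definition smooth_on ::
  "'a::real_normed_vector set \<Rightarrow> ('a \<Rightarrow> 'b::real_normed_vector) \<Rightarrow> bool" where
  "smooth_on S f \<longleftrightarrow> (\<forall>k. Ck_on k S f)"

definition pd :: "2 \<Rightarrow> (real^2 \<Rightarrow> 'b::real_normed_vector) \<Rightarrow> real^2 \<Rightarrow> 'b" where
  "pd i F x = frechet_derivative F (at x) (axis i 1)"

definition wave_op :: "(real^2 \<Rightarrow> real) \<Rightarrow> real^2 \<Rightarrow> real" where
  "wave_op u x = pd 1 (pd 1 u) x - pd 2 (pd 2 u) x"

definition vd :: "(real \<Rightarrow> 'b::real_normed_vector) \<Rightarrow> real \<Rightarrow> 'b" where
  "vd c t = vector_derivative c (at t)"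

section \<open>Affine surface theory in a coordinate domain\<close>

text \<open>Throughout, \<open>F\<close> is the position vector and \<open>\<xi>\<close> the transversal field, both expressed in
  local coordinates. The three coefficients of a vector in the frame
  $(\partial_1 F, \partial_2 F, \xi)$ give its tangential and its transversal part.\<close>

definition frame_det :: "(real^2 \<Rightarrow> real^3) \<Rightarrow> (real^2 \<Rightarrow> real^3) \<Rightarrow> real^2 \<Rightarrow> real" where
  "frame_det F \<xi> x = det (vector [pd 1 F x, pd 2 F x, \<xi> x] :: real^3^3)"

definition frame_coeffs ::
  "(real^2 \<Rightarrow> real^3) \<Rightarrow> (real^2 \<Rightarrow> real^3) \<Rightarrow> real^2 \<Rightarrow> real^3 \<Rightarrow> real^3" where
  "frame_coeffs F \<xi> x w =
     (THE c. w = c $ 1 *\<^sub>R pd 1 F x + c $ 2 *\<^sub>R pd 2 F x + c $ 3 *\<^sub>R \<xi> x)"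

definition tangential :: "real^3 \<Rightarrow> real^2" where
  "tangential c = vector [c $ 1, c $ 2]"

text \<open>Gauss formula: $D_{\partial_i} f_*\partial_j = f_*(\nabla_{\partial_i}\partial_j)
  + h(\partial_i,\partial_j)\,\xi$. Tangent vectors are given by their components with respect
  to the coordinate fields.\<close>

definition aff_metric ::
  "(real^2 \<Rightarrow> real^3) \<Rightarrow> (real^2 \<Rightarrow> real^3) \<Rightarrow> real^2 \<Rightarrow> real^2^2" where
  "aff_metric F \<xi> x = (\<chi> i j. frame_coeffs F \<xi> x (pd i (pd j F) x) $ 3)"

definition aff_conn ::
  "(real^2 \<Rightarrow> real^3) \<Rightarrow> (real^2 \<Rightarrow> real^3) \<Rightarrow> 2 \<Rightarrow> 2 \<Rightarrow> real^2 \<Rightarrow> real^2" where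
  "aff_conn F \<xi> i j x = tangential (frame_coeffs F \<xi> x (pd i (pd j F) x))"

text \<open>Weingarten formula: $D_{\partial_i}\xi = -f_*(S\partial_i)$ for equiaffine \<open>\<xi>\<close>.\<close>

definition equiaffine_at :: "(real^2 \<Rightarrow> real^3) \<Rightarrow> (real^2 \<Rightarrow> real^3) \<Rightarrow> real^2 \<Rightarrow> bool" where
  "equiaffine_at F \<xi> x \<longleftrightarrow> (\<forall>i. frame_coeffs F \<xi> x (pd i \<xi> x) $ 3 = 0)"

definition shape_op ::
  "(real^2 \<Rightarrow> real^3) \<Rightarrow> (real^2 \<Rightarrow> real^3) \<Rightarrow> 2 \<Rightarrow> real^2 \<Rightarrow> real^2" where
  "shape_op F \<xi> i x = - tangential (frame_coeffs F \<xi> x (pd i \<xi> x))"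

definition mean_curv :: "(real^2 \<Rightarrow> real^3) \<Rightarrow> (real^2 \<Rightarrow> real^3) \<Rightarrow> real^2 \<Rightarrow> real" where
  "mean_curv F \<xi> x = (1/2) * (\<Sum>i\<in>UNIV. shape_op F \<xi> i x $ i)"

text \<open>The Levi-Civita connection at \<open>x\<close>: the unique torsion-free $G$ with
  $\partial_k g_{ij} = g(G_{ki},\partial_j) + g(\partial_i,G_{kj})$.\<close>

definition levi_civita :: "(real^2 \<Rightarrow> real^2^2) \<Rightarrow> 2 \<Rightarrow> 2 \<Rightarrow> real^2 \<Rightarrow> real^2" where
  "levi_civita g i j x = (THE G :: 2 \<Rightarrow> 2 \<Rightarrow> real^2.
     (\<forall>i j. G i j = G j i) \<and>
     (\<forall>i j k. pd k (\<lambda>y. g y $ i $ j) x =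
        (\<Sum>l\<in>UNIV. G k i $ l * g x $ l $ j + G k j $ l * g x $ i $ l))) i j"

definition diff_tensor ::
  "(real^2 \<Rightarrow> real^3) \<Rightarrow> (real^2 \<Rightarrow> real^3) \<Rightarrow> 2 \<Rightarrow> 2 \<Rightarrow> real^2 \<Rightarrow> real^2" where
  "diff_tensor F \<xi> i j x = aff_conn F \<xi> i j x - levi_civita (aff_metric F \<xi>) i j x"

definition cubic_form ::
  "(real^2 \<Rightarrow> real^3) \<Rightarrow> (real^2 \<Rightarrow> real^3) \<Rightarrow> 2 \<Rightarrow> 2 \<Rightarrow> 2 \<Rightarrow> real^2 \<Rightarrow> real" where
  "cubic_form F \<xi> i j k x = pd i (\<lambda>y. aff_metric F \<xi> y $ j $ k) x -
     (\<Sum>l\<in>UNIV. aff_conn F \<xi> i j x $ l * aff_metric F \<xi> x $ l $ k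
       + aff_conn F \<xi> i k x $ l * aff_metric F \<xi> x $ j $ l)"

definition cubic_norm :: "(real^2 \<Rightarrow> real^3) \<Rightarrow> (real^2 \<Rightarrow> real^3) \<Rightarrow> real^2 \<Rightarrow> real" where
  "cubic_norm F \<xi> x = (let h' = matrix_inv (aff_metric F \<xi> x) in
     \<Sum>i\<in>UNIV. \<Sum>j\<in>UNIV. \<Sum>k\<in>UNIV. \<Sum>p\<in>UNIV. \<Sum>q\<in>UNIV. \<Sum>r\<in>UNIV.
       h' $ i $ p * h' $ j $ q * h' $ k $ r * cubic_form F \<xi> i j k x * cubic_form F \<xi> p q r x)"

text \<open>\<open>\<xi>\<close> is the affine normal of the nondegenerate immersion \<open>F\<close>. A nonzero \<open>frame_det\<close> says
  that \<open>F\<close> is an immersion and that \<open>\<xi>\<close> is transversal. The affine normal is determined only up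
  to sign, so it is part of the data; replacing \<open>\<xi>\<close> by \<open>- \<xi>\<close> changes the signs of
  $h$, $S$, $H$ and $h(C,C)$.\<close>

definition blaschke_at :: "(real^2 \<Rightarrow> real^3) \<Rightarrow> (real^2 \<Rightarrow> real^3) \<Rightarrow> real^2 \<Rightarrow> bool" where
  "blaschke_at F \<xi> x \<longleftrightarrow>
     frame_det F \<xi> x \<noteq> 0 \<and>
     det (aff_metric F \<xi> x) \<noteq> 0 \<and>
     equiaffine_at F \<xi> x \<and>
     (\<Sum>i\<in>UNIV. \<Sum>j\<in>UNIV. matrix_inv (aff_metric F \<xi> x) $ i $ j *\<^sub>R diff_tensor F \<xi> i j x) = 0 \<and>
     \<bar>frame_det F \<xi> x\<bar> = sqrt \<bar>det (aff_metric F \<xi> x)\<bar>"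

definition indefinite_at :: "(real^2 \<Rightarrow> real^3) \<Rightarrow> (real^2 \<Rightarrow> real^3) \<Rightarrow> real^2 \<Rightarrow> bool" where
  "indefinite_at F \<xi> x \<longleftrightarrow>
     (\<exists>v w. v \<bullet> (aff_metric F \<xi> x *v v) > 0 \<and> w \<bullet> (aff_metric F \<xi> x *v w) < 0)"

section \<open>Smooth surfaces\<close>

type_synonym 'a chart = "'a set \<times> ('a \<Rightarrow> real^2)"

definition in_chart :: "'a chart \<Rightarrow> ('a \<Rightarrow> 'b) \<Rightarrow> real^2 \<Rightarrow> 'b" where
  "in_chart c f = f \<circ> inv_into (fst c) (snd c)"

definition chart_on :: "'a topology \<Rightarrow> 'a chart \<Rightarrow> bool" where
  "chart_on M c \<longleftrightarrow> openin M (fst c) \<and> open (snd c ` fst c) \<and>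
     homeomorphic_map (subtopology M (fst c)) (top_of_set (snd c ` fst c)) (snd c)"

definition chart_compatible :: "'a chart \<Rightarrow> 'a chart \<Rightarrow> bool" where
  "chart_compatible c d \<longleftrightarrow> smooth_on (snd c ` (fst c \<inter> fst d)) (in_chart c (snd d))"

definition smooth_surface :: "'a topology \<Rightarrow> 'a chart set \<Rightarrow> bool" where
  "smooth_surface M A \<longleftrightarrow> Hausdorff_space M \<and> second_countable M \<and>
     topspace M = (\<Union>c\<in>A. fst c) \<and> (\<forall>c\<in>A. chart_on M c) \<and>
     (\<forall>c\<in>A. \<forall>d\<in>A. chart_compatible c d)"

text \<open>Charts of the maximal atlas containing \<open>A\<close>.\<close>

definition local_chart :: "'a topology \<Rightarrow> 'a chart set \<Rightarrow> 'a chart \<Rightarrow> bool" where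
  "local_chart M A c \<longleftrightarrow> chart_on M c \<and>
     (\<forall>d\<in>A. chart_compatible c d \<and> chart_compatible d c)"

definition restrict_atlas :: "'a chart set \<Rightarrow> 'a set \<Rightarrow> 'a chart set" where
  "restrict_atlas A W = (\<lambda>c. (fst c \<inter> W, snd c)) ` A"

definition std_atlas :: "(real^2) set \<Rightarrow> (real^2) chart set" where
  "std_atlas \<Omega> = {(\<Omega>, \<lambda>x. x)}"

definition smooth_map :: "'a chart set \<Rightarrow> 'b chart set \<Rightarrow> ('a \<Rightarrow> 'b) \<Rightarrow> bool" where
  "smooth_map A B \<phi> \<longleftrightarrow> (\<forall>c\<in>A. \<forall>d\<in>B.
     smooth_on (snd c ` {p \<in> fst c. \<phi> p \<in> fst d}) (in_chart c (snd d \<circ> \<phi>)))"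

definition diffeomorphism ::
  "'a topology \<Rightarrow> 'a chart set \<Rightarrow> 'b topology \<Rightarrow> 'b chart set \<Rightarrow> ('a \<Rightarrow> 'b) \<Rightarrow> bool" where
  "diffeomorphism M A N B \<phi> \<longleftrightarrow>
     (\<exists>\<psi>. homeomorphic_maps M N \<phi> \<psi> \<and> smooth_map A B \<phi> \<and> smooth_map B A \<psi>)"

definition equiaff_equiv ::
  "'a topology \<Rightarrow> 'a chart set \<Rightarrow> ('a \<Rightarrow> real^3) \<Rightarrow>
   'b topology \<Rightarrow> 'b chart set \<Rightarrow> ('b \<Rightarrow> real^3) \<Rightarrow> bool" where
  "equiaff_equiv M A f N B g \<longleftrightarrow>
     (\<exists>\<phi> (L :: real^3^3) t. diffeomorphism M A N B \<phi> \<and> det L = 1 \<and>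
        (\<forall>p\<in>topspace M. g (\<phi> p) = L *v f p + t))"

section \<open>Affine surfaces\<close>

definition blaschke_surface ::
  "'a topology \<Rightarrow> 'a chart set \<Rightarrow> ('a \<Rightarrow> real^3) \<Rightarrow> ('a \<Rightarrow> real^3) \<Rightarrow> bool" where
  "blaschke_surface M A f \<xi> \<longleftrightarrow> smooth_surface M A \<and>
     (\<forall>c\<in>A. smooth_on (snd c ` fst c) (in_chart c f) \<and> smooth_on (snd c ` fst c) (in_chart c \<xi>) \<and>
        (\<forall>x \<in> snd c ` fst c. blaschke_at (in_chart c f) (in_chart c \<xi>) x))"

definition indefinite_surface ::
  "'a chart set \<Rightarrow> ('a \<Rightarrow> real^3) \<Rightarrow> ('a \<Rightarrow> real^3) \<Rightarrow> bool" where
  "indefinite_surface A f \<xi> \<longleftrightarrow>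
     (\<forall>c\<in>A. \<forall>x \<in> snd c ` fst c. indefinite_at (in_chart c f) (in_chart c \<xi>) x)"

definition affine_sphere ::
  "real \<Rightarrow> 'a topology \<Rightarrow> 'a chart set \<Rightarrow> ('a \<Rightarrow> real^3) \<Rightarrow> ('a \<Rightarrow> real^3) \<Rightarrow> bool" where
  "affine_sphere H M A f \<xi> \<longleftrightarrow> blaschke_surface M A f \<xi> \<and>
     (\<forall>c\<in>A. \<forall>x \<in> snd c ` fst c.
        mean_curv (in_chart c f) (in_chart c \<xi>) x = H \<and>
        (\<forall>i. shape_op (in_chart c f) (in_chart c \<xi>) i x = H *\<^sub>R axis i 1))"

text \<open>The scalar $h(C,C)$ and the condition $K_p = 0$ do not depend on the chart, so they are
  evaluated in an arbitrary chart around \<open>p\<close>.\<close>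

definition chart_at :: "'a chart set \<Rightarrow> 'a \<Rightarrow> 'a chart" where
  "chart_at A p = (SOME c. c \<in> A \<and> p \<in> fst c)"

definition hCC :: "'a chart set \<Rightarrow> ('a \<Rightarrow> real^3) \<Rightarrow> ('a \<Rightarrow> real^3) \<Rightarrow> 'a \<Rightarrow> real" where
  "hCC A f \<xi> p = (let c = chart_at A p in
     cubic_norm (in_chart c f) (in_chart c \<xi>) (snd c p))"

definition K_zero :: "'a chart set \<Rightarrow> ('a \<Rightarrow> real^3) \<Rightarrow> ('a \<Rightarrow> real^3) \<Rightarrow> 'a \<Rightarrow> bool" where
  "K_zero A f \<xi> p \<longleftrightarrow> (let c = chart_at A p in
     \<forall>i j. diff_tensor (in_chart c f) (in_chart c \<xi>) i j (snd c p) = 0)"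

text \<open>Nondegenerate quadrics: the symmetric $4 \times 4$ matrix with blocks
  $A$, $b$, $b^T$, $c$ has trivial kernel.\<close>

definition nondegenerate_quadric :: "(real^3) set \<Rightarrow> bool" where
  "nondegenerate_quadric Q \<longleftrightarrow> (\<exists>(A :: real^3^3) b c. transpose A = A \<and>
     (\<forall>x t. A *v x + t *\<^sub>R b = 0 \<and> b \<bullet> x + t * c = 0 \<longrightarrow> x = 0 \<and> t = 0) \<and>
     Q = {x. x \<bullet> (A *v x) + 2 * (b \<bullet> x) + c = 0})"

definition nonconvex_quadric ::
  "'a topology \<Rightarrow> 'a chart set \<Rightarrow> ('a \<Rightarrow> real^3) \<Rightarrow> ('a \<Rightarrow> real^3) \<Rightarrow> bool" where
  "nonconvex_quadric M A f \<xi> \<longleftrightarrow> blaschke_surface M A f \<xi> \<and> indefinite_surface A f \<xi> \<and>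
     (\<forall>p\<in>topspace M. \<exists>W Q. openin M W \<and> p \<in> W \<and> inj_on f W \<and>
        nondegenerate_quadric Q \<and> openin (top_of_set Q) (f ` W))"

section \<open>The model surfaces\<close>

text \<open>The affine sphere $(\Omega, f_u)$; \<open>\<xi>\<close> is its affine normal.\<close>

definition sphere_of ::
  "real \<Rightarrow> real \<Rightarrow> (real^2) set \<Rightarrow> (real^2 \<Rightarrow> real) \<Rightarrow>
   (real^2 \<Rightarrow> real^3) \<Rightarrow> (real^2 \<Rightarrow> real^3) \<Rightarrow> bool" where
  "sphere_of H \<alpha> \<Omega> u F \<xi> \<longleftrightarrow>
     affine_sphere H (top_of_set \<Omega>) (std_atlas \<Omega>) F \<xi> \<and>
     indefinite_surface (std_atlas \<Omega>) F \<xi> \<and>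
     (\<forall>x\<in>\<Omega>. let E = exp (2 * u x); u1 = pd 1 u x; u2 = pd 2 u x in
        cubic_norm F \<xi> x = 16 * \<alpha> * exp (6 * u x) \<and>
        aff_metric F \<xi> x =
          vector [vector [\<alpha> * exp (- 2 * u x), 0], vector [0, - (\<alpha> * exp (- 2 * u x))]] \<and>
        diff_tensor F \<xi> 1 1 x = vector [E, 0] \<and>
        diff_tensor F \<xi> 2 2 x = vector [E, 0] \<and>
        diff_tensor F \<xi> 1 2 x = vector [0, - E] \<and>
        aff_conn F \<xi> 1 1 x = vector [- u1 + E, - u2] \<and>
        aff_conn F \<xi> 1 2 x = vector [- u2, - (u1 + E)] \<and>
        aff_conn F \<xi> 2 2 x = vector [- u1 + E, - u2])"

definition ruled_proper_model :: "real \<Rightarrow> (real^2) set \<Rightarrow> (real^2 \<Rightarrow> real^3) \<Rightarrow> bool" where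
  "ruled_proper_model H \<Omega> F \<longleftrightarrow> open \<Omega> \<and>
     (\<exists>(u :: real^2 \<Rightarrow> real) (\<xi> :: real \<Rightarrow> real^3) (a :: real \<Rightarrow> real) (b :: real \<Rightarrow> real).
        smooth_on \<Omega> u \<and> smooth_on UNIV \<xi> \<and> smooth_on UNIV a \<and> smooth_on UNIV b \<and>
        (\<forall>z\<in>\<Omega>. pd 1 (pd 2 u) z = H * exp (- u z)) \<and>
        (\<forall>t. vd (vd (vd \<xi>)) t = a t *\<^sub>R vd \<xi> t + b t *\<^sub>R \<xi> t) \<and>
        det (vector [\<xi> 0, vd \<xi> 0, vd (vd \<xi>) 0] :: real^3^3) = H \<and>
        (\<forall>t. vd a t - 2 * b t = 2 * H) \<and>
        (\<forall>z\<in>\<Omega>. F z = (1 / H) *\<^sub>R (pd 2 u z *\<^sub>R \<xi> (z $ 2) - vd \<xi> (z $ 2))))"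

definition ruled_improper_model :: "(real^2) set \<Rightarrow> (real^2 \<Rightarrow> real^3) \<Rightarrow> bool" where
  "ruled_improper_model \<Omega> F \<longleftrightarrow> open \<Omega> \<and>
     (\<exists>(J :: real set) (\<phi> :: real \<Rightarrow> real). open J \<and> is_interval J \<and> (\<forall>z\<in>\<Omega>. z $ 2 \<in> J) \<and>
        smooth_on J \<phi> \<and> (\<forall>y\<in>J. vd (vd (vd \<phi>)) y \<noteq> 0) \<and>
        (\<forall>z\<in>\<Omega>. F z = vector [z $ 1, z $ 2, z $ 1 * z $ 2 + \<phi> (z $ 2)]))"

text \<open>Both ruled families have a fixed chirality: for rulings of direction $d(s)$ through $c(s)$,
  the sign of $\det(d,d',c')$ is negative, and it is invariant under affine maps of determinant 1
  (the mirror image $(x, y, -xy + y^3)$ has the other sign). As $|{\det}(f_1,f_2,\xi)|$ enters the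
  Blaschke condition only in absolute value, both chiralities occur among affine spheres, so
  equivalence to a ruled model is taken for \<open>f\<close> or for its mirror image \<open>- f\<close>.\<close>

definition equiaff_equiv_or_mirror ::
  "'a topology \<Rightarrow> 'a chart set \<Rightarrow> ('a \<Rightarrow> real^3) \<Rightarrow>
   'b topology \<Rightarrow> 'b chart set \<Rightarrow> ('b \<Rightarrow> real^3) \<Rightarrow> bool" where
  "equiaff_equiv_or_mirror M A f N B g \<longleftrightarrow>
     equiaff_equiv M A f N B g \<or> equiaff_equiv M A (\<lambda>p. - f p) N B g"

text \<open>The partition of an indefinite affine sphere. With $Z = \{h(C,C) = 0\}$, the set
  $\{K \neq 0\} \cap Z$ need not be open, so \<open>U1_part\<close> is its interior; then \<open>U0_part\<close> and \<open>U1_part\<close>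
  are open surfaces filling the interior of $Z$ up to a nowhere dense set. The graph of
  $xy + y^4$ (with $Z$ everything and $K = 0$ exactly on $y = 0$) shows that this set can be
  nonempty, and \<open>(s + t\<^sup>3/6, s\<^sup>2/2 + t, -s\<^sup>3/6 - s t + s\<^sup>2 t\<^sup>3/12 - t\<^sup>4/12)\<close> for $|s|,|t|<1$
  (with $Z = \{t = 0\}$) that $Z$ can be nowhere dense, so that $M = \overline U \cup V$ fails
  for every open $U \subseteq Z$.\<close>

definition V_part ::
  "'a topology \<Rightarrow> 'a chart set \<Rightarrow> ('a \<Rightarrow> real^3) \<Rightarrow> ('a \<Rightarrow> real^3) \<Rightarrow> 'a set" where
  "V_part M A f \<xi> = {p \<in> topspace M. hCC A f \<xi> p \<noteq> 0}"

definition U0_part ::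
  "'a topology \<Rightarrow> 'a chart set \<Rightarrow> ('a \<Rightarrow> real^3) \<Rightarrow> ('a \<Rightarrow> real^3) \<Rightarrow> 'a set" where
  "U0_part M A f \<xi> = M interior_of {p \<in> topspace M. K_zero A f \<xi> p}"

definition U1_part ::
  "'a topology \<Rightarrow> 'a chart set \<Rightarrow> ('a \<Rightarrow> real^3) \<Rightarrow> ('a \<Rightarrow> real^3) \<Rightarrow> 'a set" where
  "U1_part M A f \<xi> = M interior_of
     ({p \<in> topspace M. \<not> K_zero A f \<xi> p} \<inter> {p \<in> topspace M. hCC A f \<xi> p = 0})"

end

theory Submission
  imports Defs "HOL-Complex_Analysis.Riemann_Mapping"
begin

text \<open>The proof rests on moving frames of null vectors (\<open>null_frame\<close>). On an indefinite affine sphere choose locally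
  vector fields \<open>X\<close>, \<open>Y\<close> along the two null directions of the affine metric with $h(X,Y) = 1$, and let \<open>\<theta>\<close>, \<open>\<omega>\<close> be
  the dual one-forms. Apolarity of the cubic form leaves the structure equations
  $$dF = \theta X + \omega Y,\quad d\xi = - H(\theta X + \omega Y),\quad dX = pX + a\theta Y + \omega\xi,\quad
    dY = b\omega X - pY + \theta\xi$$
  with a one-form \<open>p\<close> and two functions \<open>a\<close>, \<open>b\<close>. All Blaschke invariants are algebraic in these data: $K = 0$
  means $a = b = 0$, and $h(C,C) = 8ab$. The integrability conditions are $d\theta = - p\wedge\theta$,
  $d\omega = p\wedge\omega$, $dp = (H + ab)\,\theta\wedge\omega$, $da\wedge\theta = 3a\,p\wedge\theta$ and
  $db\wedge\omega = - 3b\,p\wedge\omega$. Rescaling \<open>X\<close> by \<open>l\<close> and \<open>Y\<close> by \<open>1/l\<close> multiplies \<open>a\<close> by $l^3$ and \<open>b\<close>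
  by $l^{-3}$. Such frames exist near every point (\<open>null_frame_of_sphere\<close>).

  Conversely, forms that satisfy these conditions on a simply connected domain belong to a surface
  (\<open>null_frame_from_forms\<close>). The equations are a flat linear system. On a star-shaped domain it is solved along the rays
  from the origin (\<open>flat_system_star\<close>), and by the Riemann mapping theorem every simply connected plane domain is
  diffeomorphic to a star-shaped one. For the forms attached to a function \<open>u\<close> in isothermal coordinates all
  conditions reduce to the wave equation of the theorem; this is the existence statement (\<open>sphere_of_exists\<close>).

  Where $ab \neq 0$, rescale the frame such that \<open>b\<close> becomes $\pm\frac12$. Then the Codazzi equations make $\omega$ and
  $a^{1/3}\theta$ closed, their potentials are null coordinates, and the frame is the one of the model (\<open>V_chart\<close>).

  In the interior of $\{h(C,C) = 0\}$ there are two cases. If $a = b = 0$, then for $H = 0$ the equations integrate to the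
  graph of \<open>xy\<close>, and for $H \neq 0$ the symmetric tensor
  $X \otimes Y + Y \otimes X + \frac1H \xi \otimes \xi$ is constant, which puts the surface on a central quadric
  (\<open>U0_quadric_patch\<close>). If, after interchanging \<open>X\<close> and \<open>Y\<close>, only \<open>b\<close> vanishes, then \<open>Y\<close> keeps its direction
  along the curves $\theta = 0$, and the surface is ruled by them. For $H = 0$ the frame can be rescaled
  to $p = 0$, and integrating the equations gives the graph of $xy + \varphi(y)$ (\<open>U1_improper\<close>). For $H \neq 0$ rescale
  to $a = 1$; then $\theta = dz_2$ and $p = - v\,dz_2$, and the Gauss equation permits a coordinate $z_1$ in which
  $v = \partial_2 u$ for a solution of Liouville's equation. The field \<open>Y\<close> depends on $z_2$ only and satisfies a
  third-order linear equation, and $F + \xi/H$ is constant, so $F$ is recovered from \<open>Y\<close> and its derivative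
  (\<open>U1_proper\<close>). As the model requires a curve on the whole line, the equation is extended by means of a smooth cutoff.\<close>

section \<open>Calculus of smooth maps\<close>

lemma Ck_on_subset: "Ck_on k S f \<Longrightarrow> T \<subseteq> S \<Longrightarrow> Ck_on k T f"
  by (induction k arbitrary: f) (auto intro: continuous_on_subset)

lemma Ck_on_cong:
  assumes "open S" "\<And>x. x \<in> S \<Longrightarrow> f x = g x"
  shows "Ck_on k S f \<longleftrightarrow> Ck_on k S g"
  using assms(2)
proof (induction k arbitrary: f g)
  case 0 then show ?case by (simp cong: continuous_on_cong)
next
  case (Suc k)
  have d: "(f has_derivative D) (at x) \<longleftrightarrow> (g has_derivative D) (at x)" if "x \<in> S" for x D
    using has_derivative_transform_within_open[OF _ assms(1) that, of f D UNIV g]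
      has_derivative_transform_within_open[OF _ assms(1) that, of g D UNIV f] Suc.prems by auto
  have "frechet_derivative f (at x) = frechet_derivative g (at x)" if "x \<in> S" for x
    unfolding frechet_derivative_def using d[OF that] by simp
  then have "Ck_on k S (\<lambda>x. frechet_derivative f (at x) v) \<longleftrightarrow> Ck_on k S (\<lambda>x. frechet_derivative g (at x) v)" for v
    by (intro Suc.IH) auto
  with d show ?case by (auto simp: differentiable_def)
qed

lemma Ck_on_SucI:
  assumes "open S" "\<And>x. x \<in> S \<Longrightarrow> (f has_derivative f' x) (at x)" "\<And>v. Ck_on k S (\<lambda>x. f' x v)"
  shows "Ck_on (Suc k) S f"
proof -
  have "frechet_derivative f (at x) = f' x" if "x \<in> S" for x
    using assms(2)[OF that] frechet_derivative_at by metis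
  then have "Ck_on k S (\<lambda>x. frechet_derivative f (at x) v)" for v
    using assms(3)[of v] Ck_on_cong[OF assms(1), of "\<lambda>x. f' x v" "\<lambda>x. frechet_derivative f (at x) v"] by simp
  then show ?thesis using assms(2) by (auto simp: differentiable_def)
qed

lemma Ck_on_Suc_D:
  assumes "Ck_on (Suc k) S f" "x \<in> S"
  shows "(f has_derivative frechet_derivative f (at x)) (at x)"
  using assms frechet_derivative_works by auto

lemma Ck_on_SucD: "Ck_on (Suc k) S f \<Longrightarrow> Ck_on k S f"
proof (induction k arbitrary: f)
  case 0 then show ?case
    by (auto intro: differentiable_imp_continuous_on simp: differentiable_on_def differentiable_at_withinI)
next
  case (Suc k)
  then show ?case using Ck_on.simps(2) by blast
qed

lemma Ck_on_local:
  assumes "\<And>x. x \<in> S \<Longrightarrow> \<exists>T. open T \<and> x \<in> T \<and> Ck_on k (T \<inter> S) f" "open S"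
  shows "Ck_on k S f"
  using assms(1)
proof (induction k arbitrary: f)
  case 0
  have "continuous (at x) f" if "x \<in> S" for x
  proof -
    obtain T where "open T" "x \<in> T" "continuous_on (T \<inter> S) f" using 0 \<open>x \<in> S\<close> by (metis Ck_on.simps(1))
    then show ?thesis using assms(2) that continuous_on_interior[of "T \<inter> S" f x]
      by (simp add: interior_open open_Int)
  qed
  then show ?case by (simp add: continuous_at_imp_continuous_on)
next
  case (Suc k)
  show ?case
    unfolding Ck_on.simps
  proof (intro conjI ballI allI)
    show "f differentiable at x" if "x \<in> S" for x
      using Suc.prems[OF that] that by (metis Ck_on.simps(2) IntI)
    show "Ck_on k S (\<lambda>x. frechet_derivative f (at x) v)" for v
      using Suc.prems by (intro Suc.IH) (metis Ck_on.simps(2))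
  qed
qed

lemma Ck_on_const: "Ck_on k S (\<lambda>x. c)"
  by (induction k arbitrary: c) auto

lemma Ck_on_linear:
  assumes "bounded_linear f" shows "Ck_on k S f"
proof (cases k)
  case 0 then show ?thesis using assms by (simp add: linear_continuous_on)
next
  case (Suc n)
  have "frechet_derivative f (at x) = f" for x
    using assms bounded_linear_imp_has_derivative frechet_derivative_at by metis
  then show ?thesis using assms Suc
    by (auto simp: bounded_linear_imp_differentiable Ck_on_const)
qed

lemma Ck_on_add:
  assumes "open S" "Ck_on k S f" "Ck_on k S g" shows "Ck_on k S (\<lambda>x. f x + g x)"
  using assms(2,3)
proof (induction k arbitrary: f g)
  case 0 then show ?case by (auto intro: continuous_on_add)
next
  case (Suc k)
  show ?case
    by (rule Ck_on_SucI[OF assms(1) has_derivative_add[OF Ck_on_Suc_D[OF Suc.prems(1)] Ck_on_Suc_D[OF Suc.prems(2)]]])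
       (use Suc in auto)
qed

lemma Ck_on_bilinear:
  assumes B: "bounded_bilinear B" and "open S" "Ck_on k S f" "Ck_on k S g"
  shows "Ck_on k S (\<lambda>x. B (f x) (g x))"
  using assms(3,4)
proof (induction k arbitrary: f g)
  case 0 then show ?case by (auto intro: bounded_bilinear.continuous_on[OF B])
next
  case (Suc k)
  have "Ck_on k S f" "Ck_on k S g" using Suc.prems Ck_on_SucD by blast+
  then have "Ck_on k S (\<lambda>x. B (f x) (frechet_derivative g (at x) v) + B (frechet_derivative f (at x) v) (g x))" for v
    using Suc.prems by (intro Ck_on_add assms(2) Suc.IH) simp_all
  then show ?case
    by (intro Ck_on_SucI[OF assms(2) bounded_bilinear.FDERIV[OF B Ck_on_Suc_D[OF Suc.prems(1)] Ck_on_Suc_D[OF Suc.prems(2)]]])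
qed

lemma Ck_on_sum:
  assumes "open S" "\<And>i. i \<in> I \<Longrightarrow> Ck_on k S (f i)" shows "Ck_on k S (\<lambda>x. \<Sum>i\<in>I. f i x)"
  using assms(2) by (induction I rule: infinite_finite_induct) (auto intro: Ck_on_const Ck_on_add[OF assms(1)])

lemma Ck_on_compose:
  fixes f :: "'b::euclidean_space \<Rightarrow> 'c::real_normed_vector" and g :: "'a::real_normed_vector \<Rightarrow> 'b"
  assumes "open S" "open T" "g ` S \<subseteq> T" "Ck_on k T f" "Ck_on k S g"
  shows "Ck_on k S (\<lambda>x. f (g x))"
  using assms(4,5)
proof (induction k arbitrary: f)
  case 0 then show ?case using assms(3) by (auto intro: continuous_on_compose2)
next
  case (Suc k)
  have df: "(f has_derivative frechet_derivative f (at (g x))) (at (g x))" if "x \<in> S" for x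
    using Ck_on_Suc_D[OF Suc.prems(1)] that assms(3) by blast
  have d: "((\<lambda>x. f (g x)) has_derivative
      (\<lambda>v. \<Sum>b\<in>Basis. (frechet_derivative g (at x) v \<bullet> b) *\<^sub>R frechet_derivative f (at (g x)) b)) (at x)" if "x \<in> S" for x
  proof -
    interpret l: linear "frechet_derivative f (at (g x))" using df[OF that] has_derivative_linear by blast
    have "frechet_derivative f (at (g x)) (frechet_derivative g (at x) v)
       = (\<Sum>b\<in>Basis. (frechet_derivative g (at x) v \<bullet> b) *\<^sub>R frechet_derivative f (at (g x)) b)" for v
      by (subst (1) euclidean_representation[symmetric]) (simp add: l.sum l.scaleR)
    then show ?thesis
      using has_derivative_compose[OF Ck_on_Suc_D[OF Suc.prems(2) that] df[OF that]] by presburger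
  qed
  show ?case
  proof (rule Ck_on_SucI[OF assms(1) d])
    fix v
    have "Ck_on k S (\<lambda>x. frechet_derivative g (at x) v \<bullet> b)" for b
      using Ck_on_bilinear[OF bounded_bilinear_inner assms(1), of k "\<lambda>x. frechet_derivative g (at x) v" "\<lambda>x. b"]
        Suc.prems by (simp add: Ck_on_const)
    moreover have "Ck_on k S (\<lambda>x. frechet_derivative f (at (g x)) b)" for b
      using Suc.prems Ck_on_SucD by (intro Suc.IH) auto
    ultimately show "Ck_on k S (\<lambda>x. \<Sum>b\<in>Basis. (frechet_derivative g (at x) v \<bullet> b) *\<^sub>R frechet_derivative f (at (g x)) b)"
      by (intro Ck_on_sum assms(1) Ck_on_bilinear[OF bounded_bilinear_scaleR])
  qed auto
qed

named_theorems smooth_intros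

lemma smooth_on_subset: "smooth_on S f \<Longrightarrow> T \<subseteq> S \<Longrightarrow> smooth_on T f"
  by (auto simp: smooth_on_def intro: Ck_on_subset)

lemma smooth_on_cong:
  "open S \<Longrightarrow> (\<And>x. x \<in> S \<Longrightarrow> f x = g x) \<Longrightarrow> smooth_on S f \<longleftrightarrow> smooth_on S g"
  unfolding smooth_on_def using Ck_on_cong by blast

lemma smooth_on_local:
  assumes "\<And>x. x \<in> S \<Longrightarrow> \<exists>T. open T \<and> x \<in> T \<and> smooth_on (T \<inter> S) f" "open S"
  shows "smooth_on S f"
  unfolding smooth_on_def using assms(1) by (intro allI Ck_on_local[OF _ assms(2)]) (metis smooth_on_def)

lemma smooth_on_has_derivative:
  "smooth_on S f \<Longrightarrow> x \<in> S \<Longrightarrow> (f has_derivative frechet_derivative f (at x)) (at x)"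
  unfolding smooth_on_def using Ck_on_Suc_D by blast

lemma smooth_on_differentiable: "smooth_on S f \<Longrightarrow> x \<in> S \<Longrightarrow> f differentiable (at x)"
  using smooth_on_has_derivative differentiableI by blast

lemma smooth_on_continuous_on: "smooth_on S f \<Longrightarrow> continuous_on S f"
  by (metis smooth_on_def Ck_on.simps(1))

lemma smooth_on_frechet_derivative: "smooth_on S f \<Longrightarrow> smooth_on S (\<lambda>x. frechet_derivative f (at x) v)"
  unfolding smooth_on_def by (metis Ck_on.simps(2))

lemma smooth_onI:
  assumes "open S" "\<And>x. x \<in> S \<Longrightarrow> (f has_derivative f' x) (at x)" "\<And>v. smooth_on S (\<lambda>x. f' x v)"
  shows "smooth_on S f"
  unfolding smooth_on_def
proof
  fix k show "Ck_on k S f"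
    using Ck_on_SucI[OF assms(1,2), of k] assms(3) Ck_on_SucD unfolding smooth_on_def by blast
qed

lemma smooth_on_const [smooth_intros]: "smooth_on S (\<lambda>x. c)"
  by (simp add: smooth_on_def Ck_on_const)

lemma smooth_on_linear: "bounded_linear f \<Longrightarrow> smooth_on S f"
  by (simp add: smooth_on_def Ck_on_linear)

lemma smooth_on_ident [smooth_intros]: "smooth_on S (\<lambda>x. x)"
  by (simp add: smooth_on_linear)

lemma smooth_on_add [smooth_intros]:
  "open S \<Longrightarrow> smooth_on S f \<Longrightarrow> smooth_on S g \<Longrightarrow> smooth_on S (\<lambda>x. f x + g x)"
  by (simp add: smooth_on_def Ck_on_add)

lemma smooth_on_sum [smooth_intros]:
  "open S \<Longrightarrow> (\<And>i. i \<in> I \<Longrightarrow> smooth_on S (f i)) \<Longrightarrow> smooth_on S (\<lambda>x. \<Sum>i\<in>I. f i x)"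
  by (simp add: smooth_on_def Ck_on_sum)

lemma smooth_on_scaleR [smooth_intros]:
  "open S \<Longrightarrow> smooth_on S f \<Longrightarrow> smooth_on S g \<Longrightarrow> smooth_on S (\<lambda>x. f x *\<^sub>R g x)"
  by (simp add: smooth_on_def Ck_on_bilinear[OF bounded_bilinear_scaleR])

lemma smooth_on_mult [smooth_intros]:
  fixes f g :: "_ \<Rightarrow> 'a::real_normed_algebra"
  shows "open S \<Longrightarrow> smooth_on S f \<Longrightarrow> smooth_on S g \<Longrightarrow> smooth_on S (\<lambda>x. f x * g x)"
  by (simp add: smooth_on_def Ck_on_bilinear[OF bounded_bilinear_mult])

lemma smooth_on_inner [smooth_intros]:
  "open S \<Longrightarrow> smooth_on S f \<Longrightarrow> smooth_on S g \<Longrightarrow> smooth_on S (\<lambda>x. f x \<bullet> g x)"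
  by (simp add: smooth_on_def Ck_on_bilinear[OF bounded_bilinear_inner])

lemma smooth_on_uminus [smooth_intros]:
  "open S \<Longrightarrow> smooth_on S f \<Longrightarrow> smooth_on S (\<lambda>x. - f x)"
  using smooth_on_scaleR[of S "\<lambda>x. -1" f] by (simp add: smooth_on_const)

lemma smooth_on_diff [smooth_intros]:
  "open S \<Longrightarrow> smooth_on S f \<Longrightarrow> smooth_on S g \<Longrightarrow> smooth_on S (\<lambda>x. f x - g x)"
  using smooth_on_add[of S f "\<lambda>x. - g x"] by (simp add: smooth_on_uminus)

lemma smooth_on_power [smooth_intros]:
  fixes f :: "_ \<Rightarrow> real"
  shows "open S \<Longrightarrow> smooth_on S f \<Longrightarrow> smooth_on S (\<lambda>x. f x ^ n)"
  by (induction n) (auto intro!: smooth_intros)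

lemma smooth_on_compose:
  fixes f :: "'b::euclidean_space \<Rightarrow> 'c::real_normed_vector" and g :: "'a::real_normed_vector \<Rightarrow> 'b"
  assumes "open S" "open T" "g ` S \<subseteq> T" "smooth_on T f" "smooth_on S g"
  shows "smooth_on S (\<lambda>x. f (g x))"
  using assms by (auto simp: smooth_on_def intro: Ck_on_compose)

lemma smooth_on_linear_compose:
  assumes "open S" "smooth_on S f" "bounded_linear L"
  shows "smooth_on S (\<lambda>x. L (f x))"
proof -
  have b: "bounded_bilinear (\<lambda>(r::real) x. r *\<^sub>R L x)"
    using bounded_bilinear.comp[OF bounded_bilinear_scaleR bounded_linear_ident assms(3)] by simp
  show ?thesis
    using Ck_on_bilinear[OF b assms(1), of _ "\<lambda>x. 1" f] assms(2)
    by (simp add: smooth_on_def Ck_on_const)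
qed

lemma smooth_on_nth [smooth_intros]:
  "open S \<Longrightarrow> smooth_on S f \<Longrightarrow> smooth_on S (\<lambda>x. f x $ i)"
  by (rule smooth_on_linear_compose) (auto intro: bounded_linear_vec_nth)

lemma smooth_on_vec_lambda [smooth_intros]:
  assumes "open S" "\<And>i. smooth_on S (\<lambda>x. f x i)"
  shows "smooth_on S (\<lambda>x. (\<chi> i. f x i) :: real^'n)"
proof -
  have "(\<lambda>x. (\<chi> i. f x i) :: real^'n) = (\<lambda>x. \<Sum>i\<in>UNIV. f x i *\<^sub>R axis i 1)"
    by (auto simp: fun_eq_iff vec_eq_iff axis_def if_distrib cong: if_cong)
  then show ?thesis using assms by (auto intro!: smooth_intros)
qed

lemma smooth_on_if: "smooth_on S f \<Longrightarrow> smooth_on S g \<Longrightarrow> smooth_on S (\<lambda>x. if P then f x else g x)"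
  by (cases P) simp_all

lemma vector_2_eq: "(vector [a, b] :: real^2) = (\<chi> i. if i = 1 then a else b)"
  by (auto simp: vec_eq_iff forall_2)

lemma smooth_on_vector_2 [smooth_intros]:
  "open S \<Longrightarrow> smooth_on S f \<Longrightarrow> smooth_on S g \<Longrightarrow> smooth_on S (\<lambda>x. vector [f x, g x] :: real^2)"
  unfolding vector_2_eq by (intro smooth_on_vec_lambda smooth_on_if)

lemma Ck_on_exp: "Ck_on k S (exp :: real \<Rightarrow> real)"
proof (rule Ck_on_subset[OF _ subset_UNIV], induction k)
  case (Suc k)
  show ?case
    by (rule Ck_on_SucI[of UNIV _ "\<lambda>x v. v *\<^sub>R exp x"])
       (auto intro!: derivative_eq_intros simp: mult.commute Suc Ck_on_const Ck_on_bilinear[OF bounded_bilinear_mult open_UNIV])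
qed (simp add: continuous_on_exp)

lemma smooth_on_exp [smooth_intros]:
  fixes f :: "_ \<Rightarrow> real"
  shows "open S \<Longrightarrow> smooth_on S f \<Longrightarrow> smooth_on S (\<lambda>x. exp (f x))"
  by (rule smooth_on_compose[of S UNIV]) (auto simp: smooth_on_def Ck_on_exp)

lemma Ck_on_inverse: "Ck_on k (- {0}) (inverse :: real \<Rightarrow> real)"
proof (induction k)
  case (Suc k)
  show ?case
  proof (rule Ck_on_SucI[of _ _ "\<lambda>x v. (- v) * (inverse x * inverse x)"])
    show "open (- {0::real})" by (simp add: open_Compl)
    show "(inverse has_derivative (\<lambda>v. (- v) * (inverse x * inverse x))) (at x)" if "x \<in> - {0}" for x :: real
      using that by (auto intro!: derivative_eq_intros)
    show "Ck_on k (- {0}) (\<lambda>x::real. (- v) * (inverse x * inverse x))" for v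
      by (intro Ck_on_bilinear[OF bounded_bilinear_mult] Ck_on_const Suc) (simp_all add: open_Compl)
  qed
qed (simp add: continuous_on_inverse continuous_on_id)

lemma smooth_on_inverse [smooth_intros]:
  fixes f :: "_ \<Rightarrow> real"
  shows "open S \<Longrightarrow> smooth_on S f \<Longrightarrow> (\<And>x. x \<in> S \<Longrightarrow> f x \<noteq> 0) \<Longrightarrow> smooth_on S (\<lambda>x. inverse (f x))"
  by (rule smooth_on_compose[of S "- {0}"]) (auto simp: smooth_on_def Ck_on_inverse open_Compl)

lemma smooth_on_divide [smooth_intros]:
  fixes f :: "_ \<Rightarrow> real"
  shows "open S \<Longrightarrow> smooth_on S f \<Longrightarrow> smooth_on S g \<Longrightarrow> (\<And>x. x \<in> S \<Longrightarrow> g x \<noteq> 0) \<Longrightarrow> smooth_on S (\<lambda>x. f x / g x)"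
  unfolding divide_inverse by (intro smooth_on_mult smooth_on_inverse) auto

lemma smooth_on_ln [smooth_intros]:
  fixes f :: "_ \<Rightarrow> real"
  assumes "open S" "smooth_on S f" "\<And>x. x \<in> S \<Longrightarrow> f x > 0"
  shows "smooth_on S (\<lambda>x. ln (f x))"
proof -
  have "smooth_on {0<..} (ln :: real \<Rightarrow> real)"
    by (rule smooth_onI[of _ _ "\<lambda>x v. v * inverse x"])
      (auto intro!: derivative_eq_intros smooth_intros simp: divide_inverse)
  then show ?thesis using smooth_on_compose[of S "{0<..}" f ln] assms by (simp add: image_subset_iff)
qed

lemma smooth_on_sqrt [smooth_intros]:
  fixes f :: "_ \<Rightarrow> real"
  assumes "open S" "smooth_on S f" "\<And>x. x \<in> S \<Longrightarrow> f x > 0"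
  shows "smooth_on S (\<lambda>x. sqrt (f x))"
proof -
  have "smooth_on S (\<lambda>x. exp (ln (f x) / 2))" using assms by (intro smooth_intros) auto
  moreover have "exp (ln y / 2) = sqrt y" if "y > 0" for y :: real
    using that exp_ln[of "sqrt y"] by (simp add: ln_sqrt)
  ultimately show ?thesis using assms smooth_on_cong[OF assms(1), of "\<lambda>x. exp (ln (f x) / 2)" "\<lambda>x. sqrt (f x)"] by simp
qed

subsection \<open>Partial derivatives in the plane\<close>

lemma has_derivative_pd:
  assumes "f differentiable (at x)"
  shows "(f has_derivative (\<lambda>v. v $ 1 *\<^sub>R pd 1 f x + v $ 2 *\<^sub>R pd 2 f x)) (at x)"
proof -
  have d: "(f has_derivative frechet_derivative f (at x)) (at x)" using assms frechet_derivative_works by blast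
  then interpret l: linear "frechet_derivative f (at x)" using has_derivative_linear by blast
  have "frechet_derivative f (at x) v = v $ 1 *\<^sub>R pd 1 f x + v $ 2 *\<^sub>R pd 2 f x" for v
  proof -
    have "v = v $ 1 *\<^sub>R axis 1 1 + v $ 2 *\<^sub>R axis 2 1" by (simp add: vec_eq_iff forall_2 axis_def)
    then have "frechet_derivative f (at x) v = frechet_derivative f (at x) (v $ 1 *\<^sub>R axis 1 1 + v $ 2 *\<^sub>R axis 2 1)" by simp
    then show ?thesis by (simp add: l.add l.scaleR pd_def)
  qed
  then have "frechet_derivative f (at x) = (\<lambda>v. v $ 1 *\<^sub>R pd 1 f x + v $ 2 *\<^sub>R pd 2 f x)" by (intro ext)
  with d show ?thesis by simp
qed

lemma pd_eqI: "(f has_derivative f') (at x) \<Longrightarrow> pd i f x = f' (axis i 1)"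
  unfolding pd_def using frechet_derivative_at by metis

lemma pd_eq12:
  assumes "(f has_derivative (\<lambda>v. v $ 1 *\<^sub>R p + v $ 2 *\<^sub>R q)) (at x)"
  shows "pd 1 f x = p" "pd 2 f x = q"
  using pd_eqI[OF assms, of 1] pd_eqI[OF assms, of 2] by (simp_all add: axis_def)

lemma pd_cong:
  assumes "open S" "x \<in> S" "\<And>y. y \<in> S \<Longrightarrow> f y = g y"
  shows "pd i f x = pd i g x"
proof -
  have "(f has_derivative D) (at x) \<longleftrightarrow> (g has_derivative D) (at x)" for D
    using has_derivative_transform_within_open[OF _ assms(1,2), of f D UNIV g]
      has_derivative_transform_within_open[OF _ assms(1,2), of g D UNIV f] assms(3) by auto
  then show ?thesis by (simp add: pd_def frechet_derivative_def)
qed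

lemma smooth_on_pd [smooth_intros]: "smooth_on S f \<Longrightarrow> smooth_on S (pd i f)"
  unfolding pd_def[abs_def] by (rule smooth_on_frechet_derivative)

lemma pd_const [simp]: "pd i (\<lambda>x. c) x = 0" by (simp add: pd_def)

lemma pd_bilinear:
  assumes "bounded_bilinear B" "f differentiable (at x)" "g differentiable (at x)"
  shows "pd i (\<lambda>x. B (f x) (g x)) x = B (f x) (pd i g x) + B (pd i f x) (g x)"
  using pd_eqI[OF bounded_bilinear.FDERIV[OF assms(1) assms(2,3)[unfolded frechet_derivative_works]]]
  by (simp add: pd_def)

lemma pd_linear:
  assumes "bounded_linear L" "f differentiable (at x)"
  shows "pd i (\<lambda>x. L (f x)) x = L (pd i f x)"
  using pd_eqI[OF bounded_linear.has_derivative[OF assms(1) assms(2)[unfolded frechet_derivative_works]]]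
  by (simp add: pd_def)

lemma pd_add:
  "f differentiable (at x) \<Longrightarrow> g differentiable (at x) \<Longrightarrow> pd i (\<lambda>x. f x + g x) x = pd i f x + pd i g x"
  using pd_eqI[OF has_derivative_add[of f "frechet_derivative f (at x)" "at x" g "frechet_derivative g (at x)"]]
  by (simp add: pd_def frechet_derivative_works)

lemma pd_diff:
  "f differentiable (at x) \<Longrightarrow> g differentiable (at x) \<Longrightarrow> pd i (\<lambda>x. f x - g x) x = pd i f x - pd i g x"
  using pd_eqI[OF has_derivative_diff[of f "frechet_derivative f (at x)" "at x" g "frechet_derivative g (at x)"]]
  by (simp add: pd_def frechet_derivative_works)

lemma pd_uminus: "f differentiable (at x) \<Longrightarrow> pd i (\<lambda>x. - f x) x = - pd i f x"
  using pd_linear[OF bounded_linear_minus[OF bounded_linear_ident]] by blast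

lemmas pd_scaleR = pd_bilinear[OF bounded_bilinear_scaleR]
lemmas pd_mult = pd_bilinear[OF bounded_bilinear_mult]
lemmas pd_nth = pd_linear[OF bounded_linear_vec_nth]

lemma pd_coord: "pd i (\<lambda>x. x $ j) x = (if i = j then 1 else 0)"
  by (subst pd_eqI[OF bounded_linear_imp_has_derivative[OF bounded_linear_vec_nth]]) (simp add: axis_def)

lemma pd_real_compose:
  fixes f :: "real^2 \<Rightarrow> real"
  assumes "(g has_vector_derivative g') (at (f x))" "f differentiable (at x)"
  shows "pd i (\<lambda>x. g (f x)) x = pd i f x *\<^sub>R g'"
  using pd_eqI[OF has_derivative_compose[OF assms(2)[unfolded frechet_derivative_works] assms(1)[unfolded has_vector_derivative_def]]]
  by (simp add: pd_def)

lemma pd_exp: "(f::real^2 \<Rightarrow> real) differentiable (at x) \<Longrightarrow> pd i (\<lambda>x. exp (f x)) x = exp (f x) * pd i f x"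
  using pd_real_compose[of exp "exp (f x)" f x i]
  by (simp add: DERIV_exp has_real_derivative_iff_has_vector_derivative[symmetric] mult.commute)

lemma pd_ln: "(f::real^2 \<Rightarrow> real) differentiable (at x) \<Longrightarrow> f x > 0 \<Longrightarrow> pd i (\<lambda>x. ln (f x)) x = pd i f x / f x"
  using pd_real_compose[of ln "1 / (f x)" f x i] DERIV_ln_divide[of "f x"]
  by (simp add: has_real_derivative_iff_has_vector_derivative[symmetric])

text \<open>The second difference of \<open>f\<close> over a small parallelogram is, by the mean value theorem, a value of
  either mixed derivative at a nearby point; continuity of the mixed derivatives identifies them at \<open>x\<close>.\<close>

lemma second_derivative_symmetric:
  fixes f :: "'a::real_normed_vector \<Rightarrow> real"
  assumes "smooth_on S f" "open S" "x \<in> S"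
  shows "frechet_derivative (\<lambda>y. frechet_derivative f (at y) w) (at x) v
       = frechet_derivative (\<lambda>y. frechet_derivative f (at y) v) (at x) w"
proof -
  define A where "A = (\<lambda>y. frechet_derivative (\<lambda>y. frechet_derivative f (at y) w) (at y) v)"
  define B where "B = (\<lambda>y. frechet_derivative (\<lambda>y. frechet_derivative f (at y) v) (at y) w)"
  have cA: "continuous_on S A" and cB: "continuous_on S B"
    unfolding A_def B_def by (intro smooth_on_continuous_on smooth_on_frechet_derivative assms)+
  \<comment> \<open>the second difference over a parallelogram, evaluated by the mean value theorem in two orders\<close>
  have key: "\<exists>s t. 0 < s \<and> s < d \<and> 0 < t \<and> t < d \<and>
      f (x + d *\<^sub>R v + d *\<^sub>R w) - f (x + d *\<^sub>R v) - f (x + d *\<^sub>R w) + f x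
        = d * d * frechet_derivative (\<lambda>y. frechet_derivative f (at y) v) (at (x + s *\<^sub>R v + t *\<^sub>R w)) w"
    if d: "d > 0" and inS: "\<And>s t. 0 \<le> s \<Longrightarrow> s \<le> d \<Longrightarrow> 0 \<le> t \<Longrightarrow> t \<le> d \<Longrightarrow> x + s *\<^sub>R v + t *\<^sub>R w \<in> S"
    for d v w
  proof -
    have lin: "linear (frechet_derivative g (at y))" if "smooth_on S g" "y \<in> S" for g :: "'a \<Rightarrow> real" and y
      using smooth_on_has_derivative[OF that] has_derivative_linear by blast
    have dv: "((\<lambda>s. g (y + s *\<^sub>R u)) has_real_derivative frechet_derivative g (at (y + s *\<^sub>R u)) u) (at s)"
      if "smooth_on S g" "y + s *\<^sub>R u \<in> S" for g :: "'a \<Rightarrow> real" and y u s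
    proof -
      have "((\<lambda>s. y + s *\<^sub>R u) has_derivative (\<lambda>h. h *\<^sub>R u)) (at s)" by (auto intro!: derivative_eq_intros)
      from has_derivative_compose[OF this smooth_on_has_derivative[OF that]]
      show ?thesis using linear_cmul[OF lin[OF that]]
        by (simp add: has_field_derivative_def mult.commute[of _ "frechet_derivative g (at (y + s *\<^sub>R u)) u"])
    qed
    define g where "g = (\<lambda>s. f ((x + d *\<^sub>R w) + s *\<^sub>R v) - f (x + s *\<^sub>R v))"
    have gd: "(g has_real_derivative (frechet_derivative f (at (x + d *\<^sub>R w + s *\<^sub>R v)) v
         - frechet_derivative f (at (x + s *\<^sub>R v)) v)) (at s)" if "0 \<le> s" "s \<le> d" for s
      unfolding g_def using inS[of s d] inS[of s 0] that d
      by (intro DERIV_diff dv assms) (auto simp: algebra_simps)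
    obtain s where s: "0 < s" "s < d" "g d - g 0 = (d - 0) * (frechet_derivative f (at (x + d *\<^sub>R w + s *\<^sub>R v)) v
         - frechet_derivative f (at (x + s *\<^sub>R v)) v)"
      using MVT2[OF d gd] by blast
    define h where "h = (\<lambda>t. frechet_derivative f (at ((x + s *\<^sub>R v) + t *\<^sub>R w)) v)"
    have hd: "(h has_real_derivative frechet_derivative (\<lambda>y. frechet_derivative f (at y) v) (at (x + s *\<^sub>R v + t *\<^sub>R w)) w) (at t)"
      if "0 \<le> t" "t \<le> d" for t
      unfolding h_def using inS[of s t] that s
      by (intro dv smooth_on_frechet_derivative assms) auto
    obtain t where t: "0 < t" "t < d" "h d - h 0 = (d - 0) * frechet_derivative (\<lambda>y. frechet_derivative f (at y) v) (at (x + s *\<^sub>R v + t *\<^sub>R w)) w"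
      using MVT2[OF d hd] by blast
    have "g d - g 0 = d * (h d - h 0)" using s(3) by (simp add: h_def algebra_simps)
    then show ?thesis using s t by (intro exI[of _ s] exI[of _ t]) (simp add: g_def algebra_simps)
  qed
  have "A x = B x"
  proof (rule ccontr)
    assume ne: "A x \<noteq> B x"
    define e where "e = \<bar>A x - B x\<bar> / 2"
    have "e > 0" using ne by (simp add: e_def)
    obtain r1 where r1: "r1 > 0" "\<And>y. y \<in> S \<Longrightarrow> dist y x < r1 \<Longrightarrow> dist (A y) (A x) < e"
      using cA assms(3) \<open>e > 0\<close> unfolding continuous_on_iff by metis
    obtain r2 where r2: "r2 > 0" "\<And>y. y \<in> S \<Longrightarrow> dist y x < r2 \<Longrightarrow> dist (B y) (B x) < e"
      using cB assms(3) \<open>e > 0\<close> unfolding continuous_on_iff by metis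
    obtain r3 where r3: "r3 > 0" "ball x r3 \<subseteq> S" using assms openE by blast
    define r where "r = min r1 (min r2 r3)"
    define d where "d = r / (2 * (norm v + norm w + 1))"
    have r: "r > 0" using r1 r2 r3 by (simp add: r_def)
    have nn: "norm v + norm w + 1 > 0" by (smt (verit) norm_ge_zero)
    have d: "d > 0" using r nn by (simp add: d_def)
    have near: "dist (x + s *\<^sub>R v + t *\<^sub>R w) x < r" if "0 \<le> s" "s \<le> d" "0 \<le> t" "t \<le> d" for s t
    proof -
      have "dist (x + s *\<^sub>R v + t *\<^sub>R w) x \<le> norm (s *\<^sub>R v) + norm (t *\<^sub>R w)"
        by (simp add: dist_norm) (metis norm_triangle_ineq norm_scaleR)
      also have "\<dots> \<le> d * norm v + d * norm w" using that by (simp add: add_mono mult_right_mono)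
      also have "\<dots> \<le> d * (norm v + norm w + 1)" using d by (simp add: algebra_simps)
      also have "\<dots> = r / 2" using nn by (simp add: d_def del: distrib_left_numeral)
      also have "\<dots> < r" using r by simp
      finally show ?thesis .
    qed
    have inS: "x + s *\<^sub>R v + t *\<^sub>R w \<in> S" if "0 \<le> s" "s \<le> d" "0 \<le> t" "t \<le> d" for s t
      using near[OF that] r3(2) by (auto simp: r_def dist_commute)
    have inS': "x + t *\<^sub>R w + s *\<^sub>R v \<in> S" if "0 \<le> s" "s \<le> d" "0 \<le> t" "t \<le> d" for s t
      using inS[OF that] by (simp add: algebra_simps)
    obtain s t where st: "0 < s" "s < d" "0 < t" "t < d"
      "f (x + d *\<^sub>R v + d *\<^sub>R w) - f (x + d *\<^sub>R v) - f (x + d *\<^sub>R w) + f x = d * d * B (x + s *\<^sub>R v + t *\<^sub>R w)"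
      using key[OF d inS] unfolding B_def by blast
    obtain s' t' where st': "0 < s'" "s' < d" "0 < t'" "t' < d"
      "f (x + d *\<^sub>R w + d *\<^sub>R v) - f (x + d *\<^sub>R w) - f (x + d *\<^sub>R v) + f x = d * d * A (x + s' *\<^sub>R w + t' *\<^sub>R v)"
      using key[OF d, of w v] inS' unfolding A_def by blast
    have "d * d * B (x + s *\<^sub>R v + t *\<^sub>R w) = d * d * A (x + t' *\<^sub>R v + s' *\<^sub>R w)"
      using st(5) st'(5) by (simp add: algebra_simps)
    then have eq: "B (x + s *\<^sub>R v + t *\<^sub>R w) = A (x + t' *\<^sub>R v + s' *\<^sub>R w)" using d by simp
    have "dist (B (x + s *\<^sub>R v + t *\<^sub>R w)) (B x) < e"
      using st near[of s t] inS[of s t] by (intro r2) (auto simp: r_def)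
    moreover have "dist (A (x + t' *\<^sub>R v + s' *\<^sub>R w)) (A x) < e"
      using st' near[of t' s'] inS[of t' s'] by (intro r1) (auto simp: r_def)
    ultimately show False using eq by (auto simp: dist_real_def e_def field_simps abs_if split: if_splits)
  qed
  then show ?thesis by (simp add: A_def B_def)
qed

lemma pd_commute:
  fixes f :: "real^2 \<Rightarrow> 'b::euclidean_space"
  assumes "smooth_on S f" "open S" "x \<in> S"
  shows "pd i (pd j f) x = pd j (pd i f) x"
proof (rule euclidean_eqI)
  fix b :: 'b
  have in1: "pd k g y \<bullet> b = pd k (\<lambda>y. g y \<bullet> b) y" if "smooth_on S g" "y \<in> S" for g k y
    using pd_linear[OF bounded_linear_inner_left, of g y k b] smooth_on_differentiable[OF that] by simp
  have s: "smooth_on S (\<lambda>y. f y \<bullet> b)" by (intro smooth_intros assms)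
  have "pd i (pd j f) x \<bullet> b = pd i (pd j (\<lambda>y. f y \<bullet> b)) x" for i j
    using in1[OF smooth_on_pd[OF assms(1)] assms(3), of i j] pd_cong[OF assms(2,3) in1[OF assms(1)], where i=i and k1="\<lambda>_. j"] by simp
  moreover have "pd i (pd j (\<lambda>y. f y \<bullet> b)) x = pd j (pd i (\<lambda>y. f y \<bullet> b)) x"
    using second_derivative_symmetric[OF s assms(2,3)] by (simp add: pd_def[abs_def])
  ultimately show "pd i (pd j f) x \<bullet> b = pd j (pd i f) x \<bullet> b" by simp
qed

lemma pd_compose:
  fixes f :: "real^2 \<Rightarrow> 'b::real_normed_vector" and g :: "real^2 \<Rightarrow> real^2"
  assumes "f differentiable (at (g x))" "g differentiable (at x)"
  shows "pd i (\<lambda>x. f (g x)) x = (pd i g x $ 1) *\<^sub>R pd 1 f (g x) + (pd i g x $ 2) *\<^sub>R pd 2 f (g x)"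
  using pd_eqI[OF has_derivative_compose[OF assms(2)[unfolded frechet_derivative_works] has_derivative_pd[OF assms(1)]]]
  by (simp add: pd_def)

lemma constant_on_convex_pd:
  fixes f :: "real^2 \<Rightarrow> 'b::real_normed_vector"
  assumes "convex S" "open S" "\<And>x. x \<in> S \<Longrightarrow> f differentiable (at x)" "\<And>i x. x \<in> S \<Longrightarrow> pd i f x = 0"
    and "x \<in> S" "y \<in> S"
  shows "f x = f y"
proof -
  have "(f has_derivative (\<lambda>v. 0)) (at x within S)" if "x \<in> S" for x
    using has_derivative_pd[OF assms(3)[OF that]] assms(4)[OF that] by (auto intro: has_derivative_at_withinI)
  from has_derivative_zero_unique[OF assms(1) this assms(5,6)] show ?thesis by simp
qed

lemma vd_eq_frechet: "c differentiable (at t) \<Longrightarrow> vd c t = frechet_derivative c (at t) 1"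
  unfolding vd_def using frechet_derivative_eq_vector_derivative by (metis scaleR_one)

lemma smooth_on_vd [smooth_intros]: "open S \<Longrightarrow> smooth_on S c \<Longrightarrow> smooth_on S (vd c)"
  using smooth_on_cong[of S "\<lambda>t. frechet_derivative c (at t) 1" "vd c"]
  by (simp add: smooth_on_frechet_derivative vd_eq_frechet smooth_on_differentiable)

lemma has_vector_derivative_vd: "smooth_on S c \<Longrightarrow> t \<in> S \<Longrightarrow> (c has_vector_derivative vd c t) (at t)"
  unfolding vd_def by (metis smooth_on_differentiable vector_derivative_works)

lemma vd_eqI: "(c has_vector_derivative d) (at t) \<Longrightarrow> vd c t = d"
  unfolding vd_def by (rule vector_derivative_at)

lemma vd_cong:
  assumes "open S" "x \<in> S" "\<And>y. y \<in> S \<Longrightarrow> f y = g y"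
  shows "vd f x = vd g x"
proof -
  have "(f has_vector_derivative D) (at x) \<longleftrightarrow> (g has_vector_derivative D) (at x)" for D
    using has_vector_derivative_transform_within_open[OF _ assms(1,2), of f D g]
      has_vector_derivative_transform_within_open[OF _ assms(1,2), of g D f] assms(3) by auto
  then show ?thesis by (simp add: vd_def vector_derivative_def)
qed

subsection \<open>Local inverses of smooth plane maps\<close>

text \<open>The inverse function theorem gives a differentiable inverse \<open>g\<close> whose derivative at \<open>y\<close> is the explicit
  inverse Jacobian matrix at \<open>g y\<close>. This formula turns each order of smoothness of \<open>g\<close> into the next one.\<close>

lemma smooth_local_inverse:
  fixes G :: "real^2 \<Rightarrow> real^2"
  assumes G: "smooth_on S G" and "open S" "x0 \<in> S"
    and J: "pd 1 G x0 $ 1 * pd 2 G x0 $ 2 - pd 1 G x0 $ 2 * pd 2 G x0 $ 1 \<noteq> 0"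
  obtains U V g where "open U" "x0 \<in> U" "U \<subseteq> S" "open V" "homeomorphism U V G g" "smooth_on V g"
    "\<And>y. y \<in> V \<Longrightarrow> pd 1 G (g y) $ 1 * pd 2 G (g y) $ 2 - pd 1 G (g y) $ 2 * pd 2 G (g y) $ 1 \<noteq> 0"
proof -
  define J where "J = (\<lambda>x. pd 1 G x $ 1 * pd 2 G x $ 2 - pd 1 G x $ 2 * pd 2 G x $ 1)"
  define S' where "S' = {x \<in> S. J x \<noteq> 0}"
  have Js: "smooth_on S J" unfolding J_def by (intro smooth_intros assms)
  have "S' = S \<inter> J -` (- {0})" by (auto simp: S'_def)
  then have "open S'"
    using continuous_open_preimage[OF smooth_on_continuous_on[OF Js] \<open>open S\<close>, of "- {0}"]
    by (simp add: open_Compl)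
  have x0: "x0 \<in> S'" using assms by (simp add: S'_def J_def)
  define G' where "G' = (\<lambda>x (v::real^2). v $ 1 *\<^sub>R pd 1 G x + v $ 2 *\<^sub>R pd 2 G x)"
  define f' where "f' = (\<lambda>x. Blinfun (G' x))"
  have bl: "bounded_linear (G' x)" for x
    unfolding G'_def by (intro bounded_linear_add bounded_linear_scaleR_const bounded_linear_vec_nth)
  have ap: "blinfun_apply (f' x) = G' x" for x unfolding f'_def using bl by (simp add: bounded_linear_Blinfun_apply)
  have dG: "(G has_derivative G' x) (at x)" if "x \<in> S" for x
    unfolding G'_def using has_derivative_pd[OF smooth_on_differentiable[OF G that]] .
  have contf: "continuous_on S' f'"
  proof (rule continuous_on_blinfun_componentwise)
    fix i :: "real^2"
    have "continuous_on S (\<lambda>x. G' x i)" unfolding G'_def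
      by (intro smooth_on_continuous_on smooth_intros assms)
    then show "continuous_on S' (\<lambda>x. blinfun_apply (f' x) i)"
      unfolding ap by (rule continuous_on_subset) (auto simp: S'_def)
  qed
  define I where "I = (\<lambda>x (v::real^2). (vector [(v $ 1 * pd 2 G x $ 2 - v $ 2 * pd 2 G x $ 1) / J x,
        (pd 1 G x $ 1 * v $ 2 - pd 1 G x $ 2 * v $ 1) / J x] :: real^2))"
  have blI: "bounded_linear (I x)" for x
    unfolding linear_conv_bounded_linear[symmetric]
    by (rule linearI) (auto simp: I_def vec_eq_iff forall_2 algebra_simps add_divide_distrib diff_divide_distrib)
  have IG: "I x (G' x v) = v" if "J x \<noteq> 0" for x v
    using that by (simp add: I_def G'_def vec_eq_iff forall_2 field_simps) (simp add: J_def algebra_simps)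
  have GI: "G' x (I x v) = v" if "J x \<noteq> 0" for x v
    using that by (simp add: I_def G'_def vec_eq_iff forall_2 field_simps) (simp add: J_def algebra_simps)
  have inv0: "Blinfun (I x0) o\<^sub>L f' x0 = id_blinfun"
    by (rule blinfun_eqI) (use IG[of x0] x0 in \<open>simp add: ap bounded_linear_Blinfun_apply[OF blI] S'_def\<close>)
  have dG': "(G has_derivative blinfun_apply (f' x)) (at x)" if "x \<in> S'" for x
    using dG that by (simp add: ap S'_def)
  obtain U V g g' where UV: "open U" "U \<subseteq> S'" "x0 \<in> U" "open V" "G x0 \<in> V" "homeomorphism U V G g"
    and gd: "\<And>y. y \<in> V \<Longrightarrow> (g has_derivative (g' y)) (at y)"
    and g'i: "\<And>y. y \<in> V \<Longrightarrow> g' y = inv (blinfun_apply (f'(g y)))"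
    by (rule inverse_function_theorem[OF \<open>open S'\<close> dG' contf x0 inv0]) blast+
  have gV: "g y \<in> S'" "J (g y) \<noteq> 0" if "y \<in> V" for y
    using UV that by (auto simp: homeomorphism_def S'_def)
  have g': "g' y = I (g y)" if "y \<in> V" for y
  proof -
    have "inv (G' (g y)) = I (g y)"
      using IG[OF gV(2)[OF that]] GI[OF gV(2)[OF that]] by (intro inv_unique_comp) (auto simp: fun_eq_iff)
    then show ?thesis using g'i[OF that] ap by simp
  qed
  have "Ck_on k V g" for k
  proof (induction k)
    case 0 then show ?case using UV(6) by (simp add: homeomorphism_def)
  next
    case (Suc k)
    show ?case
    proof (rule Ck_on_SucI[OF UV(4), of _ "\<lambda>y. I (g y)"])
      show "(g has_derivative I (g y)) (at y)" if "y \<in> V" for y using gd[OF that] g'[OF that] by simp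
      fix v
      have "smooth_on S' (\<lambda>x. I x v)" unfolding I_def
        by (intro smooth_intros \<open>open S'\<close> smooth_on_subset[OF G] smooth_on_subset[OF Js]) (auto simp: S'_def)
      then show "Ck_on k V (\<lambda>y. I (g y) v)"
        using Ck_on_compose[OF UV(4) \<open>open S'\<close>, of g k "\<lambda>x. I x v"] gV Suc by (auto simp: smooth_on_def)
    qed
  qed
  then have "smooth_on V g" by (simp add: smooth_on_def)
  moreover have "U \<subseteq> S" using UV by (auto simp: S'_def)
  ultimately show ?thesis using that[OF UV(1,3) _ UV(4,6)] gV by (auto simp: J_def)
qed

section \<open>Linear differential systems\<close>

lemma compact_image_norm_bound:
  assumes "compact K" "continuous_on K f"
  obtains b where "b > 0" "\<And>x. x \<in> K \<Longrightarrow> norm (f x) \<le> b"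
proof -
  have "bounded (f ` K)" using assms by (intro compact_imp_bounded compact_continuous_image)
  then obtain b where "b > 0" "\<forall>y\<in>f ` K. norm y \<le> b" unfolding bounded_pos by blast
  then show ?thesis using that[of b] by simp
qed

text \<open>The function $|E|^2 e^{-ct} - e^2 t$ with $c = 2L + 1$ is decreasing. The bound is proportional to the source
  term, which is what makes it usable for differentiability in parameters.\<close>

lemma gronwall_deriv:
  fixes E :: "real \<Rightarrow> 'a::real_inner"
  assumes E: "\<And>t. t \<in> {0..1} \<Longrightarrow> (E has_vector_derivative E' t) (at t within {0..1})"
    and bd: "\<And>t. t \<in> {0..1} \<Longrightarrow> norm (E' t) \<le> L * norm (E t) + e" and "E 0 = 0" "L \<ge> 0" "e \<ge> 0"
    and t: "t \<in> {0..1}"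
  shows "norm (E t) \<le> e * exp (L + 1/2)"
proof -
  define c where "c = 2 * L + 1"
  define g where "g = (\<lambda>t. (E t \<bullet> E t) * exp (- c * t) - e\<^sup>2 * t)"
  define g' where "g' = (\<lambda>t. (2 * (E t \<bullet> E' t)) * exp (- c * t) + (E t \<bullet> E t) * (- c * exp (- c * t)) - e\<^sup>2)"
  have gd: "(g has_real_derivative g' t) (at t within {0..1})" if "t \<in> {0..1}" for t
  proof -
    have i: "((\<lambda>t. E t \<bullet> E t) has_real_derivative 2 * (E t \<bullet> E' t)) (at t within {0..1})"
      using bounded_bilinear.has_vector_derivative[OF bounded_bilinear_inner E[OF that] E[OF that]]
      by (simp add: has_real_derivative_iff_has_vector_derivative inner_commute)
    show ?thesis unfolding g_def g'_def
      by (rule derivative_eq_intros i refl | simp add: algebra_simps)+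
  qed
  have neg: "g' t \<le> 0" if "t \<in> {0..1}" for t
  proof -
    have "2 * (E t \<bullet> E' t) \<le> 2 * (norm (E t) * norm (E' t))" using norm_cauchy_schwarz[of "E t" "E' t"] by simp
    also have "\<dots> \<le> 2 * (norm (E t) * (L * norm (E t) + e))"
      using bd[OF that] by (intro mult_left_mono) auto
    also have "\<dots> = 2 * L * (norm (E t))\<^sup>2 + 2 * (norm (E t) * e)" by (simp add: algebra_simps power2_eq_square)
    also have "\<dots> \<le> 2 * L * (norm (E t))\<^sup>2 + ((norm (E t))\<^sup>2 + e\<^sup>2)"
      using sum_squares_bound[of "norm (E t)" e] by simp
    also have "\<dots> = c * (E t \<bullet> E t) + e\<^sup>2" by (simp add: c_def power2_norm_eq_inner[symmetric] algebra_simps)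
    finally have *: "2 * (E t \<bullet> E' t) - c * (E t \<bullet> E t) \<le> e\<^sup>2" by simp
    have "c * t \<ge> 0" using that \<open>L \<ge> 0\<close> by (simp add: c_def)
    then have "exp (- c * t) \<le> 1" by simp
    then have "(2 * (E t \<bullet> E' t) - c * (E t \<bullet> E t)) * exp (- c * t) \<le> e\<^sup>2 * 1"
      using * by (intro mult_mono) auto
    then show ?thesis by (simp add: g'_def algebra_simps)
  qed
  have "g t \<le> g 0"
  proof -
    show ?thesis
    proof (rule DERIV_nonpos_imp_decreasing_open[where f = g and a = 0 and b = t])
      show "0 \<le> t" using t by simp
      have "continuous_on {0..1} g" using gd by (meson DERIV_continuous continuous_on_eq_continuous_within)
      then show "continuous_on {0..t} g" using t by (auto intro: continuous_on_subset)
      fix s assume "0 < s" "s < t"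
      then have s: "s \<in> {0..1}" "at s within {0..1} = at s" using t by (auto simp: at_within_Icc_at)
      then show "\<exists>y. (g has_real_derivative y) (at s) \<and> y \<le> 0"
        using gd[of s] neg[of s] by auto
    qed
  qed
  then have "(E t \<bullet> E t) * exp (- c * t) \<le> e\<^sup>2 * t" by (simp add: g_def \<open>E 0 = 0\<close>)
  then have "(norm (E t))\<^sup>2 \<le> e\<^sup>2 * t * exp (c * t)"
    by (simp add: power2_norm_eq_inner exp_minus field_simps)
  also have "\<dots> \<le> e\<^sup>2 * 1 * exp (c * 1)"
    using t assms by (intro mult_mono) (auto simp: c_def mult_left_le)
  also have "\<dots> = (e * exp (L + 1/2))\<^sup>2"
    by (simp add: power_mult_distrib exp_double[symmetric] c_def algebra_simps)
  finally show ?thesis using power2_le_imp_le assms by (smt (verit) exp_ge_zero mult_nonneg_nonneg)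
qed

lemma bounded_bilinear_matrix_vector: "bounded_bilinear ((*v) :: real^'n^'m \<Rightarrow> real^'n \<Rightarrow> real^'m)"
  unfolding bilinear_conv_bounded_bilinear[symmetric] bilinear_def
  by (auto intro!: linearI simp: matrix_vector_mult_add_rdistrib matrix_vector_right_distrib
      matrix_vector_mult_scaleR scaleR_matrix_vector_assoc[symmetric])

text \<open>Picard iteration. The increments are dominated by the terms of an exponential series, so the
  series of increments and the series of their derivatives converge uniformly.\<close>

lemma linear_ode_unit_interval:
  fixes B :: "real \<Rightarrow> real^'n^'n"
  assumes "continuous_on {0..1} B"
  shows "\<exists>y. y 0 = c \<and> (\<forall>t\<in>{0..1}. (y has_vector_derivative B t *v y t) (at t within {0..1}))"
proof -
  interpret mv: bounded_bilinear "(*v) :: real^'n^'n \<Rightarrow> real^'n \<Rightarrow> real^'n" by (rule bounded_bilinear_matrix_vector)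
  obtain K where K: "K > 0" "\<And>(M::real^'n^'n) w. norm (M *v w) \<le> norm M * norm w * K" using mv.pos_bounded by blast
  obtain b where b: "b > 0" "\<And>t. t \<in> {0..1} \<Longrightarrow> norm (B t) \<le> b"
    using compact_image_norm_bound[OF _ assms] by auto
  define L where "L = b * K"
  have L: "L > 0" "norm (B t *v w) \<le> L * norm w" if "t \<in> {0..1}" for t w
    using K(2)[of "B t" w] b(2)[OF that] K(1) b(1) mult_right_mono[OF b(2)[OF that], of "norm w * K"]
    by (auto simp: L_def mult.assoc mult.commute mult.left_commute intro: order_trans)
  have L0: "L > 0" using K b by (simp add: L_def)
  define Y where "Y = rec_nat (\<lambda>t. c) (\<lambda>n f t. integral {0..t} (\<lambda>s. B s *v f s))"
  have Y0: "Y 0 = (\<lambda>t. c)" and YS: "Y (Suc n) = (\<lambda>t. integral {0..t} (\<lambda>s. B s *v Y n s))" for n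
    by (simp_all add: Y_def)
  have cont: "continuous_on {0..1} (Y n)" for n
  proof (induction n)
    case (Suc n)
    then have "(\<lambda>s. B s *v Y n s) integrable_on {0..1}"
      by (intro integrable_continuous_interval mv.continuous_on assms)
    then show ?case unfolding YS by (rule indefinite_integral_continuous_1)
  qed (simp add: Y0)
  have cB: "continuous_on {0..1} (\<lambda>s. B s *v Y n s)" for n by (intro mv.continuous_on assms cont)
  have dY: "(Y (Suc n) has_vector_derivative B t *v Y n t) (at t within {0..1})" if "t \<in> {0..1}" for n t
    unfolding YS using integral_has_vector_derivative[OF cB that] .
  have bdY: "norm (Y n t) \<le> norm c * (L ^ n * t ^ n / fact n)" if "t \<in> {0..1}" for n t
    using that
  proof (induction n arbitrary: t)
    case (Suc n)
    have i: "((\<lambda>s. norm c * (L ^ Suc n * s ^ n / fact n)) has_integral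
        norm c * (L ^ Suc n * t ^ Suc n / fact (Suc n)) - norm c * (L ^ Suc n * 0 ^ Suc n / fact (Suc n))) {0..t}"
    proof (rule fundamental_theorem_of_calculus)
      fix x assume "x \<in> {0..t}"
      have "((\<lambda>x. norm c * (L ^ Suc n * x ^ Suc n / fact (Suc n))) has_real_derivative
          norm c * (L ^ Suc n * (real (Suc n) * x ^ n) / fact (Suc n))) (at x within {0..t})"
        by (rule derivative_eq_intros refl | simp)+
      moreover have "L ^ Suc n * (real (Suc n) * x ^ n) / fact (Suc n) = L ^ Suc n * x ^ n / fact n"
        using mult_divide_mult_cancel_left[of "real (Suc n)" "L ^ Suc n * x ^ n" "fact n"]
        by (simp add: mult_ac del: of_nat_Suc)
      ultimately show "((\<lambda>x. norm c * (L ^ Suc n * x ^ Suc n / fact (Suc n))) has_vector_derivative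
          norm c * (L ^ Suc n * x ^ n / fact n)) (at x within {0..t})"
        by (simp only: has_real_derivative_iff_has_vector_derivative)
    qed (use Suc.prems in auto)
    have "norm (Y (Suc n) t) \<le> integral {0..t} (\<lambda>s. norm c * (L ^ Suc n * s ^ n / fact n))"
      unfolding YS
    proof (rule integral_norm_bound_integral)
      show "(\<lambda>s. B s *v Y n s) integrable_on {0..t}"
        using Suc.prems by (intro integrable_continuous_interval continuous_on_subset[OF cB]) auto
      show "(\<lambda>s. norm c * (L ^ Suc n * s ^ n / fact n)) integrable_on {0..t}" using i by blast
      fix s assume s: "s \<in> {0..t}"
      then have s1: "s \<in> {0..1}" using Suc.prems by auto
      have "norm (B s *v Y n s) \<le> L * norm (Y n s)" using L[OF s1] by auto
      also have "\<dots> \<le> L * (norm c * (L ^ n * s ^ n / fact n))" using mult_left_mono[OF Suc.IH[OF s1], of L] L0 by simp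
      finally show "norm (B s *v Y n s) \<le> norm c * (L ^ Suc n * s ^ n / fact n)" by (simp add: mult_ac)
    qed
    also have "\<dots> = norm c * (L ^ Suc n * t ^ Suc n / fact (Suc n))" using integral_unique[OF i] by simp
    finally show ?case .
  qed (simp add: Y0)
  have bdY1: "norm (Y n t) \<le> norm c * (L ^ n / fact n)" if "t \<in> {0..1}" for n t
  proof -
    have "L ^ n * t ^ n / fact n \<le> L ^ n / fact n"
      using that L0 by (intro divide_right_mono) (auto simp: mult_left_le power_le_one)
    then show ?thesis using bdY[OF that, of n] by (meson mult_left_mono norm_ge_zero order_trans)
  qed
  have sumL: "summable (\<lambda>n. norm c * (L ^ n / fact n))"
    using summable_exp[of L] by (intro summable_mult) (simp add: divide_inverse mult.commute)
  have sY: "summable (\<lambda>n. Y n t)" if "t \<in> {0..1}" for t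
    by (rule summable_comparison_test'[OF sumL, of 0]) (use bdY1[OF that] in simp)
  define y where "y = (\<lambda>t. \<Sum>n. Y n t)"
  define g where "g = (\<lambda>n t. case n of 0 \<Rightarrow> 0 | Suc m \<Rightarrow> B t *v Y m t)"
  have gb: "norm (g n t) \<le> (case n of 0 \<Rightarrow> 0 | Suc m \<Rightarrow> L * (norm c * (L ^ m / fact m)))" if "t \<in> {0..1}" for n t
  proof (cases n)
    case (Suc m)
    have "norm (B t *v Y m t) \<le> L * norm (Y m t)" by (rule L(2)[OF that])
    also have "\<dots> \<le> L * (norm c * (L ^ m / fact m))" using mult_left_mono[OF bdY1[OF that]] L0 by simp
    finally show ?thesis by (simp add: g_def Suc)
  qed (simp add: g_def)
  have sumg: "summable (\<lambda>n. case n of 0 \<Rightarrow> 0 | Suc m \<Rightarrow> L * (norm c * (L ^ m / fact m)))"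
    using summable_mult[OF sumL, of L] by (subst summable_Suc_iff[symmetric]) simp
  have gs: "(\<lambda>n. g n t) sums (B t *v y t)" if "t \<in> {0..1}" for t
  proof -
    have "(\<lambda>n. B t *v Y n t) sums (B t *v y t)"
      unfolding y_def by (rule bounded_linear.sums[OF mv.bounded_linear_right summable_sums[OF sY[OF that]]])
    then have "(\<lambda>n. g (Suc n) t) sums (B t *v y t)" by (simp add: g_def)
    then show ?thesis by (subst (asm) sums_Suc_iff) (simp add: g_def)
  qed
  have ul: "uniform_limit {0..1} (\<lambda>n t. \<Sum>i<n. g i t) (\<lambda>t. \<Sum>i. g i t) sequentially"
    by (rule Weierstrass_m_test[OF gb sumg])
  have "\<exists>z. \<forall>t\<in>{0..1}. (\<lambda>n. Y n t) sums z t \<and> (z has_derivative (\<lambda>h. h *\<^sub>R (B t *v y t))) (at t within {0..1})"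
  proof (rule has_derivative_series[where f' = "\<lambda>n t h. h *\<^sub>R g n t" and x = 0 and l = "y 0"])
    show "(Y n has_derivative (\<lambda>h. h *\<^sub>R g n t)) (at t within {0..1})" if "t \<in> {0..1}" for n t
      using dY[OF that] by (cases n) (auto simp: g_def Y0 has_vector_derivative_def)
    show "(\<lambda>n. Y n 0) sums y 0" using summable_sums[OF sY[of 0]] by (simp add: y_def)
    fix e :: real assume "e > 0"
    have "\<forall>\<^sub>F n in sequentially. \<forall>t\<in>{0..1}. dist (\<Sum>i<n. g i t) (\<Sum>i. g i t) < e"
      using ul \<open>e > 0\<close> by (simp add: uniform_limit_iff)
    then show "\<forall>\<^sub>F n in sequentially. \<forall>x\<in>{0..1}. \<forall>h. norm ((\<Sum>i<n. h *\<^sub>R g i x) - h *\<^sub>R (B x *v y x)) \<le> e * norm h"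
    proof (rule eventually_mono, intro ballI allI)
      fix n t and h :: real assume a: "\<forall>t\<in>{0..1}. dist (\<Sum>i<n. g i t) (\<Sum>i. g i t) < e" and t: "t \<in> {0..1::real}"
      have "norm ((\<Sum>i<n. h *\<^sub>R g i t) - h *\<^sub>R (B t *v y t)) = \<bar>h\<bar> * norm ((\<Sum>i<n. g i t) - B t *v y t)"
        by (simp add: scaleR_right.sum[symmetric] scaleR_diff_right[symmetric])
      also have "\<dots> \<le> \<bar>h\<bar> * e"
        using a t sums_unique[OF gs[OF t]] by (intro mult_left_mono) (auto simp: dist_norm less_imp_le)
      finally show "norm ((\<Sum>i<n. h *\<^sub>R g i t) - h *\<^sub>R (B t *v y t)) \<le> e * norm h" by (simp add: mult.commute)
    qed
  qed auto
  then obtain z where z: "\<And>t. t \<in> {0..1} \<Longrightarrow> (\<lambda>n. Y n t) sums z t"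
    "\<And>t. t \<in> {0..1} \<Longrightarrow> (z has_derivative (\<lambda>h. h *\<^sub>R (B t *v y t))) (at t within {0..1})" by blast
  have zy: "z t = y t" if "t \<in> {0..1}" for t using sums_unique[OF z(1)[OF that]] by (simp add: y_def)
  have "Y n 0 = (if n = 0 then c else 0)" for n by (cases n) (auto simp: Y0 YS)
  then have "(\<lambda>n. Y n 0) sums c" using sums_single[of 0 "\<lambda>_. c"] by simp
  then have "z 0 = c" using z(1)[of 0] sums_unique2 by auto
  moreover have "(z has_vector_derivative B t *v z t) (at t within {0..1})" if "t \<in> {0..1}" for t
    using z(2)[OF that] zy[OF that] by (simp add: has_vector_derivative_def)
  ultimately show ?thesis by blast
qed

text \<open>The constant comes from bounds of \<open>f\<close> and its partial derivatives up to second order on the compact set;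
  the last estimate is the mean value inequality for \<open>f\<close> minus its linear part at \<open>p\<close>.\<close>

lemma taylor_bounds:
  fixes f :: "real^2 \<Rightarrow> 'b::real_normed_vector"
  assumes f: "smooth_on D f" and "open D" "compact K" "K \<subseteq> D"
  obtains C where "C > 0" "\<And>p. p \<in> K \<Longrightarrow> norm (f p) \<le> C"
    "\<And>p q. closed_segment p q \<subseteq> K \<Longrightarrow> norm (f q - f p) \<le> C * norm (q - p)"
    "\<And>p q. closed_segment p q \<subseteq> K \<Longrightarrow>
       norm (f q - f p - ((q - p) $ 1 *\<^sub>R pd 1 f p + (q - p) $ 2 *\<^sub>R pd 2 f p)) \<le> C * (norm (q - p))\<^sup>2"
proof -
  have bdd: "\<exists>c>0. \<forall>p\<in>K. norm (g p) \<le> c" if "smooth_on D g" for g :: "real^2 \<Rightarrow> 'b"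
  proof -
    have "continuous_on K g" using that assms by (meson continuous_on_subset smooth_on_continuous_on)
    then show ?thesis using compact_image_norm_bound[OF assms(3)] by metis
  qed
  have lip: "norm (g q - g p) \<le> (c1 + c2) * norm (q - p)"
    if g: "\<And>z. z \<in> K \<Longrightarrow> (g has_derivative (\<lambda>v. v $ 1 *\<^sub>R g1 z + v $ 2 *\<^sub>R g2 z)) (at z)"
      and c: "\<And>z. z \<in> closed_segment p q \<Longrightarrow> norm (g1 z) \<le> c1" "\<And>z. z \<in> closed_segment p q \<Longrightarrow> norm (g2 z) \<le> c2"
      and s: "closed_segment p q \<subseteq> K" for g g1 g2 :: "real^2 \<Rightarrow> 'b" and c1 c2 p q
  proof (rule differentiable_bound[of "closed_segment p q" g "\<lambda>z (v::real^2). v $ 1 *\<^sub>R g1 z + v $ 2 *\<^sub>R g2 z"])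
    fix z assume z: "z \<in> closed_segment p q"
    show "(g has_derivative (\<lambda>v. v $ 1 *\<^sub>R g1 z + v $ 2 *\<^sub>R g2 z)) (at z within closed_segment p q)"
      using g[of z] z s by (auto intro: has_derivative_at_withinI)
    show "onorm (\<lambda>v::real^2. v $ 1 *\<^sub>R g1 z + v $ 2 *\<^sub>R g2 z) \<le> c1 + c2"
    proof (rule onorm_le)
      fix v :: "real^2"
      have "norm (v $ 1 *\<^sub>R g1 z + v $ 2 *\<^sub>R g2 z) \<le> \<bar>v $ 1\<bar> * norm (g1 z) + \<bar>v $ 2\<bar> * norm (g2 z)"
        by (metis norm_triangle_ineq norm_scaleR)
      also have "\<dots> \<le> norm v * c1 + norm v * c2"
        using c[OF z] by (intro add_mono mult_mono component_le_norm_cart) auto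
      finally show "norm (v $ 1 *\<^sub>R g1 z + v $ 2 *\<^sub>R g2 z) \<le> (c1 + c2) * norm v" by (simp add: algebra_simps)
    qed
  qed auto
  have dpd: "(g has_derivative (\<lambda>v. v $ 1 *\<^sub>R pd 1 g z + v $ 2 *\<^sub>R pd 2 g z)) (at z)" if "smooth_on D g" "z \<in> K" for g :: "real^2 \<Rightarrow> 'b" and z
    using that assms(4) by (intro has_derivative_pd smooth_on_differentiable[of D]) auto
  obtain c0 where c0: "c0 > 0" "\<And>p. p \<in> K \<Longrightarrow> norm (f p) \<le> c0" using bdd[OF f] by blast
  have "\<forall>i. \<exists>c>0. \<forall>p\<in>K. norm (pd i f p) \<le> c" using bdd f smooth_on_pd by blast
  then obtain c1 where c1: "\<And>i. c1 i > 0" "\<And>i p. p \<in> K \<Longrightarrow> norm (pd i f p) \<le> c1 i" by metis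
  have "\<forall>j i. \<exists>c>0. \<forall>p\<in>K. norm (pd j (pd i f) p) \<le> c" using bdd f smooth_on_pd by blast
  then obtain c2 where c2: "\<And>j i. c2 j i > 0" "\<And>j i p. p \<in> K \<Longrightarrow> norm (pd j (pd i f) p) \<le> c2 j i" by metis
  define M where "M = (\<lambda>i. c2 1 i + c2 2 i)"
  define C where "C = c0 + (c1 1 + c1 2) + (M 1 + M 2)"
  have M: "M i > 0" for i using c2(1) by (simp add: M_def add_pos_pos)
  have CC: "c0 \<le> C" "c1 1 + c1 2 \<le> C" "M 1 + M 2 \<le> C" "C > 0"
    using c0(1) c1(1)[of 1] c1(1)[of 2] M[of 1] M[of 2] by (auto simp: C_def)
  have l1: "norm (f q - f p) \<le> C * norm (q - p)" if s: "closed_segment p q \<subseteq> K" for p q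
  proof -
    have "norm (f q - f p) \<le> (c1 1 + c1 2) * norm (q - p)"
      by (rule lip[OF dpd[OF f] _ _ s]) (use c1 s in auto)
    then show ?thesis using CC(2) by (meson mult_right_mono norm_ge_zero order_trans)
  qed
  have l2: "norm (f q - f p - ((q - p) $ 1 *\<^sub>R pd 1 f p + (q - p) $ 2 *\<^sub>R pd 2 f p)) \<le> C * (norm (q - p))\<^sup>2"
    if s: "closed_segment p q \<subseteq> K" for p q
  proof -
    have li: "norm (pd i f z - pd i f p) \<le> M i * norm (q - p)" if z: "z \<in> closed_segment p q" for i z
    proof -
      have sz: "closed_segment p z \<subseteq> closed_segment p q" using z by (simp add: subset_closed_segment)
      have "norm (pd i f z - pd i f p) \<le> M i * norm (z - p)"
        unfolding M_def
      proof (rule lip[where ?g1.0 = "pd 1 (pd i f)" and ?g2.0 = "pd 2 (pd i f)"])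
        show "(pd i f has_derivative (\<lambda>v. v $ 1 *\<^sub>R pd 1 (pd i f) z + v $ 2 *\<^sub>R pd 2 (pd i f) z)) (at z)" if "z \<in> K" for z
          by (rule dpd[OF smooth_on_pd[OF f] that])
        show "norm (pd 1 (pd i f) w) \<le> c2 1 i" "norm (pd 2 (pd i f) w) \<le> c2 2 i" if "w \<in> closed_segment p z" for w
          using c2 that sz s by auto
      qed (use sz s in auto)
      also have "\<dots> \<le> M i * norm (q - p)"
        using M[of i] z segment_bound1[OF z] by (intro mult_left_mono) auto
      finally show ?thesis .
    qed
    define h where "h = (\<lambda>z. f z - (z $ 1 *\<^sub>R pd 1 f p + z $ 2 *\<^sub>R pd 2 f p))"
    have hd: "(h has_derivative (\<lambda>v. v $ 1 *\<^sub>R (pd 1 f z - pd 1 f p) + v $ 2 *\<^sub>R (pd 2 f z - pd 2 f p))) (at z)" if "z \<in> K" for z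
    proof -
      have "bounded_linear (\<lambda>z::real^2. z $ 1 *\<^sub>R pd 1 f p + z $ 2 *\<^sub>R pd 2 f p)"
        by (intro bounded_linear_add bounded_linear_scaleR_const bounded_linear_vec_nth)
      from has_derivative_diff[OF dpd[OF f that] bounded_linear_imp_has_derivative[OF this]]
      show ?thesis unfolding h_def by (simp add: algebra_simps)
    qed
    have "norm (h q - h p) \<le> (M 1 * norm (q - p) + M 2 * norm (q - p)) * norm (q - p)"
      by (rule lip[OF hd li li s])
    also have "\<dots> = (M 1 + M 2) * (norm (q - p))\<^sup>2" by (simp add: power2_eq_square algebra_simps)
    also have "\<dots> \<le> C * (norm (q - p))\<^sup>2" using CC by (intro mult_right_mono) auto
    finally show ?thesis by (simp add: h_def algebra_simps)
  qed
  show thesis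
  proof (rule that[of C])
    show "norm (f p) \<le> C" if "p \<in> K" for p using c0(2)[OF that] CC(1) by simp
  qed (use CC l1 l2 in auto)
qed

text \<open>The Frobenius theorem for linear systems $\partial_1\Psi = P\Psi$, $\partial_2\Psi = Q\Psi$. The
  restriction of a solution to a ray from the origin satisfies an ordinary equation; let \<open>\<Psi> x\<close> be the value at
  time 1 of its solution \<open>Y x\<close> along the ray through \<open>x\<close>. With $A_p(v) = v_1 P(p) + v_2 Q(p)$ the
  derivative of \<open>\<Psi>\<close> should be $A_x(v)\Psi(x)$. Flatness says exactly that
  $Y_x(t) + t A_{tx}(v) Y_x(t)$ solves the equation of the ray through $x + v$ up to terms quadratic
  in \<open>v\<close>, and Gronwall's inequality carries this estimate to time 1.\<close>

lemma flat_system_star: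
  fixes P Q :: "real^2 \<Rightarrow> real^'n^'n"
  assumes D: "open D" "\<And>x t. x \<in> D \<Longrightarrow> t \<in> {0..1} \<Longrightarrow> t *\<^sub>R x \<in> D" and PQ: "smooth_on D P" "smooth_on D Q"
    and flat: "\<And>x w. x \<in> D \<Longrightarrow> pd 2 P x *v w + P x *v (Q x *v w) = pd 1 Q x *v w + Q x *v (P x *v w)"
  shows "\<exists>\<Psi>. \<Psi> 0 = c \<and> (\<forall>x\<in>D. (\<Psi> has_derivative (\<lambda>v. v $ 1 *\<^sub>R (P x *v \<Psi> x) + v $ 2 *\<^sub>R (Q x *v \<Psi> x))) (at x))"
proof -
  interpret mv: bounded_bilinear "(*v) :: real^'n^'n \<Rightarrow> real^'n \<Rightarrow> real^'n" by (rule bounded_bilinear_matrix_vector)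
  obtain \<kappa> where \<kappa>: "\<kappa> > 0" "\<And>(M::real^'n^'n) w. norm (M *v w) \<le> norm M * norm w * \<kappa>" using mv.pos_bounded by blast
  define A where "A = (\<lambda>p (v::real^2). v $ 1 *\<^sub>R P p + v $ 2 *\<^sub>R Q p)"
  have Acont: "continuous_on {0..1} (\<lambda>t. A (t *\<^sub>R x) w)" if "x \<in> D" for x w
  proof -
    have "continuous_on D (\<lambda>p. A p w)" unfolding A_def
      by (intro continuous_intros smooth_on_continuous_on PQ)
    then show ?thesis
      by (rule continuous_on_compose2) (use D(2)[OF that] in \<open>auto intro!: continuous_intros\<close>)
  qed
  have "\<forall>x\<in>D. \<exists>y. y 0 = c \<and> (\<forall>t\<in>{0..1}. (y has_vector_derivative A (t *\<^sub>R x) x *v y t) (at t within {0..1}))"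
    using linear_ode_unit_interval[OF Acont] by blast
  then obtain Y where Y0: "\<And>x. x \<in> D \<Longrightarrow> Y x 0 = c"
    and Yd: "\<And>x t. x \<in> D \<Longrightarrow> t \<in> {0..1} \<Longrightarrow> (Y x has_vector_derivative A (t *\<^sub>R x) x *v Y x t) (at t within {0..1})"
    by metis
  define \<Psi> where "\<Psi> = (\<lambda>x. if x = 0 then c else Y x 1)"
  have Y00: "Y 0 1 = c" if "0 \<in> D"
  proof -
    have "(Y 0 has_vector_derivative 0) (at t within {0..1})" if "t \<in> {0..1}" for t
      using Yd[OF \<open>0 \<in> D\<close> that] by (simp add: A_def)
    then show ?thesis using has_vector_derivative_zero_constant[of "{0..1}" "Y 0"] Y0[OF that]
      by (metis atLeastAtMost_iff convex_real_interval(5) order_refl zero_le_one)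
  qed
  have \<Psi>Y: "\<Psi> x = Y x 1" if "x \<in> D" for x using Y00 that by (auto simp: \<Psi>_def)
  have main: "\<exists>C r. r > 0 \<and> (\<forall>v. norm v < r \<longrightarrow> x + v \<in> D \<and> norm (Y (x + v) 1 - Y x 1 - A x v *v Y x 1) \<le> C * (norm v)\<^sup>2)"
    if x: "x \<in> D" for x
  proof -
    obtain r0 where r0: "r0 > 0" "cball x r0 \<subseteq> D" using D(1) x open_contains_cball by blast
    define r where "r = min r0 1"
    have r: "r > 0" "r \<le> 1" "cball x r \<subseteq> D" using r0 by (auto simp: r_def)
    define K where "K = (\<lambda>(t, z). t *\<^sub>R z) ` ({0..1} \<times> cball x r)"
    have K: "compact K" unfolding K_def
      by (intro compact_continuous_image compact_Times) (auto intro!: continuous_intros simp: case_prod_beta)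
    have KD: "K \<subseteq> D" using D(2) r(3) by (auto simp: K_def)
    obtain C1 where C1: "C1 > 0" "\<And>p. p \<in> K \<Longrightarrow> norm (P p) \<le> C1"
      "\<And>p q. closed_segment p q \<subseteq> K \<Longrightarrow> norm (P q - P p) \<le> C1 * norm (q - p)"
      "\<And>p q. closed_segment p q \<subseteq> K \<Longrightarrow> norm (P q - P p - ((q - p) $ 1 *\<^sub>R pd 1 P p + (q - p) $ 2 *\<^sub>R pd 2 P p)) \<le> C1 * (norm (q - p))\<^sup>2"
      using taylor_bounds[OF PQ(1) D(1) K KD] by blast
    obtain C2 where C2: "C2 > 0" "\<And>p. p \<in> K \<Longrightarrow> norm (Q p) \<le> C2"
      "\<And>p q. closed_segment p q \<subseteq> K \<Longrightarrow> norm (Q q - Q p) \<le> C2 * norm (q - p)"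
      "\<And>p q. closed_segment p q \<subseteq> K \<Longrightarrow> norm (Q q - Q p - ((q - p) $ 1 *\<^sub>R pd 1 Q p + (q - p) $ 2 *\<^sub>R pd 2 Q p)) \<le> C2 * (norm (q - p))\<^sup>2"
      using taylor_bounds[OF PQ(2) D(1) K KD] by blast
    define C where "C = C1 + C2"
    have Cpos: "C > 0" using C1 C2 by (simp add: C_def)
    have lin2: "norm (v $ 1 *\<^sub>R a + v $ 2 *\<^sub>R b) \<le> norm v * (c1 + c2)"
      if "norm a \<le> c1" "norm b \<le> c2" for v :: "real^2" and a b :: "real^'n^'n" and c1 c2
    proof -
      have "norm (v $ 1 *\<^sub>R a + v $ 2 *\<^sub>R b) \<le> \<bar>v $ 1\<bar> * norm a + \<bar>v $ 2\<bar> * norm b"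
        by (metis norm_triangle_ineq norm_scaleR)
      also have "\<dots> \<le> norm v * c1 + norm v * c2"
        using that by (intro add_mono mult_mono component_le_norm_cart) auto
      finally show ?thesis by (simp add: algebra_simps)
    qed
    have Ab: "norm (A p v) \<le> norm v * C" if "p \<in> K" for p v
      unfolding A_def C_def by (intro lin2 C1 C2 that)
    have AL: "norm (A q v - A p v) \<le> norm v * (C * norm (q - p))" if "closed_segment p q \<subseteq> K" for p q v
      using lin2[OF C1(3)[OF that] C2(3)[OF that], of v] by (simp add: A_def C_def algebra_simps)
    define DA where "DA = (\<lambda>p (w::real^2) (v::real^2). v $ 1 *\<^sub>R (w $ 1 *\<^sub>R pd 1 P p + w $ 2 *\<^sub>R pd 2 P p) + v $ 2 *\<^sub>R (w $ 1 *\<^sub>R pd 1 Q p + w $ 2 *\<^sub>R pd 2 Q p))"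
    have AT: "norm (A q v - A p v - DA p (q - p) v) \<le> norm v * (C * (norm (q - p))\<^sup>2)" if "closed_segment p q \<subseteq> K" for p q v
      using lin2[OF C1(4)[OF that] C2(4)[OF that], of v] by (simp add: A_def DA_def C_def algebra_simps)
    have "continuous_on {0..1} (Y x)"
      unfolding continuous_on_eq_continuous_within using has_vector_derivative_continuous[OF Yd[OF x]] by blast
    then obtain m where m: "m > 0" "\<And>t. t \<in> {0..1} \<Longrightarrow> norm (Y x t) \<le> m"
      using compact_image_norm_bound[of "{0..1}" "Y x"] by auto
    define X where "X = norm x + 1"
    have X: "X \<ge> 1" by (simp add: X_def)
    define L where "L = X * C * \<kappa>"
    define C3 where "C3 = (X * C + C) * m * \<kappa> + (X * C * (C * m * \<kappa>)) * \<kappa>"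
    have L0: "L \<ge> 0" using X Cpos \<kappa> by (simp add: L_def)
    have C30: "C3 \<ge> 0" using X Cpos \<kappa> m by (simp add: C3_def)
    have est: "norm (Y (x + v) 1 - Y x 1 - A x v *v Y x 1) \<le> (C3 * exp (L + 1/2)) * (norm v)\<^sup>2" if v: "norm v < r" for v
    proof -
      define x' where "x' = x + v"
      have x': "x' \<in> D" using v r(3) by (auto simp: x'_def subset_iff dist_norm)
      have seg: "closed_segment (t *\<^sub>R x) (t *\<^sub>R x') \<subseteq> K" if "t \<in> {0..1}" for t
      proof
        fix p assume "p \<in> closed_segment (t *\<^sub>R x) (t *\<^sub>R x')"
        then obtain s where s: "0 \<le> s" "s \<le> 1" "p = (1 - s) *\<^sub>R (t *\<^sub>R x) + s *\<^sub>R (t *\<^sub>R x')" by (auto simp: in_segment)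
        have "p = t *\<^sub>R (x + s *\<^sub>R v)" unfolding s x'_def by (simp add: algebra_simps)
        moreover have "norm (s *\<^sub>R v) \<le> r" using s v mult_left_le_one_le[of "norm v" s] by simp
        ultimately show "p \<in> K" using that unfolding K_def by (auto simp: dist_norm image_iff intro!: bexI[of _ "x + s *\<^sub>R v"] bexI[of _ t])
      qed
      have nx': "norm x' \<le> X" using v r norm_triangle_ineq[of x v] by (simp add: x'_def X_def)
      \<comment> \<open>the deviation of \<open>Y x'\<close> from its first-order approximation; it starts at 0\<close>
      define E where "E = (\<lambda>t. Y x' t - Y x t - (t *\<^sub>R A (t *\<^sub>R x) v) *v Y x t)"
      define E' where "E' = (\<lambda>t. A (t *\<^sub>R x') x' *v Y x' t - A (t *\<^sub>R x) x *v Y x t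
          - ((t *\<^sub>R A (t *\<^sub>R x) v) *v (A (t *\<^sub>R x) x *v Y x t) + (t *\<^sub>R DA (t *\<^sub>R x) x v + A (t *\<^sub>R x) v) *v Y x t))"
      have dA: "((\<lambda>t. t *\<^sub>R A (t *\<^sub>R x) v) has_vector_derivative (t *\<^sub>R DA (t *\<^sub>R x) x v + A (t *\<^sub>R x) v)) (at t within {0..1})"
        if t: "t \<in> {0..1}" for t
      proof -
        have d: "((\<lambda>t. f (t *\<^sub>R x)) has_vector_derivative x $ 1 *\<^sub>R pd 1 f (t *\<^sub>R x) + x $ 2 *\<^sub>R pd 2 f (t *\<^sub>R x)) (at t within {0..1})"
          if "smooth_on D f" for f :: "real^2 \<Rightarrow> real^'n^'n"
        proof -
          have "((\<lambda>t. t *\<^sub>R x) has_derivative (\<lambda>h. h *\<^sub>R x)) (at t within {0..1})" by (auto intro!: derivative_eq_intros)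
          from has_derivative_compose[OF this has_derivative_pd[OF smooth_on_differentiable[OF that D(2)[OF x t]]]]
          show ?thesis by (simp add: has_vector_derivative_def algebra_simps)
        qed
        have "((\<lambda>t. A (t *\<^sub>R x) v) has_vector_derivative DA (t *\<^sub>R x) x v) (at t within {0..1})"
          unfolding A_def DA_def
          by (intro has_vector_derivative_add bounded_linear.has_vector_derivative[OF bounded_linear_scaleR_right] d PQ)
        from has_vector_derivative_scaleR[OF _ this, of "\<lambda>t. t" 1] show ?thesis by (simp add: algebra_simps)
      qed
      have dE: "(E has_vector_derivative E' t) (at t within {0..1})" if t: "t \<in> {0..1}" for t
        unfolding E_def E'_def
        by (intro has_vector_derivative_diff Yd x x' t mv.has_vector_derivative dA)
      have bE: "norm (E' t) \<le> L * norm (E t) + C3 * (norm v)\<^sup>2" if t: "t \<in> {0..1}" for t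
      proof -
        define p where "p = t *\<^sub>R x" define q where "q = t *\<^sub>R x'"
        have pq: "closed_segment p q \<subseteq> K" "q - p = t *\<^sub>R v" using seg[OF t] by (auto simp: p_def q_def x'_def algebra_simps)
        have pK: "p \<in> K" "q \<in> K" using pq by auto
        have pD: "p \<in> D" using pK KD by auto
        have tv: "norm (q - p) \<le> norm v" using t by (simp add: pq mult_left_le_one_le)
        have tv2: "(norm (q - p))\<^sup>2 \<le> (norm v)\<^sup>2" using tv by (simp add: power_mono)
        define y where "y = Y x t" define y' where "y' = Y x' t"
        define N where "N = A p v *v y"
        \<comment> \<open>flatness at \<open>p\<close> in the directions \<open>v\<close> and \<open>x\<close>; it cancels the terms of \<open>E' t\<close> that are linear in \<open>v\<close>\<close>
        have flat': "DA p v x *v y + A p x *v N = DA p x v *v y + A p v *v (A p x *v y)"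
        proof -
          define k where "k = x $ 1 * v $ 2 - x $ 2 * v $ 1"
          have "DA p v x *v y + A p x *v N - (DA p x v *v y + A p v *v (A p x *v y))
            = k *\<^sub>R ((pd 2 P p *v y + P p *v (Q p *v y)) - (pd 1 Q p *v y + Q p *v (P p *v y)))"
            by (simp add: DA_def A_def N_def k_def mv.add_left mv.add_right mv.scaleR_left mv.scaleR_right algebra_simps)
          then show ?thesis using flat[OF pD, of y] by simp
        qed
        define R1 where "R1 = (A q x - A p x - DA p (q - p) x) + (A q v - A p v)"
        define R2 where "R2 = A q x' - A p x"
        have DAt: "DA p (q - p) x = t *\<^sub>R DA p v x" by (simp add: pq DA_def algebra_simps)
        have Axx: "A z x' = A z x + A z v" for z by (simp add: A_def x'_def algebra_simps)
        have "E' t = A q x' *v E t + R1 *v y + t *\<^sub>R (R2 *v N)"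
        proof -
          have "E' t - (A q x' *v E t + R1 *v y + t *\<^sub>R (R2 *v N))
            = t *\<^sub>R ((DA p v x *v y + A p x *v N) - (DA p x v *v y + A p v *v (A p x *v y)))"
            unfolding E'_def E_def R1_def R2_def DAt p_def[symmetric] q_def[symmetric] y_def[symmetric] y'_def[symmetric] N_def Axx
            by (simp add: mv.add_left mv.add_right mv.scaleR_left mv.scaleR_right mv.diff_left mv.diff_right algebra_simps)
          then show ?thesis using flat' by simp
        qed
        moreover have "norm (A q x' *v E t) \<le> L * norm (E t)"
        proof -
          have "norm (A q x') \<le> X * C" using Ab[OF pK(2), of x'] nx' Cpos by (meson less_imp_le mult_right_mono order_trans)
          then have "norm (A q x') * norm (E t) * \<kappa> \<le> X * C * norm (E t) * \<kappa>" using \<kappa> by (intro mult_right_mono) auto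
          then show ?thesis using \<kappa>(2)[of "A q x'" "E t"] by (simp add: L_def mult_ac)
        qed
        moreover have "norm (R1 *v y) \<le> ((X * C + C) * m * \<kappa>) * (norm v)\<^sup>2"
        proof -
          have "norm (A q x - A p x - DA p (q - p) x) \<le> norm x * (C * (norm (q - p))\<^sup>2)" by (rule AT[OF pq(1)])
          also have "\<dots> \<le> X * (C * (norm v)\<^sup>2)" using tv2 Cpos by (intro mult_mono) (auto simp: X_def)
          finally have 1: "norm (A q x - A p x - DA p (q - p) x) \<le> X * (C * (norm v)\<^sup>2)" .
          have "norm (A q v - A p v) \<le> norm v * (C * norm (q - p))" by (rule AL[OF pq(1)])
          also have "\<dots> \<le> norm v * (C * norm v)" using tv Cpos by (intro mult_left_mono) auto
          finally have 2: "norm (A q v - A p v) \<le> C * (norm v)\<^sup>2" by (simp add: power2_eq_square mult_ac)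
          have "norm R1 \<le> (X * C + C) * (norm v)\<^sup>2"
            unfolding R1_def using norm_triangle_le[OF add_mono[OF 1 2]] by (simp add: algebra_simps)
          then have "norm R1 * norm y * \<kappa> \<le> ((X * C + C) * (norm v)\<^sup>2) * m * \<kappa>"
            using m(2)[OF t] \<kappa> X Cpos by (intro mult_right_mono mult_mono) (auto simp: y_def)
          then show ?thesis using \<kappa>(2)[of R1 y] by (simp add: mult_ac)
        qed
        moreover have "norm (t *\<^sub>R (R2 *v N)) \<le> ((X * C * (C * m * \<kappa>)) * \<kappa>) * (norm v)\<^sup>2 + 0"
        proof -
          have "norm N \<le> norm (A p v) * norm y * \<kappa>" unfolding N_def by (rule \<kappa>)
          also have "\<dots> \<le> (norm v * C) * m * \<kappa>"
            using Ab[OF pK(1), of v] m(2)[OF t] \<kappa> Cpos by (intro mult_right_mono mult_mono) (auto simp: y_def)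
          finally have N: "norm N \<le> norm v * (C * m * \<kappa>)" by (simp add: mult_ac)
          have "R2 = (A q x - A p x) + A q v" by (simp add: R2_def Axx)
          also have "norm \<dots> \<le> norm x * (C * norm v) + norm v * C"
            using AL[OF pq(1), of x] Ab[OF pK(2), of v] tv Cpos
              mult_left_mono[OF mult_left_mono[OF tv, of C], of "norm x"] by (intro norm_triangle_le add_mono) auto
          also have "\<dots> = X * C * norm v" by (simp add: X_def algebra_simps)
          finally have R2: "norm R2 \<le> X * C * norm v" .
          have "norm (R2 *v N) \<le> norm R2 * norm N * \<kappa>" by (rule \<kappa>)
          also have "\<dots> \<le> (X * C * norm v) * (norm v * (C * m * \<kappa>)) * \<kappa>"
            using N R2 \<kappa> X Cpos by (intro mult_right_mono mult_mono) auto
          finally have "norm (R2 *v N) \<le> ((X * C * (C * m * \<kappa>)) * \<kappa>) * (norm v)\<^sup>2" by (simp add: power2_eq_square mult_ac)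
          moreover have "norm (t *\<^sub>R (R2 *v N)) \<le> norm (R2 *v N)" using t by (simp add: mult_left_le_one_le)
          ultimately show ?thesis by simp
        qed
        ultimately have "norm (E' t) \<le> L * norm (E t) + ((X * C + C) * m * \<kappa>) * (norm v)\<^sup>2 + ((X * C * (C * m * \<kappa>)) * \<kappa>) * (norm v)\<^sup>2"
          by (smt (verit) norm_triangle_ineq)
        then show ?thesis by (simp add: C3_def algebra_simps)
      qed
      have "E 0 = 0" using Y0[OF x] Y0[OF x'] by (simp add: E_def)
      then have "norm (E 1) \<le> (C3 * (norm v)\<^sup>2) * exp (L + 1/2)"
        using C30 L0 by (intro gronwall_deriv[OF dE bE]) auto
      then show ?thesis by (simp add: E_def x'_def mult_ac)
    qed
    show ?thesis
      by (rule exI[of _ "C3 * exp (L + 1/2)"], rule exI[of _ r]) (use r est in \<open>auto simp: subset_iff dist_norm\<close>)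
  qed
  have "(\<Psi> has_derivative (\<lambda>v. v $ 1 *\<^sub>R (P x *v \<Psi> x) + v $ 2 *\<^sub>R (Q x *v \<Psi> x))) (at x)" if x: "x \<in> D" for x
  proof -
    obtain C r where C: "r > 0" "\<And>v. norm v < r \<Longrightarrow> x + v \<in> D"
      "\<And>v. norm v < r \<Longrightarrow> norm (Y (x + v) 1 - Y x 1 - A x v *v Y x 1) \<le> C * (norm v)\<^sup>2" using main[OF x] by blast
    have Av: "A x v *v w = v $ 1 *\<^sub>R (P x *v w) + v $ 2 *\<^sub>R (Q x *v w)" for v w
      by (simp add: A_def mv.add_left mv.scaleR_left)
    have bl: "bounded_linear (\<lambda>v::real^2. v $ 1 *\<^sub>R (P x *v \<Psi> x) + v $ 2 *\<^sub>R (Q x *v \<Psi> x))"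
      by (intro bounded_linear_add bounded_linear_scaleR_const bounded_linear_vec_nth)
    show ?thesis
      unfolding has_derivative_at_alt
    proof (intro conjI allI impI bl)
      fix e :: real assume e: "e > 0"
      define d where "d = min r (e / (\<bar>C\<bar> + 1))"
      have d: "d > 0" using C(1) e by (simp add: d_def)
      show "\<exists>d>0. \<forall>y. norm (y - x) < d \<longrightarrow> norm (\<Psi> y - \<Psi> x - ((y - x) $ 1 *\<^sub>R (P x *v \<Psi> x) + (y - x) $ 2 *\<^sub>R (Q x *v \<Psi> x))) \<le> e * norm (y - x)"
      proof (intro exI[of _ d] conjI allI impI d)
        fix y assume y: "norm (y - x) < d"
        define v where "v = y - x"
        have v: "norm v < r" "y = x + v" using y by (auto simp: v_def d_def)
        have "norm (\<Psi> y - \<Psi> x - (v $ 1 *\<^sub>R (P x *v \<Psi> x) + v $ 2 *\<^sub>R (Q x *v \<Psi> x))) \<le> C * (norm v)\<^sup>2"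
          using C(3)[OF v(1)] \<Psi>Y[OF x] \<Psi>Y[OF C(2)[OF v(1)]] by (simp add: v(2) Av)
        also have "\<dots> \<le> (\<bar>C\<bar> + 1) * norm v * norm v" by (simp add: power2_eq_square mult_right_mono mult.assoc)
        also have "\<dots> \<le> e * norm v"
        proof (rule mult_right_mono)
          have "norm v \<le> e / (\<bar>C\<bar> + 1)" using y by (simp add: v_def d_def)
          then show "(\<bar>C\<bar> + 1) * norm v \<le> e" by (simp add: field_simps)
        qed simp
        finally show "norm (\<Psi> y - \<Psi> x - ((y - x) $ 1 *\<^sub>R (P x *v \<Psi> x) + (y - x) $ 2 *\<^sub>R (Q x *v \<Psi> x))) \<le> e * norm (y - x)"
          by (simp add: v_def)
      qed
    qed
  qed
  then show ?thesis by (intro exI[of _ \<Psi>]) (simp add: \<Psi>_def)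
qed

lemma smooth_on_matrix_vector [smooth_intros]:
  fixes M :: "_ \<Rightarrow> real^'n^'m"
  shows "open S \<Longrightarrow> smooth_on S M \<Longrightarrow> smooth_on S w \<Longrightarrow> smooth_on S (\<lambda>x. M x *v w x)"
  by (simp add: smooth_on_def Ck_on_bilinear[OF bounded_bilinear_matrix_vector])

lemma smooth_on_matrix [smooth_intros]:
  assumes "open S" "\<And>i j. smooth_on S (\<lambda>x. f x i j)"
  shows "smooth_on S (\<lambda>x. (\<chi> i j. f x i j) :: real^'n^'m)"
proof -
  have bl: "bounded_linear (axis i :: real^'n \<Rightarrow> real^'n^'m)" for i
    unfolding linear_conv_bounded_linear[symmetric] by (rule linearI) (auto simp: axis_def vec_eq_iff)
  have "(\<lambda>x. (\<chi> i j. f x i j) :: real^'n^'m) = (\<lambda>x. \<Sum>i\<in>UNIV. axis i (\<chi> j. f x i j))"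
    by (auto simp: fun_eq_iff vec_eq_iff axis_def if_distribR if_distrib[of "\<lambda>v::real^_. v $ _"] cong: if_cong)
  then show ?thesis
    using assms by (auto intro!: smooth_intros smooth_on_linear_compose[OF _ _ bl])
qed

lemmas pd_matrix_vector = pd_bilinear[OF bounded_bilinear_matrix_vector]

text \<open>The system expresses the derivative of \<open>\<Psi>\<close> through \<open>\<Psi>\<close> itself, so that regularity bootstraps.\<close>

lemma smooth_linear_system:
  fixes P Q :: "real^2 \<Rightarrow> real^'n^'n"
  assumes "open D" "smooth_on D P" "smooth_on D Q"
    and d: "\<And>x. x \<in> D \<Longrightarrow> (\<Psi> has_derivative (\<lambda>v. v $ 1 *\<^sub>R (P x *v \<Psi> x) + v $ 2 *\<^sub>R (Q x *v \<Psi> x))) (at x)"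
  shows "smooth_on D \<Psi>"
proof -
  have "Ck_on k D \<Psi>" for k
  proof (induction k)
    case 0
    show ?case using d by (auto intro: continuous_at_imp_continuous_on has_derivative_continuous)
  next
    case (Suc k)
    have "Ck_on k D (\<lambda>x. M x *v \<Psi> x)" if "smooth_on D M" for M :: "real^2 \<Rightarrow> real^'n^'n"
      using that Suc by (intro Ck_on_bilinear[OF bounded_bilinear_matrix_vector] assms(1)) (auto simp: smooth_on_def)
    then have "Ck_on k D (\<lambda>x. v $ 1 *\<^sub>R (P x *v \<Psi> x) + v $ 2 *\<^sub>R (Q x *v \<Psi> x))" for v :: "real^2"
      using assms(2,3) by (intro Ck_on_add Ck_on_bilinear[OF bounded_bilinear_scaleR] Ck_on_const assms(1)) auto
    then show ?case by (intro Ck_on_SucI[OF assms(1) d])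
  qed
  then show ?thesis by (simp add: smooth_on_def)
qed

text \<open>A flat system pulls back along a diffeomorphism; so it suffices to solve it on one
  star-shaped model of the domain.\<close>

lemma flat_system_pullback:
  fixes P Q :: "real^2 \<Rightarrow> real^'n^'n" and \<phi> \<psi> :: "real^2 \<Rightarrow> real^2"
  assumes D: "open D" "0 \<in> D" "\<And>x t. x \<in> D \<Longrightarrow> t \<in> {0..1} \<Longrightarrow> t *\<^sub>R x \<in> D"
    and \<Omega>: "open \<Omega>" and PQ: "smooth_on \<Omega> P" "smooth_on \<Omega> Q"
    and flat: "\<And>x w. x \<in> \<Omega> \<Longrightarrow> pd 2 P x *v w + P x *v (Q x *v w) = pd 1 Q x *v w + Q x *v (P x *v w)"
    and \<phi>: "smooth_on D \<phi>" "\<And>y. y \<in> D \<Longrightarrow> \<phi> y \<in> \<Omega>"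
    and \<psi>: "smooth_on \<Omega> \<psi>" "\<And>x. x \<in> \<Omega> \<Longrightarrow> \<psi> x \<in> D" "\<And>x. x \<in> \<Omega> \<Longrightarrow> \<phi> (\<psi> x) = x" "\<psi> (\<phi> 0) = 0"
  shows "\<exists>\<Psi>. smooth_on \<Omega> \<Psi> \<and> \<Psi> (\<phi> 0) = c \<and> (\<forall>x\<in>\<Omega>. pd 1 \<Psi> x = P x *v \<Psi> x \<and> pd 2 \<Psi> x = Q x *v \<Psi> x)"
proof -
  interpret mv: bounded_bilinear "(*v) :: real^'n^'n \<Rightarrow> real^'n \<Rightarrow> real^'n" by (rule bounded_bilinear_matrix_vector)
  define R where "R = (\<lambda>i y. (pd i \<phi> y $ 1) *\<^sub>R P (\<phi> y) + (pd i \<phi> y $ 2) *\<^sub>R Q (\<phi> y))"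
  have im: "\<phi> ` D \<subseteq> \<Omega>" using \<phi> by auto
  have sP: "smooth_on D (\<lambda>y. P (\<phi> y))" "smooth_on D (\<lambda>y. Q (\<phi> y))"
    using smooth_on_compose[OF D(1) \<Omega> im _ \<phi>(1)] PQ by auto
  have sR: "smooth_on D (R i)" for i
    unfolding R_def by (intro smooth_intros D sP \<phi>)
  have flatR: "pd 2 (R 1) y *v w + R 1 y *v (R 2 y *v w) = pd 1 (R 2) y *v w + R 2 y *v (R 1 y *v w)" if y: "y \<in> D" for y w
  proof -
    have dP: "pd i (\<lambda>y. f (\<phi> y)) y = (pd i \<phi> y $ 1) *\<^sub>R pd 1 f (\<phi> y) + (pd i \<phi> y $ 2) *\<^sub>R pd 2 f (\<phi> y)"
      if "smooth_on \<Omega> f" for f :: "real^2 \<Rightarrow> real^'n^'n" and i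
      by (rule pd_compose) (use that y \<phi> in \<open>auto intro: smooth_on_differentiable\<close>)
    have dn: "(\<lambda>y. pd j \<phi> y $ k) differentiable (at y)" "pd i (\<lambda>y. pd j \<phi> y $ k) y = pd i (pd j \<phi>) y $ k" for i j k
      using pd_nth[OF smooth_on_differentiable[OF smooth_on_pd[OF \<phi>(1)] y]]
        smooth_on_differentiable[OF smooth_on_nth[OF D(1) smooth_on_pd[OF \<phi>(1)]] y] by auto
    have dPd: "(\<lambda>y. P (\<phi> y)) differentiable (at y)" "(\<lambda>y. Q (\<phi> y)) differentiable (at y)"
      using sP y by (auto intro: smooth_on_differentiable)
    have dR: "pd i (R j) y = ((pd j \<phi> y $ 1) *\<^sub>R ((pd i \<phi> y $ 1) *\<^sub>R pd 1 P (\<phi> y) + (pd i \<phi> y $ 2) *\<^sub>R pd 2 P (\<phi> y)) + (pd i (pd j \<phi>) y $ 1) *\<^sub>R P (\<phi> y))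
        + ((pd j \<phi> y $ 2) *\<^sub>R ((pd i \<phi> y $ 1) *\<^sub>R pd 1 Q (\<phi> y) + (pd i \<phi> y $ 2) *\<^sub>R pd 2 Q (\<phi> y)) + (pd i (pd j \<phi>) y $ 2) *\<^sub>R Q (\<phi> y))" for i j
      unfolding R_def
      by (subst pd_add pd_scaleR; (intro differentiable_add differentiable_scaleR dn dPd)?)+ (simp add: dP PQ dn)
    have comm: "pd 2 (pd 1 \<phi>) y = pd 1 (pd 2 \<phi>) y" by (rule pd_commute[OF \<phi>(1) D(1) y])
    define k where "k = pd 1 \<phi> y $ 1 * pd 2 \<phi> y $ 2 - pd 1 \<phi> y $ 2 * pd 2 \<phi> y $ 1"
    have "pd 2 (R 1) y *v w + R 1 y *v (R 2 y *v w) - (pd 1 (R 2) y *v w + R 2 y *v (R 1 y *v w))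
      = k *\<^sub>R ((pd 2 P (\<phi> y) *v w + P (\<phi> y) *v (Q (\<phi> y) *v w)) - (pd 1 Q (\<phi> y) *v w + Q (\<phi> y) *v (P (\<phi> y) *v w)))"
      unfolding dR comm unfolding R_def k_def
      by (simp add: mv.add_left mv.add_right mv.scaleR_left mv.scaleR_right algebra_simps)
    then show ?thesis using flat[OF \<phi>(2)[OF y], of w] by simp
  qed
  obtain \<Phi> where \<Phi>: "\<Phi> 0 = c" "\<And>y. y \<in> D \<Longrightarrow> (\<Phi> has_derivative (\<lambda>v. v $ 1 *\<^sub>R (R 1 y *v \<Phi> y) + v $ 2 *\<^sub>R (R 2 y *v \<Phi> y))) (at y)"
    using flat_system_star[OF D(1,3) sR sR flatR] by blast
  have s\<Phi>: "smooth_on D \<Phi>" by (rule smooth_linear_system[OF D(1) sR sR \<Phi>(2)])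
  define \<Psi> where "\<Psi> = (\<lambda>x. \<Phi> (\<psi> x))"
  have "smooth_on \<Omega> \<Psi>" unfolding \<Psi>_def
    using \<psi> by (intro smooth_on_compose[OF \<Omega> D(1) _ s\<Phi>]) auto
  moreover have "pd i \<Psi> x = (if i = 1 then P x else Q x) *v \<Psi> x" if x: "x \<in> \<Omega>" for i x
  proof -
    have y: "\<psi> x \<in> D" using \<psi> x by auto
    have "pd i (\<lambda>x. \<phi> (\<psi> x)) x = axis i 1"
    proof -
      have "pd i (\<lambda>x. \<phi> (\<psi> x)) x = pd i (\<lambda>x. x) x" by (rule pd_cong[OF \<Omega> x]) (use \<psi> in auto)
      then show ?thesis by (simp add: pd_def)
    qed
    then have id: "(pd i \<psi> x $ 1) *\<^sub>R pd 1 \<phi> (\<psi> x) + (pd i \<psi> x $ 2) *\<^sub>R pd 2 \<phi> (\<psi> x) = axis i 1"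
      using pd_compose[OF smooth_on_differentiable[OF \<phi>(1) y] smooth_on_differentiable[OF \<psi>(1) x]] by simp
    have idk: "pd i \<psi> x $ 1 * pd 1 \<phi> (\<psi> x) $ k + pd i \<psi> x $ 2 * pd 2 \<phi> (\<psi> x) $ k = (if i = k then 1 else 0)" for k
      using arg_cong[OF id, of "\<lambda>v. v $ k"] by (simp add: axis_def)
    have "pd i \<Psi> x = (pd i \<psi> x $ 1) *\<^sub>R (R 1 (\<psi> x) *v \<Psi> x) + (pd i \<psi> x $ 2) *\<^sub>R (R 2 (\<psi> x) *v \<Psi> x)"
      unfolding \<Psi>_def
      using pd_compose[OF smooth_on_differentiable[OF s\<Phi> y] smooth_on_differentiable[OF \<psi>(1) x]] pd_eq12[OF \<Phi>(2)[OF y]] by simp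
    also have "\<dots> = ((pd i \<psi> x $ 1 * pd 1 \<phi> (\<psi> x) $ 1 + pd i \<psi> x $ 2 * pd 2 \<phi> (\<psi> x) $ 1) *\<^sub>R (P x *v \<Psi> x)
       + (pd i \<psi> x $ 1 * pd 1 \<phi> (\<psi> x) $ 2 + pd i \<psi> x $ 2 * pd 2 \<phi> (\<psi> x) $ 2) *\<^sub>R (Q x *v \<Psi> x))"
      unfolding R_def \<psi>(3)[OF x] by (simp add: mv.add_left mv.scaleR_left algebra_simps)
    also have "\<dots> = (if i = 1 then P x else Q x) *v \<Psi> x"
      unfolding idk using exhaust_2[of i] by auto
    finally show ?thesis .
  qed
  ultimately show ?thesis using \<Phi>(1) \<psi>(4) by (intro exI[of _ \<Psi>]) (auto simp: \<Psi>_def)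
qed

lemma holomorphic_smooth_on:
  assumes "open S" "f holomorphic_on S"
  shows "smooth_on S f"
proof -
  have "Ck_on k S f" if "f holomorphic_on S" for k f
    using that
  proof (induction k arbitrary: f)
    case 0 then show ?case by (simp add: holomorphic_on_imp_continuous_on)
  next
    case (Suc k)
    show ?case
    proof (rule Ck_on_SucI[OF assms(1), where f' = "\<lambda>z v. deriv f z * v"])
      show "(f has_derivative (\<lambda>v. deriv f z * v)) (at z)" if "z \<in> S" for z
        using holomorphic_derivI[OF Suc.prems assms(1) that] by (simp add: has_field_derivative_def)
      show "Ck_on k S (\<lambda>z. deriv f z * v)" for v
        using Suc by (intro Ck_on_bilinear[OF bounded_bilinear_mult assms(1)] Suc.IH Ck_on_const holomorphic_deriv assms(1))
    qed
  qed
  then show ?thesis using assms by (simp add: smooth_on_def)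
qed

text \<open>By the Riemann mapping theorem every simply connected plane domain is conformally, hence
  smoothly, equivalent to the disc or to the plane, which are star-shaped.\<close>

lemma flat_system_simply_connected:
  fixes P Q :: "real^2 \<Rightarrow> real^'n^'n"
  assumes \<Omega>: "open \<Omega>" "simply_connected \<Omega>" "\<Omega> \<noteq> {}" and PQ: "smooth_on \<Omega> P" "smooth_on \<Omega> Q"
    and flat: "\<And>x w. x \<in> \<Omega> \<Longrightarrow> pd 2 P x *v w + P x *v (Q x *v w) = pd 1 Q x *v w + Q x *v (P x *v w)"
  shows "\<exists>x0\<in>\<Omega>. \<forall>c. \<exists>\<Psi>. smooth_on \<Omega> \<Psi> \<and> \<Psi> x0 = c \<and> (\<forall>x\<in>\<Omega>. pd 1 \<Psi> x = P x *v \<Psi> x \<and> pd 2 \<Psi> x = Q x *v \<Psi> x)"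
proof -
  define \<kappa> where "\<kappa> = (\<lambda>x::real^2. Complex (x $ 1) (x $ 2))"
  define \<iota> where "\<iota> = (\<lambda>z. vector [Re z, Im z] :: real^2)"
  have inv: "\<kappa> (\<iota> z) = z" "\<iota> (\<kappa> x) = x" for z x by (simp_all add: \<kappa>_def \<iota>_def vec_eq_iff forall_2)
  have "linear \<kappa>" by (rule linearI) (simp_all add: \<kappa>_def complex_eq_iff)
  then have bl\<kappa>: "bounded_linear \<kappa>" by (simp add: linear_conv_bounded_linear)
  have "linear \<iota>" by (rule linearI) (simp_all add: \<iota>_def vec_eq_iff forall_2)
  then have bl\<iota>: "bounded_linear \<iota>" by (simp add: linear_conv_bounded_linear)
  have homeo: "homeomorphism \<Omega> (\<kappa> ` \<Omega>) \<kappa> \<iota>"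
    using linear_continuous_on[OF bl\<kappa>] linear_continuous_on[OF bl\<iota>]
    by (auto simp: homeomorphism_def inv image_iff)
  have "\<kappa> ` \<Omega> = \<iota> -` \<Omega>" using inv by (auto simp: image_iff) (metis inv)
  then have op: "open (\<kappa> ` \<Omega>)"
    using \<Omega>(1) linear_continuous_on[OF bl\<iota>] by (metis open_vimage)
  have sc: "simply_connected (\<kappa> ` \<Omega>)"
    using homeomorphic_simply_connected \<Omega>(2) homeo homeomorphic_def by blast
  consider "\<kappa> ` \<Omega> = UNIV" | f g where "f holomorphic_on (\<kappa> ` \<Omega>)" "g holomorphic_on ball 0 1"
      "\<And>z. z \<in> \<kappa> ` \<Omega> \<Longrightarrow> f z \<in> ball 0 1 \<and> g (f z) = z" "\<And>z. z \<in> ball 0 1 \<Longrightarrow> g z \<in> \<kappa> ` \<Omega> \<and> f (g z) = z"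
    using sc simply_connected_eq_biholomorphic_to_disc[OF op] \<Omega>(3) by (metis image_is_empty)
  then show ?thesis
  proof cases
    case 1
    have "\<Omega> = UNIV"
    proof -
      have "x \<in> \<Omega>" for x using 1 inv(2) by (metis UNIV_I imageE)
      then show ?thesis by blast
    qed
    moreover have "smooth_on UNIV (\<lambda>x::real^2. x)" by (rule smooth_on_ident)
    ultimately show ?thesis
      using flat_system_pullback[of UNIV \<Omega> P Q "\<lambda>x. x" "\<lambda>x. x"] PQ flat by (intro bexI[of _ 0]) auto
  next
    case (2 f g)
    have norm\<iota>: "norm (\<iota> z) = cmod z" for z
      by (simp add: \<iota>_def norm_vec_def L2_set_def sum_2 cmod_def)
    have ballc: "\<kappa> y \<in> ball 0 1 \<longleftrightarrow> y \<in> ball 0 1" for y using norm\<iota>[of "\<kappa> y"] by (simp add: inv)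
    define \<phi> where "\<phi> = (\<lambda>y. \<iota> (g (\<kappa> y)))"
    define \<psi> where "\<psi> = (\<lambda>x. \<iota> (f (\<kappa> x)))"
    have s\<phi>: "smooth_on (ball 0 1) \<phi>" unfolding \<phi>_def
      by (intro smooth_on_linear_compose[OF _ _ bl\<iota>] smooth_on_compose[of _ "ball 0 1" \<kappa> g] holomorphic_smooth_on 2 smooth_on_linear bl\<kappa>)
         (use ballc in auto)
    have s\<psi>: "smooth_on \<Omega> \<psi>" unfolding \<psi>_def
      by (intro smooth_on_linear_compose[OF _ _ bl\<iota>] smooth_on_compose[of _ "\<kappa> ` \<Omega>" \<kappa> f] holomorphic_smooth_on 2 smooth_on_linear bl\<kappa> op \<Omega>) auto
    have p1: "\<phi> y \<in> \<Omega>" if "y \<in> ball 0 1" for y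
    proof -
      have "g (\<kappa> y) \<in> \<kappa> ` \<Omega>" using 2(4)[of "\<kappa> y"] ballc that by blast
      then show ?thesis using inv by (auto simp: \<phi>_def)
    qed
    have p2: "\<psi> x \<in> ball 0 1" "\<phi> (\<psi> x) = x" if "x \<in> \<Omega>" for x
      using 2(3)[of "\<kappa> x"] that norm\<iota> by (auto simp: \<phi>_def \<psi>_def inv)
    have p3: "\<psi> (\<phi> 0) = 0"
      using 2(4)[of "\<kappa> 0"] ballc[of 0] by (simp add: \<phi>_def \<psi>_def inv)
    show ?thesis
    proof (rule bexI[of _ "\<phi> 0"], intro allI)
      fix c
      show "\<exists>\<Psi>. smooth_on \<Omega> \<Psi> \<and> \<Psi> (\<phi> 0) = c \<and> (\<forall>x\<in>\<Omega>. pd 1 \<Psi> x = P x *v \<Psi> x \<and> pd 2 \<Psi> x = Q x *v \<Psi> x)"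
        by (rule flat_system_pullback[OF _ _ _ \<Omega>(1) PQ flat s\<phi> p1 s\<psi> p2 p3])
           (auto simp: mult_le_one intro: le_less_trans[OF mult_left_le_one_le])
    qed (use p1[of 0] in simp)
  qed
qed

text \<open>A potential solves the flat system with the nilpotent matrices that have \<open>p\<close> and \<open>q\<close> as their
  only nonzero entry: if the second component of a solution is 1, then the first one is a potential.\<close>

lemma poincare_convex:
  fixes p q :: "real^2 \<Rightarrow> real"
  assumes S: "open S" "convex S" "x0 \<in> S" and pq: "smooth_on S p" "smooth_on S q" "\<And>x. x \<in> S \<Longrightarrow> pd 2 p x = pd 1 q x"
  obtains f where "smooth_on S f" "f x0 = (0::real)" "\<And>x. x \<in> S \<Longrightarrow> pd 1 f x = p x" "\<And>x. x \<in> S \<Longrightarrow> pd 2 f x = q x"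
proof -
  define M where "M = (\<lambda>(r::real^2 \<Rightarrow> real) x. (\<chi> i j. if i = 1 \<and> j = 2 then r x else 0) :: real^2^2)"
  have Mw: "M r x *v w = vector [r x * w $ 2, 0]" for r x w
    by (simp add: M_def matrix_vector_mult_def vec_eq_iff forall_2 sum_2)
  have sM: "smooth_on S (M r)" if "smooth_on S r" for r
    unfolding M_def by (intro smooth_on_matrix S smooth_on_if smooth_on_const that)
  have dM: "pd k (M r) x *v w = vector [pd k r x * w $ 2, 0]" if "smooth_on S r" "x \<in> S" for k r x w
  proof -
    have "pd k (M r) x *v w = pd k (\<lambda>x. M r x *v w) x"
      using pd_matrix_vector[OF smooth_on_differentiable[OF sM[OF that(1)] that(2)], of "\<lambda>_. w" k] by simp
    also have "\<dots> = pd k (\<lambda>x. r x *\<^sub>R (vector [w $ 2, 0] :: real^2)) x"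
      by (rule arg_cong[where f = "\<lambda>g. pd k g x"]) (auto simp: Mw fun_eq_iff vec_eq_iff forall_2)
    also have "\<dots> = vector [pd k r x * w $ 2, 0]"
      using pd_scaleR[OF smooth_on_differentiable[OF that], of "\<lambda>_. vector [w $ 2, 0] :: real^2" k]
      by (auto simp: vec_eq_iff forall_2)
    finally show ?thesis .
  qed
  have "\<exists>x1\<in>S. \<forall>c. \<exists>\<Psi>. smooth_on S \<Psi> \<and> \<Psi> x1 = c \<and> (\<forall>x\<in>S. pd 1 \<Psi> x = M p x *v \<Psi> x \<and> pd 2 \<Psi> x = M q x *v \<Psi> x)"
    by (rule flat_system_simply_connected)
       (use S pq sM in \<open>auto simp: dM Mw convex_imp_simply_connected\<close>)
  then obtain x1 \<Psi> where \<Psi>: "x1 \<in> S" "smooth_on S \<Psi>" "\<Psi> x1 = vector [0, 1]"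
    "\<And>x. x \<in> S \<Longrightarrow> pd 1 \<Psi> x = M p x *v \<Psi> x" "\<And>x. x \<in> S \<Longrightarrow> pd 2 \<Psi> x = M q x *v \<Psi> x" by metis
  have dn: "pd i (\<lambda>x. \<Psi> x $ j) x = pd i \<Psi> x $ j" if "x \<in> S" for i j x
    by (rule pd_nth) (rule smooth_on_differentiable[OF \<Psi>(2) that])
  have "pd i (\<lambda>x. \<Psi> x $ 2) x = 0" if "x \<in> S" for i x
    using \<Psi>(4,5)[OF that] exhaust_2[of i] by (auto simp: dn[OF that] Mw)
  then have "\<Psi> x $ 2 = \<Psi> x1 $ 2" if "x \<in> S" for x
    using constant_on_convex_pd[OF S(2,1), of "\<lambda>x. \<Psi> x $ 2"] smooth_on_differentiable[OF smooth_on_nth[OF S(1) \<Psi>(2)]] that \<Psi>(1) by blast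
  then have one: "\<Psi> x $ 2 = 1" if "x \<in> S" for x using that \<Psi>(3) by simp
  show thesis
  proof (rule that[of "\<lambda>x. \<Psi> x $ 1 - \<Psi> x0 $ 1"])
    show "smooth_on S (\<lambda>x. \<Psi> x $ 1 - \<Psi> x0 $ 1)" by (intro smooth_intros S \<Psi>)
    have d: "pd i (\<lambda>x. \<Psi> x $ 1 - \<Psi> x0 $ 1) x = pd i \<Psi> x $ 1" if "x \<in> S" for i x
      using pd_diff[OF smooth_on_differentiable[OF smooth_on_nth[OF S(1) \<Psi>(2)] that], of "\<lambda>_. \<Psi> x0 $ 1"] dn[OF that] by simp
    show "pd 1 (\<lambda>x. \<Psi> x $ 1 - \<Psi> x0 $ 1) x = p x" "pd 2 (\<lambda>x. \<Psi> x $ 1 - \<Psi> x0 $ 1) x = q x" if "x \<in> S" for x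
      using \<Psi>(4,5)[OF that] one[OF that] by (auto simp: d[OF that] Mw)
  qed simp
qed

text \<open>An ordinary equation is a plane system with the second matrix equal to zero, and such a system is flat.\<close>

lemma linear_ode_global:
  fixes B :: "real \<Rightarrow> real^'n^'n"
  assumes B: "smooth_on UNIV B"
  obtains y where "smooth_on UNIV y" "y t0 = c" "\<And>t. (y has_vector_derivative B t *v y t) (at t)"
proof -
  define P where "P = (\<lambda>x::real^2. B (x $ 1 + t0))"
  have sP: "smooth_on UNIV P" unfolding P_def
    by (rule smooth_on_compose[OF open_UNIV open_UNIV _ B]) (auto intro!: smooth_intros)
  have P2: "pd 2 P x = 0" for x
  proof -
    have "(B has_vector_derivative vd B (x $ 1 + t0)) (at (x $ 1 + t0))"
      by (rule has_vector_derivative_vd[OF B UNIV_I])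
    moreover have "smooth_on UNIV (\<lambda>x::real^2. x $ 1 + t0)" by (intro smooth_intros open_UNIV)
    ultimately have "pd 2 P x = pd 2 (\<lambda>x. x $ 1 + t0) x *\<^sub>R vd B (x $ 1 + t0)"
      unfolding P_def by (intro pd_real_compose smooth_on_differentiable) auto
    moreover have "(\<lambda>x::real^2. x $ 1) differentiable (at x)"
      by (rule bounded_linear_imp_differentiable[OF bounded_linear_vec_nth])
    then have "pd 2 (\<lambda>x::real^2. x $ 1 + t0) x = 0"
      using pd_add[of "\<lambda>x::real^2. x $ 1" x "\<lambda>_. t0" 2] pd_coord[of 2 1 x] by simp
    ultimately show ?thesis by simp
  qed
  obtain \<Psi> where \<Psi>: "\<Psi> 0 = c" "\<And>x. (\<Psi> has_derivative (\<lambda>v. v $ 1 *\<^sub>R (P x *v \<Psi> x) + v $ 2 *\<^sub>R (0 *v \<Psi> x))) (at x)"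
    using flat_system_star[of UNIV P "\<lambda>_. 0" c] sP P2 by (auto simp: smooth_on_const)
  define y where "y = (\<lambda>t. \<Psi> ((t - t0) *\<^sub>R axis 1 1))"
  have d: "(y has_vector_derivative B t *v y t) (at t)" for t
  proof -
    have "((\<lambda>t. (t - t0) *\<^sub>R axis 1 1 :: real^2) has_derivative (\<lambda>h. h *\<^sub>R axis 1 1)) (at t)"
      by (auto intro!: derivative_eq_intros)
    from has_derivative_compose[OF this \<Psi>(2)]
    show ?thesis by (simp add: has_vector_derivative_def y_def P_def)
  qed
  have "Ck_on k UNIV y" for k
  proof (induction k)
    case 0
    show ?case using d by (auto intro: continuous_at_imp_continuous_on has_vector_derivative_continuous)
  next
    case (Suc k)
    have "Ck_on k UNIV (\<lambda>t. B t *v y t)"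
      using Suc B by (intro Ck_on_bilinear[OF bounded_bilinear_matrix_vector]) (auto simp: smooth_on_def)
    then show ?case
      by (intro Ck_on_SucI[OF open_UNIV d[unfolded has_vector_derivative_def]] Ck_on_bilinear[OF bounded_bilinear_scaleR] Ck_on_const) auto
  qed
  then show thesis using that[of y] d \<Psi>(1) by (simp add: smooth_on_def y_def)
qed

text \<open>Gronwall's inequality without source term, applied to the difference of the two solutions after the
  segment from \<open>t0\<close> to \<open>t\<close> has been rescaled to the unit interval.\<close>

lemma linear_ode_unique:
  fixes B :: "real \<Rightarrow> real^'n^'n"
  assumes J: "is_interval J" "open J" "t0 \<in> J" "t \<in> J" and B: "continuous_on J B"
    and y: "\<And>t. t \<in> J \<Longrightarrow> (y has_vector_derivative B t *v y t) (at t)"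
    and z: "\<And>t. t \<in> J \<Longrightarrow> (z has_vector_derivative B t *v z t) (at t)"
    and "y t0 = z t0"
  shows "y t = z t"
proof -
  interpret mv: bounded_bilinear "(*v) :: real^'n^'n \<Rightarrow> real^'n \<Rightarrow> real^'n" by (rule bounded_bilinear_matrix_vector)
  obtain \<kappa> where \<kappa>: "\<kappa> > 0" "\<And>(M::real^'n^'n) w. norm (M *v w) \<le> norm M * norm w * \<kappa>" using mv.pos_bounded by blast
  define \<sigma> where "\<sigma> = (\<lambda>s. t0 + s * (t - t0))"
  have \<sigma>: "\<sigma> s \<in> J" if "s \<in> {0..1}" for s
  proof -
    have "convex J" using J(1) by (simp add: is_interval_convex)
    then have "(1 - s) *\<^sub>R t0 + s *\<^sub>R t \<in> J" using that J(3,4) by (intro convexD_alt) auto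
    then show ?thesis by (simp add: \<sigma>_def algebra_simps)
  qed
  define E where "E = (\<lambda>s. y (\<sigma> s) - z (\<sigma> s))"
  have "continuous_on {0..1} (\<lambda>s. B (\<sigma> s))"
    by (rule continuous_on_compose2[OF B]) (use \<sigma> in \<open>auto simp: \<sigma>_def intro!: continuous_intros\<close>)
  then obtain b where b: "b > 0" "\<And>s. s \<in> {0..1} \<Longrightarrow> norm (B (\<sigma> s)) \<le> b"
    using compact_image_norm_bound[of "{0..1}" "\<lambda>s. B (\<sigma> s)"] by auto
  have dE: "(E has_vector_derivative (t - t0) *\<^sub>R (B (\<sigma> s) *v E s)) (at s within {0..1})" if s: "s \<in> {0..1}" for s
  proof -
    have d\<sigma>: "(\<sigma> has_vector_derivative (t - t0)) (at s within {0..1})"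
      unfolding \<sigma>_def has_real_derivative_iff_has_vector_derivative[symmetric] by (auto intro!: derivative_eq_intros)
    have c: "((\<lambda>s. f (\<sigma> s)) has_vector_derivative (t - t0) *\<^sub>R f') (at s within {0..1})"
      if "(f has_vector_derivative f') (at (\<sigma> s))" for f :: "real \<Rightarrow> real^'n" and f'
      using vector_diff_chain_within[OF d\<sigma> has_vector_derivative_at_within[OF that]] by (simp add: o_def)
    have "(E has_vector_derivative (t - t0) *\<^sub>R (B (\<sigma> s) *v y (\<sigma> s)) - (t - t0) *\<^sub>R (B (\<sigma> s) *v z (\<sigma> s))) (at s within {0..1})"
      unfolding E_def by (intro has_vector_derivative_diff c y z \<sigma> s)
    then show ?thesis by (simp add: E_def mv.diff_right scaleR_diff_right)
  qed
  have "norm (E 1) \<le> 0 * exp (\<bar>t - t0\<bar> * b * \<kappa> + 1/2)"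
  proof (rule gronwall_deriv[OF dE])
    fix s :: real assume s: "s \<in> {0..1}"
    have "norm (B (\<sigma> s) *v E s) \<le> norm (B (\<sigma> s)) * norm (E s) * \<kappa>" by (rule \<kappa>)
    also have "\<dots> \<le> b * norm (E s) * \<kappa>" using b(2)[OF s] \<kappa>(1) by (intro mult_right_mono) auto
    finally show "norm ((t - t0) *\<^sub>R (B (\<sigma> s) *v E s)) \<le> \<bar>t - t0\<bar> * b * \<kappa> * norm (E s) + 0"
      using mult_left_mono[of _ _ "\<bar>t - t0\<bar>"] by (fastforce simp: mult_ac)
  qed (use b \<kappa> assms in \<open>auto simp: E_def \<sigma>_def\<close>)
  then show ?thesis by (simp add: E_def \<sigma>_def)
qed

section \<open>Moving frames of null vectors\<close>

abbreviation det3 :: "real^3 \<Rightarrow> real^3 \<Rightarrow> real^3 \<Rightarrow> real" where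
  "det3 u v w \<equiv> det (vector [u, v, w] :: real^3^3)"

lemma det3_expand: "det3 u v w = u $ 1 * v $ 2 * w $ 3 + u $ 2 * v $ 3 * w $ 1 + u $ 3 * v $ 1 * w $ 2
   - u $ 1 * v $ 3 * w $ 2 - u $ 2 * v $ 1 * w $ 3 - u $ 3 * v $ 2 * w $ 1"
  by (simp add: det_3)

lemma smooth_on_det3 [smooth_intros]:
  "open S \<Longrightarrow> smooth_on S u \<Longrightarrow> smooth_on S v \<Longrightarrow> smooth_on S w \<Longrightarrow> smooth_on S (\<lambda>x. det3 (u x) (v x) (w x))"
  unfolding det3_expand by (intro smooth_intros)

lemma det3_coeffs:
  "det3 (c1 *\<^sub>R u + c2 *\<^sub>R v + c3 *\<^sub>R z) v z = c1 * det3 u v z"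
  "det3 u (c1 *\<^sub>R u + c2 *\<^sub>R v + c3 *\<^sub>R z) z = c2 * det3 u v z"
  "det3 u v (c1 *\<^sub>R u + c2 *\<^sub>R v + c3 *\<^sub>R z) = c3 * det3 u v z"
  by (simp_all add: det3_expand algebra_simps)

lemma det3_independent:
  assumes "det3 u v z \<noteq> 0" "c1 *\<^sub>R u + c2 *\<^sub>R v + c3 *\<^sub>R z = d1 *\<^sub>R u + d2 *\<^sub>R v + d3 *\<^sub>R z"
  shows "c1 = d1 \<and> c2 = d2 \<and> c3 = d3"
  using det3_coeffs[where u=u and v=v and z=z] assms by (metis mult_right_cancel)

lemma det3_cramer:
  assumes "det3 u v z \<noteq> 0"
  shows "w = (det3 w v z / det3 u v z) *\<^sub>R u + (det3 u w z / det3 u v z) *\<^sub>R v + (det3 u v w / det3 u v z) *\<^sub>R z"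
proof -
  have "det3 u v z *\<^sub>R w = det3 w v z *\<^sub>R u + det3 u w z *\<^sub>R v + det3 u v w *\<^sub>R z"
    by (simp add: vec_eq_iff forall_3 det3_expand algebra_simps)
  then have "(1 / det3 u v z) *\<^sub>R (det3 u v z *\<^sub>R w) = (1 / det3 u v z) *\<^sub>R (det3 w v z *\<^sub>R u + det3 u w z *\<^sub>R v + det3 u v w *\<^sub>R z)"
    by simp
  then show ?thesis using assms by (simp add: scaleR_right_distrib)
qed

lemma frame_coeffs_eqI:
  assumes "frame_det F \<xi> x \<noteq> 0" "w = c1 *\<^sub>R pd 1 F x + c2 *\<^sub>R pd 2 F x + c3 *\<^sub>R \<xi> x"
  shows "frame_coeffs F \<xi> x w = vector [c1, c2, c3]"
  unfolding frame_coeffs_def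
proof (rule the_equality)
  show "w = (vector [c1, c2, c3] :: real^3) $ 1 *\<^sub>R pd 1 F x + (vector [c1, c2, c3] :: real^3) $ 2 *\<^sub>R pd 2 F x
      + (vector [c1, c2, c3] :: real^3) $ 3 *\<^sub>R \<xi> x"
    using assms(2) by simp
  fix c :: "real^3" assume "w = c $ 1 *\<^sub>R pd 1 F x + c $ 2 *\<^sub>R pd 2 F x + c $ 3 *\<^sub>R \<xi> x"
  then have "c $ 1 *\<^sub>R pd 1 F x + c $ 2 *\<^sub>R pd 2 F x + c $ 3 *\<^sub>R \<xi> x = c1 *\<^sub>R pd 1 F x + c2 *\<^sub>R pd 2 F x + c3 *\<^sub>R \<xi> x"
    using assms(2) by (rule trans[OF sym])
  from det3_independent[OF assms(1)[unfolded frame_det_def] this] show "c = vector [c1, c2, c3]"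
    by (simp add: vec_eq_iff forall_3)
qed

text \<open>Two symmetric metric connections differ by a tensor which, with its last index lowered, is symmetric
  in the first two and antisymmetric in the last two arguments; such a tensor vanishes.\<close>

lemma levi_civita_eqI:
  fixes G :: "2 \<Rightarrow> 2 \<Rightarrow> real^2"
  assumes G: "\<And>i j. G i j = G j i"
    and met: "\<And>i j k. pd k (\<lambda>y. g y $ i $ j) x = (\<Sum>l\<in>UNIV. G k i $ l * g x $ l $ j + G k j $ l * g x $ i $ l)"
    and g: "g x $ 1 $ 2 = g x $ 2 $ 1" "det (g x) \<noteq> 0"
  shows "levi_civita g i j x = G i j"
proof -
  define LC where "LC = (\<lambda>G :: 2 \<Rightarrow> 2 \<Rightarrow> real^2. (\<forall>i j. G i j = G j i) \<and>
     (\<forall>i j k. pd k (\<lambda>y. g y $ i $ j) x = (\<Sum>l\<in>UNIV. G k i $ l * g x $ l $ j + G k j $ l * g x $ i $ l)))"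
  have "(THE G. LC G) = G"
  proof (rule the_equality)
    show "LC G" using G met by (simp add: LC_def)
    fix G' assume G': "LC G'"
    define T where "T = (\<lambda>i j. G' i j - G i j)"
    define t where "t = (\<lambda>k i j. T k i $ 1 * g x $ 1 $ j + T k i $ 2 * g x $ 2 $ j)"
    have sym: "T i j = T j i" for i j using G G' by (simp add: T_def LC_def)
    have gs: "g x $ i $ j = g x $ j $ i" for i j using g(1) exhaust_2[of i] exhaust_2[of j] by auto
    have anti: "t k i j = - t k j i" for i j k
    proof -
      have "(\<Sum>l\<in>UNIV. G' k i $ l * g x $ l $ j + G' k j $ l * g x $ i $ l) = (\<Sum>l\<in>UNIV. G k i $ l * g x $ l $ j + G k j $ l * g x $ i $ l)"
        using met G' by (simp add: LC_def)
      then show ?thesis using gs[of i 1] gs[of i 2] by (simp add: t_def T_def sum_2 algebra_simps)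
    qed
    have tsym: "t k i j = t i k j" for i j k by (simp add: t_def sym[of k i])
    have z: "t k i j = 0" for k i j
    proof -
      have "t k i j = - t j i k" using anti[of k i j] tsym[of k j i] anti[of j k i] anti[of i j k] anti[of j i k] tsym[of j i k] tsym[of k i j] tsym[of i k j]
        by (metis minus_minus)
      moreover have "t k i j = t j i k" if "k = j" using that by simp
      moreover have "t k i j = 0" if "i = j" using anti[of k i j] that by simp
      moreover have "t k i j = 0" if "k = i" "i \<noteq> j"
        using anti[of k i j] tsym[of k j i] anti[of j k i] that by simp
      moreover have "k = j \<or> i = j \<or> k = i" using exhaust_2[of i] exhaust_2[of j] exhaust_2[of k] by metis
      ultimately show ?thesis by (metis add.inverse_inverse equal_neg_zero neg_equal_0_iff_equal)
    qed
    have "T k i = 0" for k i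
    proof -
      have e: "T k i $ 1 * g x $ 1 $ 1 + T k i $ 2 * g x $ 2 $ 1 = 0" "T k i $ 1 * g x $ 1 $ 2 + T k i $ 2 * g x $ 2 $ 2 = 0"
        using z[of k i 1] z[of k i 2] by (simp_all add: t_def)
      have d: "g x $ 1 $ 1 * g x $ 2 $ 2 - g x $ 1 $ 2 * g x $ 2 $ 1 \<noteq> 0" using g(2) by (simp add: det_2)
      have "T k i $ 1 * (g x $ 1 $ 1 * g x $ 2 $ 2 - g x $ 1 $ 2 * g x $ 2 $ 1)
         = (T k i $ 1 * g x $ 1 $ 1 + T k i $ 2 * g x $ 2 $ 1) * g x $ 2 $ 2 - (T k i $ 1 * g x $ 1 $ 2 + T k i $ 2 * g x $ 2 $ 2) * g x $ 2 $ 1"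
        by (simp add: algebra_simps)
      then have "T k i $ 1 = 0" using e d by simp
      moreover have "T k i $ 2 * (g x $ 1 $ 1 * g x $ 2 $ 2 - g x $ 1 $ 2 * g x $ 2 $ 1)
         = (T k i $ 1 * g x $ 1 $ 2 + T k i $ 2 * g x $ 2 $ 2) * g x $ 1 $ 1 - (T k i $ 1 * g x $ 1 $ 1 + T k i $ 2 * g x $ 2 $ 1) * g x $ 1 $ 2"
        by (simp add: algebra_simps)
      then have "T k i $ 2 = 0" using e d by simp
      ultimately show ?thesis by (simp add: vec_eq_iff forall_2)
    qed
    then show "G' = G" by (simp add: T_def fun_eq_iff)
  qed
  then show ?thesis unfolding levi_civita_def LC_def by simp
qed

lemma matrix_inv_eqI:
  fixes A B :: "real^'n^'n"
  assumes "A ** B = mat 1"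
  shows "matrix_inv A = B"
proof -
  have BA: "B ** A = mat 1" using assms by (simp add: matrix_left_right_inverse)
  have "A ** matrix_inv A = mat 1 \<and> matrix_inv A ** A = mat 1"
    unfolding matrix_inv_def by (rule someI[of _ B]) (use assms BA in simp)
  then have "matrix_inv A = matrix_inv A ** (A ** B)" "matrix_inv A ** A = mat 1" using assms by simp_all
  then show ?thesis by (simp add: matrix_mul_assoc)
qed

text \<open>The full contraction of two cubes of covectors is the cube of their pairing. The cubic form is a
  combination of two such cubes, which evaluates the sixfold sum in $h(C,C)$.\<close>

lemma cubic_contraction:
  fixes m :: "2 \<Rightarrow> 2 \<Rightarrow> real"
  shows "(\<Sum>i\<in>UNIV. \<Sum>j\<in>UNIV. \<Sum>k\<in>UNIV. \<Sum>l\<in>UNIV. \<Sum>q\<in>UNIV. \<Sum>r\<in>UNIV.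
       m i l * m j q * m k r * (\<alpha> i * \<alpha> j * \<alpha> k) * (\<beta> l * \<beta> q * \<beta> r)) = (\<Sum>i\<in>UNIV. \<Sum>l\<in>UNIV. m i l * \<alpha> i * \<beta> l) ^ 3"
  by (simp add: sum_2 power3_eq_cube algebra_simps)

text \<open>The structure equations of an affine sphere in a frame \<open>X\<close>, \<open>Y\<close> of null vectors with $h(X,Y) = 1$, with dual
  coframe \<open>\<theta>\<close>, \<open>\<omega>\<close> given by its components. The form \<open>p\<close> is the Levi-Civita connection of \<open>h\<close> in this frame. By
  apolarity the cubic form has only the two components belonging to $\theta^3$ and $\omega^3$; \<open>a\<close> and \<open>b\<close> are those of the
  difference tensor, $K(X,X) = aY$ and $K(Y,Y) = bX$.\<close>

locale null_frame =
  fixes H :: real and S :: "(real^2) set" and F \<xi> X Y :: "real^2 \<Rightarrow> real^3"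
    and \<theta> \<omega> p :: "2 \<Rightarrow> real^2 \<Rightarrow> real" and a b :: "real^2 \<Rightarrow> real"
  assumes open_S: "open S"
    and smooth_F: "smooth_on S F" and smooth_xi: "smooth_on S \<xi>"
    and smooth_X: "smooth_on S X" and smooth_Y: "smooth_on S Y"
    and smooth_theta: "\<And>i. smooth_on S (\<theta> i)" and smooth_omega: "\<And>i. smooth_on S (\<omega> i)"
    and smooth_p: "\<And>i. smooth_on S (p i)" and smooth_a: "smooth_on S a" and smooth_b: "smooth_on S b"
    and dF: "\<And>i z. z \<in> S \<Longrightarrow> pd i F z = \<theta> i z *\<^sub>R X z + \<omega> i z *\<^sub>R Y z"
    and dxi: "\<And>i z. z \<in> S \<Longrightarrow> pd i \<xi> z = - (H * \<theta> i z) *\<^sub>R X z + - (H * \<omega> i z) *\<^sub>R Y z"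
    and dX: "\<And>i z. z \<in> S \<Longrightarrow> pd i X z = p i z *\<^sub>R X z + (a z * \<theta> i z) *\<^sub>R Y z + \<omega> i z *\<^sub>R \<xi> z"
    and dY: "\<And>i z. z \<in> S \<Longrightarrow> pd i Y z = (b z * \<omega> i z) *\<^sub>R X z + - p i z *\<^sub>R Y z + \<theta> i z *\<^sub>R \<xi> z"
    and det_frame: "\<And>z. z \<in> S \<Longrightarrow> \<bar>det3 (X z) (Y z) (\<xi> z)\<bar> = 1"
    and coframe: "\<And>z. z \<in> S \<Longrightarrow> \<theta> 1 z * \<omega> 2 z - \<theta> 2 z * \<omega> 1 z \<noteq> 0"
begin

lemmas smooth_data = smooth_F smooth_xi smooth_X smooth_Y smooth_theta smooth_omega smooth_p smooth_a smooth_b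

lemma diffable:
  assumes "z \<in> S"
  shows "F differentiable (at z)" "\<xi> differentiable (at z)" "X differentiable (at z)" "Y differentiable (at z)"
    "\<theta> i differentiable (at z)" "\<omega> i differentiable (at z)" "p i differentiable (at z)" "a differentiable (at z)" "b differentiable (at z)"
  using smooth_on_differentiable[OF smooth_data(1) assms] smooth_on_differentiable[OF smooth_data(2) assms]
    smooth_on_differentiable[OF smooth_data(3) assms] smooth_on_differentiable[OF smooth_data(4) assms]
    smooth_on_differentiable[OF smooth_data(5) assms] smooth_on_differentiable[OF smooth_data(6) assms]
    smooth_on_differentiable[OF smooth_data(7) assms] smooth_on_differentiable[OF smooth_data(8) assms]
    smooth_on_differentiable[OF smooth_data(9) assms] by auto

lemma det_nz: "z \<in> S \<Longrightarrow> det3 (X z) (Y z) (\<xi> z) \<noteq> 0"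
  using det_frame[of z] by auto

lemma frame_indep:
  assumes "z \<in> S" "c1 *\<^sub>R X z + c2 *\<^sub>R Y z + c3 *\<^sub>R \<xi> z = d1 *\<^sub>R X z + d2 *\<^sub>R Y z + d3 *\<^sub>R \<xi> z"
  shows "c1 = d1" "c2 = d2" "c3 = d3"
  using det3_independent[OF det_nz[OF assms(1)] assms(2)] by auto

lemma ddF:
  assumes z: "z \<in> S"
  shows "pd i (pd j F) z = (pd i (\<theta> j) z + p i z * \<theta> j z + b z * \<omega> i z * \<omega> j z) *\<^sub>R X z
     + (pd i (\<omega> j) z - p i z * \<omega> j z + a z * \<theta> i z * \<theta> j z) *\<^sub>R Y z
     + (\<theta> i z * \<omega> j z + \<omega> i z * \<theta> j z) *\<^sub>R \<xi> z"
proof -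
  have "pd i (pd j F) z = pd i (\<lambda>z. \<theta> j z *\<^sub>R X z + \<omega> j z *\<^sub>R Y z) z"
    by (rule pd_cong[OF open_S z dF])
  also have "\<dots> = (\<theta> j z *\<^sub>R pd i X z + pd i (\<theta> j) z *\<^sub>R X z) + (\<omega> j z *\<^sub>R pd i Y z + pd i (\<omega> j) z *\<^sub>R Y z)"
    by (subst pd_add) (auto simp: pd_scaleR diffable[OF z])
  finally show ?thesis unfolding dX[OF z] dY[OF z] by (simp add: algebra_simps)
qed

text \<open>Symmetry of the second derivatives of \<open>F\<close>, compared in the frame: $d\theta = - p \wedge \theta$ and
  $d\omega = p \wedge \omega$.\<close>

lemma curl_theta: "z \<in> S \<Longrightarrow> pd 1 (\<theta> 2) z - pd 2 (\<theta> 1) z = p 2 z * \<theta> 1 z - p 1 z * \<theta> 2 z"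
  and curl_omega: "z \<in> S \<Longrightarrow> pd 1 (\<omega> 2) z - pd 2 (\<omega> 1) z = p 1 z * \<omega> 2 z - p 2 z * \<omega> 1 z"
proof -
  assume z: "z \<in> S"
  note e = pd_commute[OF smooth_F open_S z, of 1 2, unfolded ddF[OF z]]
  show "pd 1 (\<theta> 2) z - pd 2 (\<theta> 1) z = p 2 z * \<theta> 1 z - p 1 z * \<theta> 2 z"
    using frame_indep(1)[OF z e] by (simp add: algebra_simps)
  show "pd 1 (\<omega> 2) z - pd 2 (\<omega> 1) z = p 1 z * \<omega> 2 z - p 2 z * \<omega> 1 z"
    using frame_indep(2)[OF z e] by (simp add: algebra_simps)
qed

lemma ddX:
  assumes z: "z \<in> S"
  shows "pd i (pd j X) z = (pd i (p j) z + p j z * p i z + a z * \<theta> j z * (b z * \<omega> i z) - \<omega> j z * (H * \<theta> i z)) *\<^sub>R X z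
     + (p j z * (a z * \<theta> i z) + (a z * pd i (\<theta> j) z + pd i a z * \<theta> j z) - a z * \<theta> j z * p i z - \<omega> j z * (H * \<omega> i z)) *\<^sub>R Y z
     + (p j z * \<omega> i z + a z * \<theta> j z * \<theta> i z + pd i (\<omega> j) z) *\<^sub>R \<xi> z"
proof -
  have "pd i (pd j X) z = pd i (\<lambda>z. p j z *\<^sub>R X z + (a z * \<theta> j z) *\<^sub>R Y z + \<omega> j z *\<^sub>R \<xi> z) z"
    by (rule pd_cong[OF open_S z dX])
  also have "\<dots> = ((p j z *\<^sub>R pd i X z + pd i (p j) z *\<^sub>R X z)
     + ((a z * \<theta> j z) *\<^sub>R pd i Y z + (a z * pd i (\<theta> j) z + pd i a z * \<theta> j z) *\<^sub>R Y z)) + (\<omega> j z *\<^sub>R pd i \<xi> z + pd i (\<omega> j) z *\<^sub>R \<xi> z)"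
    by (simp add: pd_add pd_scaleR pd_mult diffable[OF z])
  finally show ?thesis unfolding dX[OF z] dY[OF z] dxi[OF z] by (simp add: algebra_simps)
qed

lemma ddY:
  assumes z: "z \<in> S"
  shows "pd i (pd j Y) z = (b z * \<omega> j z * p i z + (b z * pd i (\<omega> j) z + pd i b z * \<omega> j z) - p j z * (b z * \<omega> i z) - \<theta> j z * (H * \<theta> i z)) *\<^sub>R X z
     + (b z * \<omega> j z * (a z * \<theta> i z) - pd i (p j) z + p j z * p i z - \<theta> j z * (H * \<omega> i z)) *\<^sub>R Y z
     + (b z * \<omega> j z * \<omega> i z - p j z * \<theta> i z + pd i (\<theta> j) z) *\<^sub>R \<xi> z"
proof -
  have "pd i (pd j Y) z = pd i (\<lambda>z. (b z * \<omega> j z) *\<^sub>R X z + - p j z *\<^sub>R Y z + \<theta> j z *\<^sub>R \<xi> z) z"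
    by (rule pd_cong[OF open_S z dY])
  also have "\<dots> = (((b z * \<omega> j z) *\<^sub>R pd i X z + (b z * pd i (\<omega> j) z + pd i b z * \<omega> j z) *\<^sub>R X z)
     + (- p j z *\<^sub>R pd i Y z + - pd i (p j) z *\<^sub>R Y z)) + (\<theta> j z *\<^sub>R pd i \<xi> z + pd i (\<theta> j) z *\<^sub>R \<xi> z)"
    by (simp add: pd_add pd_diff pd_scaleR pd_mult pd_uminus diffable[OF z])
  finally show ?thesis unfolding dX[OF z] dY[OF z] dxi[OF z] by (simp add: algebra_simps)
qed

text \<open>Symmetry of the second derivatives of \<open>X\<close> and, below, of \<open>Y\<close>: the Codazzi equations
  $da \wedge \theta = 3a\, p \wedge \theta$ and $db \wedge \omega = - 3b\, p \wedge \omega$, and the Gauss equation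
  $dp = (H + ab)\, \theta \wedge \omega$.\<close>

lemma codazzi_a: "z \<in> S \<Longrightarrow> pd 1 a z * \<theta> 2 z - pd 2 a z * \<theta> 1 z = 3 * a z * (p 1 z * \<theta> 2 z - p 2 z * \<theta> 1 z)"
  and curl_p: "z \<in> S \<Longrightarrow> pd 1 (p 2) z - pd 2 (p 1) z = (H + a z * b z) * (\<theta> 1 z * \<omega> 2 z - \<theta> 2 z * \<omega> 1 z)"
proof -
  assume z: "z \<in> S"
  note e = pd_commute[OF smooth_X open_S z, of 1 2, unfolded ddX[OF z]]
  have "a z * (pd 1 (\<theta> 2) z - pd 2 (\<theta> 1) z) + (pd 1 a z * \<theta> 2 z - pd 2 a z * \<theta> 1 z) = 2 * a z * (p 1 z * \<theta> 2 z - p 2 z * \<theta> 1 z)"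
    using frame_indep(2)[OF z e] by (simp add: algebra_simps)
  then show "pd 1 a z * \<theta> 2 z - pd 2 a z * \<theta> 1 z = 3 * a z * (p 1 z * \<theta> 2 z - p 2 z * \<theta> 1 z)"
    unfolding curl_theta[OF z] by (simp add: algebra_simps)
  show "pd 1 (p 2) z - pd 2 (p 1) z = (H + a z * b z) * (\<theta> 1 z * \<omega> 2 z - \<theta> 2 z * \<omega> 1 z)"
    using frame_indep(1)[OF z e] by (simp add: algebra_simps)
qed

lemma codazzi_b: "z \<in> S \<Longrightarrow> pd 1 b z * \<omega> 2 z - pd 2 b z * \<omega> 1 z = - 3 * b z * (p 1 z * \<omega> 2 z - p 2 z * \<omega> 1 z)"
proof -
  assume z: "z \<in> S"
  note e = pd_commute[OF smooth_Y open_S z, of 1 2, unfolded ddY[OF z]]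
  have "b z * (pd 1 (\<omega> 2) z - pd 2 (\<omega> 1) z) + (pd 1 b z * \<omega> 2 z - pd 2 b z * \<omega> 1 z) = - 2 * b z * (p 1 z * \<omega> 2 z - p 2 z * \<omega> 1 z)"
    using frame_indep(1)[OF z e] by (simp add: algebra_simps)
  then show ?thesis unfolding curl_omega[OF z] by (simp add: algebra_simps)
qed

definition D where "D z = \<theta> 1 z * \<omega> 2 z - \<theta> 2 z * \<omega> 1 z"

definition eX where "eX z = (vector [\<omega> 2 z / D z, - \<omega> 1 z / D z] :: real^2)"
definition eY where "eY z = (vector [- \<theta> 2 z / D z, \<theta> 1 z / D z] :: real^2)"

lemma D_nz: "z \<in> S \<Longrightarrow> D z \<noteq> 0" using coframe by (simp add: D_def)

lemma dual:
  assumes "z \<in> S"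
  shows "\<theta> 1 z * eX z $ 1 + \<theta> 2 z * eX z $ 2 = 1" "\<omega> 1 z * eX z $ 1 + \<omega> 2 z * eX z $ 2 = 0"
    "\<theta> 1 z * eY z $ 1 + \<theta> 2 z * eY z $ 2 = 0" "\<omega> 1 z * eY z $ 1 + \<omega> 2 z * eY z $ 2 = 1"
  using D_nz[OF assms] by (simp_all add: eX_def eY_def field_simps) (simp_all add: D_def)

lemma frame_tangent:
  assumes "z \<in> S"
  shows "X z = eX z $ 1 *\<^sub>R pd 1 F z + eX z $ 2 *\<^sub>R pd 2 F z" "Y z = eY z $ 1 *\<^sub>R pd 1 F z + eY z $ 2 *\<^sub>R pd 2 F z"
proof -
  have "eX z $ 1 *\<^sub>R pd 1 F z + eX z $ 2 *\<^sub>R pd 2 F z = (\<theta> 1 z * eX z $ 1 + \<theta> 2 z * eX z $ 2) *\<^sub>R X z + (\<omega> 1 z * eX z $ 1 + \<omega> 2 z * eX z $ 2) *\<^sub>R Y z"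
    unfolding dF[OF assms] by (simp add: algebra_simps)
  then show "X z = eX z $ 1 *\<^sub>R pd 1 F z + eX z $ 2 *\<^sub>R pd 2 F z" by (simp add: dual[OF assms])
  have "eY z $ 1 *\<^sub>R pd 1 F z + eY z $ 2 *\<^sub>R pd 2 F z = (\<theta> 1 z * eY z $ 1 + \<theta> 2 z * eY z $ 2) *\<^sub>R X z + (\<omega> 1 z * eY z $ 1 + \<omega> 2 z * eY z $ 2) *\<^sub>R Y z"
    unfolding dF[OF assms] by (simp add: algebra_simps)
  then show "Y z = eY z $ 1 *\<^sub>R pd 1 F z + eY z $ 2 *\<^sub>R pd 2 F z" by (simp add: dual[OF assms])
qed

lemma frame_det_eq: "z \<in> S \<Longrightarrow> frame_det F \<xi> z = D z * det3 (X z) (Y z) (\<xi> z)"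
  unfolding frame_det_def dF D_def by (simp add: det3_expand algebra_simps)

lemma frame_det_nz: "z \<in> S \<Longrightarrow> frame_det F \<xi> z \<noteq> 0"
  using frame_det_eq D_nz det_nz by simp

lemma coeffs:
  assumes "z \<in> S"
  shows "frame_coeffs F \<xi> z (c1 *\<^sub>R X z + c2 *\<^sub>R Y z + c3 *\<^sub>R \<xi> z)
     = vector [c1 * eX z $ 1 + c2 * eY z $ 1, c1 * eX z $ 2 + c2 * eY z $ 2, c3]"
  by (rule frame_coeffs_eqI[OF frame_det_nz[OF assms]], subst (1) frame_tangent(1)[OF assms], subst (1) frame_tangent(2)[OF assms])
     (simp add: algebra_simps)

lemma metric_eq: "z \<in> S \<Longrightarrow> aff_metric F \<xi> z $ i $ j = \<theta> i z * \<omega> j z + \<omega> i z * \<theta> j z"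
  by (simp add: aff_metric_def ddF coeffs)

lemma conn_eq: "z \<in> S \<Longrightarrow> aff_conn F \<xi> i j z = (pd i (\<theta> j) z + p i z * \<theta> j z + b z * \<omega> i z * \<omega> j z) *\<^sub>R eX z
     + (pd i (\<omega> j) z - p i z * \<omega> j z + a z * \<theta> i z * \<theta> j z) *\<^sub>R eY z"
  by (simp add: aff_conn_def ddF coeffs tangential_def vec_eq_iff forall_2)

lemma xi_coeffs: "z \<in> S \<Longrightarrow> frame_coeffs F \<xi> z (pd i \<xi> z) = vector [- H * axis i 1 $ 1, - H * axis i 1 $ 2, 0]"
  using exhaust_2[of i] by (intro frame_coeffs_eqI frame_det_nz) (auto simp: dxi dF axis_def algebra_simps)

lemma equiaffine: "z \<in> S \<Longrightarrow> equiaffine_at F \<xi> z"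
  by (simp add: equiaffine_at_def xi_coeffs)

lemma shape_eq: "z \<in> S \<Longrightarrow> shape_op F \<xi> i z = H *\<^sub>R axis i 1"
  by (simp add: shape_op_def xi_coeffs tangential_def vec_eq_iff forall_2)

lemma mean_curv_eq: "z \<in> S \<Longrightarrow> mean_curv F \<xi> z = H"
  by (simp add: mean_curv_def shape_eq sum_2)

lemma det_metric: "z \<in> S \<Longrightarrow> det (aff_metric F \<xi> z) = - (D z)\<^sup>2"
  by (simp add: det_2 metric_eq D_def power2_eq_square algebra_simps)

lemma inv_metric: "z \<in> S \<Longrightarrow> matrix_inv (aff_metric F \<xi> z) = (\<chi> i j. eX z $ i * eY z $ j + eY z $ i * eX z $ j)"
proof (rule matrix_inv_eqI)
  assume z: "z \<in> S"
  have "(\<theta> i z * \<omega> 1 z + \<omega> i z * \<theta> 1 z) * (eX z $ 1 * eY z $ j + eY z $ 1 * eX z $ j)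
      + (\<theta> i z * \<omega> 2 z + \<omega> i z * \<theta> 2 z) * (eX z $ 2 * eY z $ j + eY z $ 2 * eX z $ j)
      = \<theta> i z * eX z $ j * (\<omega> 1 z * eY z $ 1 + \<omega> 2 z * eY z $ 2) + \<theta> i z * eY z $ j * (\<omega> 1 z * eX z $ 1 + \<omega> 2 z * eX z $ 2)
      + \<omega> i z * eY z $ j * (\<theta> 1 z * eX z $ 1 + \<theta> 2 z * eX z $ 2) + \<omega> i z * eX z $ j * (\<theta> 1 z * eY z $ 1 + \<theta> 2 z * eY z $ 2)" for i j
    by (simp add: algebra_simps)
  also have "\<dots> i j = \<theta> i z * eX z $ j + \<omega> i z * eY z $ j" for i j by (simp add: dual[OF z])
  also have "\<dots> i j = (if i = j then 1 else 0)" for i j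
    using D_nz[OF z] exhaust_2[of i] exhaust_2[of j] by (auto simp: eX_def eY_def field_simps) (auto simp: D_def)
  finally show "aff_metric F \<xi> z ** (\<chi> i j. eX z $ i * eY z $ j + eY z $ i * eX z $ j) = mat 1"
    by (simp add: matrix_matrix_mult_def vec_eq_iff mat_def metric_eq[OF z] sum_2)
qed

lemma pd_metric:
  assumes z: "z \<in> S"
  shows "pd k (\<lambda>y. aff_metric F \<xi> y $ i $ j) z = pd k (\<theta> i) z * \<omega> j z + \<theta> i z * pd k (\<omega> j) z + pd k (\<omega> i) z * \<theta> j z + \<omega> i z * pd k (\<theta> j) z"
proof -
  have "pd k (\<lambda>y. aff_metric F \<xi> y $ i $ j) z = pd k (\<lambda>z. \<theta> i z * \<omega> j z + \<omega> i z * \<theta> j z) z"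
    by (rule pd_cong[OF open_S z]) (simp add: metric_eq)
  also have "\<dots> = pd k (\<theta> i) z * \<omega> j z + \<theta> i z * pd k (\<omega> j) z + pd k (\<omega> i) z * \<theta> j z + \<omega> i z * pd k (\<theta> j) z"
    by (simp add: pd_add pd_mult diffable[OF z] algebra_simps)
  finally show ?thesis .
qed

lemma metric_contract:
  assumes "z \<in> S"
  shows "(\<Sum>l\<in>UNIV. (c1 *\<^sub>R eX z + c2 *\<^sub>R eY z) $ l * aff_metric F \<xi> z $ l $ k) = c1 * \<omega> k z + c2 * \<theta> k z"
    "(\<Sum>l\<in>UNIV. (c1 *\<^sub>R eX z + c2 *\<^sub>R eY z) $ l * aff_metric F \<xi> z $ k $ l) = c1 * \<omega> k z + c2 * \<theta> k z"
proof -
  have "(\<Sum>l\<in>UNIV. (c1 *\<^sub>R eX z + c2 *\<^sub>R eY z) $ l * aff_metric F \<xi> z $ l $ k)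
     = c1 * ((\<theta> 1 z * eX z $ 1 + \<theta> 2 z * eX z $ 2) * \<omega> k z + (\<omega> 1 z * eX z $ 1 + \<omega> 2 z * eX z $ 2) * \<theta> k z)
     + c2 * ((\<theta> 1 z * eY z $ 1 + \<theta> 2 z * eY z $ 2) * \<omega> k z + (\<omega> 1 z * eY z $ 1 + \<omega> 2 z * eY z $ 2) * \<theta> k z)"
    by (simp add: sum_2 metric_eq[OF assms] algebra_simps)
  then show "(\<Sum>l\<in>UNIV. (c1 *\<^sub>R eX z + c2 *\<^sub>R eY z) $ l * aff_metric F \<xi> z $ l $ k) = c1 * \<omega> k z + c2 * \<theta> k z"
    by (simp add: dual[OF assms])
  moreover have "aff_metric F \<xi> z $ k $ l = aff_metric F \<xi> z $ l $ k" for l by (simp add: metric_eq[OF assms] algebra_simps)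
  ultimately show "(\<Sum>l\<in>UNIV. (c1 *\<^sub>R eX z + c2 *\<^sub>R eY z) $ l * aff_metric F \<xi> z $ k $ l) = c1 * \<omega> k z + c2 * \<theta> k z"
    by simp
qed

text \<open>The connection $X \mapsto pX$, $Y \mapsto - pY$ preserves $h = \theta\omega + \omega\theta$, and it is symmetric
  by the structure equations of \<open>\<theta>\<close> and \<open>\<omega>\<close>.\<close>

lemma levi_civita_eq:
  assumes z: "z \<in> S"
  shows "levi_civita (aff_metric F \<xi>) i j z = (pd i (\<theta> j) z + p i z * \<theta> j z) *\<^sub>R eX z + (pd i (\<omega> j) z - p i z * \<omega> j z) *\<^sub>R eY z"
proof (rule levi_civita_eqI)
  show "(pd i (\<theta> j) z + p i z * \<theta> j z) *\<^sub>R eX z + (pd i (\<omega> j) z - p i z * \<omega> j z) *\<^sub>R eY z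
     = (pd j (\<theta> i) z + p j z * \<theta> i z) *\<^sub>R eX z + (pd j (\<omega> i) z - p j z * \<omega> i z) *\<^sub>R eY z" for i j
  proof -
    have "pd 1 (\<theta> 2) z + p 1 z * \<theta> 2 z = pd 2 (\<theta> 1) z + p 2 z * \<theta> 1 z"
      "pd 1 (\<omega> 2) z - p 1 z * \<omega> 2 z = pd 2 (\<omega> 1) z - p 2 z * \<omega> 1 z"
      using curl_theta[OF z] curl_omega[OF z] by (simp_all add: algebra_simps)
    then show ?thesis using exhaust_2[of i] exhaust_2[of j] by (elim disjE) simp_all
  qed
  show "pd k (\<lambda>y. aff_metric F \<xi> y $ i $ j) z =
      (\<Sum>l\<in>UNIV. ((pd k (\<theta> i) z + p k z * \<theta> i z) *\<^sub>R eX z + (pd k (\<omega> i) z - p k z * \<omega> i z) *\<^sub>R eY z) $ l * aff_metric F \<xi> z $ l $ j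
        + ((pd k (\<theta> j) z + p k z * \<theta> j z) *\<^sub>R eX z + (pd k (\<omega> j) z - p k z * \<omega> j z) *\<^sub>R eY z) $ l * aff_metric F \<xi> z $ i $ l)" for i j k
    unfolding sum.distrib metric_contract[OF z] pd_metric[OF z] by (simp add: algebra_simps)
  show "aff_metric F \<xi> z $ 1 $ 2 = aff_metric F \<xi> z $ 2 $ 1" by (simp add: metric_eq[OF z])
  show "det (aff_metric F \<xi> z) \<noteq> 0" using det_metric[OF z] D_nz[OF z] by simp
qed

lemma diff_tensor_eq:
  "z \<in> S \<Longrightarrow> diff_tensor F \<xi> i j z = (b z * \<omega> i z * \<omega> j z) *\<^sub>R eX z + (a z * \<theta> i z * \<theta> j z) *\<^sub>R eY z"
  by (simp add: diff_tensor_def levi_civita_eq conn_eq algebra_simps)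

lemma diff_tensor_zero_iff:
  assumes z: "z \<in> S"
  shows "(\<forall>i j. diff_tensor F \<xi> i j z = 0) \<longleftrightarrow> a z = 0 \<and> b z = 0"
proof
  assume K: "\<forall>i j. diff_tensor F \<xi> i j z = 0"
  have "a z * \<theta> i z * \<theta> j z = 0 \<and> b z * \<omega> i z * \<omega> j z = 0" for i j
  proof -
    have k: "(\<Sum>l\<in>UNIV. ((b z * \<omega> i z * \<omega> j z) *\<^sub>R eX z + (a z * \<theta> i z * \<theta> j z) *\<^sub>R eY z) $ l * aff_metric F \<xi> z $ l $ k) = 0" for k
      using K by (simp add: diff_tensor_eq[OF z, symmetric])
    have e: "b z * \<omega> i z * \<omega> j z * \<omega> k z + a z * \<theta> i z * \<theta> j z * \<theta> k z = 0" for k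
      using k[of k] unfolding metric_contract[OF z] .
    have "(a z * \<theta> i z * \<theta> j z) * D z = 0"
      using e[of 1] e[of 2] unfolding D_def by algebra
    moreover have "(b z * \<omega> i z * \<omega> j z) * D z = 0"
      using e[of 1] e[of 2] unfolding D_def by algebra
    ultimately show ?thesis using D_nz[OF z] by simp
  qed
  from this[of 1 1] this[of 2 2] D_nz[OF z] show "a z = 0 \<and> b z = 0" by (auto simp: D_def)
qed (simp add: diff_tensor_eq[OF z])

lemma cubic_form_eq: "z \<in> S \<Longrightarrow> cubic_form F \<xi> i j k z = - 2 * (a z * \<theta> i z * \<theta> j z * \<theta> k z + b z * \<omega> i z * \<omega> j z * \<omega> k z)"
  unfolding cubic_form_def sum.distrib conn_eq metric_contract pd_metric by (simp add: algebra_simps)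

text \<open>The inverse metric pairs \<open>\<theta>\<close> with \<open>\<omega>\<close> only. Hence in the square of
  $C = - 2 (a \theta^3 + b \omega^3)$ just the two mixed terms survive.\<close>

lemma cubic_norm_eq:
  assumes z: "z \<in> S"
  shows "cubic_norm F \<xi> z = 8 * a z * b z"
proof -
  define m where "m = (\<lambda>i j. eX z $ i * eY z $ j + eY z $ i * eX z $ j)"
  define t where "t = (\<lambda>i. \<theta> i z)" define w where "w = (\<lambda>i. \<omega> i z)"
  have "cubic_norm F \<xi> z = (\<Sum>i\<in>UNIV. \<Sum>j\<in>UNIV. \<Sum>k\<in>UNIV. \<Sum>l\<in>UNIV. \<Sum>q\<in>UNIV. \<Sum>r\<in>UNIV.
      4 * (a z)\<^sup>2 * (m i l * m j q * m k r * (t i * t j * t k) * (t l * t q * t r))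
      + 4 * a z * b z * (m i l * m j q * m k r * (t i * t j * t k) * (w l * w q * w r))
      + 4 * a z * b z * (m i l * m j q * m k r * (w i * w j * w k) * (t l * t q * t r))
      + 4 * (b z)\<^sup>2 * (m i l * m j q * m k r * (w i * w j * w k) * (w l * w q * w r)))"
  proof -
    have m: "matrix_inv (aff_metric F \<xi> z) $ i $ j = m i j" for i j by (simp add: inv_metric[OF z] m_def)
    have split: "M1 * M2 * M3 * (- 2 * (a z * t1 * t2 * t3 + b z * w1 * w2 * w3)) * (- 2 * (a z * s1 * s2 * s3 + b z * v1 * v2 * v3))
      = 4 * (a z)\<^sup>2 * (M1 * M2 * M3 * (t1 * t2 * t3) * (s1 * s2 * s3)) + 4 * a z * b z * (M1 * M2 * M3 * (t1 * t2 * t3) * (v1 * v2 * v3))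
      + 4 * a z * b z * (M1 * M2 * M3 * (w1 * w2 * w3) * (s1 * s2 * s3)) + 4 * (b z)\<^sup>2 * (M1 * M2 * M3 * (w1 * w2 * w3) * (v1 * v2 * v3))"
      for M1 M2 M3 t1 t2 t3 w1 w2 w3 s1 s2 s3 v1 v2 v3 :: real
      by (simp add: algebra_simps power2_eq_square)
    show ?thesis
      unfolding cubic_norm_def Let_def cubic_form_eq[OF z] m split t_def w_def by (rule refl)
  qed
  also have "\<dots> = 4 * (a z)\<^sup>2 * (\<Sum>i\<in>UNIV. \<Sum>l\<in>UNIV. m i l * t i * t l) ^ 3 + 4 * a z * b z * (\<Sum>i\<in>UNIV. \<Sum>l\<in>UNIV. m i l * t i * w l) ^ 3
     + 4 * a z * b z * (\<Sum>i\<in>UNIV. \<Sum>l\<in>UNIV. m i l * w i * t l) ^ 3 + 4 * (b z)\<^sup>2 * (\<Sum>i\<in>UNIV. \<Sum>l\<in>UNIV. m i l * w i * w l) ^ 3"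
    by (simp only: sum.distrib sum_distrib_left[symmetric] cubic_contraction)
  also have "\<dots> = 8 * a z * b z"
  proof -
    have c: "(\<Sum>i\<in>UNIV. \<Sum>l\<in>UNIV. m i l * \<alpha> i * \<beta> l) = (\<alpha> 1 * eX z $ 1 + \<alpha> 2 * eX z $ 2) * (\<beta> 1 * eY z $ 1 + \<beta> 2 * eY z $ 2)
     + (\<alpha> 1 * eY z $ 1 + \<alpha> 2 * eY z $ 2) * (\<beta> 1 * eX z $ 1 + \<beta> 2 * eX z $ 2)" for \<alpha> \<beta>
      by (simp add: sum_2 m_def algebra_simps)
    show ?thesis unfolding c unfolding t_def w_def dual[OF z] by simp
  qed
  finally show ?thesis .
qed

lemma blaschke: "z \<in> S \<Longrightarrow> blaschke_at F \<xi> z"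
proof -
  assume z: "z \<in> S"
  have "(\<Sum>i\<in>UNIV. \<Sum>j\<in>UNIV. matrix_inv (aff_metric F \<xi> z) $ i $ j *\<^sub>R diff_tensor F \<xi> i j z)
     = (2 * b z * (\<omega> 1 z * eX z $ 1 + \<omega> 2 z * eX z $ 2) * (\<omega> 1 z * eY z $ 1 + \<omega> 2 z * eY z $ 2)) *\<^sub>R eX z
     + (2 * a z * (\<theta> 1 z * eX z $ 1 + \<theta> 2 z * eX z $ 2) * (\<theta> 1 z * eY z $ 1 + \<theta> 2 z * eY z $ 2)) *\<^sub>R eY z"
    unfolding inv_metric[OF z] diff_tensor_eq[OF z] by (simp add: vec_eq_iff sum_2 algebra_simps)
  also have "\<dots> = 0" by (simp add: dual[OF z])
  finally have "(\<Sum>i\<in>UNIV. \<Sum>j\<in>UNIV. matrix_inv (aff_metric F \<xi> z) $ i $ j *\<^sub>R diff_tensor F \<xi> i j z) = 0" .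
  moreover have "\<bar>frame_det F \<xi> z\<bar> = sqrt \<bar>det (aff_metric F \<xi> z)\<bar>"
    by (simp add: frame_det_eq[OF z] det_metric[OF z] abs_mult det_frame[OF z])
  ultimately show ?thesis
    using frame_det_nz[OF z] equiaffine[OF z] det_metric[OF z] D_nz[OF z] by (simp add: blaschke_at_def)
qed

lemma indefinite: "z \<in> S \<Longrightarrow> indefinite_at F \<xi> z"
proof -
  assume z: "z \<in> S"
  have q: "(c1 *\<^sub>R eX z + c2 *\<^sub>R eY z) \<bullet> (aff_metric F \<xi> z *v (c1 *\<^sub>R eX z + c2 *\<^sub>R eY z)) = 2 * c1 * c2" for c1 c2
  proof -
    define v where "v = c1 *\<^sub>R eX z + c2 *\<^sub>R eY z"
    have "v \<bullet> (aff_metric F \<xi> z *v v) = (\<Sum>k\<in>UNIV. v $ k * (\<Sum>l\<in>UNIV. v $ l * aff_metric F \<xi> z $ k $ l))"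
      by (simp add: inner_vec_def matrix_vector_mult_def mult.commute)
    also have "\<dots> = (\<Sum>k\<in>UNIV. v $ k * (c1 * \<omega> k z + c2 * \<theta> k z))"
      unfolding v_def metric_contract[OF z] ..
    also have "\<dots> = c1 * c1 * (\<omega> 1 z * eX z $ 1 + \<omega> 2 z * eX z $ 2) + c1 * c2 * (\<omega> 1 z * eY z $ 1 + \<omega> 2 z * eY z $ 2)
       + c1 * c2 * (\<theta> 1 z * eX z $ 1 + \<theta> 2 z * eX z $ 2) + c2 * c2 * (\<theta> 1 z * eY z $ 1 + \<theta> 2 z * eY z $ 2)"
      by (simp add: v_def sum_2 algebra_simps)
    also have "\<dots> = 2 * c1 * c2" by (simp add: dual[OF z])
    finally show ?thesis by (simp add: v_def)
  qed
  show ?thesis unfolding indefinite_at_def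
    using q[of 1 1] q[of 1 "-1"] by (intro exI[of _ "1 *\<^sub>R eX z + 1 *\<^sub>R eY z"] exI[of _ "1 *\<^sub>R eX z + (-1) *\<^sub>R eY z"]) simp
qed

end

subsection \<open>Changing the frame and the coordinates\<close>

lemma null_frame_cong:
  assumes nf: "null_frame H S F \<xi> X Y \<theta> \<omega> p a b"
    and eq: "\<And>z. z \<in> S \<Longrightarrow> F' z = F z" "\<And>z. z \<in> S \<Longrightarrow> \<xi>' z = \<xi> z"
  shows "null_frame H S F' \<xi>' X Y \<theta> \<omega> p a b"
proof -
  interpret null_frame H S F \<xi> X Y \<theta> \<omega> p a b by fact
  show ?thesis
  proof
    show "smooth_on S F'" using smooth_on_cong[OF open_S, of F' F] smooth_F eq by simp
    show "smooth_on S \<xi>'" using smooth_on_cong[OF open_S, of \<xi>' \<xi>] smooth_xi eq by simp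
    show "pd i F' z = \<theta> i z *\<^sub>R X z + \<omega> i z *\<^sub>R Y z" if "z \<in> S" for i z
      using pd_cong[OF open_S that eq(1)] dF[OF that] by simp
    show "pd i \<xi>' z = - (H * \<theta> i z) *\<^sub>R X z + - (H * \<omega> i z) *\<^sub>R Y z" if "z \<in> S" for i z
      using pd_cong[OF open_S that eq(2)] dxi[OF that] by simp
  qed (use open_S smooth_data dX dY det_frame coframe eq in auto)
qed

lemma null_frame_restrict:
  assumes "null_frame H S F \<xi> X Y \<theta> \<omega> p a b" "open T" "T \<subseteq> S"
  shows "null_frame H T F \<xi> X Y \<theta> \<omega> p a b"
proof -
  interpret null_frame H S F \<xi> X Y \<theta> \<omega> p a b by fact
  show ?thesis
    by unfold_locales (use assms(2,3) dF dxi dX dY det_frame coframe in \<open>auto intro: smooth_on_subset[OF smooth_data(1)] smooth_on_subset[OF smooth_data(2)]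
      smooth_on_subset[OF smooth_data(3)] smooth_on_subset[OF smooth_data(4)] smooth_on_subset[OF smooth_data(5)] smooth_on_subset[OF smooth_data(6)]
      smooth_on_subset[OF smooth_data(7)] smooth_on_subset[OF smooth_data(8)] smooth_on_subset[OF smooth_data(9)]\<close>)
qed

lemma null_frame_swap:
  assumes "null_frame H S F \<xi> X Y \<theta> \<omega> p a b"
  shows "null_frame H S F \<xi> Y X \<omega> \<theta> (\<lambda>i z. - p i z) b a"
proof -
  interpret null_frame H S F \<xi> X Y \<theta> \<omega> p a b by fact
  have sw: "det3 (Y z) (X z) (\<xi> z) = - det3 (X z) (Y z) (\<xi> z)" for z by (simp add: det3_expand)
  have cf: "\<omega> 1 z * \<theta> 2 z - \<omega> 2 z * \<theta> 1 z \<noteq> 0" if "z \<in> S" for z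
    using coframe[OF that] by (simp add: mult.commute)
  show ?thesis
    by unfold_locales (use open_S smooth_data det_frame in \<open>auto simp: dF dxi dX dY sw intro!: smooth_on_uminus dest: cf\<close>)
qed

text \<open>The remaining gauge freedom, a local boost of the null frame. The coefficients \<open>a\<close> and \<open>b\<close> have weights
  3 and -3; their product and their zero sets are invariant.\<close>

lemma null_frame_rescale:
  assumes "null_frame H S F \<xi> X Y \<theta> \<omega> p a b" and l: "smooth_on S l" "\<And>z. z \<in> S \<Longrightarrow> l z \<noteq> 0"
  shows "null_frame H S F \<xi> (\<lambda>z. l z *\<^sub>R X z) (\<lambda>z. inverse (l z) *\<^sub>R Y z) (\<lambda>i z. \<theta> i z / l z) (\<lambda>i z. l z * \<omega> i z)
     (\<lambda>i z. p i z + pd i l z / l z) (\<lambda>z. a z * l z ^ 3) (\<lambda>z. b z / l z ^ 3)"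
proof -
  interpret null_frame H S F \<xi> X Y \<theta> \<omega> p a b by fact
  have dl: "l differentiable (at z)" if "z \<in> S" for z using smooth_on_differentiable[OF l(1) that] .
  have si: "smooth_on S (\<lambda>z. inverse (l z))" by (intro smooth_intros open_S l)
  have dil: "pd i (\<lambda>z. inverse (l z)) z = - pd i l z / (l z)\<^sup>2" if "z \<in> S" for i z
  proof -
    have "pd i (\<lambda>z. l z * inverse (l z)) z = pd i (\<lambda>z. 1) z"
      by (rule pd_cong[OF open_S that]) (use l(2) in auto)
    then have "l z * pd i (\<lambda>z. inverse (l z)) z + pd i l z * inverse (l z) = 0"
      using pd_mult[OF dl[OF that] smooth_on_differentiable[OF si that]] by simp
    then show ?thesis using l(2)[OF that] by (simp add: field_simps power2_eq_square)
  qed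
  show ?thesis
  proof
    show "pd i (\<lambda>z. l z *\<^sub>R X z) z = (p i z + pd i l z / l z) *\<^sub>R l z *\<^sub>R X z + (a z * l z ^ 3 * (\<theta> i z / l z)) *\<^sub>R inverse (l z) *\<^sub>R Y z + (l z * \<omega> i z) *\<^sub>R \<xi> z"
      if z: "z \<in> S" for i z
    proof -
      have "pd i (\<lambda>z. l z *\<^sub>R X z) z = (l z * p i z + pd i l z) *\<^sub>R X z + (l z * (a z * \<theta> i z)) *\<^sub>R Y z + (l z * \<omega> i z) *\<^sub>R \<xi> z"
        by (simp add: pd_scaleR dl diffable z dX algebra_simps)
      moreover have "(p i z + pd i l z / l z) * l z = l z * p i z + pd i l z"
        "a z * l z ^ 3 * (\<theta> i z / l z) * inverse (l z) = l z * (a z * \<theta> i z)"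
        using l(2)[OF z] by (simp_all add: field_simps power3_eq_cube)
      ultimately show ?thesis by (simp only: scaleR_scaleR)
    qed
    show "pd i (\<lambda>z. inverse (l z) *\<^sub>R Y z) z = (b z / l z ^ 3 * (l z * \<omega> i z)) *\<^sub>R l z *\<^sub>R X z + - (p i z + pd i l z / l z) *\<^sub>R inverse (l z) *\<^sub>R Y z + (\<theta> i z / l z) *\<^sub>R \<xi> z"
      if z: "z \<in> S" for i z
    proof -
      have "pd i (\<lambda>z. inverse (l z) *\<^sub>R Y z) z = inverse (l z) *\<^sub>R ((b z * \<omega> i z) *\<^sub>R X z + - p i z *\<^sub>R Y z + \<theta> i z *\<^sub>R \<xi> z)
          + (- pd i l z / (l z)\<^sup>2) *\<^sub>R Y z"
        unfolding dY[OF z, symmetric] dil[OF z, symmetric]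
        by (rule pd_scaleR[OF smooth_on_differentiable[OF si z] diffable(4)[OF z]])
      also have "\<dots> = (inverse (l z) * (b z * \<omega> i z)) *\<^sub>R X z + (- inverse (l z) * p i z - pd i l z / (l z)\<^sup>2) *\<^sub>R Y z + (inverse (l z) * \<theta> i z) *\<^sub>R \<xi> z"
        by (simp add: algebra_simps)
      moreover have "b z / l z ^ 3 * (l z * \<omega> i z) * l z = inverse (l z) * (b z * \<omega> i z)"
        "- (p i z + pd i l z / l z) * inverse (l z) = - inverse (l z) * p i z - pd i l z / (l z)\<^sup>2"
        "\<theta> i z / l z = inverse (l z) * \<theta> i z"
        using l(2)[OF z] by (simp_all add: field_simps power3_eq_cube power2_eq_square)
      ultimately show ?thesis by (simp only: scaleR_scaleR)
    qed
    show "\<bar>det3 (l z *\<^sub>R X z) (inverse (l z) *\<^sub>R Y z) (\<xi> z)\<bar> = 1" if z: "z \<in> S" for z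
    proof -
      have "det3 (l z *\<^sub>R X z) (inverse (l z) *\<^sub>R Y z) (\<xi> z) = (l z * inverse (l z)) * det3 (X z) (Y z) (\<xi> z)"
        by (simp add: det3_expand algebra_simps)
      then show ?thesis using l(2)[OF z] det_frame[OF z] by simp
    qed
    show "smooth_on S (\<lambda>z. p i z + pd i l z / l z)" "smooth_on S (\<lambda>z. \<theta> i z / l z)" "smooth_on S (\<lambda>z. b z / l z ^ 3)" for i
      by (intro smooth_intros open_S smooth_data l; use l in simp)+
  qed (use open_S smooth_data coframe l si in \<open>auto simp: dF dxi intro!: smooth_intros\<close>)
qed

lemma null_frame_pullback:
  fixes \<psi> :: "real^2 \<Rightarrow> real^2"
  assumes "null_frame H S F \<xi> X Y \<theta> \<omega> p a b" and T: "open T" and \<psi>: "smooth_on T \<psi>" "\<psi> ` T \<subseteq> S"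
    and J: "\<And>z. z \<in> T \<Longrightarrow> pd 1 \<psi> z $ 1 * pd 2 \<psi> z $ 2 - pd 1 \<psi> z $ 2 * pd 2 \<psi> z $ 1 \<noteq> 0"
  shows "null_frame H T (\<lambda>z. F (\<psi> z)) (\<lambda>z. \<xi> (\<psi> z)) (\<lambda>z. X (\<psi> z)) (\<lambda>z. Y (\<psi> z))
    (\<lambda>i z. pd i \<psi> z $ 1 * \<theta> 1 (\<psi> z) + pd i \<psi> z $ 2 * \<theta> 2 (\<psi> z)) (\<lambda>i z. pd i \<psi> z $ 1 * \<omega> 1 (\<psi> z) + pd i \<psi> z $ 2 * \<omega> 2 (\<psi> z))
    (\<lambda>i z. pd i \<psi> z $ 1 * p 1 (\<psi> z) + pd i \<psi> z $ 2 * p 2 (\<psi> z)) (\<lambda>z. a (\<psi> z)) (\<lambda>z. b (\<psi> z))"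
proof -
  interpret null_frame H S F \<xi> X Y \<theta> \<omega> p a b by fact
  have sc: "smooth_on T (\<lambda>z. g (\<psi> z))" if "smooth_on S g" for g :: "real^2 \<Rightarrow> 'z::real_normed_vector"
    by (rule smooth_on_compose[OF T open_S \<psi>(2) that \<psi>(1)])
  have dc: "pd i (\<lambda>z. g (\<psi> z)) z = (pd i \<psi> z $ 1) *\<^sub>R pd 1 g (\<psi> z) + (pd i \<psi> z $ 2) *\<^sub>R pd 2 g (\<psi> z)"
    if "g differentiable (at (\<psi> z))" "z \<in> T" for g :: "real^2 \<Rightarrow> real^3" and i z
    by (rule pd_compose[OF that(1) smooth_on_differentiable[OF \<psi>(1) that(2)]])
  have in_S: "\<psi> z \<in> S" if "z \<in> T" for z using \<psi>(2) that by auto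
  show ?thesis
  proof
    fix z assume z: "z \<in> T"
    have "(pd 1 \<psi> z $ 1 * \<theta> 1 (\<psi> z) + pd 1 \<psi> z $ 2 * \<theta> 2 (\<psi> z)) * (pd 2 \<psi> z $ 1 * \<omega> 1 (\<psi> z) + pd 2 \<psi> z $ 2 * \<omega> 2 (\<psi> z))
       - (pd 2 \<psi> z $ 1 * \<theta> 1 (\<psi> z) + pd 2 \<psi> z $ 2 * \<theta> 2 (\<psi> z)) * (pd 1 \<psi> z $ 1 * \<omega> 1 (\<psi> z) + pd 1 \<psi> z $ 2 * \<omega> 2 (\<psi> z))
      = (pd 1 \<psi> z $ 1 * pd 2 \<psi> z $ 2 - pd 1 \<psi> z $ 2 * pd 2 \<psi> z $ 1) * (\<theta> 1 (\<psi> z) * \<omega> 2 (\<psi> z) - \<theta> 2 (\<psi> z) * \<omega> 1 (\<psi> z))"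
      by (simp add: algebra_simps)
    then show "(pd 1 \<psi> z $ 1 * \<theta> 1 (\<psi> z) + pd 1 \<psi> z $ 2 * \<theta> 2 (\<psi> z)) * (pd 2 \<psi> z $ 1 * \<omega> 1 (\<psi> z) + pd 2 \<psi> z $ 2 * \<omega> 2 (\<psi> z))
       - (pd 2 \<psi> z $ 1 * \<theta> 1 (\<psi> z) + pd 2 \<psi> z $ 2 * \<theta> 2 (\<psi> z)) * (pd 1 \<psi> z $ 1 * \<omega> 1 (\<psi> z) + pd 1 \<psi> z $ 2 * \<omega> 2 (\<psi> z)) \<noteq> 0"
      using J[OF z] coframe[OF in_S[OF z]] by simp
  qed (use T \<psi> det_frame in_S in \<open>auto simp: dc diffable dF dX dY dxi algebra_simps intro!: smooth_intros sc smooth_data\<close>)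
qed

subsection \<open>Frames with prescribed connection forms\<close>

lemma differentiable_nth: "f differentiable (at x) \<Longrightarrow> (\<lambda>x. f x $ k) differentiable (at x)"
  unfolding differentiable_def using bounded_linear.has_derivative[OF bounded_linear_vec_nth] by blast

lemma pd_det3:
  assumes "u differentiable (at x)" "v differentiable (at x)" "w differentiable (at x)"
  shows "pd i (\<lambda>x. det3 (u x) (v x) (w x)) x = det3 (pd i u x) (v x) (w x) + det3 (u x) (pd i v x) (w x) + det3 (u x) (v x) (pd i w x)"
proof -
  have d: "(\<lambda>x. f x $ k) differentiable (at x)" if "f differentiable (at x)" for f :: "real^2 \<Rightarrow> real^3" and k
    using differentiable_nth[OF that] .
  show ?thesis unfolding det3_expand
    by (simp add: pd_add pd_diff pd_mult d assms differentiable_add differentiable_diff differentiable_mult pd_nth algebra_simps)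
qed

lemma constant_on_connected_pd:
  fixes f :: "real^2 \<Rightarrow> real"
  assumes "connected S" "open S" "\<And>x. x \<in> S \<Longrightarrow> f differentiable (at x)" "\<And>i x. x \<in> S \<Longrightarrow> pd i f x = 0"
    and "x \<in> S" "y \<in> S"
  shows "f x = f y"
proof -
  have "(f has_derivative (\<lambda>v. 0)) (at x within S)" if "x \<in> S" for x
    using has_derivative_pd[OF assms(3)[OF that]] assms(4)[OF that] has_derivative_at_withinI by force
  moreover have "continuous_on S f" using assms(3) by (simp add: continuous_at_imp_continuous_on differentiable_imp_continuous_within)
  ultimately have "f constant_on S"
    by (intro has_derivative_zero_connected_constant_on[OF assms(1,2) finite.emptyI]) auto
  then obtain c where "\<And>x. x \<in> S \<Longrightarrow> f x = c"
    unfolding constant_on_def by blast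
  then show ?thesis using assms(5,6) by simp
qed

text \<open>The fundamental theorem. Each Cartesian component of $(X, Y, \xi, F)$ has to solve one and the same
  linear system with $4 \times 4$ matrices, and the five integrability conditions make it flat. The
  determinant of $(X, Y, \xi)$ stays constant because the corresponding $3 \times 3$ block has trace zero.\<close>

lemma null_frame_from_forms:
  assumes \<Omega>: "open \<Omega>" "simply_connected \<Omega>"
    and s\<theta>: "\<And>i. smooth_on \<Omega> (\<theta> i)" and s\<omega>: "\<And>i. smooth_on \<Omega> (\<omega> i)" and sp: "\<And>i. smooth_on \<Omega> (p i)"
    and sa: "smooth_on \<Omega> a" and sb: "smooth_on \<Omega> b"
    and c\<theta>: "\<And>z. z \<in> \<Omega> \<Longrightarrow> pd 1 (\<theta> 2) z - pd 2 (\<theta> 1) z = p 2 z * \<theta> 1 z - p 1 z * \<theta> 2 z"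
    and c\<omega>: "\<And>z. z \<in> \<Omega> \<Longrightarrow> pd 1 (\<omega> 2) z - pd 2 (\<omega> 1) z = p 1 z * \<omega> 2 z - p 2 z * \<omega> 1 z"
    and cp: "\<And>z. z \<in> \<Omega> \<Longrightarrow> pd 1 (p 2) z - pd 2 (p 1) z = (H + a z * b z) * (\<theta> 1 z * \<omega> 2 z - \<theta> 2 z * \<omega> 1 z)"
    and ca: "\<And>z. z \<in> \<Omega> \<Longrightarrow> pd 1 a z * \<theta> 2 z - pd 2 a z * \<theta> 1 z = 3 * a z * (p 1 z * \<theta> 2 z - p 2 z * \<theta> 1 z)"
    and cb: "\<And>z. z \<in> \<Omega> \<Longrightarrow> pd 1 b z * \<omega> 2 z - pd 2 b z * \<omega> 1 z = - 3 * b z * (p 1 z * \<omega> 2 z - p 2 z * \<omega> 1 z)"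
    and nz: "\<And>z. z \<in> \<Omega> \<Longrightarrow> \<theta> 1 z * \<omega> 2 z - \<theta> 2 z * \<omega> 1 z \<noteq> 0"
  shows "\<exists>F \<xi> X Y. null_frame H \<Omega> F \<xi> X Y \<theta> \<omega> p a b"
proof (cases "\<Omega> = {}")
  case True
  have "null_frame H \<Omega> (\<lambda>z. 0) (\<lambda>z. 0) (\<lambda>z. 0) (\<lambda>z. 0) \<theta> \<omega> p a b"
    by unfold_locales (use True assms in \<open>auto intro: smooth_on_const\<close>)
  then show ?thesis by blast
next
  case False
  define e where "e = (\<lambda>i z (r::4) (c::4). if r = 1 then (if c = 1 then p i z else if c = 2 then a z * \<theta> i z else if c = 3 then \<omega> i z else 0)
    else if r = 2 then (if c = 1 then b z * \<omega> i z else if c = 2 then - p i z else if c = 3 then \<theta> i z else 0)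
    else if r = 3 then (if c = 1 then - (H * \<theta> i z) else if c = 2 then - (H * \<omega> i z) else 0)
    else (if c = 1 then \<theta> i z else if c = 2 then \<omega> i z else 0))"
  define M where "M = (\<lambda>i z. (\<chi> r c. e i z r c) :: real^4^4)"
  have se: "smooth_on \<Omega> (\<lambda>z. e i z r c)" for i r c
    unfolding e_def by (intro smooth_on_if smooth_intros assms)
  have sM: "smooth_on \<Omega> (M i)" for i unfolding M_def by (intro smooth_on_matrix \<Omega> se)
  have Mw: "(M i z *v w) $ 1 = p i z * w $ 1 + a z * \<theta> i z * w $ 2 + \<omega> i z * w $ 3"
    "(M i z *v w) $ 2 = b z * \<omega> i z * w $ 1 - p i z * w $ 2 + \<theta> i z * w $ 3"
    "(M i z *v w) $ 3 = - (H * \<theta> i z) * w $ 1 - (H * \<omega> i z) * w $ 2"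
    "(M i z *v w) $ 4 = \<theta> i z * w $ 1 + \<omega> i z * w $ 2" for i z w
    by (simp_all add: M_def e_def matrix_vector_mult_def sum_4)
  have flat: "pd 2 (M 1) z *v w + M 1 z *v (M 2 z *v w) = pd 1 (M 2) z *v w + M 2 z *v (M 1 z *v w)" if z: "z \<in> \<Omega>" for z w
  proof -
    have de: "pd i (M j) z $ r $ c = pd i (\<lambda>z. e j z r c) z" for i j r c
    proof -
      have d: "M j differentiable (at z)" by (rule smooth_on_differentiable[OF sM z])
      have d': "(\<lambda>z. M j z $ r) differentiable (at z)" using differentiable_nth[OF d] .
      show ?thesis using pd_nth[OF d', of i c] pd_nth[OF d, of i r] by (simp add: M_def)
    qed
    have dd: "\<theta> i differentiable (at z)" "\<omega> i differentiable (at z)" "p i differentiable (at z)" "a differentiable (at z)" "b differentiable (at z)" for i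
      using smooth_on_differentiable z assms by blast+
    have Hc: "pd i (\<lambda>z. H * g z) z = H * pd i g z" if "g differentiable (at z)" for g :: "real^2 \<Rightarrow> real" and i
      using pd_mult[OF differentiable_const that, of i H] by simp
    have dM: "pd i (M j) z *v w = vector [pd i (p j) z * w $ 1 + (a z * pd i (\<theta> j) z + pd i a z * \<theta> j z) * w $ 2 + pd i (\<omega> j) z * w $ 3,
      (b z * pd i (\<omega> j) z + pd i b z * \<omega> j z) * w $ 1 - pd i (p j) z * w $ 2 + pd i (\<theta> j) z * w $ 3,
      - (H * pd i (\<theta> j) z) * w $ 1 - (H * pd i (\<omega> j) z) * w $ 2,
      pd i (\<theta> j) z * w $ 1 + pd i (\<omega> j) z * w $ 2]" (is "_ = ?R") for i j
    proof -
      have "(pd i (M j) z *v w) $ r = ?R $ r" for r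
      proof -
        have v4: "(vector [x1, x2, x3, x4] :: real^4) $ 1 = x1" "(vector [x1, x2, x3, x4] :: real^4) $ 2 = x2"
          "(vector [x1, x2, x3, x4] :: real^4) $ 3 = x3" "(vector [x1, x2, x3, x4] :: real^4) $ 4 = x4" for x1 x2 x3 x4
          by (simp_all add: vector_def)
        consider "r = 1" | "r = 2" | "r = 3" | "r = 4" using exhaust_4[of r] by blast
        then show ?thesis
          by cases (simp_all add: matrix_vector_mult_def sum_4 de e_def v4 pd_mult pd_uminus dd Hc differentiable_mult)
      qed
      then show ?thesis by (simp add: vec_eq_iff)
    qed
    have v4: "(vector [x1, x2, x3, x4] :: real^4) $ 1 = x1" "(vector [x1, x2, x3, x4] :: real^4) $ 2 = x2"
      "(vector [x1, x2, x3, x4] :: real^4) $ 3 = x3" "(vector [x1, x2, x3, x4] :: real^4) $ 4 = x4" for x1 x2 x3 x4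
      by (simp_all add: vector_def)
    define A where "A = pd 1 a z * \<theta> 2 z"
    define B where "B = pd 1 b z * \<omega> 2 z"
    have e1: "pd 1 (\<theta> 2) z = pd 2 (\<theta> 1) z + (p 2 z * \<theta> 1 z - p 1 z * \<theta> 2 z)" using c\<theta>[OF z] by simp
    have e2: "pd 1 (\<omega> 2) z = pd 2 (\<omega> 1) z + (p 1 z * \<omega> 2 z - p 2 z * \<omega> 1 z)" using c\<omega>[OF z] by simp
    have e3: "pd 1 (p 2) z = pd 2 (p 1) z + (H + a z * b z) * (\<theta> 1 z * \<omega> 2 z - \<theta> 2 z * \<omega> 1 z)" using cp[OF z] by simp
    have e4: "A = pd 2 a z * \<theta> 1 z + 3 * a z * (p 1 z * \<theta> 2 z - p 2 z * \<theta> 1 z)" using ca[OF z] by (simp add: A_def)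
    have e5: "B = pd 2 b z * \<omega> 1 z - 3 * b z * (p 1 z * \<omega> 2 z - p 2 z * \<omega> 1 z)" using cb[OF z] by (simp add: B_def)
    show ?thesis
      unfolding vec_eq_iff forall_4 vector_add_component dM v4 Mw A_def[symmetric] B_def[symmetric] e1 e2 e3 e4 e5
      by (simp add: algebra_simps)
  qed
  obtain z0 where z0: "z0 \<in> \<Omega>" and sol: "\<And>c. \<exists>\<Psi>. smooth_on \<Omega> \<Psi> \<and> \<Psi> z0 = c \<and> (\<forall>x\<in>\<Omega>. pd 1 \<Psi> x = M 1 x *v \<Psi> x \<and> pd 2 \<Psi> x = M 2 x *v \<Psi> x)"
    using flat_system_simply_connected[OF \<Omega> False sM sM flat] by blast
  define c0 where "c0 = (\<lambda>k::3. (\<chi> r. if k = 1 \<and> r = 1 \<or> k = 2 \<and> r = 2 \<or> k = 3 \<and> r = 3 then 1 else 0) :: real^4)"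
  have "\<forall>k. \<exists>\<Psi>. smooth_on \<Omega> \<Psi> \<and> \<Psi> z0 = c0 k \<and> (\<forall>x\<in>\<Omega>. pd 1 \<Psi> x = M 1 x *v \<Psi> x \<and> pd 2 \<Psi> x = M 2 x *v \<Psi> x)"
    using sol by blast
  then obtain \<Psi> where \<Psi>: "\<And>k. smooth_on \<Omega> (\<Psi> k)" "\<And>k. \<Psi> k z0 = c0 k"
    "\<And>k x. x \<in> \<Omega> \<Longrightarrow> pd 1 (\<Psi> k) x = M 1 x *v \<Psi> k x" "\<And>k x. x \<in> \<Omega> \<Longrightarrow> pd 2 (\<Psi> k) x = M 2 x *v \<Psi> k x" by metis
  define G where "G = (\<lambda>r z. (\<chi> k. \<Psi> k z $ r) :: real^3)"
  have sG: "smooth_on \<Omega> (G r)" for r unfolding G_def by (intro smooth_intros \<Omega> \<Psi>)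
  have dG: "pd i (G r) z = (\<chi> k. (M i z *v \<Psi> k z) $ r)" if z: "z \<in> \<Omega>" for i r z
  proof -
    have "pd i (G r) z $ k = (M i z *v \<Psi> k z) $ r" for k
    proof -
      have "pd i (G r) z $ k = pd i (\<lambda>z. G r z $ k) z"
        using pd_nth[OF smooth_on_differentiable[OF sG z]] by simp
      also have "\<dots> = pd i (\<Psi> k) z $ r"
        using pd_nth[OF smooth_on_differentiable[OF \<Psi>(1) z]] by (simp add: G_def)
      finally show ?thesis using \<Psi>(3,4)[OF z] exhaust_2[of i] by auto
    qed
    then show ?thesis by (simp add: vec_eq_iff)
  qed
  have dX: "pd i (G 1) z = p i z *\<^sub>R G 1 z + (a z * \<theta> i z) *\<^sub>R G 2 z + \<omega> i z *\<^sub>R G 3 z" if "z \<in> \<Omega>" for i z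
    unfolding dG[OF that] Mw by (simp add: G_def vec_eq_iff)
  have dY: "pd i (G 2) z = (b z * \<omega> i z) *\<^sub>R G 1 z + - p i z *\<^sub>R G 2 z + \<theta> i z *\<^sub>R G 3 z" if "z \<in> \<Omega>" for i z
    unfolding dG[OF that] Mw by (simp add: G_def vec_eq_iff)
  have dxi: "pd i (G 3) z = - (H * \<theta> i z) *\<^sub>R G 1 z + - (H * \<omega> i z) *\<^sub>R G 2 z" if "z \<in> \<Omega>" for i z
    unfolding dG[OF that] Mw by (simp add: G_def vec_eq_iff)
  have dF: "pd i (G 4) z = \<theta> i z *\<^sub>R G 1 z + \<omega> i z *\<^sub>R G 2 z" if "z \<in> \<Omega>" for i z
    unfolding dG[OF that] Mw by (simp add: G_def vec_eq_iff)
  define \<Delta> where "\<Delta> = (\<lambda>z. det3 (G 1 z) (G 2 z) (G 3 z))"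
  have "pd i \<Delta> z = 0" if z: "z \<in> \<Omega>" for i z
  proof -
    have "pd i \<Delta> z = det3 (pd i (G 1) z) (G 2 z) (G 3 z) + det3 (G 1 z) (pd i (G 2) z) (G 3 z) + det3 (G 1 z) (G 2 z) (pd i (G 3) z)"
      unfolding \<Delta>_def by (rule pd_det3) (rule smooth_on_differentiable[OF sG z])+
    then show ?thesis unfolding dX[OF z] dY[OF z] dxi[OF z] by (simp add: det3_expand algebra_simps)
  qed
  moreover have "smooth_on \<Omega> \<Delta>" unfolding \<Delta>_def by (intro smooth_intros \<Omega> sG)
  ultimately have "\<Delta> z = \<Delta> z0" if "z \<in> \<Omega>" for z
    using constant_on_connected_pd[OF simply_connected_imp_connected[OF \<Omega>(2)] \<Omega>(1), of \<Delta> z z0] that z0 smooth_on_differentiable by blast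
  moreover have "\<Delta> z0 = 1" by (simp add: \<Delta>_def det3_expand G_def \<Psi>(2) c0_def)
  ultimately have det: "det3 (G 1 z) (G 2 z) (G 3 z) = 1" if "z \<in> \<Omega>" for z using that by (simp add: \<Delta>_def)
  have "null_frame H \<Omega> (G 4) (G 3) (G 1) (G 2) \<theta> \<omega> p a b"
    by unfold_locales (use assms sG dX dY dF dxi det in auto)
  then show ?thesis by blast
qed

subsection \<open>Null frames of an affine sphere\<close>

text \<open>The null directions of \<open>h\<close> are the roots of a quadratic equation with positive discriminant and thus
  depend smoothly on the point. Normalise $h(X,Y) = 1$. Then the volume condition in the definition of the affine normal
  reads $\det(X,Y,\xi) = \pm 1$, so the connection is trace free in this frame. It remains to see that the
  \<open>Y\<close>-coefficient of $dX$ is a multiple of \<open>\<theta>\<close> and the \<open>X\<close>-coefficient of $dY$ one of \<open>\<omega>\<close>;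
  both follow by comparing the symmetry of the second derivatives of \<open>F\<close> with that of \<open>X\<close> and \<open>Y\<close>.\<close>

lemma null_frame_of_sphere:
  assumes S: "open S" "smooth_on S F" "smooth_on S \<xi>" "z0 \<in> S"
    and bl: "\<And>z. z \<in> S \<Longrightarrow> blaschke_at F \<xi> z" and ind: "\<And>z. z \<in> S \<Longrightarrow> indefinite_at F \<xi> z"
    and sh: "\<And>i z. z \<in> S \<Longrightarrow> shape_op F \<xi> i z = H *\<^sub>R axis i 1"
  shows "\<exists>T X Y \<theta> \<omega> p a b. z0 \<in> T \<and> T \<subseteq> S \<and> null_frame H T F \<xi> X Y \<theta> \<omega> p a b"
proof -
  have fd: "frame_det F \<xi> z \<noteq> 0" if "z \<in> S" for z using bl[OF that] by (simp add: blaschke_at_def)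
  define c where "c = (\<lambda>(k::3) z w. if k = 1 then det3 w (pd 2 F z) (\<xi> z) / frame_det F \<xi> z
     else if k = 2 then det3 (pd 1 F z) w (\<xi> z) / frame_det F \<xi> z else det3 (pd 1 F z) (pd 2 F z) w / frame_det F \<xi> z)"
  have cram: "w = c (1::3) z w *\<^sub>R pd 1 F z + c 2 z w *\<^sub>R pd 2 F z + c 3 z w *\<^sub>R \<xi> z" if "z \<in> S" for z w
    using det3_cramer[of "pd 1 F z" "pd 2 F z" "\<xi> z" w] fd[OF that] by (simp add: c_def frame_det_def)
  have fc: "frame_coeffs F \<xi> z w = vector [c 1 z w, c 2 z w, c 3 z w]" if "z \<in> S" for z w
    by (rule frame_coeffs_eqI[OF fd[OF that] cram[OF that]])
  have sfd: "smooth_on S (frame_det F \<xi>)" unfolding frame_det_def[abs_def] by (intro smooth_intros S)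
  define h where "h = (\<lambda>i j z. c 3 z (pd i (pd j F) z))"
  have sh': "smooth_on S (h i j)" for i j
    unfolding h_def c_def by simp (intro smooth_intros S sfd; use fd in simp)
  have hsym: "h 1 2 z = h 2 1 z" if "z \<in> S" for z using pd_commute[OF S(2,1) that, of 1 2] by (simp add: h_def)
  have hm: "aff_metric F \<xi> z $ i $ j = h i j z" if "z \<in> S" for i j z by (simp add: aff_metric_def fc[OF that] h_def)
  have dxi: "pd i \<xi> z = (- H) *\<^sub>R pd i F z" if z: "z \<in> S" for i z
  proof -
    have "c 3 z (pd i \<xi> z) = 0" using bl[OF z] by (simp add: blaschke_at_def equiaffine_at_def fc[OF z])
    moreover have "- c 1 z (pd i \<xi> z) = H * axis i 1 $ 1" "- c 2 z (pd i \<xi> z) = H * axis i 1 $ 2"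
      using arg_cong[OF sh[OF z, of i], of "\<lambda>v. v $ 1"] arg_cong[OF sh[OF z, of i], of "\<lambda>v. v $ 2"]
      by (simp_all add: shape_op_def fc[OF z] tangential_def)
    then have "c 1 z (pd i \<xi> z) = - H * axis i 1 $ 1" "c 2 z (pd i \<xi> z) = - H * axis i 1 $ 2" by auto
    ultimately show ?thesis using cram[OF z, of "pd i \<xi> z"] exhaust_2[of i] by (auto simp: axis_def)
  qed
  define \<delta> where "\<delta> = (\<lambda>z. (h 1 2 z)\<^sup>2 - h 1 1 z * h 2 2 z)"
  have s\<delta>: "smooth_on S \<delta>" unfolding \<delta>_def by (intro smooth_intros S sh')
  have dpos: "\<delta> z > 0" if z: "z \<in> S" for z
  proof (rule ccontr)
    assume "\<not> \<delta> z > 0"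
    then have d: "\<delta> z \<le> 0" by simp
    define q where "q = (\<lambda>v::real^2. h 1 1 z * (v $ 1)\<^sup>2 + 2 * h 1 2 z * v $ 1 * v $ 2 + h 2 2 z * (v $ 2)\<^sup>2)"
    have qm: "v \<bullet> (aff_metric F \<xi> z *v v) = q v" for v
      by (simp add: q_def inner_vec_def matrix_vector_mult_def sum_2 hm[OF z] hsym[OF z] power2_eq_square algebra_simps)
    obtain v w where vw: "q v > 0" "q w < 0" using ind[OF z] unfolding indefinite_at_def qm by blast
    show False
    proof (cases "h 1 1 z = 0")
      case True
      then have "h 1 2 z = 0" using d by (simp add: \<delta>_def)
      then have "q v = h 2 2 z * (v $ 2)\<^sup>2" "q w = h 2 2 z * (w $ 2)\<^sup>2" using True by (simp_all add: q_def)
      then show False using vw by (smt (verit) mult_nonneg_nonneg mult_nonpos_nonneg zero_le_power2)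
    next
      case False
      have sq: "h 1 1 z * q v = (h 1 1 z * v $ 1 + h 1 2 z * v $ 2)\<^sup>2 - \<delta> z * (v $ 2)\<^sup>2" for v
        by (simp add: q_def \<delta>_def power2_eq_square algebra_simps)
      have pos: "h 1 1 z * q v \<ge> 0" for v
        using sq[of v] zero_le_power2[of "h 1 1 z * v $ 1 + h 1 2 z * v $ 2"] mult_nonpos_nonneg[OF d zero_le_power2[of "v $ 2"]]
        by linarith
      then show False using pos[of v] pos[of w] vw False by (smt (verit) mult_neg_pos mult_pos_neg)
    qed
  qed
  define \<sigma> where "\<sigma> = (if h 1 2 z0 \<ge> 0 then 1 else - 1 :: real)"
  define d where "d = (\<lambda>z. - \<sigma> * sqrt (\<delta> z))"
  define e where "e = (\<lambda>z. h 1 2 z - d z)"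
  have \<sigma>2: "\<sigma> * \<sigma> = 1" by (simp add: \<sigma>_def)
  have sd: "smooth_on S d" unfolding d_def by (intro smooth_intros S s\<delta> dpos)
  have se: "smooth_on S e" unfolding e_def by (intro smooth_intros S sh' sd)
  have d2: "d z * d z = \<delta> z" if "z \<in> S" for z
  proof -
    have "d z * d z = (\<sigma> * \<sigma>) * (sqrt (\<delta> z) * sqrt (\<delta> z))" by (simp add: d_def)
    then show ?thesis using dpos[OF that] \<sigma>2 by simp
  qed
  have dnz: "d z \<noteq> 0" if "z \<in> S" for z using d2[OF that] dpos[OF that] by auto
  define T where "T = S \<inter> e -` (- {0})"
  have oT: "open T" unfolding T_def
    using continuous_open_preimage[OF smooth_on_continuous_on[OF se] S(1), of "- {0}"] by (simp add: open_Compl)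
  have TS: "T \<subseteq> S" by (auto simp: T_def)
  have "sqrt (\<delta> z0) > 0" using dpos[OF S(4)] by simp
  then have "e z0 \<noteq> 0" unfolding e_def d_def \<sigma>_def by (smt (verit) mult_cancel_right1 mult_minus_left)
  then have z0T: "z0 \<in> T" using S(4) by (simp add: T_def)
  have enz: "e z \<noteq> 0" if "z \<in> T" for z using that by (simp add: T_def)
  \<comment> \<open>\<open>e\<close> and \<open>h 1 2 + d\<close> are the roots of \<open>x\<^sup>2 - 2 h\<^sub>1\<^sub>2 x + h\<^sub>1\<^sub>1 h\<^sub>2\<^sub>2\<close>, so the fields \<open>X\<close> and \<open>Y\<close> below are null;
     the sign \<open>\<sigma>\<close> picks the root that does not vanish at \<open>z0\<close>\<close>
  have AC: "h 1 1 z * h 2 2 z = 2 * h 1 2 z * e z - e z * e z" if "z \<in> S" for z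
    using d2[OF that] unfolding e_def \<delta>_def by (simp add: power2_eq_square algebra_simps)
  have B: "h 1 2 z = e z + d z" for z by (simp add: e_def)
  have AC': "h 1 1 z * h 2 2 z = e z * e z + 2 * d z * e z" if "z \<in> S" for z
    using AC[OF that] unfolding B by (simp add: algebra_simps)
  define \<theta> where "\<theta> = (\<lambda>(i::2) z. if i = 1 then 1 / (2 * d z) else h 2 2 z / (2 * e z * d z))"
  define \<omega> where "\<omega> = (\<lambda>(i::2) z. if i = 1 then h 1 1 z * d z else e z * d z)"
  define X where "X = (\<lambda>z. - e z *\<^sub>R pd 1 F z + h 1 1 z *\<^sub>R pd 2 F z)"
  define k where "k = (\<lambda>z. 1 / (2 * e z * (d z * d z)))"
  define Y where "Y = (\<lambda>z. (h 2 2 z * k z) *\<^sub>R pd 1 F z + (- e z * k z) *\<^sub>R pd 2 F z)"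
  have sT: "smooth_on T F" "smooth_on T \<xi>" "smooth_on T d" "smooth_on T e" "\<And>i j. smooth_on T (h i j)"
    using S sd se sh' TS by (auto intro: smooth_on_subset)
  have sth: "smooth_on T (\<theta> i)" for i unfolding \<theta>_def
    by (intro smooth_on_if smooth_intros oT sT) (use enz dnz TS in auto)
  have som: "smooth_on T (\<omega> i)" for i unfolding \<omega>_def by (intro smooth_on_if smooth_intros oT sT)
  have sk: "smooth_on T k" unfolding k_def by (intro smooth_intros oT sT) (use enz dnz TS in auto)
  have sX: "smooth_on T X" unfolding X_def by (intro smooth_intros oT sT)
  have sY: "smooth_on T Y" unfolding Y_def by (intro smooth_intros oT sT sk)
  have dFT: "pd i F z = \<theta> i z *\<^sub>R X z + \<omega> i z *\<^sub>R Y z" if z: "z \<in> T" for i z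
  proof -
    have zS: "z \<in> S" using z TS by auto
    note nz = enz[OF z] dnz[OF zS]
    have a1: "- (\<theta> 1 z * e z) + \<omega> 1 z * (h 2 2 z * k z) = 1" "\<theta> 1 z * h 1 1 z - \<omega> 1 z * (e z * k z) = 0"
      "- (\<theta> 2 z * e z) + \<omega> 2 z * (h 2 2 z * k z) = 0" "\<theta> 2 z * h 1 1 z - \<omega> 2 z * (e z * k z) = 1"
    proof -
      have "\<omega> 1 z * (h 2 2 z * k z) = (h 1 1 z * h 2 2 z) * d z * k z" by (simp add: \<omega>_def)
      also have "\<dots> = (e z * e z + 2 * d z * e z) * d z * k z" unfolding AC'[OF zS] ..
      also have "\<dots> = e z / (2 * d z) + 1" using nz by (simp add: k_def field_simps)
      finally show "- (\<theta> 1 z * e z) + \<omega> 1 z * (h 2 2 z * k z) = 1" by (simp add: \<theta>_def)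
      show "\<theta> 1 z * h 1 1 z - \<omega> 1 z * (e z * k z) = 0" "- (\<theta> 2 z * e z) + \<omega> 2 z * (h 2 2 z * k z) = 0"
        using nz by (simp_all add: \<theta>_def \<omega>_def k_def field_simps)
      have "\<theta> 2 z * h 1 1 z = (h 1 1 z * h 2 2 z) / (2 * e z * d z)" by (simp add: \<theta>_def)
      also have "\<dots> = (e z * e z + 2 * d z * e z) / (2 * e z * d z)" unfolding AC'[OF zS] ..
      also have "\<dots> = e z / (2 * d z) + 1" using nz by (simp add: field_simps)
      finally show "\<theta> 2 z * h 1 1 z - \<omega> 2 z * (e z * k z) = 1" using nz by (simp add: \<omega>_def k_def field_simps)
    qed
    have "\<theta> i z *\<^sub>R X z + \<omega> i z *\<^sub>R Y z = (- (\<theta> i z * e z) + \<omega> i z * (h 2 2 z * k z)) *\<^sub>R pd 1 F z + (\<theta> i z * h 1 1 z - \<omega> i z * (e z * k z)) *\<^sub>R pd 2 F z"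
      by (simp add: X_def Y_def algebra_simps)
    then show ?thesis using a1 exhaust_2[of i] by auto
  qed
  have cof: "\<theta> 1 z * \<omega> 2 z - \<theta> 2 z * \<omega> 1 z = - d z" if z: "z \<in> T" for z
  proof -
    have zS: "z \<in> S" using z TS by auto
    have "\<theta> 1 z * \<omega> 2 z - \<theta> 2 z * \<omega> 1 z = e z / 2 - (h 1 1 z * h 2 2 z) / (2 * e z)"
      using enz[OF z] dnz[OF zS] by (simp add: \<theta>_def \<omega>_def field_simps)
    then show ?thesis unfolding AC'[OF zS] using enz[OF z] by (simp add: field_simps)
  qed
  have detc: "det3 (X z) (Y z) w * - d z = det3 (pd 1 F z) (pd 2 F z) w" if z: "z \<in> T" for z w
    unfolding cof[OF z, symmetric] dFT[OF z] by (simp add: det3_expand algebra_simps)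
  have hcond: "h i j z = \<theta> i z * \<omega> j z + \<omega> i z * \<theta> j z" if z: "z \<in> T" for i j z
  proof -
    have zS: "z \<in> S" using z TS by auto
    note nz = enz[OF z] dnz[OF zS]
    have "\<theta> 1 z * \<omega> 1 z + \<omega> 1 z * \<theta> 1 z = h 1 1 z" "\<theta> 2 z * \<omega> 2 z + \<omega> 2 z * \<theta> 2 z = h 2 2 z"
      using nz by (simp_all add: \<theta>_def \<omega>_def field_simps)
    moreover have "\<theta> 1 z * \<omega> 2 z + \<omega> 1 z * \<theta> 2 z = e z / 2 + (h 1 1 z * h 2 2 z) / (2 * e z)"
      using nz by (simp add: \<theta>_def \<omega>_def field_simps)
    moreover have "\<dots> = h 1 2 z" unfolding AC'[OF zS] B using nz by (simp add: field_simps)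
    ultimately show ?thesis using hsym[OF zS] exhaust_2[of i] exhaust_2[of j] by (auto simp: algebra_simps)
  qed
  have det1: "\<bar>det3 (X z) (Y z) (\<xi> z)\<bar> = 1" if z: "z \<in> T" for z
  proof -
    have zS: "z \<in> S" using z TS by auto
    have "\<bar>frame_det F \<xi> z\<bar> = sqrt \<bar>det (aff_metric F \<xi> z)\<bar>" using bl[OF zS] by (simp add: blaschke_at_def)
    also have "det (aff_metric F \<xi> z) = - \<delta> z" by (simp add: det_2 hm[OF zS] hsym[OF zS] \<delta>_def power2_eq_square)
    also have "\<bar>- \<delta> z\<bar> = \<bar>d z\<bar>\<^sup>2" using d2[OF zS] dpos[OF zS] by (simp add: power2_eq_square)
    finally have "\<bar>frame_det F \<xi> z\<bar> = \<bar>d z\<bar>" by simp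
    moreover have "\<bar>frame_det F \<xi> z\<bar> = \<bar>det3 (X z) (Y z) (\<xi> z)\<bar> * \<bar>d z\<bar>"
      unfolding frame_det_def detc[OF z, symmetric] by (simp add: abs_mult)
    ultimately show ?thesis using dnz[OF zS] by simp
  qed
  have detnz: "det3 (X z) (Y z) (\<xi> z) \<noteq> 0" if "z \<in> T" for z using det1[OF that] by auto
  \<comment> \<open>the coefficients of \<open>pd i Z z\<close> in the frame, by Cramer's rule\<close>
  define P where "P = (\<lambda>Z i z. det3 (pd i Z z) (Y z) (\<xi> z) / det3 (X z) (Y z) (\<xi> z))"
  define Q where "Q = (\<lambda>Z i z. det3 (X z) (pd i Z z) (\<xi> z) / det3 (X z) (Y z) (\<xi> z))"
  define R where "R = (\<lambda>Z i z. det3 (X z) (Y z) (pd i Z z) / det3 (X z) (Y z) (\<xi> z))"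
  have sPQ: "smooth_on T (P Z i)" "smooth_on T (Q Z i)" if "smooth_on T Z" for Z i
    unfolding P_def Q_def by (intro smooth_intros oT sX sY sT that detnz; assumption)+
  have dZ: "pd i Z z = P Z i z *\<^sub>R X z + Q Z i z *\<^sub>R Y z + R Z i z *\<^sub>R \<xi> z" if "z \<in> T" for Z i z
    unfolding P_def Q_def R_def by (rule det3_cramer[OF detnz[OF that]])
  have dif: "Z differentiable (at z)" if "smooth_on T Z" "z \<in> T" for Z :: "real^2 \<Rightarrow> 'z::real_normed_vector" and z
    using smooth_on_differentiable that by blast
  have Rc: "R (\<lambda>z. u z *\<^sub>R pd 1 F z + v z *\<^sub>R pd 2 F z) i z = u z * h i 1 z + v z * h i 2 z"
    if z: "z \<in> T" and uv: "smooth_on T u" "smooth_on T v" for u v i z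
  proof -
    have zS: "z \<in> S" using z TS by auto
    have hh: "det3 (pd 1 F z) (pd 2 F z) (pd i (pd j F) z) = h i j z * det3 (pd 1 F z) (pd 2 F z) (\<xi> z)" for j
      using fd[OF zS] by (simp add: h_def c_def frame_det_def)
    have "pd i (\<lambda>z. u z *\<^sub>R pd 1 F z + v z *\<^sub>R pd 2 F z) z = (u z *\<^sub>R pd i (pd 1 F) z + pd i u z *\<^sub>R pd 1 F z) + (v z *\<^sub>R pd i (pd 2 F) z + pd i v z *\<^sub>R pd 2 F z)"
      by (simp add: pd_add pd_scaleR dif[OF _ z] uv smooth_on_pd sT differentiable_scaleR)
    then have "det3 (pd 1 F z) (pd 2 F z) (pd i (\<lambda>z. u z *\<^sub>R pd 1 F z + v z *\<^sub>R pd 2 F z) z)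
      = u z * det3 (pd 1 F z) (pd 2 F z) (pd i (pd 1 F) z) + v z * det3 (pd 1 F z) (pd 2 F z) (pd i (pd 2 F) z)"
      by (simp add: det3_expand algebra_simps)
    also have "\<dots> = (u z * h i 1 z + v z * h i 2 z) * det3 (pd 1 F z) (pd 2 F z) (\<xi> z)"
      unfolding hh by (simp add: algebra_simps)
    finally have "- d z * det3 (X z) (Y z) (pd i (\<lambda>z. u z *\<^sub>R pd 1 F z + v z *\<^sub>R pd 2 F z) z)
      = - d z * ((u z * h i 1 z + v z * h i 2 z) * det3 (X z) (Y z) (\<xi> z))"
      unfolding detc[OF z, symmetric] by (simp only: mult_ac)
    then show ?thesis unfolding R_def using detnz[OF z] dnz[OF zS] by simp
  qed
  have R1: "R X i z = \<omega> i z" if z: "z \<in> T" for i z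
  proof -
    have zS: "z \<in> S" using z TS by auto
    have "R X i z = - e z * h i 1 z + h 1 1 z * h i 2 z"
      unfolding X_def by (rule Rc[OF z]) (intro smooth_intros oT sT)+
    moreover have "h 2 1 z = e z + d z" using hsym[OF zS] B[of z] by simp
    ultimately show ?thesis using AC'[OF zS] exhaust_2[of i] by (auto simp: \<omega>_def B algebra_simps)
  qed
  have R2: "R Y i z = \<theta> i z" if z: "z \<in> T" for i z
  proof -
    have zS: "z \<in> S" using z TS by auto
    have "R Y i z = (h 2 2 z * k z) * h i 1 z + (- e z * k z) * h i 2 z"
      unfolding Y_def by (rule Rc[OF z]) (intro smooth_intros oT sT sk)+
    also have "\<dots> = k z * (h 2 2 z * h i 1 z - e z * h i 2 z)" by (simp add: algebra_simps)
    also have "h 2 2 z * h i 1 z - e z * h i 2 z = (if i = 1 then e z * d z else h 2 2 z * d z)"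
    proof -
      have "h 2 1 z = e z + d z" using hsym[OF zS] B[of z] by simp
      then show ?thesis using AC'[OF zS] exhaust_2[of i] by (auto simp: B algebra_simps)
    qed
    also have "k z * (if i = 1 then e z * d z else h 2 2 z * d z) = \<theta> i z"
      using enz[OF z] dnz[OF zS] by (simp add: k_def \<theta>_def field_simps)
    finally show ?thesis .
  qed
  have tr: "Q Y i z = - P X i z" if z: "z \<in> T" for i z
  proof -
    define \<Delta> where "\<Delta> = (\<lambda>z. det3 (X z) (Y z) (\<xi> z))"
    have s\<Delta>: "smooth_on T \<Delta>" unfolding \<Delta>_def by (intro smooth_intros oT sX sY sT)
    have "\<Delta> z * \<Delta> z = 1" if "z \<in> T" for z
      using det1[OF that] by (metis \<Delta>_def abs_mult_self mult.right_neutral)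
    then have "pd i (\<lambda>z. \<Delta> z * \<Delta> z) z = pd i (\<lambda>z. 1) z" by (intro pd_cong[OF oT z])
    then have "2 * \<Delta> z * pd i \<Delta> z = 0" using pd_mult[OF dif[OF s\<Delta> z] dif[OF s\<Delta> z], of i] by simp
    then have "pd i \<Delta> z = 0" using detnz[OF z] by (simp add: \<Delta>_def)
    moreover have "pd i \<Delta> z = det3 (pd i X z) (Y z) (\<xi> z) + det3 (X z) (pd i Y z) (\<xi> z) + det3 (X z) (Y z) (pd i \<xi> z)"
      unfolding \<Delta>_def by (rule pd_det3) (intro dif z sX sY sT)+
    moreover have "det3 (X z) (Y z) (pd i \<xi> z) = 0"
    proof -
      have "z \<in> S" using z TS by auto
      then show ?thesis unfolding dxi[OF \<open>z \<in> S\<close>] dFT[OF z] by (simp add: det3_expand algebra_simps)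
    qed
    ultimately have "det3 (X z) (pd i Y z) (\<xi> z) = - det3 (pd i X z) (Y z) (\<xi> z)" by simp
    then show ?thesis unfolding P_def Q_def by simp
  qed
  have dd: "pd i (pd j F) z = (pd i (\<theta> j) z + \<theta> j z * P X i z + \<omega> j z * P Y i z) *\<^sub>R X z
      + (pd i (\<omega> j) z + \<theta> j z * Q X i z + \<omega> j z * Q Y i z) *\<^sub>R Y z + (\<theta> j z * R X i z + \<omega> j z * R Y i z) *\<^sub>R \<xi> z" if z: "z \<in> T" for i j z
  proof -
    have "pd i (pd j F) z = pd i (\<lambda>z. \<theta> j z *\<^sub>R X z + \<omega> j z *\<^sub>R Y z) z" by (rule pd_cong[OF oT z dFT])
    also have "\<dots> = (\<theta> j z *\<^sub>R pd i X z + pd i (\<theta> j) z *\<^sub>R X z) + (\<omega> j z *\<^sub>R pd i Y z + pd i (\<omega> j) z *\<^sub>R Y z)"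
      by (simp add: pd_add pd_scaleR dif[OF _ z] sth som sX sY differentiable_scaleR)
    finally show ?thesis unfolding dZ[OF z, of i X] dZ[OF z, of i Y] by (simp add: algebra_simps)
  qed
  have dd3: "(pd i (R Z j) z + P Z j z * R X i z + Q Z j z * R Y i z) = det3 (X z) (Y z) (pd i (pd j Z) z) / det3 (X z) (Y z) (\<xi> z)"
    if z: "z \<in> T" and sZ: "smooth_on T Z" for Z i j z
  proof -
    have sR: "smooth_on T (R Z j)" unfolding R_def by (intro smooth_intros oT sX sY sT sZ detnz)
    have "pd i (pd j Z) z = pd i (\<lambda>z. P Z j z *\<^sub>R X z + Q Z j z *\<^sub>R Y z + R Z j z *\<^sub>R \<xi> z) z" by (rule pd_cong[OF oT z dZ])
    also have "\<dots> = ((P Z j z *\<^sub>R pd i X z + pd i (P Z j) z *\<^sub>R X z) + (Q Z j z *\<^sub>R pd i Y z + pd i (Q Z j) z *\<^sub>R Y z)) + (R Z j z *\<^sub>R pd i \<xi> z + pd i (R Z j) z *\<^sub>R \<xi> z)"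
      by (simp add: pd_add pd_scaleR dif[OF _ z] sPQ[OF sZ] sR sX sY sT differentiable_scaleR differentiable_add)
    finally have *: "pd i (pd j Z) z = \<dots>" .
    have "pd i \<xi> z = (- H * \<theta> i z) *\<^sub>R X z + (- H * \<omega> i z) *\<^sub>R Y z"
      using z TS by (subst dxi) (auto simp: dFT[OF z] algebra_simps)
    note ** = this
    have "pd i (pd j Z) z = (P Z j z * P X i z + pd i (P Z j) z + Q Z j z * P Y i z - R Z j z * (H * \<theta> i z)) *\<^sub>R X z
       + (P Z j z * Q X i z + Q Z j z * Q Y i z + pd i (Q Z j) z - R Z j z * (H * \<omega> i z)) *\<^sub>R Y z
       + (pd i (R Z j) z + P Z j z * R X i z + Q Z j z * R Y i z) *\<^sub>R \<xi> z"
      unfolding * ** dZ[OF z, of i X] dZ[OF z, of i Y] by (simp add: algebra_simps)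
    then show ?thesis using det3_coeffs(3) detnz[OF z] by simp
  qed
  have QX: "Q X 1 z * \<theta> 2 z = Q X 2 z * \<theta> 1 z" and PY: "P Y 1 z * \<omega> 2 z = P Y 2 z * \<omega> 1 z" if z: "z \<in> T" for z
  proof -
    have zS: "z \<in> S" using z TS by auto
    have "pd 1 (pd 2 F) z = pd 2 (pd 1 F) z" by (rule pd_commute[OF S(2,1) zS])
    note i = det3_independent[OF detnz[OF z] this[unfolded dd[OF z]]]
    have c: "pd 1 (R Z 2) z + P Z 2 z * \<omega> 1 z + Q Z 2 z * \<theta> 1 z = pd 2 (R Z 1) z + P Z 1 z * \<omega> 2 z + Q Z 1 z * \<theta> 2 z" if "smooth_on T Z" for Z
      using dd3[OF z that, of 2 1] dd3[OF z that, of 1 2] pd_commute[OF that oT z, of 1 2] R1[OF z] R2[OF z] by simp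
    have "pd i (R X j) z = pd i (\<omega> j) z" "pd i (R Y j) z = pd i (\<theta> j) z" for i j
      using pd_cong[OF oT z, of "R X j" "\<omega> j"] pd_cong[OF oT z, of "R Y j" "\<theta> j"] R1 R2 by auto
    then have cX: "pd 1 (\<omega> 2) z + P X 2 z * \<omega> 1 z + Q X 2 z * \<theta> 1 z = pd 2 (\<omega> 1) z + P X 1 z * \<omega> 2 z + Q X 1 z * \<theta> 2 z"
      and cY: "pd 1 (\<theta> 2) z + P Y 2 z * \<omega> 1 z + Q Y 2 z * \<theta> 1 z = pd 2 (\<theta> 1) z + P Y 1 z * \<omega> 2 z + Q Y 1 z * \<theta> 2 z"
      using c[OF sX] c[OF sY] by auto
    show "Q X 1 z * \<theta> 2 z = Q X 2 z * \<theta> 1 z" using i cX tr[OF z, of 1] tr[OF z, of 2] by (simp add: algebra_simps)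
    show "P Y 1 z * \<omega> 2 z = P Y 2 z * \<omega> 1 z" using i cY tr[OF z, of 1] tr[OF z, of 2] by (simp add: algebra_simps)
  qed
  define a where "a = (\<lambda>z. - Q X 1 z * e z + Q X 2 z * h 1 1 z)"
  define b where "b = (\<lambda>z. P Y 1 z * (h 2 2 z * k z) - P Y 2 z * (e z * k z))"
  have "null_frame H T F \<xi> X Y \<theta> \<omega> (P X) a b"
  proof
    show "smooth_on T a" "smooth_on T b" unfolding a_def b_def by (intro smooth_intros oT sT sk sPQ sX sY)+
    fix z i assume z: "z \<in> T"
    have zS: "z \<in> S" using z TS by auto
    note nz = enz[OF z] dnz[OF zS]
    have u1: "- (\<theta> 1 z * e z) + \<theta> 2 z * h 1 1 z = 1"
    proof -
      have "- (\<theta> 1 z * e z) + \<theta> 2 z * h 1 1 z = - (e z / (2 * d z)) + (h 1 1 z * h 2 2 z) / (2 * e z * d z)" by (simp add: \<theta>_def)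
      then show ?thesis unfolding AC'[OF zS] using nz by (simp add: field_simps)
    qed
    have u2: "\<omega> 1 z * (h 2 2 z * k z) - \<omega> 2 z * (e z * k z) = 1"
    proof -
      have "\<omega> 1 z * (h 2 2 z * k z) - \<omega> 2 z * (e z * k z) = (h 1 1 z * h 2 2 z - e z * e z) * d z * k z" by (simp add: \<omega>_def algebra_simps)
      then show ?thesis unfolding AC'[OF zS] using nz by (simp add: k_def field_simps)
    qed
    have "a z * \<theta> 1 z = Q X 1 z * (- (\<theta> 1 z * e z) + \<theta> 2 z * h 1 1 z)" "a z * \<theta> 2 z = Q X 2 z * (- (\<theta> 1 z * e z) + \<theta> 2 z * h 1 1 z)"
      unfolding a_def using QX[OF z] by algebra+
    then have aQ: "Q X i z = a z * \<theta> i z" using exhaust_2[of i] u1 by auto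
    have "b z * \<omega> 1 z = P Y 1 z * (\<omega> 1 z * (h 2 2 z * k z) - \<omega> 2 z * (e z * k z))" "b z * \<omega> 2 z = P Y 2 z * (\<omega> 1 z * (h 2 2 z * k z) - \<omega> 2 z * (e z * k z))"
      unfolding b_def using PY[OF z] by algebra+
    then have bP: "P Y i z = b z * \<omega> i z" using exhaust_2[of i] u2 by auto
    show "pd i X z = P X i z *\<^sub>R X z + (a z * \<theta> i z) *\<^sub>R Y z + \<omega> i z *\<^sub>R \<xi> z"
      using dZ[OF z, of i X] aQ R1[OF z] by simp
    show "pd i Y z = (b z * \<omega> i z) *\<^sub>R X z + - P X i z *\<^sub>R Y z + \<theta> i z *\<^sub>R \<xi> z"
      using dZ[OF z, of i Y] bP R2[OF z] tr[OF z] by simp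
    show "pd i \<xi> z = - (H * \<theta> i z) *\<^sub>R X z + - (H * \<omega> i z) *\<^sub>R Y z"
      unfolding dxi[OF zS] dFT[OF z] by (simp add: algebra_simps)
  qed (use oT sT sX sY sth som sPQ dFT det1 cof dnz TS in auto)
  then show ?thesis using z0T TS by blast
qed

subsection \<open>Isothermal coordinates: the first model\<close>

lemma in_chart_std: "x \<in> \<Omega> \<Longrightarrow> in_chart (\<Omega>, \<lambda>x. x) f x = f x"
  using inv_into_f_f[of "\<lambda>x. x" \<Omega> x] by (simp add: in_chart_def)

lemma second_countable_euclidean: "second_countable (euclidean :: 'a::second_countable_topology topology)"
proof -
  obtain \<B> :: "'a set set" where \<B>: "countable \<B>" "\<And>C. C \<in> \<B> \<Longrightarrow> open C" "\<And>S. open S \<Longrightarrow> \<exists>U. U \<subseteq> \<B> \<and> S = \<Union>U"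
    by (rule univ_second_countable) blast+
  have "\<exists>V\<in>\<B>. x \<in> V \<and> V \<subseteq> U" if "open U" "x \<in> U" for U and x :: 'a
    using \<B>(3)[OF that(1)] that(2) by blast
  then show ?thesis
    unfolding second_countable_def using \<B>(1,2) by (intro exI[of _ \<B>]) simp
qed

lemma smooth_surface_std:
  assumes "open \<Omega>"
  shows "smooth_surface (top_of_set \<Omega>) (std_atlas \<Omega>)"
proof -
  have "homeomorphic_map (top_of_set \<Omega>) (top_of_set \<Omega>) (\<lambda>x. x)" by (simp add: homeomorphic_map_id[unfolded id_def])
  moreover have "smooth_on \<Omega> (in_chart (\<Omega>, \<lambda>x. x) (\<lambda>x. x))"
    using smooth_on_cong[OF assms, of "in_chart (\<Omega>, \<lambda>x. x) (\<lambda>x. x)" "\<lambda>x. x"] by (simp add: in_chart_std smooth_on_ident)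
  moreover have "second_countable (top_of_set \<Omega>)"
    by (simp add: second_countable_euclidean second_countable_subtopology)
  ultimately show ?thesis using assms
    by (simp add: smooth_surface_def std_atlas_def chart_on_def chart_compatible_def Hausdorff_space_subtopology subtopology_subtopology)
qed

text \<open>Since \<open>b\<close> is constant, its Codazzi equation and the structure equation of \<open>\<theta>\<close> determine the
  connection form.\<close>

lemma isothermal_connection:
  assumes nf: "null_frame H \<Omega> F \<xi> X Y \<theta> \<omega> p a b" and \<alpha>: "\<alpha> \<in> {-1, 1 :: real}" and u: "smooth_on \<Omega> u"
    and \<theta>: "\<And>i z. z \<in> \<Omega> \<Longrightarrow> \<theta> i z = \<alpha> / 2 * exp (- 2 * u z)"
    and \<omega>: "\<And>z. z \<in> \<Omega> \<Longrightarrow> \<omega> 1 z = 1" "\<And>z. z \<in> \<Omega> \<Longrightarrow> \<omega> 2 z = - 1"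
    and b: "\<And>z. z \<in> \<Omega> \<Longrightarrow> b z = \<alpha> / 2" and x: "x \<in> \<Omega>"
  shows "pd i (\<theta> j) x = - \<alpha> * pd i u x / exp (2 * u x)" "pd i (\<omega> j) x = 0" "p 2 x = - p 1 x" "p 1 x = pd 1 u x - pd 2 u x"
proof -
  interpret null_frame H \<Omega> F \<xi> X Y \<theta> \<omega> p a b by fact
  define E where "E = exp (2 * u x)"
  have E: "E > 0" "exp (- 2 * u x) = 1 / E"
    by (simp_all add: E_def exp_minus inverse_eq_divide)
  have \<alpha>2: "\<alpha> * \<alpha> = 1" "\<alpha> \<noteq> 0" using \<alpha> by auto
  note vals = \<theta>[OF x] \<omega>[OF x] b[OF x]
  have du: "u differentiable (at x)" by (rule smooth_on_differentiable[OF u x])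
  have du2: "(\<lambda>z. - (2 * u z)) differentiable (at x)"
    using du by (intro differentiable_minus differentiable_mult differentiable_const)
  have d\<theta>: "pd i (\<theta> j) x = - \<alpha> * pd i u x / E" for i j
  proof -
    have "pd i (\<theta> j) x = pd i (\<lambda>z. \<alpha> / 2 * exp (- (2 * u z))) x"
      by (rule pd_cong[OF open_S x]) (simp add: \<theta>)
    also have "\<dots> = \<alpha> / 2 * pd i (\<lambda>z. exp (- (2 * u z))) x"
      using pd_linear[OF bounded_linear_mult_right, of "\<lambda>z. exp (- (2 * u z))" x i "\<alpha> / 2"]
        differentiable_compose[of exp "\<lambda>z. - (2 * u z)" x UNIV] du2
      by (simp add: field_differentiable_imp_differentiable field_differentiable_within_exp)
    also have "pd i (\<lambda>z. exp (- (2 * u z))) x = exp (- (2 * u x)) * (- (2 * pd i u x))"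
      using pd_exp[OF du2, of i] pd_uminus[of "\<lambda>z. 2 * u z" x i] pd_linear[OF bounded_linear_mult_right du, of i 2] du
      by (simp add: differentiable_mult)
    finally show ?thesis using E by simp
  qed
  have d\<omega>: "pd i (\<omega> j) x = 0" for i j
  proof -
    have "pd i (\<omega> j) x = pd i (\<lambda>z. if j = 1 then 1 else - 1) x"
      by (rule pd_cong[OF open_S x]) (use exhaust_2[of j] \<omega> in auto)
    then show ?thesis by simp
  qed
  have db: "pd i b x = 0" for i
  proof -
    have "pd i b x = pd i (\<lambda>z. \<alpha> / 2) x" by (rule pd_cong[OF open_S x]) (simp add: b)
    then show ?thesis by simp
  qed
  have p2: "p 2 x = - p 1 x" using codazzi_b[OF x] \<alpha>2 by (simp add: db vals)
  have p1: "p 1 x = pd 1 u x - pd 2 u x"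
  proof -
    have "E * (\<alpha> * (pd 1 u x - pd 2 u x)) = E * (\<alpha> * p 1 x)"
      using curl_theta[OF x] E(1) unfolding d\<theta> vals E(2) p2 by (simp add: field_simps)
    then show ?thesis using \<alpha>2(2) E(1) by simp
  qed
  show "pd i (\<theta> j) x = - \<alpha> * pd i u x / exp (2 * u x)" "pd i (\<omega> j) x = 0" "p 2 x = - p 1 x" "p 1 x = pd 1 u x - pd 2 u x"
    using d\<theta> d\<omega> p1 p2 by (simp_all add: E_def)
qed

text \<open>The Gauss equation for a frame of the special form that isothermal coordinates provide.\<close>

lemma isothermal_wave_equation:
  assumes nf: "null_frame H \<Omega> F \<xi> X Y \<theta> \<omega> p a b" and \<alpha>: "\<alpha> \<in> {-1, 1 :: real}" and u: "smooth_on \<Omega> u"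
    and \<theta>: "\<And>i z. z \<in> \<Omega> \<Longrightarrow> \<theta> i z = \<alpha> / 2 * exp (- 2 * u z)"
    and \<omega>: "\<And>z. z \<in> \<Omega> \<Longrightarrow> \<omega> 1 z = 1" "\<And>z. z \<in> \<Omega> \<Longrightarrow> \<omega> 2 z = - 1"
    and a: "\<And>z. z \<in> \<Omega> \<Longrightarrow> a z = 4 * exp (6 * u z)" and b: "\<And>z. z \<in> \<Omega> \<Longrightarrow> b z = \<alpha> / 2" and x: "x \<in> \<Omega>"
  shows "wave_op u x = exp (- 2 * u x) * (\<alpha> * H + 2 * exp (6 * u x))"
proof -
  interpret null_frame H \<Omega> F \<xi> X Y \<theta> \<omega> p a b by fact
  note con = isothermal_connection[OF nf \<alpha> u \<theta> \<omega> b]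
  have \<alpha>2: "\<alpha> * \<alpha> = 1" using \<alpha> by auto
  have d: "pd i u differentiable (at x)" for i using smooth_on_differentiable[OF smooth_on_pd[OF u] x] .
  have "pd 1 (p 2) x = pd 1 (\<lambda>z. - (pd 1 u z - pd 2 u z)) x" "pd 2 (p 1) x = pd 2 (\<lambda>z. pd 1 u z - pd 2 u z) x"
    by (rule pd_cong[OF open_S x], simp add: con(3,4))+
  then have "pd 1 (p 2) x - pd 2 (p 1) x = - wave_op u x"
    using pd_commute[OF u open_S x, of 1 2]
    by (simp add: wave_op_def pd_diff pd_uminus d differentiable_diff)
  then have "wave_op u x = - ((H + a x * b x) * (\<theta> 1 x * \<omega> 2 x - \<theta> 2 x * \<omega> 1 x))"
    using curl_p[OF x] by simp
  also have "\<dots> = exp (- 2 * u x) * (\<alpha> * H + 2 * exp (6 * u x))"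
    using \<alpha>2 unfolding \<theta>[OF x] \<omega>[OF x] a[OF x] b[OF x] by (simp add: algebra_simps)
  finally show ?thesis .
qed

text \<open>The dual frame is $X = \alpha e^{2u}(\partial_1 + \partial_2)$, $Y = \frac12(\partial_1 - \partial_2)$; all tensors
  of the model are evaluations of the general formulas for null frames.\<close>

lemma sphere_of_null_frame:
  assumes nf: "null_frame H \<Omega> F \<xi> X Y \<theta> \<omega> p a b" and \<alpha>: "\<alpha> \<in> {-1, 1 :: real}" and u: "smooth_on \<Omega> u"
    and \<theta>: "\<And>i z. z \<in> \<Omega> \<Longrightarrow> \<theta> i z = \<alpha> / 2 * exp (- 2 * u z)"
    and \<omega>: "\<And>z. z \<in> \<Omega> \<Longrightarrow> \<omega> 1 z = 1" "\<And>z. z \<in> \<Omega> \<Longrightarrow> \<omega> 2 z = - 1"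
    and a: "\<And>z. z \<in> \<Omega> \<Longrightarrow> a z = 4 * exp (6 * u z)" and b: "\<And>z. z \<in> \<Omega> \<Longrightarrow> b z = \<alpha> / 2"
  shows "sphere_of H \<alpha> \<Omega> u F \<xi>"
proof -
  interpret null_frame H \<Omega> F \<xi> X Y \<theta> \<omega> p a b by fact
  have nf': "null_frame H \<Omega> (in_chart (\<Omega>, \<lambda>x. x) F) (in_chart (\<Omega>, \<lambda>x. x) \<xi>) X Y \<theta> \<omega> p a b"
    by (rule null_frame_cong[OF nf]) (simp_all add: in_chart_std)
  interpret c: null_frame H \<Omega> "in_chart (\<Omega>, \<lambda>x. x) F" "in_chart (\<Omega>, \<lambda>x. x) \<xi>" X Y \<theta> \<omega> p a b by fact
  have "affine_sphere H (top_of_set \<Omega>) (std_atlas \<Omega>) F \<xi>"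
    using smooth_surface_std[OF open_S] c.smooth_F c.smooth_xi c.blaschke c.mean_curv_eq c.shape_eq
    by (simp add: affine_sphere_def blaschke_surface_def std_atlas_def)
  moreover have "indefinite_surface (std_atlas \<Omega>) F \<xi>"
    using c.indefinite by (simp add: indefinite_surface_def std_atlas_def)
  moreover have "let E = exp (2 * u x); u1 = pd 1 u x; u2 = pd 2 u x in
        cubic_norm F \<xi> x = 16 * \<alpha> * exp (6 * u x) \<and>
        aff_metric F \<xi> x =
          vector [vector [\<alpha> * exp (- 2 * u x), 0], vector [0, - (\<alpha> * exp (- 2 * u x))]] \<and>
        diff_tensor F \<xi> 1 1 x = vector [E, 0] \<and>
        diff_tensor F \<xi> 2 2 x = vector [E, 0] \<and>
        diff_tensor F \<xi> 1 2 x = vector [0, - E] \<and>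
        aff_conn F \<xi> 1 1 x = vector [- u1 + E, - u2] \<and>
        aff_conn F \<xi> 1 2 x = vector [- u2, - (u1 + E)] \<and>
        aff_conn F \<xi> 2 2 x = vector [- u1 + E, - u2]" if x: "x \<in> \<Omega>" for x
  proof -
    define E where "E = exp (2 * u x)"
    have E: "E > 0" "exp (- 2 * u x) = 1 / E" "exp (6 * u x) = E ^ 3"
      by (simp_all add: E_def exp_minus inverse_eq_divide exp_of_nat_mult[symmetric])
    have \<alpha>2: "\<alpha> * \<alpha> = 1" "\<alpha> \<noteq> 0" using \<alpha> by auto
    note vals = \<theta>[OF x] \<omega>[OF x] a[OF x] b[OF x]
    have d\<theta>: "pd i (\<theta> j) x = - \<alpha> * pd i u x / E" and d\<omega>: "pd i (\<omega> j) x = 0"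
      and p2: "p 2 x = - p 1 x" and p1: "p 1 x = pd 1 u x - pd 2 u x" for i j
      unfolding E_def by (rule isothermal_connection[OF nf \<alpha> u \<theta> \<omega> b x]; assumption)+
    have Dx: "D x = - \<alpha> / E" using E by (simp add: D_def vals)
    have eX: "eX x = vector [\<alpha> * E, \<alpha> * E]" and eY: "eY x = vector [1 / 2, - 1 / 2]"
      using E \<alpha>2 by (auto simp: eX_def eY_def Dx vals vec_eq_iff forall_2 field_simps)
    have "cubic_norm F \<xi> x = 16 * \<alpha> * exp (6 * u x)" by (simp add: cubic_norm_eq[OF x] vals)
    moreover have "aff_metric F \<xi> x = vector [vector [\<alpha> * exp (- 2 * u x), 0], vector [0, - (\<alpha> * exp (- 2 * u x))]]"
      by (simp add: vec_eq_iff forall_2 metric_eq[OF x] vals)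
    moreover have "diff_tensor F \<xi> 1 1 x = vector [E, 0]" "diff_tensor F \<xi> 2 2 x = vector [E, 0]" "diff_tensor F \<xi> 1 2 x = vector [0, - E]"
      unfolding diff_tensor_eq[OF x] vals eX eY E(2,3)
      using E(1) \<alpha>2 by (simp_all add: vec_eq_iff forall_2 field_simps power3_eq_cube)
    moreover have "aff_conn F \<xi> 1 1 x = vector [- pd 1 u x + E, - pd 2 u x]" "aff_conn F \<xi> 1 2 x = vector [- pd 2 u x, - (pd 1 u x + E)]"
        "aff_conn F \<xi> 2 2 x = vector [- pd 1 u x + E, - pd 2 u x]"
      unfolding conn_eq[OF x] d\<theta> d\<omega> vals eX eY E(2,3) p2 p1
      using E(1) \<alpha> by (auto simp: vec_eq_iff forall_2 field_simps power3_eq_cube)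
    ultimately show ?thesis by (simp add: E_def[symmetric])
  qed
  ultimately show ?thesis by (simp add: sphere_of_def)
qed

text \<open>Read off the forms from the coordinates: every integrability condition except the Gauss equation holds
  identically in \<open>u\<close>, and the Gauss equation is the given wave equation.\<close>

lemma sphere_of_exists:
  assumes \<alpha>: "\<alpha> \<in> {-1, 1 :: real}" and \<Omega>: "open \<Omega>" "simply_connected \<Omega>" and u: "smooth_on \<Omega> u"
    and pde: "\<And>x. x \<in> \<Omega> \<Longrightarrow> wave_op u x = exp (- 2 * u x) * (\<alpha> * H + 2 * exp (6 * u x))"
  shows "\<exists>f \<xi>. sphere_of H \<alpha> \<Omega> u f \<xi>"
proof -
  define \<theta> where "\<theta> = (\<lambda>(i::2) z. \<alpha> / 2 * exp (- 2 * u z))"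
  define \<omega> where "\<omega> = (\<lambda>(i::2) (z::real^2). if i = 1 then 1 else - 1 :: real)"
  define p where "p = (\<lambda>(i::2) z. if i = 1 then pd 1 u z - pd 2 u z else - (pd 1 u z - pd 2 u z))"
  define a where "a = (\<lambda>z. 4 * exp (6 * u z))"
  have \<alpha>2: "\<alpha> * \<alpha> = 1" using \<alpha> by auto
  have du: "u differentiable (at z)" "pd i u differentiable (at z)" if "z \<in> \<Omega>" for z i
    using smooth_on_differentiable[OF u that] smooth_on_differentiable[OF smooth_on_pd[OF u] that] by auto
  have dexp: "pd i (\<lambda>z. c * exp (k * u z)) z = c * (exp (k * u z) * (k * pd i u z))" if z: "z \<in> \<Omega>" for i z and c k :: real
  proof -
    have s: "smooth_on \<Omega> (\<lambda>z. k * u z)" "smooth_on \<Omega> (\<lambda>z. exp (k * u z))" by (intro smooth_intros \<Omega> u)+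
    show ?thesis
      using pd_linear[OF bounded_linear_mult_right smooth_on_differentiable[OF s(2) z], of i c]
        pd_exp[OF smooth_on_differentiable[OF s(1) z], of i] pd_linear[OF bounded_linear_mult_right du(1)[OF z], of i k] by simp
  qed
  have "\<exists>F \<xi> X Y. null_frame H \<Omega> F \<xi> X Y \<theta> \<omega> p a (\<lambda>z. \<alpha> / 2)"
  proof (rule null_frame_from_forms[OF \<Omega>])
    show "smooth_on \<Omega> (\<theta> i)" "smooth_on \<Omega> (\<omega> i)" "smooth_on \<Omega> (p i)" "smooth_on \<Omega> a" "smooth_on \<Omega> (\<lambda>z. \<alpha> / 2)" for i
      unfolding \<theta>_def \<omega>_def p_def a_def by (intro smooth_on_if smooth_intros \<Omega> u)+
    fix z assume z: "z \<in> \<Omega>"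
    show "pd 1 (\<theta> 2) z - pd 2 (\<theta> 1) z = p 2 z * \<theta> 1 z - p 1 z * \<theta> 2 z"
      unfolding \<theta>_def p_def dexp[OF z] by (simp add: field_simps)
    show "pd 1 (\<omega> 2) z - pd 2 (\<omega> 1) z = p 1 z * \<omega> 2 z - p 2 z * \<omega> 1 z"
      by (simp add: \<omega>_def p_def)
    have "pd 1 (p 2) z - pd 2 (p 1) z = - wave_op u z"
      using pd_commute[OF u \<Omega>(1) z, of 1 2] z
      by (simp add: p_def wave_op_def pd_diff pd_uminus du differentiable_diff)
    also have "\<dots> = (H + a z * (\<alpha> / 2)) * (\<theta> 1 z * \<omega> 2 z - \<theta> 2 z * \<omega> 1 z)"
      unfolding pde[OF z] \<theta>_def \<omega>_def a_def using \<alpha>2 by (simp add: algebra_simps)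
    finally show "pd 1 (p 2) z - pd 2 (p 1) z = (H + a z * (\<alpha> / 2)) * (\<theta> 1 z * \<omega> 2 z - \<theta> 2 z * \<omega> 1 z)" .
    show "pd 1 a z * \<theta> 2 z - pd 2 a z * \<theta> 1 z = 3 * a z * (p 1 z * \<theta> 2 z - p 2 z * \<theta> 1 z)"
      unfolding a_def dexp[OF z] by (simp add: \<theta>_def p_def field_simps)
    show "pd 1 (\<lambda>z. \<alpha> / 2) z * \<omega> 2 z - pd 2 (\<lambda>z. \<alpha> / 2) z * \<omega> 1 z = - 3 * (\<alpha> / 2) * (p 1 z * \<omega> 2 z - p 2 z * \<omega> 1 z)"
      by (simp add: \<omega>_def p_def)
    show "\<theta> 1 z * \<omega> 2 z - \<theta> 2 z * \<omega> 1 z \<noteq> 0" using \<alpha> by (auto simp: \<theta>_def \<omega>_def)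
  qed
  then obtain F \<xi> X Y where "null_frame H \<Omega> F \<xi> X Y \<theta> \<omega> p a (\<lambda>z. \<alpha> / 2)" by blast
  then have "sphere_of H \<alpha> \<Omega> u F \<xi>"
    by (rule sphere_of_null_frame[OF _ \<alpha> u]) (simp_all add: \<theta>_def \<omega>_def a_def)
  then show ?thesis by blast
qed

section \<open>Charts\<close>

lemma chart_inj: "chart_on M c \<Longrightarrow> inj_on (snd c) (fst c)"
  unfolding chart_on_def using homeomorphic_imp_injective_map openin_subset by (metis topspace_subtopology_subset)

lemma in_chart_apply: "chart_on M c \<Longrightarrow> p \<in> fst c \<Longrightarrow> in_chart c f (snd c p) = f p"
  using chart_inj[of M c] by (simp add: in_chart_def)

lemma chart_subset: "chart_on M c \<Longrightarrow> fst c \<subseteq> topspace M"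
  unfolding chart_on_def using openin_subset by blast

lemma chart_open_image:
  assumes "chart_on M c" "openin M U"
  shows "open (snd c ` (fst c \<inter> U))"
proof -
  have om: "open_map (subtopology M (fst c)) (top_of_set (snd c ` fst c)) (snd c)"
    using assms homeomorphic_imp_open_map by (auto simp: chart_on_def)
  have "openin (subtopology M (fst c)) (fst c \<inter> U)" using assms(2) openin_subtopology_Int2 by blast
  then have "openin (top_of_set (snd c ` fst c)) (snd c ` (fst c \<inter> U))" using om by (simp add: open_map_def)
  then show ?thesis using assms(1) openin_open_eq by (auto simp: chart_on_def)
qed

lemma chart_open_preimage:
  assumes "chart_on M c" "open T"
  shows "openin M (fst c \<inter> snd c -` T)"
proof -
  have cm: "continuous_map (subtopology M (fst c)) (top_of_set (snd c ` fst c)) (snd c)"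
    using assms homeomorphic_imp_continuous_map by (auto simp: chart_on_def)
  have "openin (top_of_set (snd c ` fst c)) (snd c ` fst c \<inter> T)" using assms(2) by blast
  from openin_continuous_map_preimage[OF cm this]
  have "openin (subtopology M (fst c)) {x \<in> topspace (subtopology M (fst c)). snd c x \<in> snd c ` fst c \<inter> T}" .
  moreover have "{x \<in> topspace (subtopology M (fst c)). snd c x \<in> snd c ` fst c \<inter> T} = fst c \<inter> snd c -` T"
    using chart_subset[OF assms(1)] by auto
  ultimately show ?thesis using assms(1) openin_trans_full by (metis chart_on_def)
qed

lemma chart_on_restrict:
  assumes "chart_on M c" "openin M U"
  shows "chart_on M (fst c \<inter> U, snd c)"
proof -
  have hm: "homeomorphic_map (subtopology M (fst c)) (top_of_set (snd c ` fst c)) (snd c)"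
    using assms by (simp add: chart_on_def)
  have "homeomorphic_map (subtopology (subtopology M (fst c)) (fst c \<inter> U)) (subtopology (top_of_set (snd c ` fst c)) (snd c ` (fst c \<inter> U))) (snd c)"
    by (rule homeomorphic_map_subtopologies[OF hm]) (use chart_subset[OF assms(1)] in auto)
  moreover have "fst c \<inter> (fst c \<inter> U) = fst c \<inter> U" "snd c ` fst c \<inter> snd c ` (fst c \<inter> U) = snd c ` (fst c \<inter> U)" by auto
  ultimately have "homeomorphic_map (subtopology M (fst c \<inter> U)) (top_of_set (snd c ` (fst c \<inter> U))) (snd c)"
    by (simp add: subtopology_subtopology)
  then show ?thesis using assms chart_open_image[OF assms] by (auto simp: chart_on_def)
qed

lemma in_chart_restrict:
  assumes "chart_on M c" "openin M U" "x \<in> snd c ` (fst c \<inter> U)"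
  shows "in_chart (fst c \<inter> U, snd c) f x = in_chart c f x"
  using assms in_chart_apply[OF assms(1), where f = f] in_chart_apply[OF chart_on_restrict[OF assms(1,2)], where f = f] by auto

lemma chart_compatible_restrict:
  assumes c: "chart_on M c" and d: "chart_on M d" and U: "openin M U" "openin M U'" and cd: "chart_compatible c d"
  shows "chart_compatible (fst c \<inter> U, snd c) (fst d \<inter> U', snd d)"
proof -
  define ZZ where "ZZ = snd c ` (fst c \<inter> U \<inter> (fst d \<inter> U'))"
  have "openin M (U \<inter> (fst d \<inter> U'))" using U d by (simp add: chart_on_def openin_Int)
  from chart_open_image[OF c this] have oO: "open ZZ" by (simp add: ZZ_def Int_assoc)
  have "smooth_on ZZ (in_chart c (snd d))"
    using cd unfolding chart_compatible_def ZZ_def by (rule smooth_on_subset) auto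
  moreover have "in_chart (fst c \<inter> U, snd c) (snd d) x = in_chart c (snd d) x" if "x \<in> ZZ" for x
    using that by (intro in_chart_restrict[OF c U(1)]) (auto simp: ZZ_def)
  ultimately have "smooth_on ZZ (in_chart (fst c \<inter> U, snd c) (snd d))"
    using smooth_on_cong[OF oO, of "in_chart (fst c \<inter> U, snd c) (snd d)" "in_chart c (snd d)"] by simp
  then show ?thesis by (simp add: chart_compatible_def ZZ_def)
qed

lemma local_chart_restrict:
  assumes s: "\<And>d. d \<in> A \<Longrightarrow> chart_on M d" and c: "local_chart M A c" and U: "openin M U"
  shows "local_chart M A (fst c \<inter> U, snd c)"
proof -
  have co: "chart_on M c" using c by (simp add: local_chart_def)
  have "chart_compatible (fst c \<inter> U, snd c) d \<and> chart_compatible d (fst c \<inter> U, snd c)" if d: "d \<in> A" for d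
  proof -
    have "fst d \<inter> topspace M = fst d" using chart_subset[OF s[OF d]] by auto
    then show ?thesis
      using chart_compatible_restrict[OF co s[OF d] U openin_topspace] chart_compatible_restrict[OF s[OF d] co openin_topspace U] c d
      by (simp add: local_chart_def)
  qed
  then show ?thesis using chart_on_restrict[OF co U] by (simp add: local_chart_def)
qed

lemma local_chart_atlas:
  "smooth_surface M A \<Longrightarrow> c \<in> A \<Longrightarrow> local_chart M A c"
  by (simp add: smooth_surface_def local_chart_def)

lemma local_chart_reparam:
  assumes s: "\<And>d. d \<in> A \<Longrightarrow> chart_on M d" and c: "local_chart M A c" and hg: "homeomorphism (snd c ` fst c) V G g"
    and V: "open V" and G: "smooth_on (snd c ` fst c) G" and g: "smooth_on V g"
  shows "local_chart M A (fst c, G \<circ> snd c)" "(G \<circ> snd c) ` fst c = V"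
    "\<And>y. y \<in> V \<Longrightarrow> in_chart (fst c, G \<circ> snd c) f y = in_chart c f (g y)"
proof -
  have co: "chart_on M c" using c by (simp add: local_chart_def)
  have im: "G ` snd c ` fst c = V" using hg by (simp add: homeomorphism_def)
  show imV: "(G \<circ> snd c) ` fst c = V" using im by (simp add: image_comp)
  have "homeomorphic_maps (top_of_set (snd c ` fst c)) (top_of_set V) G g"
    using hg by (auto simp: homeomorphic_maps_def homeomorphism_def continuous_map_in_subtopology)
  then have "homeomorphic_map (top_of_set (snd c ` fst c)) (top_of_set V) G" using homeomorphic_map_maps by blast
  then have "homeomorphic_map (subtopology M (fst c)) (top_of_set V) (G \<circ> snd c)"
    using co homeomorphic_map_compose by (auto simp: chart_on_def)
  then have co': "chart_on M (fst c, G \<circ> snd c)" using co V imV by (simp add: chart_on_def)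
  show inc: "in_chart (fst c, G \<circ> snd c) f y = in_chart c f (g y)" if "y \<in> V" for y and f :: "'a \<Rightarrow> 'z"
  proof -
    have "y \<in> (G \<circ> snd c) ` fst c" using that imV by blast
    then obtain q where q: "q \<in> fst c" "y = G (snd c q)" by auto
    have "g y = snd c q" using hg q by (simp add: homeomorphism_def)
    then show ?thesis using in_chart_apply[OF co' , of q f] in_chart_apply[OF co q(1), of f] q by simp
  qed
  have "chart_compatible (fst c, G \<circ> snd c) d \<and> chart_compatible d (fst c, G \<circ> snd c)" if d: "d \<in> A" for d
  proof
    have dop: "openin M (fst d)" "openin M (fst c)" using s[OF d] co by (auto simp: chart_on_def)
    have cd: "smooth_on (snd c ` (fst c \<inter> fst d)) (in_chart c (snd d))" "smooth_on (snd d ` (fst d \<inter> fst c)) (in_chart d (snd c))"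
      using c d by (auto simp: local_chart_def chart_compatible_def)
    define ZZ where "ZZ = (G \<circ> snd c) ` (fst c \<inter> fst d)"
    have oO: "open ZZ" using chart_open_image[OF co' dop(1)] by (simp add: ZZ_def)
    have OV: "ZZ \<subseteq> V" using imV by (auto simp: ZZ_def)
    have "smooth_on ZZ (\<lambda>y. in_chart c (snd d) (g y))"
    proof (rule smooth_on_compose[OF oO chart_open_image[OF co dop(1)] _ cd(1) smooth_on_subset[OF g OV]])
      show "g ` ZZ \<subseteq> snd c ` (fst c \<inter> fst d)" using hg by (auto simp: ZZ_def homeomorphism_def)
    qed
    then have "smooth_on ZZ (in_chart (fst c, G \<circ> snd c) (snd d))"
      using smooth_on_cong[OF oO, of "in_chart (fst c, G \<circ> snd c) (snd d)" "\<lambda>y. in_chart c (snd d) (g y)"] inc OV by blast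
    then show "chart_compatible (fst c, G \<circ> snd c) d" by (simp add: chart_compatible_def ZZ_def)
    define ZZ' where "ZZ' = snd d ` (fst d \<inter> fst c)"
    have oO': "open ZZ'" using chart_open_image[OF s[OF d] dop(2)] by (simp add: ZZ'_def)
    have "smooth_on ZZ' (\<lambda>x. G (in_chart d (snd c) x))"
    proof (rule smooth_on_compose[OF oO' _ _ G])
      show "open (snd c ` fst c)" using co by (simp add: chart_on_def)
      show "in_chart d (snd c) ` ZZ' \<subseteq> snd c ` fst c" using in_chart_apply[OF s[OF d], where f = "snd c"] by (auto simp: ZZ'_def)
    qed (use cd in \<open>simp add: ZZ'_def\<close>)
    moreover have "in_chart d (G \<circ> snd c) = (\<lambda>x. G (in_chart d (snd c) x))" by (auto simp: in_chart_def)
    ultimately show "chart_compatible d (fst c, G \<circ> snd c)" by (simp add: chart_compatible_def ZZ'_def)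
  qed
  then show "local_chart M A (fst c, G \<circ> snd c)" using co' by (simp add: local_chart_def)
qed

lemma jacobian_inverse:
  fixes \<psi> \<tau> :: "real^2 \<Rightarrow> real^2"
  assumes T: "open T" "z \<in> T" and \<psi>: "smooth_on T \<psi>" and \<tau>: "smooth_on S \<tau>" "\<psi> ` T \<subseteq> S" and inv: "\<And>z. z \<in> T \<Longrightarrow> \<tau> (\<psi> z) = z"
  shows "pd 1 \<psi> z $ 1 * pd 2 \<psi> z $ 2 - pd 1 \<psi> z $ 2 * pd 2 \<psi> z $ 1 \<noteq> 0"
proof -
  have "pd i (\<lambda>z. \<tau> (\<psi> z)) z = pd i (\<lambda>z. z) z" for i by (rule pd_cong[OF T]) (rule inv)
  moreover have "\<psi> z \<in> S" using \<tau>(2) T by auto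
  ultimately have e: "(pd i \<psi> z $ 1) *\<^sub>R pd 1 \<tau> (\<psi> z) + (pd i \<psi> z $ 2) *\<^sub>R pd 2 \<tau> (\<psi> z) = axis i 1" for i
    using pd_compose[OF smooth_on_differentiable[OF \<tau>(1)] smooth_on_differentiable[OF \<psi> T(2)], of i] by (simp add: pd_def)
  have e': "pd i \<psi> z $ 1 * pd 1 \<tau> (\<psi> z) $ j + pd i \<psi> z $ 2 * pd 2 \<tau> (\<psi> z) $ j = (if i = j then 1 else 0)" for i j
    using arg_cong[OF e[of i], of "\<lambda>v. v $ j"] by (simp add: axis_def)
  have "(pd 1 \<psi> z $ 1 * pd 2 \<psi> z $ 2 - pd 1 \<psi> z $ 2 * pd 2 \<psi> z $ 1) *
     (pd 1 \<tau> (\<psi> z) $ 1 * pd 2 \<tau> (\<psi> z) $ 2 - pd 1 \<tau> (\<psi> z) $ 2 * pd 2 \<tau> (\<psi> z) $ 1)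
    = (pd 1 \<psi> z $ 1 * pd 1 \<tau> (\<psi> z) $ 1 + pd 1 \<psi> z $ 2 * pd 2 \<tau> (\<psi> z) $ 1) * (pd 2 \<psi> z $ 1 * pd 1 \<tau> (\<psi> z) $ 2 + pd 2 \<psi> z $ 2 * pd 2 \<tau> (\<psi> z) $ 2)
     - (pd 1 \<psi> z $ 1 * pd 1 \<tau> (\<psi> z) $ 2 + pd 1 \<psi> z $ 2 * pd 2 \<tau> (\<psi> z) $ 2) * (pd 2 \<psi> z $ 1 * pd 1 \<tau> (\<psi> z) $ 1 + pd 2 \<psi> z $ 2 * pd 2 \<tau> (\<psi> z) $ 1)"
    by (simp add: algebra_simps)
  also have "\<dots> = 1" by (simp add: e')
  finally show ?thesis by auto
qed

text \<open>The diffeomorphism is the chart, so the equivalence with a model on the chart image becomes an equality of maps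
  up to an affine transformation.\<close>

lemma equiaff_equiv_chart:
  fixes f :: "'a \<Rightarrow> real^3"
  assumes s: "\<And>d. d \<in> A \<Longrightarrow> chart_on M d" and c: "local_chart M A c" and L: "det (L::real^3^3) = 1"
    and g: "\<And>y. y \<in> snd c ` fst c \<Longrightarrow> g y = L *v in_chart c f y + t"
  shows "equiaff_equiv (subtopology M (fst c)) (restrict_atlas A (fst c)) f (top_of_set (snd c ` fst c)) (std_atlas (snd c ` fst c)) g"
proof -
  have co: "chart_on M c" using c by (simp add: local_chart_def)
  define \<Omega> where "\<Omega> = snd c ` fst c"
  have o\<Omega>: "open \<Omega>" "openin M (fst c)" using co by (auto simp: chart_on_def \<Omega>_def)
  define \<psi> where "\<psi> = inv_into (fst c) (snd c)"
  have \<psi>: "\<psi> (snd c p) = p" if "p \<in> fst c" for p using chart_inj[OF co] that by (simp add: \<psi>_def)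
  have hm: "homeomorphic_map (subtopology M (fst c)) (top_of_set \<Omega>) (snd c)" using co by (simp add: chart_on_def \<Omega>_def)
  then obtain \<psi>' where \<psi>': "homeomorphic_maps (subtopology M (fst c)) (top_of_set \<Omega>) (snd c) \<psi>'" using homeomorphic_map_maps by blast
  have tops: "topspace (subtopology M (fst c)) = fst c" using chart_subset[OF co] by auto
  have "\<psi>' y = \<psi> y" if "y \<in> \<Omega>" for y
  proof -
    have "y \<in> snd c ` fst c" using that by (simp add: \<Omega>_def)
    then obtain q where "q \<in> fst c" "y = snd c q" by blast
    then show ?thesis using \<psi>' \<psi> tops unfolding homeomorphic_maps_def by metis
  qed
  then have hms: "homeomorphic_maps (subtopology M (fst c)) (top_of_set \<Omega>) (snd c) \<psi>"
    using \<psi>' by (rule_tac homeomorphic_maps_eq[OF \<psi>']) auto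
  have sm1: "smooth_map (restrict_atlas A (fst c)) (std_atlas \<Omega>) (snd c)"
    unfolding smooth_map_def restrict_atlas_def std_atlas_def
  proof clarsimp
    fix D \<phi> assume d: "(D, \<phi>) \<in> A"
    have eq: "{q. q \<in> D \<and> q \<in> fst c \<and> snd c q \<in> \<Omega>} = D \<inter> fst c" by (auto simp: \<Omega>_def)
    have o: "open (\<phi> ` (D \<inter> fst c))" using chart_open_image[OF s[OF d] o\<Omega>(2)] by simp
    have "smooth_on (\<phi> ` (D \<inter> fst c)) (in_chart (D, \<phi>) (snd c))"
      using c d by (auto simp: local_chart_def chart_compatible_def)
    moreover have "in_chart (D \<inter> fst c, \<phi>) ((\<lambda>x. x) \<circ> snd c) x = in_chart (D, \<phi>) (snd c) x" if "x \<in> \<phi> ` (D \<inter> fst c)" for x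
      using in_chart_restrict[OF s[OF d] o\<Omega>(2), of x "snd c"] that by (simp add: comp_def)
    ultimately have "smooth_on (\<phi> ` (D \<inter> fst c)) (in_chart (D \<inter> fst c, \<phi>) ((\<lambda>x. x) \<circ> snd c))"
      using smooth_on_cong[OF o, of "in_chart (D \<inter> fst c, \<phi>) ((\<lambda>x. x) \<circ> snd c)" "in_chart (D, \<phi>) (snd c)"] by blast
    then show "smooth_on (\<phi> ` {p. p \<in> D \<and> p \<in> fst c \<and> snd c p \<in> \<Omega>}) (in_chart (D \<inter> fst c, \<phi>) ((\<lambda>x. x) \<circ> snd c))"
      unfolding eq .
  qed
  have sm2: "smooth_map (std_atlas \<Omega>) (restrict_atlas A (fst c)) \<psi>"
    unfolding smooth_map_def restrict_atlas_def std_atlas_def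
  proof clarsimp
    fix D \<phi> assume d: "(D, \<phi>) \<in> A"
    have Dop: "openin M D" using s[OF d] by (simp add: chart_on_def)
    have eq: "{q \<in> \<Omega>. \<psi> q \<in> D \<and> \<psi> q \<in> fst c} = snd c ` (fst c \<inter> D)" using \<psi> by (auto simp: \<Omega>_def)
    have o: "open (snd c ` (fst c \<inter> D))" using chart_open_image[OF co Dop] .
    have "smooth_on (snd c ` (fst c \<inter> D)) (in_chart c \<phi>)"
      using c d by (auto simp: local_chart_def chart_compatible_def)
    moreover have "in_chart (\<Omega>, \<lambda>x. x) (\<phi> \<circ> \<psi>) x = in_chart c \<phi> x" if "x \<in> snd c ` (fst c \<inter> D)" for x
      using that by (subst in_chart_std) (auto simp: \<Omega>_def in_chart_def \<psi>_def)
    ultimately have "smooth_on (snd c ` (fst c \<inter> D)) (in_chart (\<Omega>, \<lambda>x. x) (\<phi> \<circ> \<psi>))"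
      using smooth_on_cong[OF o, of "in_chart (\<Omega>, \<lambda>x. x) (\<phi> \<circ> \<psi>)" "in_chart c \<phi>"] by blast
    then show "smooth_on {q \<in> \<Omega>. \<psi> q \<in> D \<and> \<psi> q \<in> fst c} (in_chart (\<Omega>, \<lambda>x. x) (\<phi> \<circ> \<psi>))"
      unfolding eq .
  qed
  have "diffeomorphism (subtopology M (fst c)) (restrict_atlas A (fst c)) (top_of_set \<Omega>) (std_atlas \<Omega>) (snd c)"
    unfolding diffeomorphism_def using hms sm1 sm2 by blast
  moreover have "\<forall>p\<in>topspace (subtopology M (fst c)). g (snd c p) = L *v f p + t"
    using g in_chart_apply[OF co, where f = f] tops by auto
  ultimately show ?thesis unfolding equiaff_equiv_def \<Omega>_def[symmetric] using L by blast
qed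

section \<open>Framed charts of an indefinite affine sphere\<close>

locale indefinite_sphere =
  fixes H :: real and M :: "'a topology" and A :: "'a chart set" and f \<xi> :: "'a \<Rightarrow> real^3"
  assumes sphere: "affine_sphere H M A f \<xi>" and indef: "indefinite_surface A f \<xi>"
begin

lemma surface: "smooth_surface M A" using sphere by (simp add: affine_sphere_def blaschke_surface_def)

lemma atlas_chart: "c \<in> A \<Longrightarrow> chart_on M c" using surface by (simp add: smooth_surface_def)

lemma atlas_cover: "p \<in> topspace M \<Longrightarrow> \<exists>c\<in>A. p \<in> fst c" using surface by (auto simp: smooth_surface_def)

text \<open>A chart of the maximal atlas that carries a null frame on its whole domain. A null frame refers to coordinates only
  through the components of its forms; the fields and the coefficients \<open>a\<close>, \<open>b\<close> are functions on the surface.\<close>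

definition framed where
  "framed c X Y \<theta> \<omega> p a b \<longleftrightarrow> local_chart M A c \<and> null_frame H (snd c ` fst c) (in_chart c f) (in_chart c \<xi>) X Y \<theta> \<omega> p a b"

lemma framed_chart: "framed c X Y \<theta> \<omega> p a b \<Longrightarrow> chart_on M c"
  by (simp add: framed_def local_chart_def)

lemma framed_restrict:
  assumes fr: "framed c X Y \<theta> \<omega> p a b" and T: "open T" "T \<subseteq> snd c ` fst c"
  shows "framed (fst c \<inter> snd c -` T, snd c) X Y \<theta> \<omega> p a b" "snd c ` (fst c \<inter> snd c -` T) = T"
proof -
  note co = framed_chart[OF fr]
  define U where "U = fst c \<inter> snd c -` T"
  have U: "openin M U" using chart_open_preimage[OF co T(1)] by (simp add: U_def)
  show im: "snd c ` (fst c \<inter> snd c -` T) = T" using T(2) by auto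
  have eq: "fst c \<inter> U = fst c \<inter> snd c -` T" by (auto simp: U_def)
  have lc: "local_chart M A (fst c \<inter> U, snd c)"
    using fr by (intro local_chart_restrict atlas_chart U) (auto simp: framed_def)
  have "null_frame H (snd c ` fst c) (in_chart c f) (in_chart c \<xi>) X Y \<theta> \<omega> p a b" using fr by (simp add: framed_def)
  then have "null_frame H T (in_chart c f) (in_chart c \<xi>) X Y \<theta> \<omega> p a b" by (rule null_frame_restrict[OF _ T])
  then have "null_frame H T (in_chart (fst c \<inter> U, snd c) f) (in_chart (fst c \<inter> U, snd c) \<xi>) X Y \<theta> \<omega> p a b"
    by (rule null_frame_cong) (rule in_chart_restrict[OF co U]; simp add: eq im)+
  then show "framed (fst c \<inter> snd c -` T, snd c) X Y \<theta> \<omega> p a b" using lc by (simp add: framed_def eq im)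
qed

lemma framed_exists:
  assumes q: "q \<in> topspace M"
  shows "\<exists>c X Y \<theta> \<omega> p a b. framed c X Y \<theta> \<omega> p a b \<and> q \<in> fst c"
proof -
  obtain c where c: "c \<in> A" "q \<in> fst c" using atlas_cover[OF q] by blast
  note co = atlas_chart[OF c(1)]
  define S where "S = snd c ` fst c"
  have "\<exists>T X Y \<theta> \<omega> p a b. snd c q \<in> T \<and> T \<subseteq> S \<and> null_frame H T (in_chart c f) (in_chart c \<xi>) X Y \<theta> \<omega> p a b"
    by (rule null_frame_of_sphere)
       (use c co sphere indef in \<open>auto simp: S_def chart_on_def affine_sphere_def blaschke_surface_def indefinite_surface_def\<close>)
  then obtain T X Y \<theta> \<omega> p a b where T: "snd c q \<in> T" "T \<subseteq> S" and nf: "null_frame H T (in_chart c f) (in_chart c \<xi>) X Y \<theta> \<omega> p a b"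
    by blast
  interpret null_frame H T "in_chart c f" "in_chart c \<xi>" X Y \<theta> \<omega> p a b by fact
  define U where "U = fst c \<inter> snd c -` T"
  have U: "openin M U" using chart_open_preimage[OF co open_S] by (simp add: U_def)
  have im: "snd c ` (fst c \<inter> U) = T" using T(2) by (auto simp: U_def S_def)
  have lc: "local_chart M A (fst c \<inter> U, snd c)"
    by (intro local_chart_restrict atlas_chart U local_chart_atlas surface c)
  have "null_frame H T (in_chart (fst c \<inter> U, snd c) f) (in_chart (fst c \<inter> U, snd c) \<xi>) X Y \<theta> \<omega> p a b"
    by (rule null_frame_cong[OF nf]) (rule in_chart_restrict[OF co U]; simp add: im)+
  then have "framed (fst c \<inter> U, snd c) X Y \<theta> \<omega> p a b" using lc by (simp add: framed_def im)
  moreover have "q \<in> fst c \<inter> U" using c T by (auto simp: U_def)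
  ultimately show ?thesis by (metis fst_conv)
qed

text \<open>A map with nonvanishing Jacobian determinant at a point gives new coordinates there; the frame fields are
  transported and the forms pulled back. The new domain is a ball, so closed forms have potentials on it.\<close>

lemma framed_new_coords:
  assumes fr: "framed c X Y \<theta> \<omega> p a b" and q: "q \<in> fst c" and G: "smooth_on (snd c ` fst c) G"
    and J: "pd 1 G (snd c q) $ 1 * pd 2 G (snd c q) $ 2 - pd 1 G (snd c q) $ 2 * pd 2 G (snd c q) $ 1 \<noteq> 0"
    and N: "open N" "G (snd c q) \<in> N"
  obtains W B g where "q \<in> W" "W \<subseteq> fst c" "\<exists>r>0. B = ball (G (snd c q)) r" "B \<subseteq> N" "(G \<circ> snd c) ` W = B" "smooth_on B g"
    "\<And>y. y \<in> B \<Longrightarrow> g y \<in> snd c ` fst c" "\<And>y. y \<in> B \<Longrightarrow> G (g y) = y" "\<And>r. r \<in> W \<Longrightarrow> g (G (snd c r)) = snd c r"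
    "\<And>y. y \<in> B \<Longrightarrow> in_chart (W, G \<circ> snd c) f y = in_chart c f (g y)"
    "framed (W, G \<circ> snd c) (\<lambda>z. X (g z)) (\<lambda>z. Y (g z))
    (\<lambda>i z. pd i g z $ 1 * \<theta> 1 (g z) + pd i g z $ 2 * \<theta> 2 (g z)) (\<lambda>i z. pd i g z $ 1 * \<omega> 1 (g z) + pd i g z $ 2 * \<omega> 2 (g z))
    (\<lambda>i z. pd i g z $ 1 * p 1 (g z) + pd i g z $ 2 * p 2 (g z)) (\<lambda>z. a (g z)) (\<lambda>z. b (g z))"
proof -
  note co = framed_chart[OF fr]
  define S where "S = snd c ` fst c"
  have oS: "open S" using co by (simp add: chart_on_def S_def)
  obtain U V g where U: "open U" "snd c q \<in> U" "U \<subseteq> S" "open V" "homeomorphism U V G g" "smooth_on V g"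
  proof (rule smooth_local_inverse[OF G[folded S_def] oS _ J])
    show "snd c q \<in> S" using q by (simp add: S_def)
  qed blast
  have "G (snd c q) \<in> V \<inter> N" using U N by (auto simp: homeomorphism_def)
  then obtain r where r: "r > 0" "ball (G (snd c q)) r \<subseteq> V \<inter> N"
    using openE[of "V \<inter> N" "G (snd c q)"] U(4) N(1) by blast
  define B where "B = ball (G (snd c q)) r"
  have B: "open B" "convex B" "B \<subseteq> N" "B \<subseteq> V" "G (snd c q) \<in> B" using r by (auto simp: B_def)
  define T where "T = U \<inter> G -` B"
  have UG: "continuous_on U G" "\<And>x. x \<in> U \<Longrightarrow> G x \<in> V" "\<And>x. x \<in> U \<Longrightarrow> g (G x) = x" "\<And>y. y \<in> V \<Longrightarrow> g y \<in> U" "\<And>y. y \<in> V \<Longrightarrow> G (g y) = y"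
    using U(5) by (auto simp: homeomorphism_def)
  have oT: "open T" unfolding T_def using continuous_open_preimage[OF UG(1) U(1) B(1)] .
  have TS: "T \<subseteq> snd c ` fst c" using U by (auto simp: T_def S_def)
  have TB: "homeomorphism T B G g"
  proof (rule homeomorphismI)
    show "continuous_on T G" using UG(1) by (rule continuous_on_subset) (auto simp: T_def)
    show "continuous_on B g" using smooth_on_continuous_on[OF U(6)] B(4) by (rule continuous_on_subset)
  qed (use UG B in \<open>auto simp: T_def\<close>)
  have sgB: "smooth_on B g" using U(6) B(4) by (rule smooth_on_subset)
  define W where "W = fst c \<inter> snd c -` T"
  have im: "snd c ` W = T" using TS by (auto simp: W_def)
  have fr': "framed (W, snd c) X Y \<theta> \<omega> p a b" using framed_restrict(1)[OF fr oT TS] by (simp add: W_def)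
  have lc: "local_chart M A (W, snd c)" using fr' by (simp add: framed_def)
  have sGT: "smooth_on T G" using G TS by (rule smooth_on_subset)
  have hT: "homeomorphism (snd (W, snd c) ` fst (W, snd c)) B G g" "smooth_on (snd (W, snd c) ` fst (W, snd c)) G"
    using TB sGT im by simp_all
  have rp1: "local_chart M A (W, G \<circ> snd c)" "(G \<circ> snd c) ` W = B"
    using local_chart_reparam(1,2)[OF atlas_chart lc hT(1) B(1) hT(2) sgB] by simp_all
  have rp: "in_chart (W, G \<circ> snd c) h y = in_chart (W, snd c) h (g y)" if "y \<in> B" for y and h :: "'a \<Rightarrow> real^3"
    using local_chart_reparam(3)[OF atlas_chart lc hT(1) B(1) hT(2) sgB that, of h] by simp
  have gBT: "g ` B \<subseteq> T" using TB by (auto simp: homeomorphism_def)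
  have Jg: "pd 1 g z $ 1 * pd 2 g z $ 2 - pd 1 g z $ 2 * pd 2 g z $ 1 \<noteq> 0" if "z \<in> B" for z
    by (rule jacobian_inverse[OF B(1) that sgB sGT gBT]) (use TB in \<open>auto simp: homeomorphism_def\<close>)
  have nf: "null_frame H T (in_chart (W, snd c) f) (in_chart (W, snd c) \<xi>) X Y \<theta> \<omega> p a b" using fr' im by (simp add: framed_def)
  have "null_frame H B (in_chart (W, G \<circ> snd c) f) (in_chart (W, G \<circ> snd c) \<xi>) (\<lambda>z. X (g z)) (\<lambda>z. Y (g z))
    (\<lambda>i z. pd i g z $ 1 * \<theta> 1 (g z) + pd i g z $ 2 * \<theta> 2 (g z)) (\<lambda>i z. pd i g z $ 1 * \<omega> 1 (g z) + pd i g z $ 2 * \<omega> 2 (g z))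
    (\<lambda>i z. pd i g z $ 1 * p 1 (g z) + pd i g z $ 2 * p 2 (g z)) (\<lambda>z. a (g z)) (\<lambda>z. b (g z))"
    by (rule null_frame_cong[OF null_frame_pullback[OF nf B(1) sgB gBT Jg]]) (auto intro: rp)
  then have frn: "framed (W, G \<circ> snd c) (\<lambda>z. X (g z)) (\<lambda>z. Y (g z))
    (\<lambda>i z. pd i g z $ 1 * \<theta> 1 (g z) + pd i g z $ 2 * \<theta> 2 (g z)) (\<lambda>i z. pd i g z $ 1 * \<omega> 1 (g z) + pd i g z $ 2 * \<omega> 2 (g z))
    (\<lambda>i z. pd i g z $ 1 * p 1 (g z) + pd i g z $ 2 * p 2 (g z)) (\<lambda>z. a (g z)) (\<lambda>z. b (g z))"
    using rp1 by (simp add: framed_def)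
  have inW: "in_chart (W, snd c) f z = in_chart c f z" if "z \<in> T" for z
  proof -
    have "z \<in> snd c ` W" using that im by simp
    then obtain r where "r \<in> W" "z = snd c r" by blast
    then show ?thesis using in_chart_apply[OF framed_chart[OF fr'], of r f] in_chart_apply[OF co, of r f] by (simp add: W_def)
  qed
  show thesis
  proof (rule that[of W B g])
    show "\<exists>r>0. B = ball (G (snd c q)) r" using r(1) by (auto simp: B_def)
    show "q \<in> W" using q U(2) B(5) by (auto simp: W_def T_def)
    show "W \<subseteq> fst c" by (auto simp: W_def)
    show "(G \<circ> snd c) ` W = B" using rp1 by simp
    show "g y \<in> snd c ` fst c" if "y \<in> B" for y using gBT TS that by auto
    show "G (g y) = y" if "y \<in> B" for y using TB that by (simp add: homeomorphism_def)
    show "g (G (snd c r)) = snd c r" if "r \<in> W" for r using UG(3) that by (auto simp: W_def T_def)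
    show "in_chart (W, G \<circ> snd c) f y = in_chart c f (g y)" if "y \<in> B" for y
      using rp that gBT inW by auto
  qed (use B sgB frn in auto)
qed

text \<open>The invariants are defined in a chart picked by choice. Pulling the frame back to that chart does not
  change \<open>a\<close> and \<open>b\<close>, so any framed chart computes them.\<close>

lemma framed_invariants:
  assumes fr: "framed c X Y \<theta> \<omega> p a b" and q: "q \<in> fst c"
  shows "hCC A f \<xi> q = 8 * a (snd c q) * b (snd c q)" "K_zero A f \<xi> q \<longleftrightarrow> a (snd c q) = 0 \<and> b (snd c q) = 0"
proof -
  note co = framed_chart[OF fr]
  have "q \<in> topspace M" using chart_subset[OF co] q by auto
  then have ex: "\<exists>d. d \<in> A \<and> q \<in> fst d" using atlas_cover by blast
  define d where "d = chart_at A q"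
  have d: "d \<in> A" "q \<in> fst d" using someI_ex[OF ex] by (auto simp: d_def chart_at_def)
  note cod = atlas_chart[OF d(1)]
  define T where "T = snd d ` (fst d \<inter> fst c)"
  define T' where "T' = snd c ` (fst c \<inter> fst d)"
  have oT: "open T" using chart_open_image[OF cod] co by (simp add: T_def chart_on_def)
  define \<psi> where "\<psi> = in_chart d (snd c)"
  define \<tau> where "\<tau> = in_chart c (snd d)"
  have s: "smooth_on T \<psi>" "smooth_on T' \<tau>"
    using fr d(1) by (auto simp: framed_def local_chart_def chart_compatible_def T_def T'_def \<psi>_def \<tau>_def)
  have ap: "\<psi> (snd d r) = snd c r" "\<tau> (snd c r) = snd d r" if "r \<in> fst c" "r \<in> fst d" for r
    using in_chart_apply[OF co that(1), of "snd d"] in_chart_apply[OF cod that(2), of "snd c"] by (auto simp: \<psi>_def \<tau>_def)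
  have im: "\<psi> ` T \<subseteq> T'" "\<psi> ` T \<subseteq> snd c ` fst c" using ap by (auto simp: T_def T'_def)
  have J: "pd 1 \<psi> z $ 1 * pd 2 \<psi> z $ 2 - pd 1 \<psi> z $ 2 * pd 2 \<psi> z $ 1 \<noteq> 0" if "z \<in> T" for z
    by (rule jacobian_inverse[OF oT that s im(1)]) (use ap in \<open>auto simp: T_def\<close>)
  have nf: "null_frame H (snd c ` fst c) (in_chart c f) (in_chart c \<xi>) X Y \<theta> \<omega> p a b" using fr by (simp add: framed_def)
  have eq: "in_chart d h z = in_chart c h (\<psi> z)" if "z \<in> T" for z and h :: "'a \<Rightarrow> real^3"
    using that in_chart_apply[OF co, where f = h] in_chart_apply[OF cod, where f = h] ap by (auto simp: T_def)
  note nd = null_frame_cong[OF null_frame_pullback[OF nf oT s(1) im(2) J] eq eq]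
  have zT: "snd d q \<in> T" using q d by (auto simp: T_def)
  have apq: "\<psi> (snd d q) = snd c q" using ap q d by auto
  have "cubic_norm (in_chart d f) (in_chart d \<xi>) (snd d q) = 8 * a (snd c q) * b (snd c q)"
    using null_frame.cubic_norm_eq[OF nd zT] apq by simp
  then show "hCC A f \<xi> q = 8 * a (snd c q) * b (snd c q)" by (simp add: hCC_def d_def Let_def)
  have "(\<forall>i j. diff_tensor (in_chart d f) (in_chart d \<xi>) i j (snd d q) = 0) \<longleftrightarrow> a (snd c q) = 0 \<and> b (snd c q) = 0"
    using null_frame.diff_tensor_zero_iff[OF nd zT] apq by simp
  then show "K_zero A f \<xi> q \<longleftrightarrow> a (snd c q) = 0 \<and> b (snd c q) = 0" by (simp add: K_zero_def d_def Let_def)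
qed

lemma framed_open:
  assumes fr: "framed c X Y \<theta> \<omega> p a b" and h: "smooth_on (snd c ` fst c) h" and D: "open D"
  shows "openin M {q \<in> fst c. (h (snd c q) :: real) \<in> D}"
proof -
  note co = framed_chart[OF fr]
  have "open (snd c ` fst c \<inter> h -` D)"
    using co by (intro continuous_open_preimage smooth_on_continuous_on h D) (simp add: chart_on_def)
  from chart_open_preimage[OF co this]
  show ?thesis by (simp add: vimage_def Int_def conj_ac) (metis (mono_tags, lifting) Collect_cong imageI)
qed

lemma open_V: "openin M (V_part M A f \<xi>)"
proof (subst openin_subopen, intro ballI)
  fix q assume q: "q \<in> V_part M A f \<xi>"
  then obtain c X Y \<theta> \<omega> p a b where fr: "framed c X Y \<theta> \<omega> p a b" "q \<in> fst c"
    using framed_exists[of q] by (auto simp: V_part_def)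
  interpret null_frame H "snd c ` fst c" "in_chart c f" "in_chart c \<xi>" X Y \<theta> \<omega> p a b using fr by (simp add: framed_def)
  have "openin M {q \<in> fst c. a (snd c q) * b (snd c q) \<in> - {0}}"
    using framed_open[OF fr(1), of "\<lambda>z. a z * b z" "- {0}"] smooth_a smooth_b open_S by (simp add: smooth_on_mult open_Compl)
  moreover have "q \<in> {q \<in> fst c. a (snd c q) * b (snd c q) \<in> - {0}}"
    using q fr framed_invariants[OF fr] by (simp add: V_part_def)
  moreover have "{q \<in> fst c. a (snd c q) * b (snd c q) \<in> - {0}} \<subseteq> V_part M A f \<xi>"
    using framed_invariants[OF fr(1)] chart_subset[OF framed_chart[OF fr(1)]] by (auto simp: V_part_def)
  ultimately show "\<exists>T. openin M T \<and> q \<in> T \<and> T \<subseteq> V_part M A f \<xi>" by blast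
qed

lemma open_K_nonzero: "openin M {q \<in> topspace M. \<not> K_zero A f \<xi> q}"
proof (subst openin_subopen, intro ballI)
  fix q assume q: "q \<in> {q \<in> topspace M. \<not> K_zero A f \<xi> q}"
  then obtain c X Y \<theta> \<omega> p a b where fr: "framed c X Y \<theta> \<omega> p a b" "q \<in> fst c"
    using framed_exists[of q] by auto
  interpret null_frame H "snd c ` fst c" "in_chart c f" "in_chart c \<xi>" X Y \<theta> \<omega> p a b using fr by (simp add: framed_def)
  have "openin M {q \<in> fst c. (a (snd c q))\<^sup>2 + (b (snd c q))\<^sup>2 \<in> - {0}}"
    by (rule framed_open[OF fr(1), of "\<lambda>z. (a z)\<^sup>2 + (b z)\<^sup>2"]) (intro smooth_intros open_S smooth_a smooth_b, simp add: open_Compl)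
  moreover have "q \<in> {q \<in> fst c. (a (snd c q))\<^sup>2 + (b (snd c q))\<^sup>2 \<in> - {0}}"
    using q fr framed_invariants[OF fr] by (auto simp: sum_power2_eq_zero_iff)
  moreover have "{q \<in> fst c. (a (snd c q))\<^sup>2 + (b (snd c q))\<^sup>2 \<in> - {0}} \<subseteq> {q \<in> topspace M. \<not> K_zero A f \<xi> q}"
    using framed_invariants[OF fr(1)] chart_subset[OF framed_chart[OF fr(1)]] by auto
  ultimately show "\<exists>T. openin M T \<and> q \<in> T \<and> T \<subseteq> {q \<in> topspace M. \<not> K_zero A f \<xi> q}" by blast
qed

lemma K_zero_hCC: "q \<in> topspace M \<Longrightarrow> K_zero A f \<xi> q \<Longrightarrow> hCC A f \<xi> q = 0"
  using framed_exists framed_invariants by fastforce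

end

context indefinite_sphere
begin

lemma framed_rescale:
  assumes "framed c X Y \<theta> \<omega> p a b" "smooth_on (snd c ` fst c) l" "\<And>z. z \<in> snd c ` fst c \<Longrightarrow> l z \<noteq> 0"
  shows "framed c (\<lambda>z. l z *\<^sub>R X z) (\<lambda>z. inverse (l z) *\<^sub>R Y z) (\<lambda>i z. \<theta> i z / l z) (\<lambda>i z. l z * \<omega> i z)
     (\<lambda>i z. p i z + pd i l z / l z) (\<lambda>z. a z * l z ^ 3) (\<lambda>z. b z / l z ^ 3)"
proof -
  have nf: "null_frame H (snd c ` fst c) (in_chart c f) (in_chart c \<xi>) X Y \<theta> \<omega> p a b" using assms(1) by (simp add: framed_def)
  show ?thesis using null_frame_rescale[OF nf assms(2,3)] assms(1) by (simp add: framed_def)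
qed

lemma framed_swap:
  "framed c X Y \<theta> \<omega> p a b \<Longrightarrow> framed c Y X \<omega> \<theta> (\<lambda>i z. - p i z) b a"
  unfolding framed_def using null_frame_swap by blast

lemmas framed_new_coords_pair = framed_new_coords[of "(D, \<phi>)" for D \<phi>, unfolded fst_conv snd_conv]

lemma framed_ball:
  assumes fr: "framed c X Y \<theta> \<omega> p a b" and q: "q \<in> fst c" and N: "open N" "snd c q \<in> N"
  obtains D where "framed (D, snd c) X Y \<theta> \<omega> p a b" "q \<in> D" "D \<subseteq> fst c" "convex (snd c ` D)" "snd c ` D \<subseteq> N" "open (snd c ` D)"
proof -
  have "open (snd c ` fst c)" using framed_chart[OF fr] by (simp add: chart_on_def)
  then obtain r where r: "r > 0" "ball (snd c q) r \<subseteq> snd c ` fst c \<inter> N"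
    using openE[of "snd c ` fst c \<inter> N" "snd c q"] N q by blast
  define T where "T = ball (snd c q) r"
  have T: "open T" "T \<subseteq> snd c ` fst c" "T \<subseteq> N" "convex T" using r by (auto simp: T_def)
  note fr' = framed_restrict[OF fr T(1,2)]
  show thesis
  proof (rule that[of "fst c \<inter> snd c -` T"])
    show "q \<in> fst c \<inter> snd c -` T" using q r by (simp add: T_def)
  qed (use fr' T in auto)
qed

lemma framed_null_frame: "framed (D, \<phi>) X Y \<theta> \<omega> p a b \<Longrightarrow> null_frame H (\<phi> ` D) (in_chart (D, \<phi>) f) (in_chart (D, \<phi>) \<xi>) X Y \<theta> \<omega> p a b"
  by (simp add: framed_def)

subsection \<open>Isothermal charts where the cubic form is not null\<close>

text \<open>With \<open>\<alpha>\<close> and \<open>\<beta>\<close> the signs of \<open>ab\<close> and \<open>b\<close>, rescaling by the cube root \<open>l\<close> of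
  $2\alpha b$ turns \<open>b\<close> into $\alpha/2$ and \<open>a\<close> into the positive function $2\alpha ab$.\<close>

lemma V_chart_rescaled:
  assumes q: "q \<in> V_part M A f \<xi>" and \<alpha>: "\<alpha> = sgn (hCC A f \<xi> q)"
  obtains D \<phi> X Y \<theta> \<omega> p a b where "framed (D, \<phi>) X Y \<theta> \<omega> p a b" "q \<in> D" "convex (\<phi> ` D)"
    "\<And>z. z \<in> \<phi> ` D \<Longrightarrow> a z > 0" "\<And>z. z \<in> \<phi> ` D \<Longrightarrow> b z = \<alpha> / 2"
proof -
  have qM: "q \<in> topspace M" "hCC A f \<xi> q \<noteq> 0" using q by (auto simp: V_part_def)
  obtain c X Y \<theta> \<omega> p a b where fr: "framed c X Y \<theta> \<omega> p a b" "q \<in> fst c" using framed_exists[OF qM(1)] by blast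
  define S where "S = snd c ` fst c"
  interpret null_frame H S "in_chart c f" "in_chart c \<xi>" X Y \<theta> \<omega> p a b using fr by (simp add: framed_def S_def)
  have ab: "\<alpha> = sgn (a (snd c q) * b (snd c q))" "a (snd c q) * b (snd c q) \<noteq> 0"
    using framed_invariants[OF fr] qM(2) \<alpha> by (auto simp: sgn_mult)
  define \<beta> where "\<beta> = sgn (b (snd c q))"
  have sq: "\<alpha> * \<alpha> = 1" "\<beta> * \<beta> = 1" using ab by (auto simp: \<beta>_def sgn_if)
  define N where "N = (S \<inter> (\<lambda>z. \<alpha> * (a z * b z)) -` {0<..}) \<inter> (S \<inter> (\<lambda>z. \<beta> * b z) -` {0<..})"
  have oN: "open N" unfolding N_def
    by (intro open_Int continuous_open_preimage smooth_on_continuous_on smooth_intros open_S smooth_a smooth_b open_greaterThan)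
  have qN: "snd c q \<in> N" using ab fr(2) by (auto simp: N_def S_def \<beta>_def sgn_if zero_less_mult_iff mult_less_0_iff split: if_splits)
  obtain D where D: "framed (D, snd c) X Y \<theta> \<omega> p a b" "q \<in> D" "D \<subseteq> fst c" "convex (snd c ` D)" "snd c ` D \<subseteq> N" "open (snd c ` D)"
    using framed_ball[OF fr oN qN] by blast
  have pos: "\<alpha> * (a z * b z) > 0" "\<beta> * b z > 0" "z \<in> S" if "z \<in> snd c ` D" for z using D(5) that by (auto simp: N_def)
  define l where "l = (\<lambda>z. \<alpha> * \<beta> * exp (ln (2 * (\<beta> * b z)) / 3))"
  have l3: "l z ^ 3 = 2 * \<alpha> * b z" if z: "z \<in> snd c ` D" for z
  proof -
    have "l z ^ 3 = (\<alpha> * \<alpha> * \<alpha>) * (\<beta> * \<beta> * \<beta>) * exp (ln (2 * (\<beta> * b z)) / 3) ^ 3"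
      by (simp add: l_def power3_eq_cube)
    also have "exp (ln (2 * (\<beta> * b z)) / 3) ^ 3 = 2 * (\<beta> * b z)"
      using pos(2)[OF z] by (simp add: exp_of_nat_mult[symmetric])
    finally show ?thesis using sq by (simp add: algebra_simps)
  qed
  have ln: "l z \<noteq> 0" for z using sq by (auto simp: l_def)
  have sl: "smooth_on (snd c ` D) l" unfolding l_def
  proof (intro smooth_intros D)
    show "smooth_on (snd c ` D) b" using smooth_b by (rule smooth_on_subset) (use pos in auto)
  qed (use pos in auto)
  show thesis
  proof (rule that[OF framed_rescale[OF D(1), of l] D(2,4)])
    fix z assume z: "z \<in> snd c ` D"
    have "2 * \<alpha> * (a z * b z) > 0" using pos(1)[OF z] by (simp add: mult.assoc)
    then show "0 < a z * l z ^ 3" unfolding l3[OF z] by (simp add: algebra_simps)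
    have "b z \<noteq> 0" "\<alpha> \<noteq> 0" using pos[OF z] by auto
    then show "b z / l z ^ 3 = \<alpha> / 2" unfolding l3[OF z] using sq(1) by (simp add: divide_simps)
  qed (use sl ln in auto)
qed

text \<open>Put $E = (a/4)^{1/3}$, which will be $e^{2u}$. The Codazzi equations say that the one-forms
  \<open>\<omega>\<close> and $2\alpha E\theta$ are closed. If \<open>t\<close> and \<open>s\<close> are potentials of them, then in the coordinates
  $x_1 = (s+t)/2$, $x_2 = (s-t)/2$ the frame has the form required by the model.\<close>

lemma V_chart:
  assumes q: "q \<in> V_part M A f \<xi>"
  shows "\<exists>W \<gamma> \<alpha> u.
             q \<in> W \<and> local_chart M A (W, \<gamma>) \<and> simply_connected (\<gamma> ` W) \<and>
             \<alpha> = sgn (hCC A f \<xi> q) \<and> (\<forall>p\<in>W. sgn (hCC A f \<xi> p) = \<alpha>) \<and>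
             u = in_chart (W, \<gamma>) (\<lambda>p. 1/3 * ln (1/4 * sqrt (\<alpha> * hCC A f \<xi> p))) \<and>
             smooth_on (\<gamma> ` W) u \<and>
             (\<forall>x \<in> \<gamma> ` W. wave_op u x = exp (- 2 * u x) * (\<alpha> * H + 2 * exp (6 * u x))) \<and>
             (\<exists>g \<eta>. sphere_of H \<alpha> (\<gamma> ` W) u g \<eta> \<and>
                equiaff_equiv (subtopology M W) (restrict_atlas A W) f
                  (top_of_set (\<gamma> ` W)) (std_atlas (\<gamma> ` W)) g)"
proof -
  define \<alpha> where "\<alpha> = sgn (hCC A f \<xi> q)"
  obtain D \<phi> X Y \<theta> \<omega> p a b where fr: "framed (D, \<phi>) X Y \<theta> \<omega> p a b" "q \<in> D" "convex (\<phi> ` D)"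
    and a: "\<And>z. z \<in> \<phi> ` D \<Longrightarrow> a z > 0" and b: "\<And>z. z \<in> \<phi> ` D \<Longrightarrow> b z = \<alpha> / 2"
    using V_chart_rescaled[OF q \<alpha>_def] by blast
  have \<alpha>: "\<alpha> \<in> {-1, 1}" using q by (auto simp: \<alpha>_def V_part_def sgn_if)
  then have \<alpha>2: "\<alpha> * \<alpha> = 1" "\<alpha> \<noteq> 0" by auto
  define S where "S = \<phi> ` D"
  interpret null_frame H S "in_chart (D, \<phi>) f" "in_chart (D, \<phi>) \<xi>" X Y \<theta> \<omega> p a b
    using framed_null_frame[OF fr(1)] by (simp add: S_def)
  have a: "a z > 0" and b: "b z = \<alpha> / 2" if "z \<in> S" for z using a b that by (auto simp: S_def)
  have qS: "\<phi> q \<in> S" using fr by (simp add: S_def)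
  define E where "E = (\<lambda>z. exp (ln (a z / 4) / 3))"
  have sE: "smooth_on S E" unfolding E_def by (intro smooth_intros open_S smooth_a) (use a in auto)
  have E3: "a z = 4 * E z ^ 3" if "z \<in> S" for z
    using a[OF that] by (simp add: E_def exp_of_nat_mult[symmetric])
  have Epos: "E z > 0" for z by (simp add: E_def)
  have dE: "E differentiable (at z)" if "z \<in> S" for z using smooth_on_differentiable[OF sE that] .
  have pdb: "pd i b z = 0" if "z \<in> S" for i z
    using pd_cong[OF open_S that b, where i = i] by simp
  have pda: "pd i a z = 12 * (E z)\<^sup>2 * pd i E z" if z: "z \<in> S" for i z
  proof -
    have "pd i a z = pd i (\<lambda>z. 4 * (E z * (E z * E z))) z"
      by (rule pd_cong[OF open_S z]) (simp add: E3 power3_eq_cube)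
    also have "\<dots> = 4 * pd i (\<lambda>z. E z * (E z * E z)) z"
      by (rule pd_linear[OF bounded_linear_mult_right]) (use dE[OF z] in \<open>simp add: differentiable_mult\<close>)
    also have "pd i (\<lambda>z. E z * (E z * E z)) z = 3 * (E z)\<^sup>2 * pd i E z"
      using dE[OF z] by (simp add: pd_mult differentiable_mult power2_eq_square algebra_simps)
    finally show ?thesis by simp
  qed
  \<comment> \<open>the Codazzi equations say that these two one-forms are closed\<close>
  have closed_\<omega>: "pd 2 (\<omega> 1) z = pd 1 (\<omega> 2) z" if z: "z \<in> S" for z
    using codazzi_b[OF z] curl_omega[OF z] \<alpha>2 by (simp add: pdb[OF z] b[OF z])
  have closed_\<theta>: "pd 2 (\<lambda>z. (2 * \<alpha> * E z) * \<theta> 1 z) z = pd 1 (\<lambda>z. (2 * \<alpha> * E z) * \<theta> 2 z) z" if z: "z \<in> S" for z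
  proof -
    have d: "pd i (\<lambda>z. (2 * \<alpha> * E z) * \<theta> j z) z = 2 * \<alpha> * (E z * pd i (\<theta> j) z + pd i E z * \<theta> j z)" for i j
    proof -
      have "pd i (\<lambda>z. (2 * \<alpha>) * (E z * \<theta> j z)) z = 2 * \<alpha> * pd i (\<lambda>z. E z * \<theta> j z) z"
        by (rule pd_linear[OF bounded_linear_mult_right]) (use dE[OF z] diffable[OF z] in \<open>simp add: differentiable_mult\<close>)
      then show ?thesis using pd_mult[OF dE[OF z] diffable(5)[OF z, of j], of i] by (simp add: mult.assoc)
    qed
    have "12 * (E z)\<^sup>2 * (pd 1 E z * \<theta> 2 z - pd 2 E z * \<theta> 1 z) = 12 * (E z)\<^sup>2 * (E z * (p 1 z * \<theta> 2 z - p 2 z * \<theta> 1 z))"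
      using codazzi_a[OF z] unfolding pda[OF z] E3[OF z] by (simp add: power2_eq_square power3_eq_cube algebra_simps)
    then have "pd 1 E z * \<theta> 2 z - pd 2 E z * \<theta> 1 z = E z * (p 1 z * \<theta> 2 z - p 2 z * \<theta> 1 z)"
      using Epos[of z] by simp
    also have "\<dots> = E z * (pd 2 (\<theta> 1) z - pd 1 (\<theta> 2) z)" using curl_theta[OF z] by simp
    finally have "E z * pd 2 (\<theta> 1) z + pd 2 E z * \<theta> 1 z = E z * pd 1 (\<theta> 2) z + pd 1 E z * \<theta> 2 z" by (simp add: algebra_simps)
    then show ?thesis unfolding d by simp
  qed
  have conv: "convex S" using fr(3) by (simp add: S_def)
  obtain t where t: "smooth_on S t" "\<And>z. z \<in> S \<Longrightarrow> pd 1 t z = \<omega> 1 z" "\<And>z. z \<in> S \<Longrightarrow> pd 2 t z = \<omega> 2 z"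
    by (rule poincare_convex[OF open_S conv qS smooth_omega smooth_omega closed_\<omega>]) blast+
  have s2: "smooth_on S (\<lambda>z. (2 * \<alpha> * E z) * \<theta> i z)" for i by (intro smooth_intros open_S sE smooth_theta)
  obtain s where s: "smooth_on S s" "\<And>z. z \<in> S \<Longrightarrow> pd 1 s z = (2 * \<alpha> * E z) * \<theta> 1 z" "\<And>z. z \<in> S \<Longrightarrow> pd 2 s z = (2 * \<alpha> * E z) * \<theta> 2 z"
    by (rule poincare_convex[OF open_S conv qS s2 s2 closed_\<theta>]) blast+
  define G where "G = (\<lambda>z. vector [(s z + t z) / 2, (s z - t z) / 2] :: real^2)"
  have sG: "smooth_on S G" unfolding G_def by (intro smooth_intros open_S s t) simp_all
  have dst: "s differentiable (at z)" "t differentiable (at z)" if "z \<in> S" for z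
    using smooth_on_differentiable s(1) t(1) that by blast+
  have pG: "pd i G z $ 1 = (pd i s z + pd i t z) / 2" "pd i G z $ 2 = (pd i s z - pd i t z) / 2" if z: "z \<in> S" for i z
  proof -
    have half: "pd i (\<lambda>z. h z / 2) z = pd i h z / 2" if "h differentiable (at z)" for h :: "real^2 \<Rightarrow> real"
      using pd_linear[OF bounded_linear_divide that] .
    have dG: "G differentiable (at z)" by (rule smooth_on_differentiable[OF sG z])
    show "pd i G z $ 1 = (pd i s z + pd i t z) / 2" "pd i G z $ 2 = (pd i s z - pd i t z) / 2"
      using pd_nth[OF dG, of i 1] pd_nth[OF dG, of i 2] dst[OF z]
      by (simp_all add: G_def half pd_add pd_diff differentiable_add differentiable_diff)
  qed
  have J: "pd 1 G (\<phi> q) $ 1 * pd 2 G (\<phi> q) $ 2 - pd 1 G (\<phi> q) $ 2 * pd 2 G (\<phi> q) $ 1 \<noteq> 0"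
  proof -
    have "pd 1 G (\<phi> q) $ 1 * pd 2 G (\<phi> q) $ 2 - pd 1 G (\<phi> q) $ 2 * pd 2 G (\<phi> q) $ 1
       = - \<alpha> * E (\<phi> q) * (\<theta> 1 (\<phi> q) * \<omega> 2 (\<phi> q) - \<theta> 2 (\<phi> q) * \<omega> 1 (\<phi> q))"
      unfolding pG[OF qS] s(2,3)[OF qS] t(2,3)[OF qS] by (simp add: field_simps)
    then show ?thesis using coframe[OF qS] Epos[of "\<phi> q"] \<alpha>2 by simp
  qed
  obtain W B g where W: "q \<in> W" "W \<subseteq> D" "\<exists>r>0. B = ball (G (\<phi> q)) r" "(G \<circ> \<phi>) ` W = B" "smooth_on B g"
    "\<And>y. y \<in> B \<Longrightarrow> g y \<in> \<phi> ` D" "\<And>y. y \<in> B \<Longrightarrow> G (g y) = y" "\<And>r. r \<in> W \<Longrightarrow> g (G (\<phi> r)) = \<phi> r"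
    and frW: "framed (W, G \<circ> \<phi>) (\<lambda>z. X (g z)) (\<lambda>z. Y (g z))
    (\<lambda>i z. pd i g z $ 1 * \<theta> 1 (g z) + pd i g z $ 2 * \<theta> 2 (g z)) (\<lambda>i z. pd i g z $ 1 * \<omega> 1 (g z) + pd i g z $ 2 * \<omega> 2 (g z))
    (\<lambda>i z. pd i g z $ 1 * p 1 (g z) + pd i g z $ 2 * p 2 (g z)) (\<lambda>z. a (g z)) (\<lambda>z. b (g z))"
    by (rule framed_new_coords_pair[OF fr(1,2) sG[unfolded S_def] J open_UNIV UNIV_I]) (rule that; assumption)
  note W = W[folded S_def]
  define \<gamma> where "\<gamma> = G \<circ> \<phi>"
  have B: "open B" "convex B" "\<gamma> ` W = B" using W by (auto simp: \<gamma>_def)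
  note nfB = framed_null_frame[OF frW, folded \<gamma>_def, unfolded B(3)]
  define u where "u = in_chart (W, \<gamma>) (\<lambda>p. 1/3 * ln (1/4 * sqrt (\<alpha> * hCC A f \<xi> p)))"
  have hC: "\<alpha> * hCC A f \<xi> r = 4 * a (\<phi> r)" if "r \<in> W" for r
  proof -
    have "hCC A f \<xi> r = 8 * a (\<phi> r) * b (\<phi> r)" "\<phi> r \<in> S"
      using framed_invariants(1)[OF fr(1), of r] W(2) that by (auto simp: S_def)
    then show ?thesis using \<alpha>2(1) b[of "\<phi> r"] by (simp add: algebra_simps)
  qed
  have ueq: "u y = ln (a (g y) / 4) / 6" if y: "y \<in> B" for y
  proof -
    obtain r where r: "r \<in> W" "y = \<gamma> r" using y B(3) by blast
    have "chart_on M (W, \<gamma>)" using framed_chart[OF frW] by (simp add: \<gamma>_def)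
    then have "u y = 1/3 * ln (1/4 * sqrt (4 * a (\<phi> r)))"
      using in_chart_apply[of M "(W, \<gamma>)" r "\<lambda>p. 1/3 * ln (1/4 * sqrt (\<alpha> * hCC A f \<xi> p))"] r hC[OF r(1)]
      by (simp add: u_def)
    also have "g y = \<phi> r" using W(8)[OF r(1)] r(2) by (simp add: \<gamma>_def)
    then have "\<phi> r = g y" by simp
    also have "1/4 * sqrt (4 * a (g y)) = sqrt (a (g y) / 4)"
      by (simp add: real_sqrt_divide real_sqrt_mult)
    also have "ln (sqrt (a (g y) / 4)) = ln (a (g y) / 4) / 2"
      using a[OF W(6)[OF y]] by (simp add: ln_sqrt)
    finally show ?thesis by simp
  qed
  have sag: "smooth_on B (\<lambda>y. a (g y))"
    by (rule smooth_on_compose[OF B(1) open_S _ smooth_a W(5)]) (use W(6) in auto)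
  have "smooth_on B (\<lambda>y. ln (a (g y) / 4) / 6)"
    by (intro smooth_intros B sag) (use a W(6) in auto)
  then have su: "smooth_on B u" using smooth_on_cong[OF B(1), of u "\<lambda>y. ln (a (g y) / 4) / 6"] ueq by simp
  have Eg: "E (g y) = exp (2 * u y)" if "y \<in> B" for y by (simp add: ueq[OF that] E_def)
  have chain: "pd i g y $ 1 * pd 1 h (g y) + pd i g y $ 2 * pd 2 h (g y) = pd i (\<lambda>y. h (g y)) y"
    if "smooth_on S h" "y \<in> B" for h :: "real^2 \<Rightarrow> real" and i y
    using pd_compose[OF smooth_on_differentiable[OF that(1) W(6)[OF that(2)]] smooth_on_differentiable[OF W(5) that(2)]] by simp
  have dc: "(\<lambda>y::real^2. y $ j) differentiable (at y)" for y j
    by (rule bounded_linear_imp_differentiable[OF bounded_linear_vec_nth])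
  have \<omega>B: "pd i g y $ 1 * \<omega> 1 (g y) + pd i g y $ 2 * \<omega> 2 (g y) = (if i = 1 then 1 else - 1)" if y: "y \<in> B" for i y
  proof -
    have "pd i (\<lambda>y. t (g y)) y = pd i (\<lambda>y. y $ 1 - y $ 2) y"
    proof (rule pd_cong[OF B(1) y])
      fix y assume "y \<in> B"
      then have "y $ 1 - y $ 2 = G (g y) $ 1 - G (g y) $ 2" using W(7) by simp
      then show "t (g y) = y $ 1 - y $ 2" by (simp add: G_def field_simps)
    qed
    then show ?thesis using chain[OF t(1) y, of i] t(2,3)[OF W(6)[OF y]] exhaust_2[of i]
      by (auto simp: pd_diff dc pd_coord)
  qed
  have \<theta>B: "pd i g y $ 1 * \<theta> 1 (g y) + pd i g y $ 2 * \<theta> 2 (g y) = \<alpha> / 2 * exp (- 2 * u y)" if y: "y \<in> B" for i y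
  proof -
    have "pd i (\<lambda>y. s (g y)) y = pd i (\<lambda>y. y $ 1 + y $ 2) y"
    proof (rule pd_cong[OF B(1) y])
      fix y assume "y \<in> B"
      then have "y $ 1 + y $ 2 = G (g y) $ 1 + G (g y) $ 2" using W(7) by simp
      then show "s (g y) = y $ 1 + y $ 2" by (simp add: G_def field_simps)
    qed
    then have "(2 * \<alpha> * E (g y)) * (pd i g y $ 1 * \<theta> 1 (g y) + pd i g y $ 2 * \<theta> 2 (g y)) = 1"
      using chain[OF s(1) y, of i] s(2,3)[OF W(6)[OF y]] exhaust_2[of i]
      by (auto simp: pd_add dc pd_coord algebra_simps)
    then have e: "(2 * \<alpha> * exp (2 * u y)) * (pd i g y $ 1 * \<theta> 1 (g y) + pd i g y $ 2 * \<theta> 2 (g y)) = 1" by (simp add: Eg[OF y])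
    have "pd i g y $ 1 * \<theta> 1 (g y) + pd i g y $ 2 * \<theta> 2 (g y) = 1 / (2 * \<alpha> * exp (2 * u y))"
      using e \<alpha>2(2) by (simp add: eq_divide_eq mult.commute)
    also have "\<dots> = \<alpha> / 2 * exp (- 2 * u y)"
      using \<alpha>2 by (simp add: exp_minus field_simps)
    finally show ?thesis .
  qed
  have aB: "a (g y) = 4 * exp (6 * u y)" if "y \<in> B" for y
    using a[OF W(6)[OF that]] by (simp add: ueq[OF that])
  have bB: "b (g y) = \<alpha> / 2" if "y \<in> B" for y using b W(6)[OF that] by blast
  have \<omega>12: "pd 1 g y $ 1 * \<omega> 1 (g y) + pd 1 g y $ 2 * \<omega> 2 (g y) = 1"
     "pd 2 g y $ 1 * \<omega> 1 (g y) + pd 2 g y $ 2 * \<omega> 2 (g y) = - 1" if "y \<in> B" for y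
    using \<omega>B[OF that, of 1] \<omega>B[OF that, of 2] by simp_all
  have "wave_op u x = exp (- 2 * u x) * (\<alpha> * H + 2 * exp (6 * u x))" if "x \<in> B" for x
    by (rule isothermal_wave_equation[OF nfB \<alpha> su \<theta>B \<omega>12 aB bB that])
  moreover have "sphere_of H \<alpha> B u (in_chart (W, \<gamma>) f) (in_chart (W, \<gamma>) \<xi>)"
    by (rule sphere_of_null_frame[OF nfB \<alpha> su \<theta>B \<omega>12 aB bB])
  moreover have lc: "local_chart M A (W, \<gamma>)" using frW by (simp add: framed_def \<gamma>_def)
  moreover have "equiaff_equiv (subtopology M W) (restrict_atlas A W) f (top_of_set B) (std_atlas B) (in_chart (W, \<gamma>) f)"
    using equiaff_equiv_chart[OF atlas_chart lc, of "mat 1" "in_chart (W, \<gamma>) f" f 0] by (simp add: B(3))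
  moreover have "sgn (hCC A f \<xi> r) = \<alpha>" if "r \<in> W" for r
  proof -
    have "a (\<phi> r) > 0" using a W(2) that by (auto simp: S_def)
    then have "\<alpha> * hCC A f \<xi> r > 0" using hC[OF that] by simp
    then show ?thesis using \<alpha> by (auto simp: sgn_if)
  qed
  ultimately have "q \<in> W \<and> local_chart M A (W, \<gamma>) \<and> simply_connected (\<gamma> ` W) \<and>
             \<alpha> = sgn (hCC A f \<xi> q) \<and> (\<forall>p\<in>W. sgn (hCC A f \<xi> p) = \<alpha>) \<and>
             u = in_chart (W, \<gamma>) (\<lambda>p. 1/3 * ln (1/4 * sqrt (\<alpha> * hCC A f \<xi> p))) \<and>
             smooth_on (\<gamma> ` W) u \<and>
             (\<forall>x \<in> \<gamma> ` W. wave_op u x = exp (- 2 * u x) * (\<alpha> * H + 2 * exp (6 * u x))) \<and>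
             (\<exists>g \<eta>. sphere_of H \<alpha> (\<gamma> ` W) u g \<eta> \<and>
                equiaff_equiv (subtopology M W) (restrict_atlas A W) f
                  (top_of_set (\<gamma> ` W)) (std_atlas (\<gamma> ` W)) g)"
    unfolding B(3)
    by (intro conjI exI[of _ "in_chart (W, \<gamma>) f"] exI[of _ "in_chart (W, \<gamma>) \<xi>"] ballI W(1) su convex_imp_simply_connected[OF B(2)] u_def \<alpha>_def)
  then show ?thesis by (rule_tac exI, rule_tac exI, rule_tac exI, rule_tac exI)
qed

subsection \<open>The decomposition of the surface\<close>

text \<open>Let \<open>q\<close> be an interior point of $Z = \{h(C,C) = 0\}$. Either \<open>K\<close> vanishes near \<open>q\<close>, and \<open>q\<close> belongs
  to \<open>U0_part\<close>, or there are points with $K \neq 0$ arbitrarily close to \<open>q\<close>; these belong to \<open>U1_part\<close> since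
  $K \neq 0$ is an open condition.\<close>

lemma interior_of_null_set:
  defines "U \<equiv> M interior_of {q \<in> topspace M. hCC A f \<xi> q = 0}"
  shows "openin M U" "U \<inter> V_part M A f \<xi> = {}" "U \<subseteq> {q \<in> topspace M. hCC A f \<xi> q = 0}"
    "topspace M = U \<union> (M closure_of V_part M A f \<xi>)"
    "U0_part M A f \<xi> \<union> U1_part M A f \<xi> \<subseteq> U" "U \<subseteq> M closure_of (U0_part M A f \<xi> \<union> U1_part M A f \<xi>)"
proof -
  define Z where "Z = {q \<in> topspace M. hCC A f \<xi> q = 0}"
  have UZ: "U \<subseteq> Z" unfolding U_def Z_def by (rule interior_of_subset)
  show "openin M U" by (simp add: U_def)
  show "U \<inter> V_part M A f \<xi> = {}" "U \<subseteq> {q \<in> topspace M. hCC A f \<xi> q = 0}"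
    using UZ by (auto simp: Z_def V_part_def)
  have "V_part M A f \<xi> = topspace M - Z" by (auto simp: V_part_def Z_def)
  then have "M closure_of V_part M A f \<xi> = topspace M - U"
    unfolding U_def Z_def[symmetric] by (simp add: closure_of_complement)
  then show "topspace M = U \<union> (M closure_of V_part M A f \<xi>)"
    using interior_of_subset_topspace[of M] unfolding U_def by blast
  have "U0_part M A f \<xi> \<subseteq> U"
    unfolding U0_part_def U_def by (rule interior_of_mono) (use K_zero_hCC in auto)
  moreover have "U1_part M A f \<xi> \<subseteq> U"
    unfolding U1_part_def U_def by (rule interior_of_mono) auto
  ultimately show "U0_part M A f \<xi> \<union> U1_part M A f \<xi> \<subseteq> U" by blast
  show "U \<subseteq> M closure_of (U0_part M A f \<xi> \<union> U1_part M A f \<xi>)"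
  proof
    fix q assume q: "q \<in> U"
    have qM: "q \<in> topspace M" using q UZ by (auto simp: Z_def)
    show "q \<in> M closure_of (U0_part M A f \<xi> \<union> U1_part M A f \<xi>)"
      unfolding in_closure_of
    proof (intro conjI allI impI qM)
      fix T assume T: "q \<in> T \<and> openin M T"
      have TU: "openin M (T \<inter> U)" using T by (simp add: U_def openin_Int)
      show "\<exists>y. y \<in> U0_part M A f \<xi> \<union> U1_part M A f \<xi> \<and> y \<in> T"
      proof (cases "\<exists>y\<in>T \<inter> U. \<not> K_zero A f \<xi> y")
        case True
        then obtain y where y: "y \<in> T" "y \<in> U" "\<not> K_zero A f \<xi> y" by blast
        have "openin M (U \<inter> {q \<in> topspace M. \<not> K_zero A f \<xi> q})" using open_K_nonzero by (simp add: U_def openin_Int)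
        moreover have "U \<inter> {q \<in> topspace M. \<not> K_zero A f \<xi> q} \<subseteq> {q \<in> topspace M. \<not> K_zero A f \<xi> q} \<inter> {q \<in> topspace M. hCC A f \<xi> q = 0}"
          using UZ by (auto simp: Z_def)
        ultimately have "U \<inter> {q \<in> topspace M. \<not> K_zero A f \<xi> q} \<subseteq> U1_part M A f \<xi>"
          unfolding U1_part_def by (rule interior_of_maximal[rotated])
        then show ?thesis using y UZ by (auto simp: Z_def)
      next
        case False
        have "T \<inter> U \<subseteq> U0_part M A f \<xi>"
          unfolding U0_part_def by (rule interior_of_maximal[OF _ TU]) (use False UZ in \<open>auto simp: Z_def\<close>)
        then show ?thesis using T q by blast
      qed
    qed
  qed
qed

end

section \<open>Nondegenerate quadrics\<close>

lemma det3_dual_matrix: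
  assumes "det3 u v w \<noteq> 0"
  obtains L :: "real^3^3" where "det L = 1 / det3 u v w"
    "\<And>c1 c2 c3. L *v (c1 *\<^sub>R u + c2 *\<^sub>R v + c3 *\<^sub>R w) = vector [c1, c2, c3]"
proof -
  define P where "P = transpose (vector [u, v, w] :: real^3^3)"
  have Pv: "P *v x = x $ 1 *\<^sub>R u + x $ 2 *\<^sub>R v + x $ 3 *\<^sub>R w" for x
    by (simp add: P_def vec_eq_iff matrix_vector_mult_def transpose_def sum_3 mult.commute)
  have dP: "det P = det3 u v w" by (simp add: P_def det_transpose)
  then obtain L where L: "L ** P = mat 1" using assms invertible_det_nz[of P] by (auto simp: invertible_def)
  have "det L * det P = 1" using det_mul[of L P] by (simp add: L)
  then have "det L = 1 / det3 u v w" using assms by (simp add: dP eq_divide_eq)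
  moreover have "L *v (c1 *\<^sub>R u + c2 *\<^sub>R v + c3 *\<^sub>R w) = vector [c1, c2, c3]" for c1 c2 c3
    using arg_cong[OF Pv[of "vector [c1, c2, c3]"], of "\<lambda>v. L *v v"] by (simp add: matrix_vector_mul_assoc L)
  ultimately show thesis by (rule that)
qed

lemma matrix_vector_cancel:
  fixes L :: "real^3^3"
  assumes "det L \<noteq> 0" "L *v v = L *v w" shows "v = w"
proof -
  obtain L' where "L' ** L = mat 1" using assms(1) invertible_det_nz[of L] by (auto simp: invertible_def)
  then show ?thesis using arg_cong[OF assms(2), of "\<lambda>v. L' *v v"] by (simp add: matrix_vector_mul_assoc)
qed

text \<open>The substitution $w \mapsto L(w - t)$ changes the symmetric $4 \times 4$ matrix of the quadric by a congruence
  with an invertible matrix.\<close>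

lemma nondegenerate_quadric_affine:
  fixes L :: "real^3^3"
  assumes Q: "nondegenerate_quadric Q" and L: "det L \<noteq> 0"
  shows "nondegenerate_quadric {w. L *v (w - t) \<in> Q}"
proof -
  obtain A b c where A: "transpose A = A" and ker: "\<And>x t. A *v x + t *\<^sub>R b = 0 \<Longrightarrow> b \<bullet> x + t * c = 0 \<Longrightarrow> x = 0 \<and> t = 0"
    and Qe: "Q = {x. x \<bullet> (A *v x) + 2 * (b \<bullet> x) + c = 0}"
    using Q unfolding nondegenerate_quadric_def by blast
  define s where "s = L *v t"
  define A' where "A' = transpose L ** A ** L"
  define b' where "b' = transpose L *v (b - A *v s)"
  define c' where "c' = s \<bullet> (A *v s) - 2 * (b \<bullet> s) + c"
  have tr: "x \<bullet> (transpose L *v y) = (L *v x) \<bullet> y" "(transpose L *v y) \<bullet> x = y \<bullet> (L *v x)" for x y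
    using dot_lmul_matrix[of y L x] by (simp_all add: inner_commute)
  have As: "x \<bullet> (A *v y) = y \<bullet> (A *v x)" for x y
    using dot_lmul_matrix[of x A y] A by (metis inner_commute transpose_matrix_vector)
  have A'v: "A' *v x = transpose L *v (A *v (L *v x))" for x
    by (simp add: A'_def matrix_vector_mul_assoc matrix_mul_assoc)
  have "transpose A' = A'" by (simp add: A'_def matrix_transpose_mul A matrix_mul_assoc)
  moreover have "x = 0 \<and> t' = 0" if k: "A' *v x + t' *\<^sub>R b' = 0" "b' \<bullet> x + t' * c' = 0" for x t'
  proof -
    define v where "v = L *v x - t' *\<^sub>R s"
    have "transpose L *v (A *v v + t' *\<^sub>R b) = A' *v x + t' *\<^sub>R b'"
      by (simp add: A'v b'_def v_def matrix_vector_mult_diff_distrib matrix_vector_right_distrib matrix_vector_mult_scaleR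
          scaleR_diff_right algebra_simps)
    then have "transpose L *v (A *v v + t' *\<^sub>R b) = transpose L *v 0" using k(1) by simp
    then have Av: "A *v v + t' *\<^sub>R b = 0" using matrix_vector_cancel[of "transpose L"] L by (simp add: det_transpose)
    have "b' \<bullet> x = b \<bullet> (L *v x) - s \<bullet> (A *v (L *v x))"
      unfolding b'_def tr inner_diff_left using As[of s "L *v x"] by (simp add: inner_commute)
    moreover have "s \<bullet> (A *v v + t' *\<^sub>R b) = s \<bullet> (A *v (L *v x)) - t' * (s \<bullet> (A *v s)) + t' * (b \<bullet> s)"
      unfolding v_def matrix_vector_mult_diff_distrib matrix_vector_mult_scaleR inner_add_right inner_diff_right inner_scaleR_right
      by (simp add: inner_commute[of b s])
    moreover have "b \<bullet> v = b \<bullet> (L *v x) - t' * (b \<bullet> s)" unfolding v_def inner_diff_right inner_scaleR_right ..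
    moreover have "t' * c' = t' * (s \<bullet> (A *v s)) - 2 * (t' * (b \<bullet> s)) + t' * c" unfolding c'_def by (simp add: algebra_simps)
    ultimately have "b \<bullet> v + t' * c = (b' \<bullet> x + t' * c') + s \<bullet> (A *v v + t' *\<^sub>R b)" by linarith
    then have "b \<bullet> v + t' * c = 0" using k(2) Av by simp
    from ker[OF Av this] have "v = 0" "t' = 0" by auto
    then have "L *v x = L *v 0" by (simp add: v_def)
    then show ?thesis using matrix_vector_cancel[OF L] \<open>t' = 0\<close> by blast
  qed
  moreover have "{w. L *v (w - t) \<in> Q} = {w. w \<bullet> (A' *v w) + 2 * (b' \<bullet> w) + c' = 0}"
  proof -
    have "(L *v (w - t)) \<bullet> (A *v (L *v (w - t))) + 2 * (b \<bullet> (L *v (w - t))) + c = w \<bullet> (A' *v w) + 2 * (b' \<bullet> w) + c'" for w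
    proof -
      have Lw: "L *v (w - t) = L *v w - s" by (simp add: s_def matrix_vector_mult_diff_distrib)
      have 1: "w \<bullet> (A' *v w) = (L *v w) \<bullet> (A *v (L *v w))" unfolding A'v tr ..
      have 2: "b' \<bullet> w = b \<bullet> (L *v w) - (L *v w) \<bullet> (A *v s)"
        unfolding b'_def tr inner_diff_left by (simp add: inner_commute[of "A *v s"])
      show ?thesis
        unfolding Lw 1 2 c'_def
        unfolding matrix_vector_mult_diff_distrib inner_diff_left inner_diff_right
        using As[of s "L *v w"] by (simp add: algebra_simps)
    qed
    then show ?thesis by (simp add: Qe)
  qed
  ultimately show ?thesis unfolding nondegenerate_quadric_def by blast
qed

lemma nondegenerate_paraboloid: "nondegenerate_quadric {w. w $ 3 = w $ 1 * w $ 2}"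
proof -
  define A where "A = (vector [vector [0, 1/2, 0], vector [1/2, 0, 0], vector [0, 0, 0]] :: real^3^3)"
  define b where "b = (vector [0, 0, - 1/2] :: real^3)"
  have Av: "A *v x = vector [x $ 2 / 2, x $ 1 / 2, 0]" for x
    by (simp add: A_def vec_eq_iff forall_3 matrix_vector_mult_def sum_3)
  have "transpose A = A" by (simp add: A_def vec_eq_iff forall_3 transpose_def)
  moreover have "x = 0 \<and> t = 0" if "A *v x + t *\<^sub>R b = 0" "b \<bullet> x + t * 0 = 0" for x t
    using that by (simp add: Av b_def vec_eq_iff forall_3 inner_vec_def sum_3)
  moreover have "{w. w $ 3 = w $ 1 * w $ 2} = {x. x \<bullet> (A *v x) + 2 * (b \<bullet> x) + 0 = 0}"
    by (auto simp: Av b_def inner_vec_def sum_3 field_simps)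
  ultimately show ?thesis unfolding nondegenerate_quadric_def by blast
qed

lemma nondegenerate_hyperboloid:
  assumes "H \<noteq> (0::real)"
  shows "nondegenerate_quadric {w. 2 * (w $ 1 * w $ 2) + H * (w $ 3)\<^sup>2 = 1 / H}"
proof -
  define A where "A = (vector [vector [0, 1, 0], vector [1, 0, 0], vector [0, 0, H]] :: real^3^3)"
  have Av: "A *v x = vector [x $ 2, x $ 1, H * x $ 3]" for x
    by (simp add: A_def vec_eq_iff forall_3 matrix_vector_mult_def sum_3)
  have "transpose A = A" by (simp add: A_def vec_eq_iff forall_3 transpose_def)
  moreover have "x = 0 \<and> t = 0" if "A *v x + t *\<^sub>R 0 = 0" "0 \<bullet> x + t * (- (1 / H)) = 0" for x t
    using that assms by (simp add: Av vec_eq_iff forall_3)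
  moreover have "{w. 2 * (w $ 1 * w $ 2) + H * (w $ 3)\<^sup>2 = 1 / H} = {x. x \<bullet> (A *v x) + 2 * (0 \<bullet> x) + - (1 / H) = 0}"
    by (auto simp: Av inner_vec_def sum_3 power2_eq_square algebra_simps)
  ultimately show ?thesis unfolding nondegenerate_quadric_def by blast
qed

text \<open>If a continuous map \<open>pr\<close> is injective on $Q \cap N$ and restricts to a chart on the image of the surface,
  then that image is cut out of \<open>Q\<close> by an open set.\<close>

lemma graph_patch_open:
  fixes f :: "'a \<Rightarrow> real^3" and pr :: "real^3 \<Rightarrow> real^2"
  assumes "inj_on \<gamma> W" "\<And>q. q \<in> W \<Longrightarrow> pr (f q) = \<gamma> q" "f ` W \<subseteq> Q \<inter> N" "open N" "open (\<gamma> ` W)"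
    "continuous_on UNIV pr" "inj_on pr (Q \<inter> N)"
  shows "inj_on f W" "openin (top_of_set Q) (f ` W)"
proof -
  show "inj_on f W" using assms(1,2) by (metis inj_on_def)
  have "f ` W = Q \<inter> (N \<inter> pr -` (\<gamma> ` W))"
  proof (intro equalityI subsetI)
    fix w assume w: "w \<in> Q \<inter> (N \<inter> pr -` (\<gamma> ` W))"
    then obtain q where q: "q \<in> W" "pr w = \<gamma> q" by auto
    then have "pr w = pr (f q)" using assms(2) by simp
    moreover have "f q \<in> Q \<inter> N" "w \<in> Q \<inter> N" using assms(3) q w by auto
    ultimately show "w \<in> f ` W" using assms(7) q by (auto dest: inj_onD)
  next
    fix w assume "w \<in> f ` W"
    then obtain q where "q \<in> W" "w = f q" by blast
    then show "w \<in> Q \<inter> (N \<inter> pr -` (\<gamma> ` W))" using assms(2,3) by auto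
  qed
  moreover have "open (N \<inter> pr -` (\<gamma> ` W))"
    using open_vimage[OF assms(5,6)] assms(4) by blast
  ultimately show "openin (top_of_set Q) (f ` W)" by (metis openin_open)
qed

section \<open>Frames with one vanishing cubic coefficient\<close>

text \<open>For \<open>H = 0\<close> and \<open>b = 0\<close> the Gauss equation says that the connection form is closed; a potential of it
  rescales the frame to one with vanishing connection form.\<close>

lemma null_frame_flatten:
  assumes nf: "null_frame 0 B F \<xi> X Y \<theta> \<omega> p a b" and B: "convex B" "z0 \<in> B" and b: "\<And>z. z \<in> B \<Longrightarrow> b z = 0"
  obtains l where "smooth_on B l" "\<And>z. l z \<noteq> (0::real)" "\<And>i z. z \<in> B \<Longrightarrow> p i z + pd i l z / l z = 0"
proof -
  interpret null_frame 0 B F \<xi> X Y \<theta> \<omega> p a b by fact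
  have "pd 2 (p 1) z = pd 1 (p 2) z" if "z \<in> B" for z using curl_p[OF that] b[OF that] by simp
  then obtain \<pi> where \<pi>: "smooth_on B \<pi>" "\<And>x. x \<in> B \<Longrightarrow> pd 1 \<pi> x = p 1 x" "\<And>x. x \<in> B \<Longrightarrow> pd 2 \<pi> x = p 2 x"
    using poincare_convex[OF open_S B(1,2) smooth_p smooth_p] by blast
  show thesis
  proof (rule that[of "\<lambda>z. exp (- \<pi> z)"])
    show "smooth_on B (\<lambda>z. exp (- \<pi> z))" by (intro smooth_intros open_S \<pi>)
    fix i z assume z: "z \<in> B"
    have d: "\<pi> differentiable (at z)" "(\<lambda>z. - \<pi> z) differentiable (at z)"
      using smooth_on_differentiable[OF \<pi>(1) z] by auto
    show "p i z + pd i (\<lambda>z. exp (- \<pi> z)) z / exp (- \<pi> z) = 0"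
      using \<pi>(2,3)[OF z] exhaust_2[of i] by (auto simp: pd_exp[OF d(2)] pd_uminus[OF d(1)])
  qed simp
qed

text \<open>For \<open>H = 0\<close> the affine normal is constant. In the linear coordinates given by the frame at one
  point the surface is a graph over the plane, and its third coordinate differs from the product of the
  first two by a function of the second one alone.\<close>

lemma improper_normal_form:
  assumes nf: "null_frame 0 B F \<xi> X Y \<theta> \<omega> p a b" and B: "convex B" "z0 \<in> B"
    and pb: "\<And>i z. z \<in> B \<Longrightarrow> p i z = 0" "\<And>z. z \<in> B \<Longrightarrow> b z = 0"
  obtains L :: "real^3^3" and \<Phi> \<Phi>1 \<alpha> where "det L = - 1 / det3 (X z0) (Y z0) (\<xi> z0)"
    "smooth_on B \<Phi>" "smooth_on B \<Phi>1" "smooth_on B \<alpha>"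
    "\<And>z. z \<in> B \<Longrightarrow> (L *v (F z - F z0)) $ 3 = (L *v (F z - F z0)) $ 1 * (L *v (F z - F z0)) $ 2 + \<Phi> z"
    "\<And>i z. z \<in> B \<Longrightarrow> pd i (\<lambda>z. (L *v (F z - F z0)) $ 1) z = \<alpha> z * \<theta> i z + \<omega> i z"
    "\<And>i z. z \<in> B \<Longrightarrow> pd i (\<lambda>z. (L *v (F z - F z0)) $ 2) z = \<theta> i z"
    "\<And>i z. z \<in> B \<Longrightarrow> pd i \<Phi> z = \<Phi>1 z * \<theta> i z"
    "\<And>i z. z \<in> B \<Longrightarrow> pd i \<Phi>1 z = - 2 * \<alpha> z * \<theta> i z"
    "\<And>i z. z \<in> B \<Longrightarrow> pd i \<alpha> z = a z * \<theta> i z"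
    "\<Phi> z0 = 0" "\<Phi>1 z0 = 0" "\<alpha> z0 = 0"
proof -
  interpret null_frame 0 B F \<xi> X Y \<theta> \<omega> p a b by fact
  have sw: "det3 (Y z) (X z) (\<xi> z) = - det3 (X z) (Y z) (\<xi> z)" for z by (simp add: det3_expand)
  have "det3 (Y z0) (X z0) (\<xi> z0) \<noteq> 0" using det_nz[OF B(2)] by (simp add: sw)
  then obtain L :: "real^3^3" where L: "det L = 1 / det3 (Y z0) (X z0) (\<xi> z0)"
    "\<And>c1 c2 c3. L *v (c1 *\<^sub>R Y z0 + c2 *\<^sub>R X z0 + c3 *\<^sub>R \<xi> z0) = vector [c1, c2, c3]" by (rule det3_dual_matrix) blast
  have Ly: "L *v Y z0 = vector [1, 0, 0]" "L *v X z0 = vector [0, 1, 0]" "L *v \<xi> z0 = vector [0, 0, 1]"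
    using L(2)[of 1 0 0] L(2)[of 0 1 0] L(2)[of 0 0 1] by simp_all
  have "\<xi> z = \<xi> z0" if "z \<in> B" for z
    by (rule constant_on_convex_pd[OF B(1) open_S diffable(2) _ that B(2)]) (simp_all add: dxi)
  then have Lxi: "L *v \<xi> z = vector [0, 0, 1]" if "z \<in> B" for z using that Ly by simp
  have blL: "bounded_linear (\<lambda>v. (L *v v) $ k)" for k
    using bounded_linear_compose[OF bounded_linear_vec_nth matrix_vector_mul_bounded_linear] .
  have sL: "smooth_on B (\<lambda>z. (L *v V z) $ k)" if "smooth_on B V" for V k
    by (rule smooth_on_linear_compose[OF open_S that blL])
  have dL: "pd i (\<lambda>z. (L *v V z) $ k) z = (L *v pd i V z) $ k" if "V differentiable (at z)" for V k i z
    by (rule pd_linear[OF blL that])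
  define x where "x = (\<lambda>k z. (L *v X z) $ k)"
  define y where "y = (\<lambda>k z. (L *v Y z) $ k)"
  define W where "W = (\<lambda>k z. (L *v (F z - F z0)) $ k)"
  have sxy: "smooth_on B (x k)" "smooth_on B (y k)" "smooth_on B (W k)" for k
    unfolding x_def y_def W_def by (intro sL smooth_intros open_S smooth_data)+
  have dif: "x k differentiable (at z)" "y k differentiable (at z)" "W k differentiable (at z)" if "z \<in> B" for k z
    using sxy that smooth_on_differentiable by blast+
  have dx: "pd i (x k) z = a z * \<theta> i z * y k z + \<omega> i z * (if k = 3 then 1 else 0)" if z: "z \<in> B" for i k z
    using exhaust_3[of k] unfolding x_def dL[OF diffable(3)[OF z]] dX[OF z]
    by (auto simp: matrix_vector_right_distrib matrix_vector_mult_scaleR pb z Lxi y_def)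
  have dy: "pd i (y k) z = \<theta> i z * (if k = 3 then 1 else 0)" if z: "z \<in> B" for i k z
    using exhaust_3[of k] unfolding y_def dL[OF diffable(4)[OF z]] dY[OF z]
    by (auto simp: matrix_vector_right_distrib matrix_vector_mult_scaleR pb z Lxi)
  have dW: "pd i (W k) z = \<theta> i z * x k z + \<omega> i z * y k z" if z: "z \<in> B" for i k z
  proof -
    have "(\<lambda>z. F z - F z0) differentiable (at z)" using diffable(1)[OF z] by simp
    moreover have "pd i (\<lambda>z. F z - F z0) z = pd i F z" using pd_diff[OF diffable(1)[OF z], of "\<lambda>_. F z0" i] by simp
    ultimately show ?thesis unfolding W_def
      by (subst dL) (auto simp: dF[OF z] matrix_vector_right_distrib matrix_vector_mult_scaleR x_def y_def)
  qed
  have const: "h z = h z0" if "smooth_on B h" "\<And>i z. z \<in> B \<Longrightarrow> pd i h z = 0" "z \<in> B" for h :: "real^2 \<Rightarrow> real" and z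
    using constant_on_convex_pd[OF B(1) open_S, of h z z0] smooth_on_differentiable[OF that(1)] that(2,3) B(2) by blast
  \<comment> \<open>the coordinates \<open>L\<close> are taken with respect to \<open>(Y, X, \<xi>)\<close>, in this order, at \<open>z0\<close>\<close>
  have y1: "y 1 z = 1" and y2: "y 2 z = 0" if "z \<in> B" for z
    using const[OF sxy(2), of 1 z] const[OF sxy(2), of 2 z] dy that Ly by (simp_all add: y_def)
  have x2: "x 2 z = 1" if "z \<in> B" for z
    using const[OF sxy(1), of 2 z] dx that Ly y2 by (simp add: x_def)
  have y3: "y 3 z = W 2 z" if z: "z \<in> B" for z
  proof -
    have "y 3 z - W 2 z = y 3 z0 - W 2 z0"
    proof (rule const[OF _ _ z])
      show "smooth_on B (\<lambda>z. y 3 z - W 2 z)" by (intro smooth_intros open_S sxy)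
      show "pd i (\<lambda>z. y 3 z - W 2 z) z = 0" if "z \<in> B" for i z
        by (simp add: pd_diff dif that dy dW x2 y2)
    qed
    then show ?thesis using Ly by (simp add: y_def W_def)
  qed
  define \<Phi> where "\<Phi> = (\<lambda>z. W 3 z - W 1 z * W 2 z)"
  define \<Phi>1 where "\<Phi>1 = (\<lambda>z. x 3 z - x 1 z * W 2 z - W 1 z)"
  show thesis
  proof (rule that[of L \<Phi> \<Phi>1 "x 1"])
    show "det L = - 1 / det3 (X z0) (Y z0) (\<xi> z0)" using L(1) by (simp add: sw)
    show "smooth_on B \<Phi>" "smooth_on B \<Phi>1" "smooth_on B (x 1)"
      unfolding \<Phi>_def \<Phi>1_def by (intro smooth_intros open_S sxy)+
    fix i z assume z: "z \<in> B"
    show "(L *v (F z - F z0)) $ 3 = (L *v (F z - F z0)) $ 1 * (L *v (F z - F z0)) $ 2 + \<Phi> z"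
      by (simp add: \<Phi>_def W_def)
    show "pd i (\<lambda>z. (L *v (F z - F z0)) $ 1) z = x 1 z * \<theta> i z + \<omega> i z"
      using dW[OF z, of i 1] y1[OF z] by (simp add: W_def)
    show "pd i (\<lambda>z. (L *v (F z - F z0)) $ 2) z = \<theta> i z"
      using dW[OF z, of i 2] y2[OF z] x2[OF z] by (simp add: W_def)
    show "pd i \<Phi> z = \<Phi>1 z * \<theta> i z"
      unfolding \<Phi>_def \<Phi>1_def
      by (simp add: pd_diff pd_mult dif[OF z] differentiable_mult dW[OF z] y1[OF z] y2[OF z] y3[OF z] x2[OF z] algebra_simps)
    show "pd i \<Phi>1 z = - 2 * x 1 z * \<theta> i z"
    proof -
      have d1: "(\<lambda>z. x 1 z * W 2 z) differentiable (at z)" "(\<lambda>z. x 3 z - x 1 z * W 2 z) differentiable (at z)"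
        by (intro differentiable_mult differentiable_diff dif z)+
      have "pd i \<Phi>1 z = pd i (x 3) z - (pd i (x 1) z * W 2 z + x 1 z * pd i (W 2) z) - pd i (W 1) z"
        unfolding \<Phi>1_def pd_diff[OF d1(2) dif(3)[OF z]] pd_diff[OF dif(1)[OF z] d1(1)] pd_mult[OF dif(1)[OF z] dif(3)[OF z]]
        by (simp add: algebra_simps)
      then show ?thesis by (simp add: dW[OF z] dx[OF z] y1[OF z] y2[OF z] y3[OF z] x2[OF z] algebra_simps)
    qed
    show "pd i (x 1) z = a z * \<theta> i z" by (simp add: dx[OF z] y1[OF z])
  qed (use Ly in \<open>simp_all add: \<Phi>_def \<Phi>1_def x_def W_def\<close>)
qed

text \<open>For \<open>H \<noteq> 0\<close> and vanishing cubic form the symmetric tensor \<open>X \<otimes> Y + Y \<otimes> X + (1/H) \<xi> \<otimes> \<xi>\<close> is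
  constant in space. Its inverse matrix is a quadratic form that takes the value \<open>H\<close> on \<open>\<xi>\<close>.\<close>

lemma proper_quadric_equation:
  fixes L :: "real^3^3"
  assumes nf: "null_frame H B F \<xi> X Y \<theta> \<omega> p a b" and B: "convex B" "z0 \<in> B" "z \<in> B" and H: "H \<noteq> 0"
    and ab: "\<And>z. z \<in> B \<Longrightarrow> a z = 0" "\<And>z. z \<in> B \<Longrightarrow> b z = 0"
    and L: "L *v X z0 = vector [1, 0, 0]" "L *v Y z0 = vector [0, 1, 0]" "L *v \<xi> z0 = vector [0, 0, 1]"
  shows "2 * ((L *v \<xi> z) $ 1 * (L *v \<xi> z) $ 2) + H * ((L *v \<xi> z) $ 3)\<^sup>2 = H"
proof -
  interpret null_frame H B F \<xi> X Y \<theta> \<omega> p a b by fact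
  have blL: "bounded_linear (\<lambda>v. (L *v v) $ k)" for k
    using bounded_linear_compose[OF bounded_linear_vec_nth matrix_vector_mul_bounded_linear] .
  define x where "x = (\<lambda>k z. (L *v X z) $ k)"
  define y where "y = (\<lambda>k z. (L *v Y z) $ k)"
  define n where "n = (\<lambda>k z. (L *v \<xi> z) $ k)"
  have s: "smooth_on B (x k)" "smooth_on B (y k)" "smooth_on B (n k)" for k
    unfolding x_def y_def n_def by (intro smooth_on_linear_compose[OF open_S _ blL] smooth_data)+
  have d: "x k differentiable (at z)" "y k differentiable (at z)" "n k differentiable (at z)" if "z \<in> B" for k z
    using s that smooth_on_differentiable by blast+
  have dx: "pd i (x k) z = p i z * x k z + \<omega> i z * n k z" if z: "z \<in> B" for i k z
    unfolding x_def pd_linear[OF blL diffable(3)[OF z]] dX[OF z]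
    by (simp add: matrix_vector_right_distrib matrix_vector_mult_scaleR ab z n_def)
  have dy: "pd i (y k) z = - p i z * y k z + \<theta> i z * n k z" if z: "z \<in> B" for i k z
    unfolding y_def pd_linear[OF blL diffable(4)[OF z]] dY[OF z]
    by (simp add: matrix_vector_mult_diff_distrib matrix_vector_right_distrib matrix_vector_mult_scaleR ab z n_def)
  have dn: "pd i (n k) z = - (H * \<theta> i z) * x k z - (H * \<omega> i z) * y k z" if z: "z \<in> B" for i k z
  proof -
    have "pd i \<xi> z = (- (H * \<theta> i z)) *\<^sub>R X z + (- (H * \<omega> i z)) *\<^sub>R Y z"
      using dxi[OF z, of i] by (simp add: algebra_simps)
    then have "L *v pd i \<xi> z = (- (H * \<theta> i z)) *\<^sub>R (L *v X z) + (- (H * \<omega> i z)) *\<^sub>R (L *v Y z)"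
      by (simp only: matrix_vector_right_distrib matrix_vector_mult_scaleR)
    then show ?thesis unfolding n_def pd_linear[OF blL diffable(2)[OF z]] x_def y_def by simp
  qed
  define T where "T = (\<lambda>j k z. x j z * y k z + y j z * x k z + (1 / H) * (n j z * n k z))"
  have sT: "smooth_on B (T j k)" for j k unfolding T_def by (intro smooth_intros open_S s)
  have "pd i (T j k) z = 0" if z: "z \<in> B" for i j k z
  proof -
    note m = differentiable_mult[OF d(1)[OF z, of j] d(2)[OF z, of k]] differentiable_mult[OF d(2)[OF z, of j] d(1)[OF z, of k]]
      differentiable_mult[OF d(3)[OF z, of j] d(3)[OF z, of k]]
    have "pd i (T j k) z = pd i (\<lambda>z. x j z * y k z) z + pd i (\<lambda>z. y j z * x k z) z + (1 / H) * pd i (\<lambda>z. n j z * n k z) z"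
      unfolding T_def pd_add[OF differentiable_add[OF m(1,2)] differentiable_mult[OF differentiable_const m(3)]] pd_add[OF m(1,2)]
        pd_linear[OF bounded_linear_mult_right m(3)] ..
    also have "pd i (\<lambda>z. n j z * n k z) z = H * ((- \<theta> i z * x j z - \<omega> i z * y j z) * n k z + n j z * (- \<theta> i z * x k z - \<omega> i z * y k z))"
      by (simp add: pd_mult d[OF z] dn[OF z] algebra_simps)
    finally show ?thesis using H by (simp add: pd_mult d[OF z] dx[OF z] dy[OF z] algebra_simps)
  qed
  then have Tc: "T j k z = T j k z0" for j k
    using constant_on_convex_pd[OF B(1) open_S, of "T j k" z z0] smooth_on_differentiable[OF sT] B(2,3) by blast
  define J where "J = (vector [vector [0, 1, 0], vector [1, 0, 0], vector [0, 0, 1 / H]] :: real^3^3)"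
  define J' where "J' = (vector [vector [0, 1, 0], vector [1, 0, 0], vector [0, 0, H]] :: real^3^3)"
  define P where "P = transpose (vector [L *v X z, L *v Y z, L *v \<xi> z] :: real^3^3)"
  have JJ: "J ** J' = mat 1" using H by (simp add: J_def J'_def matrix_matrix_mult_def vec_eq_iff forall_3 sum_3 mat_def)
  have T0: "T j k z0 = J $ j $ k" for j k
    using exhaust_3[of j] exhaust_3[of k] L by (auto simp: T_def x_def y_def n_def J_def)
  have "(P ** J ** transpose P) $ j $ k = T j k z" for j k
    by (simp add: P_def J_def T_def x_def y_def n_def matrix_matrix_mult_def transpose_def sum_3 algebra_simps)
  then have PJP: "P ** J ** transpose P = J" using Tc T0 by (simp add: vec_eq_iff)
  have "(P ** J) ** (transpose P ** J') = mat 1" using PJP JJ by (simp add: matrix_mul_assoc)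
  then have "(transpose P ** J') ** (P ** J) = mat 1" by (simp add: matrix_left_right_inverse)
  then have "(transpose P ** J' ** P) ** (J ** J') = J'" by (simp add: matrix_mul_assoc)
  then have "transpose P ** J' ** P = J'" by (simp add: JJ)
  then have "(transpose P ** J' ** P) $ 3 $ 3 = J' $ 3 $ 3" by simp
  then show ?thesis
    by (simp add: P_def J'_def matrix_matrix_mult_def transpose_def sum_3 power2_eq_square algebra_simps)
qed

context indefinite_sphere
begin

lemma restricted_surface:
  assumes U: "openin M U"
  shows "blaschke_surface (subtopology M U) (restrict_atlas A U) f \<xi>" "indefinite_surface (restrict_atlas A U) f \<xi>"
proof -
  have Us: "U \<subseteq> topspace M" using U openin_subset by blast
  have ch: "chart_on (subtopology M U) (fst c \<inter> U, snd c)" if "c \<in> A" for c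
    using chart_on_restrict[OF atlas_chart[OF that] U] atlas_chart[OF that]
    by (auto simp: chart_on_def subtopology_subtopology Int_commute Int_left_commute openin_subtopology_Int2 inf_assoc)
  have local: "\<exists>T X Y \<theta> \<omega> p a b. x \<in> T \<and> null_frame H T (in_chart (fst c \<inter> U, snd c) f) (in_chart (fst c \<inter> U, snd c) \<xi>) X Y \<theta> \<omega> p a b"
    if c: "c \<in> A" and x: "x \<in> snd c ` (fst c \<inter> U)" for c x
  proof -
    note co = atlas_chart[OF c]
    have "\<exists>T X Y \<theta> \<omega> p a b. x \<in> T \<and> T \<subseteq> snd c ` fst c \<and> null_frame H T (in_chart c f) (in_chart c \<xi>) X Y \<theta> \<omega> p a b"
      by (rule null_frame_of_sphere)
        (use c co x sphere indef in \<open>auto simp: chart_on_def affine_sphere_def blaschke_surface_def indefinite_surface_def\<close>)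
    then obtain T X Y \<theta> \<omega> p a b where T: "x \<in> T" and nf: "null_frame H T (in_chart c f) (in_chart c \<xi>) X Y \<theta> \<omega> p a b" by blast
    define T' where "T' = T \<inter> snd c ` (fst c \<inter> U)"
    have oT: "open T'" using nf chart_open_image[OF co U] by (simp add: T'_def open_Int null_frame_def)
    have "null_frame H T' (in_chart (fst c \<inter> U, snd c) f) (in_chart (fst c \<inter> U, snd c) \<xi>) X Y \<theta> \<omega> p a b"
      by (rule null_frame_cong[OF null_frame_restrict[OF nf oT]])
         (auto simp: T'_def intro!: in_chart_restrict[OF co U])
    then show ?thesis using T x by (metis IntI T'_def)
  qed
  have sm: "smooth_on (snd c ` (fst c \<inter> U)) (in_chart (fst c \<inter> U, snd c) h)"
    if c: "c \<in> A" and h: "smooth_on (snd c ` fst c) (in_chart c h)" for c and h :: "'a \<Rightarrow> real^3"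
  proof -
    have "smooth_on (snd c ` (fst c \<inter> U)) (in_chart c h)" by (rule smooth_on_subset[OF h]) auto
    moreover have "smooth_on (snd c ` (fst c \<inter> U)) (in_chart (fst c \<inter> U, snd c) h) = smooth_on (snd c ` (fst c \<inter> U)) (in_chart c h)"
      by (rule smooth_on_cong[OF chart_open_image[OF atlas_chart[OF c] U]]) (rule in_chart_restrict[OF atlas_chart[OF c] U])
    ultimately show ?thesis by simp
  qed
  have "smooth_surface (subtopology M U) (restrict_atlas A U)"
    unfolding smooth_surface_def
  proof (intro conjI)
    show "Hausdorff_space (subtopology M U)" "second_countable (subtopology M U)"
      using surface by (auto simp: smooth_surface_def Hausdorff_space_subtopology second_countable_subtopology)
    show "topspace (subtopology M U) = (\<Union>c\<in>restrict_atlas A U. fst c)"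
      using surface Us by (auto simp: smooth_surface_def restrict_atlas_def)
    show "\<forall>c\<in>restrict_atlas A U. chart_on (subtopology M U) c" using ch by (auto simp: restrict_atlas_def)
    show "\<forall>c\<in>restrict_atlas A U. \<forall>d\<in>restrict_atlas A U. chart_compatible c d"
      using chart_compatible_restrict[OF atlas_chart atlas_chart U U] surface
      by (auto simp: restrict_atlas_def smooth_surface_def)
  qed
  moreover have "\<forall>c\<in>A. smooth_on (snd c ` fst c) (in_chart c f) \<and> smooth_on (snd c ` fst c) (in_chart c \<xi>)"
    using sphere by (simp add: affine_sphere_def blaschke_surface_def)
  ultimately show "blaschke_surface (subtopology M U) (restrict_atlas A U) f \<xi>"
  proof -
    assume s: "\<forall>c\<in>A. smooth_on (snd c ` fst c) (in_chart c f) \<and> smooth_on (snd c ` fst c) (in_chart c \<xi>)"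
      and S: "smooth_surface (subtopology M U) (restrict_atlas A U)"
    have "blaschke_at (in_chart (fst c \<inter> U, snd c) f) (in_chart (fst c \<inter> U, snd c) \<xi>) x" if "c \<in> A" "x \<in> snd c ` (fst c \<inter> U)" for c x
      using local[OF that] null_frame.blaschke by blast
    then show ?thesis using s S sm unfolding blaschke_surface_def restrict_atlas_def by simp
  qed
  show "indefinite_surface (restrict_atlas A U) f \<xi>"
  proof -
    have "indefinite_at (in_chart (fst c \<inter> U, snd c) f) (in_chart (fst c \<inter> U, snd c) \<xi>) x" if "c \<in> A" "x \<in> snd c ` (fst c \<inter> U)" for c x
      using local[OF that] null_frame.indefinite by blast
    then show ?thesis unfolding indefinite_surface_def restrict_atlas_def by simp
  qed
qed

text \<open>The first two affine coordinates of the normal form serve as coordinates on the surface. In them the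
  form \<open>\<theta>\<close> is \<open>dy\<^sub>2\<close>, so that the function \<open>\<Phi>\<close>, whose differential is a multiple of \<open>\<theta>\<close>, depends on
  the second coordinate only.\<close>

lemma improper_chart:
  assumes H0: "H = 0" and fr: "framed (D, \<phi>) X Y \<theta> \<omega> p a b" "q \<in> D" "convex (\<phi> ` D)" and b: "\<And>z. z \<in> \<phi> ` D \<Longrightarrow> b z = 0"
  obtains W \<gamma> r and L :: "real^3^3" and c \<Phi> \<Phi>1 \<Phi>2 where "local_chart M A (W, \<gamma>)" "q \<in> W" "W \<subseteq> D" "r > 0" "\<gamma> ` W = ball 0 r" "\<bar>det L\<bar> = 1"
    "\<And>y. y \<in> ball 0 r \<Longrightarrow> L *v (in_chart (W, \<gamma>) f y - c) = vector [y $ 1, y $ 2, y $ 1 * y $ 2 + \<Phi> y]"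
    "smooth_on (ball 0 r) \<Phi>" "smooth_on (ball 0 r) \<Phi>1" "smooth_on (ball 0 r) \<Phi>2"
    "\<And>y. y \<in> ball 0 r \<Longrightarrow> pd 1 \<Phi> y = 0 \<and> pd 2 \<Phi> y = \<Phi>1 y \<and> pd 1 \<Phi>1 y = 0 \<and> pd 2 \<Phi>1 y = \<Phi>2 y \<and> pd 1 \<Phi>2 y = 0"
    "(\<forall>z\<in>\<phi> ` D. a z \<noteq> 0) \<Longrightarrow> (\<forall>y\<in>ball 0 r. pd 2 \<Phi>2 y \<noteq> 0)" "(\<forall>z\<in>\<phi> ` D. a z = 0) \<Longrightarrow> (\<forall>y\<in>ball 0 r. \<Phi> y = 0)"
proof -
  define B where "B = \<phi> ` D"
  define z0 where "z0 = \<phi> q"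
  have z0: "z0 \<in> B" using fr(2) by (simp add: B_def z0_def)
  have nf0: "null_frame 0 B (in_chart (D, \<phi>) f) (in_chart (D, \<phi>) \<xi>) X Y \<theta> \<omega> p a b"
    using framed_null_frame[OF fr(1)] by (simp add: B_def H0)
  have conv: "convex B" using fr(3) by (simp add: B_def)
  obtain l where l: "smooth_on B l" "\<And>z. l z \<noteq> (0::real)" "\<And>i z. z \<in> B \<Longrightarrow> p i z + pd i l z / l z = 0"
    using null_frame_flatten[OF nf0 conv z0] b by (auto simp: B_def)
  define X' Y' \<theta>' \<omega>' p' a' b' where "X' = (\<lambda>z. l z *\<^sub>R X z)" and "Y' = (\<lambda>z. inverse (l z) *\<^sub>R Y z)"
    and "\<theta>' = (\<lambda>i z. \<theta> i z / l z)" and "\<omega>' = (\<lambda>i z. l z * \<omega> i z)" and "p' = (\<lambda>i z. p i z + pd i l z / l z)"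
    and "a' = (\<lambda>z. a z * l z ^ 3)" and "b' = (\<lambda>z. b z / l z ^ 3)"
  note defs = X'_def Y'_def \<theta>'_def \<omega>'_def p'_def a'_def b'_def
  have fr': "framed (D, \<phi>) X' Y' \<theta>' \<omega>' p' a' b'"
    unfolding defs by (rule framed_rescale[OF fr(1)]) (use l in \<open>simp_all add: B_def\<close>)
  have nf: "null_frame 0 B (in_chart (D, \<phi>) f) (in_chart (D, \<phi>) \<xi>) X' Y' \<theta>' \<omega>' p' a' b'"
    using framed_null_frame[OF fr'] by (simp add: B_def H0)
  interpret null_frame 0 B "in_chart (D, \<phi>) f" "in_chart (D, \<phi>) \<xi>" X' Y' \<theta>' \<omega>' p' a' b' by fact
  define F where "F = in_chart (D, \<phi>) f"
  have p0: "p' i z = 0" and b0: "b' z = 0" if "z \<in> B" for i z using l(3)[OF that] b that by (auto simp: p'_def b'_def B_def)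
  obtain L :: "real^3^3" and \<Phi> \<Phi>1 \<alpha> where L: "det L = - 1 / det3 (X' z0) (Y' z0) (in_chart (D, \<phi>) \<xi> z0)"
    and s: "smooth_on B \<Phi>" "smooth_on B \<Phi>1" "smooth_on B \<alpha>"
    and W3: "\<And>z. z \<in> B \<Longrightarrow> (L *v (F z - F z0)) $ 3 = (L *v (F z - F z0)) $ 1 * (L *v (F z - F z0)) $ 2 + \<Phi> z"
    and dW: "\<And>i z. z \<in> B \<Longrightarrow> pd i (\<lambda>z. (L *v (F z - F z0)) $ 1) z = \<alpha> z * \<theta>' i z + \<omega>' i z"
    "\<And>i z. z \<in> B \<Longrightarrow> pd i (\<lambda>z. (L *v (F z - F z0)) $ 2) z = \<theta>' i z"
    and d\<Phi>: "\<And>i z. z \<in> B \<Longrightarrow> pd i \<Phi> z = \<Phi>1 z * \<theta>' i z" "\<And>i z. z \<in> B \<Longrightarrow> pd i \<Phi>1 z = - 2 * \<alpha> z * \<theta>' i z"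
    "\<And>i z. z \<in> B \<Longrightarrow> pd i \<alpha> z = a' z * \<theta>' i z" and i0: "\<Phi> z0 = 0" "\<Phi>1 z0 = 0" "\<alpha> z0 = 0"
    by (rule improper_normal_form[OF nf conv z0 p0 b0, folded F_def]) blast+
  have detL: "\<bar>det L\<bar> = 1" using det_frame[OF z0] L by (simp add: abs_divide)
  define w where "w = (\<lambda>k z. (L *v (F z - F z0)) $ k)"
  have blL: "bounded_linear (\<lambda>v. (L *v v) $ k)" for k
    using bounded_linear_compose[OF bounded_linear_vec_nth matrix_vector_mul_bounded_linear] .
  have sw: "smooth_on B (w k)" for k
    unfolding w_def F_def by (intro smooth_on_linear_compose[OF open_S _ blL] smooth_intros open_S smooth_F)
  define G where "G = (\<lambda>z. vector [w 1 z, w 2 z] :: real^2)"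
  have sG: "smooth_on B G" unfolding G_def by (intro smooth_intros open_S sw)
  have pG: "pd i G z $ 1 = \<alpha> z * \<theta>' i z + \<omega>' i z" "pd i G z $ 2 = \<theta>' i z" if z: "z \<in> B" for i z
    using pd_nth[OF smooth_on_differentiable[OF sG z], of i 1] pd_nth[OF smooth_on_differentiable[OF sG z], of i 2] dW[OF z]
    by (simp_all add: G_def w_def)
  have J: "pd 1 G (\<phi> q) $ 1 * pd 2 G (\<phi> q) $ 2 - pd 1 G (\<phi> q) $ 2 * pd 2 G (\<phi> q) $ 1 \<noteq> 0"
    using coframe[OF z0] unfolding z0_def[symmetric] pG[OF z0] by (simp add: algebra_simps)
  have G0: "G (\<phi> q) = 0" unfolding G_def z0_def[symmetric] w_def by (simp add: vec_eq_iff forall_2)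
  obtain W BB g where W: "q \<in> W" "W \<subseteq> D" "\<exists>r>0. BB = ball (G (\<phi> q)) r" "(G \<circ> \<phi>) ` W = BB" "smooth_on BB g"
    "\<And>y. y \<in> BB \<Longrightarrow> g y \<in> \<phi> ` D" "\<And>y. y \<in> BB \<Longrightarrow> G (g y) = y" "\<And>y. y \<in> BB \<Longrightarrow> in_chart (W, G \<circ> \<phi>) f y = in_chart (D, \<phi>) f (g y)"
    and frW: "framed (W, G \<circ> \<phi>) (\<lambda>z. X' (g z)) (\<lambda>z. Y' (g z))
    (\<lambda>i z. pd i g z $ 1 * \<theta>' 1 (g z) + pd i g z $ 2 * \<theta>' 2 (g z)) (\<lambda>i z. pd i g z $ 1 * \<omega>' 1 (g z) + pd i g z $ 2 * \<omega>' 2 (g z))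
    (\<lambda>i z. pd i g z $ 1 * p' 1 (g z) + pd i g z $ 2 * p' 2 (g z)) (\<lambda>z. a' (g z)) (\<lambda>z. b' (g z))"
    by (rule framed_new_coords_pair[OF fr' fr(2) sG[unfolded B_def] J open_UNIV UNIV_I]) (rule that; assumption)
  obtain r where r: "r > 0" "BB = ball 0 r" using W(3) G0 by auto
  note W = W[unfolded r(2), folded B_def F_def]
  have oB: "open (ball 0 r :: (real^2) set)" by simp
  have gB: "g ` ball 0 r \<subseteq> B" using W(6) by auto
  have comp: "smooth_on (ball 0 r) (\<lambda>y. h (g y))" if "smooth_on B h" for h :: "real^2 \<Rightarrow> real"
    by (rule smooth_on_compose[OF oB open_S gB that W(5)])
  have w2: "pd i g y $ 1 * \<theta>' 1 (g y) + pd i g y $ 2 * \<theta>' 2 (g y) = (if i = 2 then 1 else 0)" if y: "y \<in> ball 0 r" for i y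
  proof -
    have "pd i (\<lambda>y. w 2 (g y)) y = pd i (\<lambda>y. y $ 2) y"
    proof (rule pd_cong[OF oB y])
      fix y :: "real^2" assume "y \<in> ball 0 r"
      then have "G (g y) $ 2 = y $ 2" using W(7) by simp
      then show "w 2 (g y) = y $ 2" by (simp add: G_def)
    qed
    moreover have "pd i (w 2) (g y) = \<theta>' i (g y)" for i using dW(2)[OF W(6)[OF y]] by (simp only: w_def)
    ultimately show ?thesis
      using pd_compose[OF smooth_on_differentiable[OF sw W(6)[OF y]] smooth_on_differentiable[OF W(5) y], of i 2]
      by (simp add: pd_coord)
  qed
  have chain: "pd i (\<lambda>y. h (g y)) y = k (g y) * (if i = 2 then 1 else 0)"
    if h: "smooth_on B h" and k: "\<And>i z. z \<in> B \<Longrightarrow> pd i h z = k z * \<theta>' i z" and y: "y \<in> ball 0 r" for h k :: "real^2 \<Rightarrow> real" and i y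
  proof -
    have "pd i (\<lambda>y. h (g y)) y = k (g y) * (pd i g y $ 1 * \<theta>' 1 (g y) + pd i g y $ 2 * \<theta>' 2 (g y))"
      using pd_compose[OF smooth_on_differentiable[OF h W(6)[OF y]] smooth_on_differentiable[OF W(5) y], of i] k[OF W(6)[OF y]]
      by (simp add: algebra_simps)
    then show ?thesis unfolding w2[OF y] .
  qed
  have s2: "smooth_on B (\<lambda>z. - 2 * \<alpha> z)" by (intro smooth_intros open_S s)
  have d2: "pd i (\<lambda>z. - 2 * \<alpha> z) z = (- 2 * a' z) * \<theta>' i z" if "z \<in> B" for i z
    using pd_linear[OF bounded_linear_mult_right smooth_on_differentiable[OF s(3) that], of i "- 2"] d\<Phi>(3)[OF that] by simp
  show thesis
  proof (rule that[of W "G \<circ> \<phi>" r L "F z0" "\<lambda>y. \<Phi> (g y)" "\<lambda>y. \<Phi>1 (g y)" "\<lambda>y. - 2 * \<alpha> (g y)"])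
    show "local_chart M A (W, G \<circ> \<phi>)" using frW by (simp add: framed_def)
    show "smooth_on (ball 0 r) (\<lambda>y. \<Phi> (g y))" "smooth_on (ball 0 r) (\<lambda>y. \<Phi>1 (g y))" "smooth_on (ball 0 r) (\<lambda>y. - 2 * \<alpha> (g y))"
      using comp[OF s(1)] comp[OF s(2)] comp[OF s2] by simp_all
    show "L *v (in_chart (W, G \<circ> \<phi>) f y - F z0) = vector [y $ 1, y $ 2, y $ 1 * y $ 2 + \<Phi> (g y)]" if y: "y \<in> ball 0 r" for y
    proof -
      have "w 1 (g y) = y $ 1" "w 2 (g y) = y $ 2"
        using arg_cong[OF W(7)[OF y], of "\<lambda>v. v $ 1"] arg_cong[OF W(7)[OF y], of "\<lambda>v. v $ 2"] by (simp_all add: G_def)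
      then show ?thesis unfolding W(8)[OF y] using W3[OF W(6)[OF y]] by (simp add: w_def vec_eq_iff[where x = "L *v _"] forall_3)
    qed
    show "pd 1 (\<lambda>y. \<Phi> (g y)) y = 0 \<and> pd 2 (\<lambda>y. \<Phi> (g y)) y = \<Phi>1 (g y) \<and> pd 1 (\<lambda>y. \<Phi>1 (g y)) y = 0 \<and>
        pd 2 (\<lambda>y. \<Phi>1 (g y)) y = - 2 * \<alpha> (g y) \<and> pd 1 (\<lambda>y. - 2 * \<alpha> (g y)) y = 0" if y: "y \<in> ball 0 r" for y
      using chain[OF s(1) d\<Phi>(1) y] chain[OF s(2) d\<Phi>(2) y] chain[OF s2 d2 y] by simp
    show "\<forall>y\<in>ball 0 r. pd 2 (\<lambda>y. - 2 * \<alpha> (g y)) y \<noteq> 0" if "\<forall>z\<in>\<phi> ` D. a z \<noteq> 0"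
    proof
      fix y :: "real^2" assume y: "y \<in> ball 0 r"
      have "a (g y) \<noteq> 0" using that W(6)[OF y] unfolding B_def by blast
      then have "a' (g y) \<noteq> 0" using l(2) by (simp add: a'_def)
      then show "pd 2 (\<lambda>y. - 2 * \<alpha> (g y)) y \<noteq> 0" using chain[OF s2 d2 y, of 2] by simp
    qed
    show "\<forall>y\<in>ball 0 r. \<Phi> (g y) = 0" if a0: "\<forall>z\<in>\<phi> ` D. a z = 0"
    proof -
      have c: "h z = h z0" if "smooth_on B h" "\<And>i z. z \<in> B \<Longrightarrow> pd i h z = 0" "z \<in> B" for h :: "real^2 \<Rightarrow> real" and z
        using constant_on_convex_pd[OF conv open_S, of h z z0] smooth_on_differentiable[OF that(1)] that(2,3) z0 by blast
      have "a z = 0" if "z \<in> B" for z using a0 that unfolding B_def by blast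
      then have "a' z = 0" if "z \<in> B" for z using that by (simp add: a'_def)
      then have 1: "\<alpha> z = 0" if "z \<in> B" for z using c[OF s(3) _ that] d\<Phi>(3) i0 by simp
      then have 2: "\<Phi>1 z = 0" if "z \<in> B" for z using c[OF s(2) _ that] d\<Phi>(2) i0 by simp
      then have "\<Phi> z = 0" if "z \<in> B" for z using c[OF s(1) _ that] d\<Phi>(1) i0 by simp
      then show ?thesis using W(6) by blast
    qed
  qed (use W r detL in auto)
qed

lemma U0_chart:
  assumes q: "q \<in> U0_part M A f \<xi>"
  obtains D \<phi> X Y \<theta> \<omega> p a b where "framed (D, \<phi>) X Y \<theta> \<omega> p a b" "q \<in> D" "D \<subseteq> U0_part M A f \<xi>" "convex (\<phi> ` D)"
    "\<And>z. z \<in> \<phi> ` D \<Longrightarrow> a z = 0" "\<And>z. z \<in> \<phi> ` D \<Longrightarrow> b z = 0"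
proof -
  have U: "openin M (U0_part M A f \<xi>)" "U0_part M A f \<xi> \<subseteq> {p \<in> topspace M. K_zero A f \<xi> p}"
    unfolding U0_part_def by (auto simp: interior_of_subset)
  obtain c X Y \<theta> \<omega> p a b where fr: "framed c X Y \<theta> \<omega> p a b" "q \<in> fst c"
    using framed_exists[of q] q U by blast
  note co = framed_chart[OF fr(1)]
  obtain D where D: "framed (D, snd c) X Y \<theta> \<omega> p a b" "q \<in> D" "D \<subseteq> fst c" "convex (snd c ` D)" "snd c ` D \<subseteq> snd c ` (fst c \<inter> U0_part M A f \<xi>)"
    by (rule framed_ball[OF fr chart_open_image[OF co U(1)]]) (use fr q in auto)
  have DU: "D \<subseteq> U0_part M A f \<xi>"
  proof
    fix x assume "x \<in> D"
    then obtain y where "y \<in> fst c \<inter> U0_part M A f \<xi>" "snd c x = snd c y" using D(5) by blast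
    then show "x \<in> U0_part M A f \<xi>" using chart_inj[OF co] D(3) \<open>x \<in> D\<close> by (auto dest: inj_onD)
  qed
  have "a z = 0 \<and> b z = 0" if "z \<in> snd c ` D" for z
  proof -
    from that obtain x where x: "x \<in> D" "z = snd c x" by blast
    then have "K_zero A f \<xi> x" using DU U by blast
    then show ?thesis using framed_invariants(2)[OF D(1), of x] x by simp
  qed
  then show thesis using that[OF D(1,2) DU D(4)] by blast
qed

text \<open>For \<open>H = 0\<close> the normal form is the graph of \<open>xy\<close>. For \<open>H \<noteq> 0\<close> the point \<open>f + \<xi>/H\<close> is
  constant, and \<open>f\<close> inherits the quadratic equation of \<open>\<xi>\<close>. The third coordinate is nonzero at the given
  point, so the half of the quadric on which it keeps its sign is a graph over the first two coordinates.\<close>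

lemma U0_quadric_patch:
  assumes q: "q \<in> U0_part M A f \<xi>"
  shows "\<exists>W Q. openin M W \<and> q \<in> W \<and> W \<subseteq> U0_part M A f \<xi> \<and> inj_on f W \<and> nondegenerate_quadric Q \<and> openin (top_of_set Q) (f ` W)"
proof -
  obtain D \<phi> X Y \<theta> \<omega> p a b where fr: "framed (D, \<phi>) X Y \<theta> \<omega> p a b" "q \<in> D" "D \<subseteq> U0_part M A f \<xi>" "convex (\<phi> ` D)"
    and ab: "\<And>z. z \<in> \<phi> ` D \<Longrightarrow> a z = 0" "\<And>z. z \<in> \<phi> ` D \<Longrightarrow> b z = 0"
    using U0_chart[OF q] by blast
  have chartW: "openin M W \<and> inj_on \<gamma> W \<and> open (\<gamma> ` W)" if "local_chart M A (W, \<gamma>)" for W \<gamma>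
    using that chart_inj[of M "(W, \<gamma>)"] by (auto simp: local_chart_def chart_on_def)
  have cont: "continuous_on UNIV (\<lambda>w. vector [(L *v (w - c)) $ 1, (L *v (w - c)) $ 2] :: real^2)" for L :: "real^3^3" and c
  proof -
    have "smooth_on UNIV (\<lambda>w. vector [(L *v (w - c)) $ 1, (L *v (w - c)) $ 2] :: real^2)"
      by (intro smooth_intros open_UNIV)
    then show ?thesis by (rule smooth_on_continuous_on)
  qed
  show ?thesis
  proof (cases "H = 0")
    case True
    obtain W \<gamma> r and L :: "real^3^3" and c \<Phi> where W: "local_chart M A (W, \<gamma>)" "q \<in> W" "W \<subseteq> D" "\<gamma> ` W = ball 0 r" "\<bar>det L\<bar> = 1"
      "\<And>y. y \<in> ball 0 r \<Longrightarrow> L *v (in_chart (W, \<gamma>) f y - c) = vector [y $ 1, y $ 2, y $ 1 * y $ 2 + \<Phi> y]"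
      "\<And>y. y \<in> ball 0 r \<Longrightarrow> \<Phi> y = 0"
      by (rule improper_chart[OF True fr(1,2,4) ab(2)]) (use ab(1) in \<open>blast+\<close>)
    have coW: "chart_on M (W, \<gamma>)" using W(1) by (simp add: local_chart_def)
    define Q where "Q = {w. L *v (w - c) \<in> {w. w $ 3 = w $ 1 * w $ 2}}"
    define pr where "pr = (\<lambda>w. vector [(L *v (w - c)) $ 1, (L *v (w - c)) $ 2] :: real^2)"
    have dL: "det L \<noteq> 0" using W(5) by auto
    have val: "L *v (f x - c) = vector [\<gamma> x $ 1, \<gamma> x $ 2, \<gamma> x $ 1 * \<gamma> x $ 2]" if "x \<in> W" for x
    proof -
      have "\<gamma> x \<in> ball 0 r" using that W(4) by blast
      then show ?thesis using W(6,7)[of "\<gamma> x"] in_chart_apply[OF coW, of x f] that by simp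
    qed
    have pr: "pr (f x) = \<gamma> x" if "x \<in> W" for x by (simp add: pr_def val[OF that] vec_eq_iff forall_2)
    have fQ: "f ` W \<subseteq> Q \<inter> UNIV" by (auto simp: Q_def val)
    have inj: "inj_on pr (Q \<inter> UNIV)"
    proof (rule inj_onI)
      fix v w assume vw: "v \<in> Q \<inter> UNIV" "w \<in> Q \<inter> UNIV" "pr v = pr w"
      then have "(L *v (v - c)) $ 1 = (L *v (w - c)) $ 1" "(L *v (v - c)) $ 2 = (L *v (w - c)) $ 2"
        by (auto simp: pr_def vec_eq_iff forall_2)
      then have "L *v (v - c) = L *v (w - c)" using vw by (simp add: Q_def vec_eq_iff forall_3)
      then have "v - c = w - c" by (rule matrix_vector_cancel[OF dL])
      then show "v = w" by simp
    qed
    note cw = chartW[OF W(1)]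
    have "inj_on f W" "openin (top_of_set Q) (f ` W)"
      using graph_patch_open[OF _ pr fQ open_UNIV _ cont[of L c, folded pr_def] inj] cw by blast+
    moreover have "nondegenerate_quadric Q" unfolding Q_def
      by (rule nondegenerate_quadric_affine[OF nondegenerate_paraboloid dL])
    ultimately show ?thesis using W(2,3) fr(3) cw by blast
  next
    case False
    define B where "B = \<phi> ` D"
    define z0 where "z0 = \<phi> q"
    have z0: "z0 \<in> B" using fr(2) by (simp add: B_def z0_def)
    define F N where "F = in_chart (D, \<phi>) f" and "N = in_chart (D, \<phi>) \<xi>"
    have nf: "null_frame H B F N X Y \<theta> \<omega> p a b" using framed_null_frame[OF fr(1)] by (simp add: B_def F_def N_def)
    interpret null_frame H B F N X Y \<theta> \<omega> p a b by fact
    have conv: "convex B" using fr(4) by (simp add: B_def)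
    obtain L :: "real^3^3" where L: "det L = 1 / det3 (X z0) (Y z0) (N z0)"
      "\<And>c1 c2 c3. L *v (c1 *\<^sub>R X z0 + c2 *\<^sub>R Y z0 + c3 *\<^sub>R N z0) = vector [c1, c2, c3]"
      using det3_dual_matrix[OF det_nz[OF z0]] by blast
    have Le: "L *v X z0 = vector [1, 0, 0]" "L *v Y z0 = vector [0, 1, 0]" "L *v N z0 = vector [0, 0, 1]"
      using L(2)[of 1 0 0] L(2)[of 0 1 0] L(2)[of 0 0 1] by simp_all
    have dL: "det L \<noteq> 0" using L(1) det_nz[OF z0] by simp
    define c where "c = F z0 + (1 / H) *\<^sub>R N z0"
    have Fc: "F z - c = - (1 / H) *\<^sub>R N z" if z: "z \<in> B" for z
    proof -
      have s: "smooth_on B (\<lambda>z. (1 / H) *\<^sub>R N z)" "smooth_on B (\<lambda>z. F z + (1 / H) *\<^sub>R N z)" by (intro smooth_intros open_S smooth_F smooth_xi)+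
      have "pd i (\<lambda>z. F z + (1 / H) *\<^sub>R N z) z = 0" if z: "z \<in> B" for i z
        using False pd_add[OF diffable(1)[OF z] smooth_on_differentiable[OF s(1) z], of i] pd_linear[OF bounded_linear_scaleR_right diffable(2)[OF z], of i "1 / H"]
        by (simp add: dF[OF z] dxi[OF z] algebra_simps)
      then have "F z + (1 / H) *\<^sub>R N z = c"
        unfolding c_def by (intro constant_on_convex_pd[OF conv open_S _ _ z z0] smooth_on_differentiable[OF s(2)])
      then show ?thesis by (simp add: algebra_simps)
    qed
    define w where "w = (\<lambda>k z. (L *v (F z - c)) $ k)"
    have blL: "bounded_linear (\<lambda>v. (L *v v) $ k)" for k
      using bounded_linear_compose[OF bounded_linear_vec_nth matrix_vector_mul_bounded_linear] .
    have sw: "smooth_on B (w k)" for k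
      unfolding w_def by (intro smooth_on_linear_compose[OF open_S _ blL] smooth_intros open_S smooth_F)
    have wN: "w k z = - (1 / H) * (L *v N z) $ k" if "z \<in> B" for k z
      unfolding w_def Fc[OF that] by (simp only: matrix_vector_mult_scaleR vector_scaleR_component real_scaleR_def)
    have quad: "2 * (w 1 z * w 2 z) + H * (w 3 z)\<^sup>2 = 1 / H" if z: "z \<in> B" for z
    proof -
      have "2 * ((L *v N z) $ 1 * (L *v N z) $ 2) + H * ((L *v N z) $ 3)\<^sup>2 = H"
        by (rule proper_quadric_equation[OF nf conv z0 z False _ _ Le]) (use ab in \<open>auto simp: B_def\<close>)
      moreover have "2 * (w 1 z * w 2 z) + H * (w 3 z)\<^sup>2 = (2 * ((L *v N z) $ 1 * (L *v N z) $ 2) + H * ((L *v N z) $ 3)\<^sup>2) / H\<^sup>2"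
        using False by (simp add: wN[OF z] power2_eq_square field_simps)
      ultimately show ?thesis using False by (simp add: power2_eq_square)
    qed
    have oT: "open (B \<inter> (\<lambda>z. H * w 3 z) -` {..<0})"
      by (intro continuous_open_preimage smooth_on_continuous_on smooth_intros open_S sw open_lessThan)
    have qT: "snd (D, \<phi>) q \<in> B \<inter> (\<lambda>z. H * w 3 z) -` {..<0}"
      using z0 False by (simp add: z0_def[symmetric] wN[OF z0] Le)
    obtain D' where D': "framed (D', \<phi>) X Y \<theta> \<omega> p a b" "q \<in> D'" "D' \<subseteq> D" "\<phi> ` D' \<subseteq> B \<inter> (\<lambda>z. H * w 3 z) -` {..<0}"
      by (rule framed_ball[OF fr(1) _ oT qT]) (use fr(2) in auto)
    define G where "G = (\<lambda>z. vector [w 1 z, w 2 z] :: real^2)"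
    have sG: "smooth_on B G" unfolding G_def by (intro smooth_intros open_S sw)
    have sG': "smooth_on (\<phi> ` D') G" using sG by (rule smooth_on_subset) (use D'(4) in auto)
    have pw: "pd i (w k) z0 = \<theta> i z0 * (L *v X z0) $ k + \<omega> i z0 * (L *v Y z0) $ k" for i k
    proof -
      have "(\<lambda>z. F z - c) differentiable (at z0)" "pd i (\<lambda>z. F z - c) z0 = pd i F z0"
        using diffable(1)[OF z0] pd_diff[OF diffable(1)[OF z0], of "\<lambda>_. c" i] by simp_all
      then show ?thesis unfolding w_def
        by (subst pd_linear[OF blL]) (auto simp: dF[OF z0] matrix_vector_right_distrib matrix_vector_mult_scaleR)
    qed
    have J: "pd 1 G (\<phi> q) $ 1 * pd 2 G (\<phi> q) $ 2 - pd 1 G (\<phi> q) $ 2 * pd 2 G (\<phi> q) $ 1 \<noteq> 0"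
    proof -
      have "pd i G z0 $ 1 = \<theta> i z0" "pd i G z0 $ 2 = \<omega> i z0" for i
        using pd_nth[OF smooth_on_differentiable[OF sG z0], of i 1] pd_nth[OF smooth_on_differentiable[OF sG z0], of i 2]
          pw[of i 1] pw[of i 2] by (simp_all add: G_def Le)
      then show ?thesis using coframe[OF z0] by (simp add: z0_def algebra_simps)
    qed
    obtain W BB g where W: "q \<in> W" "W \<subseteq> D'" "(G \<circ> \<phi>) ` W = BB" and lc: "local_chart M A (W, G \<circ> \<phi>)"
      by (rule framed_new_coords_pair[OF D'(1,2) sG' J open_UNIV UNIV_I]) (auto simp: framed_def)
    define Q where "Q = {v. L *v (v - c) \<in> {w. 2 * (w $ 1 * w $ 2) + H * (w $ 3)\<^sup>2 = 1 / H}}"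
    define R where "R = {v. H * (L *v (v - c)) $ 3 < 0}"
    define pr where "pr = (\<lambda>w. vector [(L *v (w - c)) $ 1, (L *v (w - c)) $ 2] :: real^2)"
    have fF: "f x = F (\<phi> x)" "\<phi> x \<in> B" "H * w 3 (\<phi> x) < 0" if "x \<in> W" for x
    proof -
      have "x \<in> D'" "x \<in> D" using that W(2) D'(3) by auto
      then show "f x = F (\<phi> x)" using in_chart_apply[OF framed_chart[OF fr(1)], of x f] by (simp add: F_def)
      show "\<phi> x \<in> B" "H * w 3 (\<phi> x) < 0" using \<open>x \<in> D'\<close> D'(4) by auto
    qed
    have pr: "pr (f x) = (G \<circ> \<phi>) x" if "x \<in> W" for x using fF[OF that] by (simp add: pr_def G_def w_def)
    have fQ: "f ` W \<subseteq> Q \<inter> R"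
    proof
      fix v assume "v \<in> f ` W"
      then obtain x where x: "x \<in> W" "v = f x" by blast
      show "v \<in> Q \<inter> R" using quad[OF fF(2)[OF x(1)]] fF(1,3)[OF x(1)] by (simp add: x(2) Q_def R_def w_def)
    qed
    have oR: "open R"
    proof -
      have "smooth_on UNIV (\<lambda>v. H * (L *v (v - c)) $ 3)" by (intro smooth_intros open_UNIV)
      then have "continuous_on UNIV (\<lambda>v. H * (L *v (v - c)) $ 3)" by (rule smooth_on_continuous_on)
      then show ?thesis unfolding R_def by (intro open_Collect_less continuous_on_const)
    qed
    have inj: "inj_on pr (Q \<inter> R)"
    proof (rule inj_onI)
      fix v w assume vw: "v \<in> Q \<inter> R" "w \<in> Q \<inter> R" "pr v = pr w"
      then have e: "(L *v (v - c)) $ 1 = (L *v (w - c)) $ 1" "(L *v (v - c)) $ 2 = (L *v (w - c)) $ 2"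
        by (auto simp: pr_def vec_eq_iff forall_2)
      then have "H * ((L *v (v - c)) $ 3)\<^sup>2 = H * ((L *v (w - c)) $ 3)\<^sup>2" using vw(1,2) unfolding Q_def mem_Collect_eq Int_iff by smt
      then have "((L *v (v - c)) $ 3)\<^sup>2 = ((L *v (w - c)) $ 3)\<^sup>2" using False by simp
      then have "(L *v (v - c)) $ 3 = (L *v (w - c)) $ 3 \<or> (L *v (v - c)) $ 3 = - (L *v (w - c)) $ 3"
        by (simp add: power2_eq_iff)
      moreover have "H * (L *v (v - c)) $ 3 < 0" "H * (L *v (w - c)) $ 3 < 0" using vw by (auto simp: R_def)
      ultimately have "(L *v (v - c)) $ 3 = (L *v (w - c)) $ 3" by auto
      then have "L *v (v - c) = L *v (w - c)" using e by (simp add: vec_eq_iff forall_3)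
      then have "v - c = w - c" by (rule matrix_vector_cancel[OF dL])
      then show "v = w" by simp
    qed
    note cw = chartW[OF lc]
    have "inj_on f W" "openin (top_of_set Q) (f ` W)"
      using graph_patch_open[OF _ pr fQ oR _ cont[of L c, folded pr_def] inj] cw by blast+
    moreover have "nondegenerate_quadric Q" unfolding Q_def
      by (rule nondegenerate_quadric_affine[OF nondegenerate_hyperboloid[OF False] dL])
    ultimately show ?thesis using W D'(3) fr(3) cw by blast
  qed
qed

lemma U0_nonconvex_quadric:
  "nonconvex_quadric (subtopology M (U0_part M A f \<xi>)) (restrict_atlas A (U0_part M A f \<xi>)) f \<xi>"
proof -
  have U: "openin M (U0_part M A f \<xi>)" by (simp add: U0_part_def)
  have "\<exists>W Q. openin (subtopology M (U0_part M A f \<xi>)) W \<and> q \<in> W \<and> inj_on f W \<and> nondegenerate_quadric Q \<and> openin (top_of_set Q) (f ` W)"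
    if "q \<in> topspace (subtopology M (U0_part M A f \<xi>))" for q
    using U0_quadric_patch[of q] that openin_open_subtopology[OF U] by (metis IntD2 topspace_subtopology)
  then show ?thesis using restricted_surface[OF U] by (simp add: nonconvex_quadric_def)
qed

subsection \<open>Ruled improper affine spheres\<close>

text \<open>Where $ab = 0$ and $K \neq 0$, exactly one of \<open>a\<close> and \<open>b\<close> vanishes; interchanging \<open>X\<close> and \<open>Y\<close> makes
  it \<open>b\<close>.\<close>

lemma U1_chart:
  assumes q: "q \<in> U1_part M A f \<xi>"
  obtains D \<phi> X Y \<theta> \<omega> p a b where "framed (D, \<phi>) X Y \<theta> \<omega> p a b" "q \<in> D" "D \<subseteq> U1_part M A f \<xi>" "convex (\<phi> ` D)"
    "\<And>z. z \<in> \<phi> ` D \<Longrightarrow> a z \<noteq> 0" "\<And>z. z \<in> \<phi> ` D \<Longrightarrow> b z = 0"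
proof -
  have U: "openin M (U1_part M A f \<xi>)" by (simp add: U1_part_def)
  have UK: "x \<in> topspace M \<and> \<not> K_zero A f \<xi> x \<and> hCC A f \<xi> x = 0" if "x \<in> U1_part M A f \<xi>" for x
    using that interior_of_subset[of M] unfolding U1_part_def by blast
  obtain c X0 Y0 \<theta>0 \<omega>0 p0 a0 b0 where fr0: "framed c X0 Y0 \<theta>0 \<omega>0 p0 a0 b0" "q \<in> fst c"
    using framed_exists[of q] UK[OF q] by blast
  have "a0 (snd c q) \<noteq> 0 \<or> b0 (snd c q) \<noteq> 0" using framed_invariants(2)[OF fr0] UK[OF q] by blast
  then have "\<exists>X Y \<theta> \<omega> p a b. framed c X Y \<theta> \<omega> p a b \<and> a (snd c q) \<noteq> 0"
    using fr0(1) framed_swap[OF fr0(1)] by blast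
  then obtain X Y \<theta> \<omega> p a b where fr: "framed c X Y \<theta> \<omega> p a b" "a (snd c q) \<noteq> 0" by blast
  note co = framed_chart[OF fr(1)]
  interpret null_frame H "snd c ` fst c" "in_chart c f" "in_chart c \<xi>" X Y \<theta> \<omega> p a b using fr by (simp add: framed_def)
  define N where "N = (snd c ` fst c \<inter> a -` (- {0})) \<inter> snd c ` (fst c \<inter> U1_part M A f \<xi>)"
  have oN: "open N" unfolding N_def
    by (intro open_Int continuous_open_preimage smooth_on_continuous_on smooth_a open_S chart_open_image[OF co U]) (simp add: open_Compl)
  obtain D where D: "framed (D, snd c) X Y \<theta> \<omega> p a b" "q \<in> D" "D \<subseteq> fst c" "convex (snd c ` D)" "snd c ` D \<subseteq> N"
    by (rule framed_ball[OF fr(1) fr0(2) oN]) (use fr fr0 q in \<open>auto simp: N_def\<close>)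
  have DU: "D \<subseteq> U1_part M A f \<xi>"
  proof
    fix x assume "x \<in> D"
    then obtain y where "y \<in> fst c \<inter> U1_part M A f \<xi>" "snd c x = snd c y" using D(5) unfolding N_def by blast
    then show "x \<in> U1_part M A f \<xi>" using chart_inj[OF co] D(3) \<open>x \<in> D\<close> by (auto dest: inj_onD)
  qed
  have an: "a z \<noteq> 0" if "z \<in> snd c ` D" for z using D(5) that by (auto simp: N_def)
  have "b z = 0" if "z \<in> snd c ` D" for z
  proof -
    from that obtain x where x: "x \<in> D" "z = snd c x" by blast
    then have "hCC A f \<xi> x = 0" using DU UK by blast
    then show ?thesis using framed_invariants(1)[OF D(1), of x] x an[OF that] by simp
  qed
  then show thesis using that[OF D(1,2) DU D(4) an] by blast
qed

lemma independent_of_first: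
  fixes h :: "real^2 \<Rightarrow> 'b::real_normed_vector"
  assumes B: "open B" "convex B" and h: "smooth_on B h" "\<And>z. z \<in> B \<Longrightarrow> pd 1 h z = 0" and z: "z \<in> B" "z' \<in> B" "z $ 2 = z' $ 2"
  shows "h z = h z'"
proof -
  define S where "S = closed_segment z z'"
  have SB: "S \<subseteq> B" unfolding S_def using closed_segment_subset[OF z(1,2) B(2)] .
  have s2: "w $ 2 = z $ 2" if "w \<in> S" for w
  proof -
    from that obtain u where "w = (1 - u) *\<^sub>R z + u *\<^sub>R z'" by (auto simp: S_def in_segment)
    then have "w $ 2 = (1 - u) * z $ 2 + u * z' $ 2" by simp
    then show ?thesis using z(3) by (simp add: algebra_simps)
  qed
  define c where "c = (\<lambda>t. h ((1 - t) *\<^sub>R z + t *\<^sub>R z'))"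
  have dc: "(c has_vector_derivative 0) (at t within {0..1})" if t: "t \<in> {0..1}" for t
  proof -
    have "(1 - t) *\<^sub>R z + t *\<^sub>R z' \<in> S" unfolding S_def in_segment using t by (intro exI[of _ t]) simp
    then have inB: "(1 - t) *\<^sub>R z + t *\<^sub>R z' \<in> B" using SB by blast
    have d: "((\<lambda>t. (1 - t) *\<^sub>R z + t *\<^sub>R z') has_derivative (\<lambda>s. s *\<^sub>R (z' - z))) (at t within {0..1})"
      by (auto intro!: derivative_eq_intros simp: algebra_simps)
    have "(h has_derivative (\<lambda>v. v $ 2 *\<^sub>R pd 2 h ((1 - t) *\<^sub>R z + t *\<^sub>R z'))) (at ((1 - t) *\<^sub>R z + t *\<^sub>R z'))"
      using has_derivative_pd[OF smooth_on_differentiable[OF h(1) inB]] h(2)[OF inB] by simp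
    from has_derivative_compose[OF d this] show ?thesis using z(3) by (simp add: c_def has_vector_derivative_def)
  qed
  obtain k where "\<And>t. t \<in> {0..1} \<Longrightarrow> c t = k"
    by (rule has_vector_derivative_zero_constant[of "{0..1}" c]) (use dc in auto)
  then have "c 0 = c 1" by simp
  then show ?thesis by (simp add: c_def)
qed

lemma slice_derivative:
  fixes h :: "real^2 \<Rightarrow> 'b::real_normed_vector"
  assumes "h differentiable (at (vector [c, t]))"
  shows "((\<lambda>t. h (vector [c, t])) has_vector_derivative pd 2 h (vector [c, t])) (at t)"
proof -
  have e: "vector [c, t] = c *\<^sub>R axis 1 1 + t *\<^sub>R (axis 2 1 :: real^2)" for t by (simp add: vec_eq_iff forall_2 axis_def)
  have "((\<lambda>t. vector [c, t] :: real^2) has_derivative (\<lambda>s. s *\<^sub>R axis 2 1)) (at t)"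
    unfolding e by (auto intro!: derivative_eq_intros)
  from has_derivative_compose[OF this has_derivative_pd[OF assms]]
  show ?thesis by (simp add: has_vector_derivative_def axis_def)
qed

lemma smooth_on_slice:
  fixes h :: "real^2 \<Rightarrow> 'b::real_normed_vector"
  assumes "open B" "smooth_on B h" "open J" "\<And>t. t \<in> J \<Longrightarrow> vector [c, t] \<in> B"
  shows "smooth_on J (\<lambda>t. h (vector [c, t]))"
  by (rule smooth_on_compose[OF assms(3,1) _ assms(2)]) (use assms in \<open>auto intro!: smooth_intros\<close>)

text \<open>The third derivative of the function \<open>\<Phi>\<close> in the normal form is \<open>- 2a\<close> for the rescaled frame, hence nonzero.
  The linear part of the normalising map has determinant 1 or -1, and in the second case it is the mirror image
  that is equivalent to the model.\<close>

lemma U1_improper: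
  assumes H0: "H = 0" and q: "q \<in> U1_part M A f \<xi>"
  shows "\<exists>W \<Omega> g. openin M W \<and> q \<in> W \<and> W \<subseteq> U1_part M A f \<xi> \<and> ruled_improper_model \<Omega> g \<and>
     equiaff_equiv_or_mirror (subtopology M W) (restrict_atlas A W) f (top_of_set \<Omega>) (std_atlas \<Omega>) g"
proof -
  obtain D \<phi> X Y \<theta> \<omega> p a b where fr: "framed (D, \<phi>) X Y \<theta> \<omega> p a b" "q \<in> D" "D \<subseteq> U1_part M A f \<xi>" "convex (\<phi> ` D)"
    and an: "\<And>z. z \<in> \<phi> ` D \<Longrightarrow> a z \<noteq> 0" and b: "\<And>z. z \<in> \<phi> ` D \<Longrightarrow> b z = 0"
    using U1_chart[OF q] by blast
  obtain W \<gamma> r and L :: "real^3^3" and c \<Phi> \<Phi>1 \<Phi>2 where W: "local_chart M A (W, \<gamma>)" "q \<in> W" "W \<subseteq> D" "r > 0" "\<gamma> ` W = ball 0 r" "\<bar>det L\<bar> = 1"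
    and val: "\<And>y. y \<in> ball 0 r \<Longrightarrow> L *v (in_chart (W, \<gamma>) f y - c) = vector [y $ 1, y $ 2, y $ 1 * y $ 2 + \<Phi> y]"
    and s: "smooth_on (ball 0 r) \<Phi>" "smooth_on (ball 0 r) \<Phi>1" "smooth_on (ball 0 r) \<Phi>2"
    and d: "\<And>y. y \<in> ball 0 r \<Longrightarrow> pd 1 \<Phi> y = 0 \<and> pd 2 \<Phi> y = \<Phi>1 y \<and> pd 1 \<Phi>1 y = 0 \<and> pd 2 \<Phi>1 y = \<Phi>2 y \<and> pd 1 \<Phi>2 y = 0"
    and nz: "\<And>y. y \<in> ball 0 r \<Longrightarrow> pd 2 \<Phi>2 y \<noteq> 0"
    by (rule improper_chart[OF H0 fr(1,2,4) b]) (use an in \<open>blast+\<close>)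
  define \<Omega> where "\<Omega> = (ball 0 r :: (real^2) set)"
  define J where "J = {-r<..<r}"
  have in\<Omega>: "vector [0, t] \<in> \<Omega>" if "t \<in> J" for t
    using that by (auto simp: \<Omega>_def J_def norm_vec_def L2_set_def sum_2)
  have inJ: "z $ 2 \<in> J" if "z \<in> \<Omega>" for z
    using that component_le_norm_cart[of z 2] by (auto simp: \<Omega>_def J_def abs_if split: if_splits)
  define \<psi> where "\<psi> = (\<lambda>t. \<Phi> (vector [0, t]))"
  have sl: "vd (\<lambda>t. h (vector [0, t])) t = pd 2 h (vector [0, t])" if "smooth_on \<Omega> h" "t \<in> J" for h :: "real^2 \<Rightarrow> real" and t
    using slice_derivative[OF smooth_on_differentiable[OF that(1) in\<Omega>[OF that(2)]]] by (rule vd_eqI)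
  have oJ: "open J" by (simp add: J_def)
  have s': "smooth_on \<Omega> \<Phi>" "smooth_on \<Omega> \<Phi>1" "smooth_on \<Omega> \<Phi>2" using s by (simp_all add: \<Omega>_def)
  have v1: "vd \<psi> t = \<Phi>1 (vector [0, t])" if "t \<in> J" for t
    using sl[OF s'(1) that] d in\<Omega>[OF that] by (simp add: \<psi>_def \<Omega>_def)
  have v2: "vd (vd \<psi>) t = \<Phi>2 (vector [0, t])" if "t \<in> J" for t
    using vd_cong[OF oJ that v1] sl[OF s'(2) that] d in\<Omega>[OF that] by (simp add: \<Omega>_def)
  have v3: "vd (vd (vd \<psi>)) t = pd 2 \<Phi>2 (vector [0, t])" if "t \<in> J" for t
    using vd_cong[OF oJ that v2] sl[OF s'(3) that] by simp
  define g where "g = (\<lambda>z::real^2. vector [z $ 1, z $ 2, z $ 1 * z $ 2 + \<psi> (z $ 2)] :: real^3)"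
  have "ruled_improper_model \<Omega> g"
    unfolding ruled_improper_model_def
  proof (intro conjI exI[of _ J] exI[of _ \<psi>] ballI)
    show "smooth_on J \<psi>" unfolding \<psi>_def by (rule smooth_on_slice[OF _ s'(1) oJ in\<Omega>]) (simp_all add: \<Omega>_def)
    show "is_interval J" by (simp add: J_def is_interval_oo)
    show "vd (vd (vd \<psi>)) y \<noteq> 0" if "y \<in> J" for y using nz in\<Omega>[OF that] by (simp add: v3[OF that] \<Omega>_def)
  qed (use oJ inJ in \<open>simp_all add: \<Omega>_def g_def\<close>)
  moreover have "equiaff_equiv_or_mirror (subtopology M W) (restrict_atlas A W) f (top_of_set \<Omega>) (std_atlas \<Omega>) g"
  proof -
    have gv: "g y = L *v in_chart (W, \<gamma>) f y + - (L *v c)" if "y \<in> \<Omega>" for y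
    proof -
      have "\<Phi> y = \<psi> (y $ 2)" unfolding \<psi>_def
        using independent_of_first[OF _ _ s'(1), of y "vector [0, y $ 2]"] d that in\<Omega>[OF inJ[OF that]] by (simp add: \<Omega>_def)
      then show ?thesis using val[of y] that by (simp add: g_def \<Omega>_def matrix_vector_mult_diff_distrib)
    qed
    have im: "\<gamma> ` W = \<Omega>" using W(5) by (simp add: \<Omega>_def)
    consider "det L = 1" | "det (- L) = 1"
    proof -
      have "det (- L) = - det L" by (simp add: det_3)
      then show ?thesis using W(6) that by (auto simp: abs_if split: if_splits)
    qed
    then show ?thesis
    proof cases
      case 1
      then show ?thesis
        using equiaff_equiv_chart[OF atlas_chart W(1) 1, of g f "- (L *v c)"] gv im by (simp add: equiaff_equiv_or_mirror_def)
    next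
      case 2
      have "g y = - L *v in_chart (W, \<gamma>) (\<lambda>p. - f p) y + - (L *v c)" if "y \<in> \<Omega>" for y
      proof -
        have "in_chart (W, \<gamma>) (\<lambda>p. - f p) y = - in_chart (W, \<gamma>) f y" by (simp add: in_chart_def)
        moreover have "- L *v (- v) = L *v v" for v :: "real^3"
          by (simp add: vec_eq_iff matrix_vector_mult_def)
        ultimately show ?thesis using gv[OF that] by simp
      qed
      then show ?thesis
        using equiaff_equiv_chart[OF atlas_chart W(1) 2, of g "\<lambda>p. - f p" "- (L *v c)"] im by (simp add: equiaff_equiv_or_mirror_def)
    qed
  qed
  moreover have "openin M W" using W(1) by (simp add: local_chart_def chart_on_def)
  ultimately show ?thesis using W(2,3) fr(3) by blast
qed

end

section \<open>Extending linear differential equations along a line\<close>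

text \<open>The functions $e^{-1/x} x^{-n}$, extended by zero: the family is closed under differentiation up to linear
  combinations, so all of its members are smooth.\<close>

definition flat_exp :: "nat \<Rightarrow> real \<Rightarrow> real" where
  "flat_exp n x = (if x > 0 then exp (- inverse x) * inverse x ^ n else 0)"

lemma flat_exp_tendsto: "(flat_exp n \<longlongrightarrow> 0) (at 0)"
proof -
  have "((\<lambda>x::real. inverse x ^ n / exp (inverse x)) \<longlongrightarrow> 0) (at_right 0)"
    by (rule filterlim_compose[OF tendsto_power_div_exp_0 filterlim_inverse_at_top_right])
  then have "(flat_exp n \<longlongrightarrow> 0) (at_right 0)"
    by (rule Lim_transform_eventually)
       (auto simp: flat_exp_def exp_minus field_simps eventually_at_filter)
  moreover have "(flat_exp n \<longlongrightarrow> 0) (at_left 0)"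
    by (rule Lim_transform_eventually[OF tendsto_const]) (auto simp: flat_exp_def eventually_at_filter)
  ultimately show ?thesis by (simp add: filterlim_split_at)
qed

lemma flat_exp_derivative:
  "(flat_exp n has_real_derivative flat_exp (n + 2) x - real n * flat_exp (n + 1) x) (at x)"
proof -
  consider "x > 0" | "x < 0" | "x = 0" by linarith
  then show ?thesis
  proof cases
    case 1
    have "((\<lambda>x. exp (- inverse x) * inverse x ^ n) has_real_derivative flat_exp (n + 2) x - real n * flat_exp (n + 1) x) (at x)"
    proof -
      have di: "((\<lambda>x. inverse x) has_real_derivative - (inverse x * inverse x)) (at x)"
        using DERIV_inverse[of x UNIV] 1 by simp
      have de: "((\<lambda>x. exp (- inverse x)) has_real_derivative exp (- inverse x) * (inverse x * inverse x)) (at x)"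
        using DERIV_fun_exp[OF DERIV_minus[OF di]] by simp
      show ?thesis
        by (rule DERIV_cong[OF DERIV_mult[OF de DERIV_power[OF di, of n]]]) (use 1 in \<open>cases n; simp add: flat_exp_def algebra_simps\<close>)
    qed
    then show ?thesis
      by (rule has_field_derivative_transform_within_open[of _ _ _ "{0<..}"]) (use 1 in \<open>auto simp: flat_exp_def\<close>)
  next
    case 2
    have "((\<lambda>x. 0) has_real_derivative flat_exp (n + 2) x - real n * flat_exp (n + 1) x) (at x)"
      using 2 by (simp add: flat_exp_def)
    then show ?thesis
      by (rule has_field_derivative_transform_within_open[of _ _ _ "{..<0}"]) (use 2 in \<open>auto simp: flat_exp_def\<close>)
  next
    case 3
    have "flat_exp n z - flat_exp n 0 = flat_exp (Suc n) z * (z - 0)" for z by (simp add: flat_exp_def)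
    moreover have "isCont (flat_exp (Suc n)) 0" using flat_exp_tendsto[of "Suc n"] by (simp add: isCont_def flat_exp_def)
    ultimately have "(flat_exp n has_real_derivative flat_exp (Suc n) 0) (at 0)"
      unfolding CARAT_DERIV by blast
    then show ?thesis using 3 by (simp add: flat_exp_def)
  qed
qed

lemma smooth_on_flat_exp: "smooth_on UNIV (flat_exp n)"
proof -
  have "Ck_on k UNIV (flat_exp n)" for k n
  proof (induction k arbitrary: n)
    case 0
    show ?case using DERIV_isCont[OF flat_exp_derivative] by (simp add: continuous_at_imp_continuous_on)
  next
    case (Suc k)
    have m: "Ck_on k UNIV (\<lambda>x. c * flat_exp n x)" for c n
      using Ck_on_bilinear[OF bounded_bilinear_mult open_UNIV Ck_on_const Suc.IH] .
    have "Ck_on k UNIV (\<lambda>x. v * flat_exp (n + 2) x + (- real n * v) * flat_exp (n + 1) x)" for v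
      by (rule Ck_on_add[OF open_UNIV m m])
    moreover have "(flat_exp n has_derivative (\<lambda>v. v * flat_exp (n + 2) x + (- real n * v) * flat_exp (n + 1) x)) (at x)" for x
      by (rule has_derivative_eq_rhs[OF flat_exp_derivative[of n x, unfolded has_field_derivative_def]]) (auto simp: algebra_simps)
    ultimately show ?case by (intro Ck_on_SucI[OF open_UNIV])
  qed
  then show ?thesis by (simp add: smooth_on_def)
qed

text \<open>Multiplication by the cutoff function $A/(A+B)$, which is 1 for $|t| \le r/2$ and 0 for $|t| \ge 3r/4$.\<close>

lemma smooth_extension:
  fixes a :: "real \<Rightarrow> real"
  assumes r: "r > 0" and a: "smooth_on {-r<..<r} a"
  obtains a' where "smooth_on UNIV a'" "\<And>t. \<bar>t\<bar> < r / 2 \<Longrightarrow> a' t = a t"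
proof -
  define A where "A = (\<lambda>t. flat_exp 0 ((3 * r / 4)\<^sup>2 - t\<^sup>2))"
  define B where "B = (\<lambda>t. flat_exp 0 (t\<^sup>2 - (r / 2)\<^sup>2))"
  have sAB: "smooth_on UNIV A" "smooth_on UNIV B"
    unfolding A_def B_def by (rule smooth_on_compose[OF open_UNIV open_UNIV _ smooth_on_flat_exp]; intro smooth_intros open_UNIV subset_UNIV)+
  have AB: "A t + B t > 0" for t
  proof -
    have "(r / 2)\<^sup>2 < (3 * r / 4)\<^sup>2" using r by (intro power_strict_mono) auto
    then show ?thesis by (auto simp: A_def B_def flat_exp_def intro: add_pos_nonneg add_nonneg_pos)
  qed
  define a' where "a' = (\<lambda>t. if \<bar>t\<bar> < r then A t / (A t + B t) * a t else 0)"
  show thesis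
  proof (rule that[of a'])
    show "smooth_on UNIV a'"
    proof (rule smooth_on_local)
      fix x :: real
      show "\<exists>T. open T \<and> x \<in> T \<and> smooth_on (T \<inter> UNIV) a'"
      proof (cases "\<bar>x\<bar> < r")
        case True
        have "A t + B t \<noteq> 0" for t using AB[of t] by simp
        then have "smooth_on {-r<..<r} (\<lambda>t. A t / (A t + B t) * a t)"
          by (intro smooth_intros open_greaterThanLessThan a smooth_on_subset[OF sAB(1)] smooth_on_subset[OF sAB(2)] subset_UNIV)
        then have "smooth_on {-r<..<r} a'"
          by (subst smooth_on_cong[OF open_greaterThanLessThan, of _ _ a' "\<lambda>t. A t / (A t + B t) * a t"]) (auto simp: a'_def)
        then show ?thesis using True by (intro exI[of _ "{-r<..<r}"]) auto
      next
        case False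
        define T where "T = {t. 3 * r / 4 < \<bar>t\<bar>}"
        have oT: "open T" unfolding T_def by (intro open_Collect_less continuous_intros)
        have "A t = 0" if "t \<in> T" for t
        proof -
          have "(3 * r / 4)\<^sup>2 \<le> \<bar>t\<bar>\<^sup>2" using that r by (intro power_mono) (auto simp: T_def)
          then show ?thesis by (simp add: A_def flat_exp_def)
        qed
        then have "smooth_on T a'"
          by (subst smooth_on_cong[OF oT, of a' "\<lambda>_. 0"]) (auto simp: a'_def smooth_on_const)
        then show ?thesis using False r oT by (intro exI[of _ T]) (auto simp: T_def)
      qed
    qed simp
    show "a' t = a t" if t: "\<bar>t\<bar> < r / 2" for t
    proof -
      have "\<bar>t\<bar>\<^sup>2 < (r / 2)\<^sup>2" using t by (intro power_strict_mono) auto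
      then have "B t = 0" by (simp add: B_def flat_exp_def)
      then show ?thesis using AB[of t] t r by (auto simp: a'_def)
    qed
  qed
qed

text \<open>Extend the coefficient \<open>a\<close>, let the relation $a' - 2b = 2H$ define \<open>b\<close>, and solve the equation on the
  whole line with the initial values of \<open>\<zeta>\<close> at 0. By uniqueness the solution agrees with \<open>\<zeta>\<close> as long as the
  coefficients do.\<close>

lemma third_order_extension:
  fixes \<zeta> :: "real \<Rightarrow> real^3"
  assumes r: "r > 0" and a: "smooth_on {-r<..<r} a" and s: "smooth_on {-r<..<r} \<zeta>"
    and eq: "\<And>t. t \<in> {-r<..<r} \<Longrightarrow> vd (vd (vd \<zeta>)) t = a t *\<^sub>R vd \<zeta> t + ((vd a t - 2 * H) / 2) *\<^sub>R \<zeta> t"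
  obtains a' \<zeta>' where "smooth_on UNIV a'" "smooth_on UNIV \<zeta>'" "\<And>t. \<bar>t\<bar> < r / 2 \<Longrightarrow> \<zeta>' t = \<zeta> t"
    "\<And>t. vd (vd (vd \<zeta>')) t = a' t *\<^sub>R vd \<zeta>' t + ((vd a' t - 2 * H) / 2) *\<^sub>R \<zeta>' t"
proof -
  obtain a' where a': "smooth_on UNIV a'" "\<And>t. \<bar>t\<bar> < r / 2 \<Longrightarrow> a' t = a t" using smooth_extension[OF r a] by blast
  define J where "J = {-(r/2)<..<r/2}"
  have J: "open J" "is_interval J" "0 \<in> J" "J \<subseteq> {-r<..<r}" using r by (auto simp: J_def is_interval_oo)
  define b' where "b' = (\<lambda>t. (vd a' t - 2 * H) / 2)"
  have sb: "smooth_on UNIV b'" unfolding b'_def by (intro smooth_intros a' open_UNIV) simp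
  define B where "B = (\<lambda>t. (\<chi> i j. if i = 1 \<and> j = 2 \<or> i = 2 \<and> j = 3 then 1 else if i = 3 \<and> j = 1 then b' t
     else if i = 3 \<and> j = 2 then a' t else 0) :: real^3^3)"
  have sB: "smooth_on UNIV B" unfolding B_def by (intro smooth_on_matrix smooth_on_if smooth_on_const a' sb open_UNIV)
  have Bv: "B t *v v = vector [v $ 2, v $ 3, b' t * v $ 1 + a' t * v $ 2]" for t v
    by (simp add: B_def matrix_vector_mult_def vec_eq_iff forall_3 sum_3)
  define y0 where "y0 = (\<lambda>k. vector [\<zeta> 0 $ k, vd \<zeta> 0 $ k, vd (vd \<zeta>) 0 $ k] :: real^3)"
  have "\<exists>y. smooth_on UNIV y \<and> y 0 = y0 k \<and> (\<forall>t. (y has_vector_derivative B t *v y t) (at t))" for k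
    by (rule linear_ode_global[OF sB, of 0 "y0 k"]) blast
  then obtain y where y: "smooth_on UNIV (y k)" "y k 0 = y0 k" "(y k has_vector_derivative B t *v y k t) (at t)" for k t
    by metis
  define V where "V = (\<lambda>i t. \<Sum>k\<in>UNIV. (y k t $ i) *\<^sub>R axis k (1::real))"
  have sum_axis: "(\<Sum>k\<in>UNIV. c k *\<^sub>R axis k (1::real)) $ j = (c j :: real)" for c and j :: 3
    using exhaust_3[of j] by (auto simp: sum_3 axis_def)
  have Vk: "V i t $ k = y k t $ i" for i k t by (simp only: V_def sum_axis)
  have dV: "vd (V i) t = (\<Sum>k\<in>UNIV. ((B t *v y k t) $ i) *\<^sub>R axis k 1)" for i t
    unfolding V_def
    by (intro vd_eqI has_vector_derivative_sum bounded_linear.has_vector_derivative[OF bounded_linear_scaleR_left]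
        bounded_linear.has_vector_derivative[OF bounded_linear_vec_nth] y)
  have dVk: "vd (V i) t $ k = (B t *v y k t) $ i" for i k t by (simp only: dV sum_axis)
  have V1: "vd (V 1) = V 2" and V2: "vd (V 2) = V 3"
    by (simp_all add: fun_eq_iff vec_eq_iff dVk Bv Vk)
  have V3: "vd (V 3) t = a' t *\<^sub>R V 2 t + b' t *\<^sub>R V 1 t" for t
    by (simp add: vec_eq_iff dVk Bv Vk)
  have "V 1 t = \<zeta> t" if t: "t \<in> J" for t
  proof -
    have "y k t $ 1 = \<zeta> t $ k" for k
    proof -
      define z where "z = (\<lambda>t. (\<zeta> t $ k) *\<^sub>R axis 1 1 + (vd \<zeta> t $ k) *\<^sub>R axis 2 1 + (vd (vd \<zeta>) t $ k) *\<^sub>R axis 3 1 :: real^3)"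
      have zc: "z t $ 1 = \<zeta> t $ k" "z t $ 2 = vd \<zeta> t $ k" "z t $ 3 = vd (vd \<zeta>) t $ k" for t
        by (simp_all add: z_def axis_def)
      have "(z has_vector_derivative B t *v z t) (at t)" if t: "t \<in> J" for t
      proof -
        note o = open_greaterThanLessThan[of "- r" r]
        have t': "t \<in> {-r<..<r}" using t J by blast
        have s3: "smooth_on {-r<..<r} (vd \<zeta>)" "smooth_on {-r<..<r} (vd (vd \<zeta>))" by (intro smooth_intros o s)+
        have "(z has_vector_derivative (vd \<zeta> t $ k) *\<^sub>R axis 1 1 + (vd (vd \<zeta>) t $ k) *\<^sub>R axis 2 1 + (vd (vd (vd \<zeta>)) t $ k) *\<^sub>R axis 3 1) (at t)"
          unfolding z_def
          by (intro has_vector_derivative_add bounded_linear.has_vector_derivative[OF bounded_linear_scaleR_left]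
              bounded_linear.has_vector_derivative[OF bounded_linear_vec_nth] has_vector_derivative_vd[OF s t']
              has_vector_derivative_vd[OF s3(1) t'] has_vector_derivative_vd[OF s3(2) t'])
        moreover have aJ: "a t = a' t" if "t \<in> J" for t using a'(2)[of t] that by (auto simp: J_def)
        have "a t = a' t" "vd a t = vd a' t" using aJ[OF t] vd_cong[OF J(1) t aJ] by simp_all
        then have "(vd \<zeta> t $ k) *\<^sub>R axis 1 1 + (vd (vd \<zeta>) t $ k) *\<^sub>R axis 2 1 + (vd (vd (vd \<zeta>)) t $ k) *\<^sub>R axis 3 1 = B t *v z t"
          unfolding eq[OF t'] by (simp add: Bv zc b'_def vec_eq_iff[where 'b = 3] forall_3 axis_def)
        ultimately show ?thesis by simp
      qed
      then have "y k t = z t"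
        by (intro linear_ode_unique[OF J(2,1,3) t smooth_on_continuous_on[OF smooth_on_subset[OF sB subset_UNIV]] y(3)])
           (simp_all add: y(2) y0_def vec_eq_iff[where x = "vector _"] forall_3 zc)
      then show ?thesis by (simp add: zc)
    qed
    then show ?thesis by (simp add: vec_eq_iff Vk)
  qed
  moreover have "smooth_on UNIV (V 1)" unfolding V_def by (intro smooth_intros open_UNIV y)
  ultimately show thesis
    by (intro that[of a' "V 1"] a') (auto simp: V1 V2 V3 J_def b'_def abs_if split: if_splits)
qed

section \<open>Ruled proper affine spheres\<close>

text \<open>The functions \<open>\<zeta>\<close>, \<open>n\<close> and \<open>x\<close> are the restrictions of \<open>Y\<close>, \<open>\<xi>\<close> and \<open>X\<close> to a curve along which
  $\theta = dt$, $\omega = \rho\, dt$, $p = - w\, dt$, $a = 1$ and $b = 0$. Eliminating \<open>n\<close> and \<open>x\<close> from the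
  structure equations leaves a third-order equation for \<open>\<zeta>\<close> without second-order term.\<close>

lemma frame_curve_third_order:
  fixes \<zeta> n x :: "real \<Rightarrow> real^3" and w \<rho> :: "real \<Rightarrow> real"
  assumes J: "open J" and w: "smooth_on J w" and \<rho>: "smooth_on J \<rho>"
    and d\<zeta>: "\<And>t. t \<in> J \<Longrightarrow> (\<zeta> has_vector_derivative w t *\<^sub>R \<zeta> t + n t) (at t)"
    and dn: "\<And>t. t \<in> J \<Longrightarrow> (n has_vector_derivative - (H *\<^sub>R x t) - (H * \<rho> t) *\<^sub>R \<zeta> t) (at t)"
    and dx: "\<And>t. t \<in> J \<Longrightarrow> (x has_vector_derivative - (w t *\<^sub>R x t) + \<zeta> t + \<rho> t *\<^sub>R n t) (at t)"
    and a: "a = (\<lambda>t. 2 * vd w t + w t * w t - 2 * H * \<rho> t)" and t: "t \<in> J"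
  shows "vd \<zeta> t = w t *\<^sub>R \<zeta> t + n t"
    "vd (vd \<zeta>) t = (vd w t + w t * w t - H * \<rho> t) *\<^sub>R \<zeta> t + w t *\<^sub>R n t - H *\<^sub>R x t"
    "vd (vd (vd \<zeta>)) t = a t *\<^sub>R vd \<zeta> t + ((vd a t - 2 * H) / 2) *\<^sub>R \<zeta> t"
proof -
  have sw: "smooth_on J (vd w)" by (intro smooth_intros J w)
  have dw: "(w has_real_derivative vd w t) (at t)" "(vd w has_real_derivative vd (vd w) t) (at t)"
    "(\<rho> has_real_derivative vd \<rho> t) (at t)" if "t \<in> J" for t
    using has_vector_derivative_vd[OF w that] has_vector_derivative_vd[OF sw that] has_vector_derivative_vd[OF \<rho> that]
    by (simp_all add: has_real_derivative_iff_has_vector_derivative)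
  have 1: "vd \<zeta> t = w t *\<^sub>R \<zeta> t + n t" if "t \<in> J" for t using d\<zeta>[OF that] by (rule vd_eqI)
  then show "vd \<zeta> t = w t *\<^sub>R \<zeta> t + n t" using t by blast
  define E where "E = (\<lambda>t. (vd w t + w t * w t - H * \<rho> t) *\<^sub>R \<zeta> t + w t *\<^sub>R n t - H *\<^sub>R x t)"
  have 2: "vd (vd \<zeta>) t = E t" if t: "t \<in> J" for t
  proof -
    have "((\<lambda>t. w t *\<^sub>R \<zeta> t + n t) has_vector_derivative (w t *\<^sub>R (w t *\<^sub>R \<zeta> t + n t) + vd w t *\<^sub>R \<zeta> t)
        + (- (H *\<^sub>R x t) - (H * \<rho> t) *\<^sub>R \<zeta> t)) (at t)"
      by (intro has_vector_derivative_add has_vector_derivative_scaleR dw d\<zeta> dn t)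
    from vd_eqI[OF this] show ?thesis
      using vd_cong[OF J t 1] by (simp add: E_def algebra_simps)
  qed
  from 2[OF t] show "vd (vd \<zeta>) t = (vd w t + w t * w t - H * \<rho> t) *\<^sub>R \<zeta> t + w t *\<^sub>R n t - H *\<^sub>R x t" by (simp only: E_def)
  have "(E has_vector_derivative
      ((vd w t + w t * w t - H * \<rho> t) *\<^sub>R (w t *\<^sub>R \<zeta> t + n t) + (vd (vd w) t + (vd w t * w t + vd w t * w t) - H * vd \<rho> t) *\<^sub>R \<zeta> t)
      + (w t *\<^sub>R (- (H *\<^sub>R x t) - (H * \<rho> t) *\<^sub>R \<zeta> t) + vd w t *\<^sub>R n t) - H *\<^sub>R (- (w t *\<^sub>R x t) + \<zeta> t + \<rho> t *\<^sub>R n t)) (at t)"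
    unfolding E_def
    by (intro has_vector_derivative_add has_vector_derivative_diff has_vector_derivative_scaleR
        bounded_linear.has_vector_derivative[OF bounded_linear_scaleR_right] DERIV_add DERIV_diff DERIV_mult DERIV_cmult dw d\<zeta> dn dx t)
  note 3 = vd_eqI[OF this]
  have "(a has_real_derivative 2 * vd (vd w) t + (vd w t * w t + vd w t * w t) - 2 * H * vd \<rho> t) (at t)"
    unfolding a by (intro DERIV_add DERIV_diff DERIV_mult DERIV_cmult dw t)
  then have "vd a t = 2 * vd (vd w) t + (vd w t * w t + vd w t * w t) - 2 * H * vd \<rho> t"
    by (intro vd_eqI) (simp add: has_real_derivative_iff_has_vector_derivative)
  then have b: "(vd a t - 2 * H) / 2 = vd (vd w) t + w t * vd w t - H * vd \<rho> t - H" by simp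
  show "vd (vd (vd \<zeta>)) t = a t *\<^sub>R vd \<zeta> t + ((vd a t - 2 * H) / 2) *\<^sub>R \<zeta> t"
    using vd_cong[OF J t, of "vd (vd \<zeta>)" E] 2 unfolding 3 b 1[OF t] by (simp add: a vec_eq_iff algebra_simps)
qed

text \<open>A travelling-wave solution of Liouville's equation $\partial_1\partial_2 u = H e^{-u}$, with
  $\partial_2 u = 2k \tanh (k(z_2 + H z_1 + m))$.\<close>

lemma liouville_potential:
  fixes H k m :: real
  assumes k: "k > 0"
  defines "e \<equiv> \<lambda>z::real^2. k * (z $ 2 + H * z $ 1 + m)"
  defines "v \<equiv> \<lambda>z. 2 * k * ((exp (e z) - exp (- e z)) / (exp (e z) + exp (- e z)))"
  defines "u \<equiv> \<lambda>z. 2 * ln (exp (e z) + exp (- e z)) - ln (8 * k\<^sup>2)"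
  shows "smooth_on UNIV u" "smooth_on UNIV v" "pd 2 u z = v z" "pd 1 v z = H * exp (- u z)"
proof -
  define E D where "E = (\<lambda>z. exp (e z) + exp (- e z))" and "D = (\<lambda>z. exp (e z) - exp (- e z))"
  have Epos: "E z > 0" for z by (simp add: E_def add_pos_pos)
  then have Enz: "E z \<noteq> 0" for z by (metis less_irrefl)
  have se: "smooth_on UNIV e" unfolding e_def by (intro smooth_intros open_UNIV)
  have sED: "smooth_on UNIV E" "smooth_on UNIV D" unfolding E_def D_def by (intro smooth_intros open_UNIV se)+
  have uE: "u = (\<lambda>z. 2 * ln (E z) - ln (8 * k\<^sup>2))" and vE: "v = (\<lambda>z. 2 * k * (D z / E z))" by (simp_all add: u_def v_def E_def D_def)
  show "smooth_on UNIV u" unfolding uE by (intro smooth_intros open_UNIV sED Epos)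
  show sv: "smooth_on UNIV v" unfolding vE by (intro smooth_intros open_UNIV sED Enz)
  define h where "h = (\<lambda>i::2. if i = 1 then k * H else k)"
  have d: "E differentiable (at z)" "D differentiable (at z)" "e differentiable (at z)" "v differentiable (at z)" for z
    using smooth_on_differentiable sED se sv by blast+
  have de: "pd i e z = h i" for i z
  proof -
    have "pd i (\<lambda>z::real^2. z $ 2 + H * z $ 1 + m) z = (if i = 2 then 1 else 0) + H * (if i = 1 then 1 else 0)"
      by (simp add: pd_add pd_mult pd_coord differentiable_add differentiable_mult differentiable_nth)
    moreover have "pd i e z = k * pd i (\<lambda>z::real^2. z $ 2 + H * z $ 1 + m) z"
      unfolding e_def by (rule pd_linear[OF bounded_linear_mult_right]) (intro smooth_on_differentiable[where S = UNIV] smooth_intros open_UNIV UNIV_I)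
    ultimately show ?thesis using exhaust_2[of i] by (auto simp: h_def)
  qed
  have dx: "pd i (\<lambda>z. exp (e z)) z = exp (e z) * h i" "pd i (\<lambda>z. exp (- e z)) z = - (exp (- e z) * h i)" for i z
    using pd_exp[OF d(3)] pd_exp[of "\<lambda>z. - e z"] d(3) by (simp_all add: de pd_uminus)
  have dd: "(\<lambda>z. exp (e z)) differentiable (at z)" "(\<lambda>z. exp (- e z)) differentiable (at z)" for z
    by (intro smooth_on_differentiable[where S = UNIV] smooth_intros open_UNIV UNIV_I se)+
  have dE: "pd i E z = h i * D z" "pd i D z = h i * E z" for i z
    unfolding E_def D_def by (simp_all add: pd_add pd_diff dd dx algebra_simps)
  show "pd 2 u z = v z"
  proof -
    have "pd 2 (\<lambda>z. 2 * ln (E z)) z = 2 * (pd 2 E z / E z)"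
      using pd_linear[OF bounded_linear_mult_right, of "\<lambda>z. ln (E z)" z 2 2] pd_ln[OF d(1) Epos, of 2 z]
        smooth_on_differentiable[of UNIV "\<lambda>z. ln (E z)" z] sED Epos by (simp add: smooth_on_ln)
    moreover have "pd 2 u z = pd 2 (\<lambda>z. 2 * ln (E z)) z"
      unfolding uE by (subst pd_diff) (auto intro!: smooth_on_differentiable[where S = UNIV] smooth_intros sED Epos)
    ultimately show ?thesis by (simp add: dE h_def vE)
  qed
  show "pd 1 v z = H * exp (- u z)"
  proof -
    have "v z * E z = 2 * k * D z" for z using Enz by (simp add: vE)
    then have "pd 1 (\<lambda>z. v z * E z) z = pd 1 (\<lambda>z. (2 * k) * D z) z" by simp
    then have "pd 1 v z * E z + v z * (k * H * D z) = 2 * k * (k * H * E z)"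
      using pd_linear[OF bounded_linear_mult_right d(2), of 1 "2 * k" z] by (simp add: pd_mult d dE h_def)
    then have "pd 1 v z * E z * E z + 2 * k * D z * (k * H * D z) = 2 * k * (k * H * E z) * E z"
      using Enz[of z] by (simp add: vE field_simps)
    then have "pd 1 v z * (E z * E z) = 2 * k\<^sup>2 * H * (E z * E z - D z * D z)" by (simp add: algebra_simps power2_eq_square)
    also have "E z * E z - D z * D z = 4" by (simp add: E_def D_def algebra_simps exp_minus)
    finally have 1: "pd 1 v z = 8 * k\<^sup>2 * H / (E z * E z)" using Enz[of z] by (simp add: field_simps)
    have "exp (- u z) = exp (ln (8 * k\<^sup>2)) / exp (ln (E z) + ln (E z))"
      by (simp add: uE exp_diff[symmetric])
    also have "\<dots> = 8 * k\<^sup>2 / (E z * E z)" unfolding exp_add using k Epos[of z] by simp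
    finally show ?thesis by (simp add: 1)
  qed
qed

context indefinite_sphere
begin

text \<open>Rescale by the real cube root of $1/a$, written in a form that is smooth for either sign of \<open>a\<close>.\<close>

lemma U1_chart_normalised:
  assumes q: "q \<in> U1_part M A f \<xi>"
  obtains D \<phi> X Y \<theta> \<omega> p a b where "framed (D, \<phi>) X Y \<theta> \<omega> p a b" "q \<in> D" "D \<subseteq> U1_part M A f \<xi>" "convex (\<phi> ` D)"
    "\<And>z. z \<in> \<phi> ` D \<Longrightarrow> a z = 1" "\<And>z. z \<in> \<phi> ` D \<Longrightarrow> b z = 0"
proof -
  obtain D \<phi> X Y \<theta> \<omega> p a b where fr: "framed (D, \<phi>) X Y \<theta> \<omega> p a b" "q \<in> D" "D \<subseteq> U1_part M A f \<xi>" "convex (\<phi> ` D)"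
    and an: "\<And>z. z \<in> \<phi> ` D \<Longrightarrow> a z \<noteq> 0" and b: "\<And>z. z \<in> \<phi> ` D \<Longrightarrow> b z = 0"
    using U1_chart[OF q] by blast
  interpret null_frame H "\<phi> ` D" "in_chart (D, \<phi>) f" "in_chart (D, \<phi>) \<xi>" X Y \<theta> \<omega> p a b
    using framed_null_frame[OF fr(1)] .
  define l where "l = (\<lambda>z. a z * exp (- (2 / 3) * ln ((a z)\<^sup>2)))"
  have sl: "smooth_on (\<phi> ` D) l" unfolding l_def by (intro smooth_intros open_S smooth_a) (simp add: an)
  have l0: "l z \<noteq> 0" if "z \<in> \<phi> ` D" for z using an[OF that] by (simp add: l_def)
  have l3: "a z * l z ^ 3 = 1" if "z \<in> \<phi> ` D" for z
  proof -
    have "exp (- (2 / 3) * ln ((a z)\<^sup>2)) ^ 3 = exp (- 2 * ln ((a z)\<^sup>2))" by (simp add: exp_of_nat_mult[symmetric])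
    also have "- 2 * ln ((a z)\<^sup>2) = - (ln ((a z)\<^sup>2) + ln ((a z)\<^sup>2))" by simp
    also have "exp \<dots> = inverse ((a z)\<^sup>2 * (a z)\<^sup>2)"
      unfolding exp_minus exp_add using an[OF that] by simp
    finally show ?thesis
      using an[OF that] unfolding l_def power_mult_distrib by (simp only:) (simp add: power2_eq_square power3_eq_cube field_simps)
  qed
  have "framed (D, \<phi>) (\<lambda>z. l z *\<^sub>R X z) (\<lambda>z. inverse (l z) *\<^sub>R Y z) (\<lambda>i z. \<theta> i z / l z) (\<lambda>i z. l z * \<omega> i z)
     (\<lambda>i z. p i z + pd i l z / l z) (\<lambda>z. a z * l z ^ 3) (\<lambda>z. b z / l z ^ 3)"
    by (rule framed_rescale[OF fr(1)]) (use sl l0 in simp_all)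
  then show thesis by (rule that) (use fr(2-4) l3 b in simp_all)
qed

text \<open>If $a = 1$ and $b = 0$, the Codazzi equation for \<open>a\<close> gives $p \wedge \theta = 0$, so $p = - v\theta$ for a
  function \<open>v\<close>, and \<open>\<theta>\<close> is closed, say $\theta = dz_2$. The Gauss equation becomes
  $dv \wedge \theta = - H\, \theta \wedge \omega$, so \<open>v\<close> and \<open>z\<^sub>2\<close> are independent for \<open>H \<noteq> 0\<close>. The first coordinate may
  therefore be any function for which \<open>v\<close> becomes a prescribed function of both coordinates; it is chosen such that \<open>v\<close>
  is the derivative of the solution of Liouville's equation above.\<close>

lemma U1_proper_chart:
  assumes H: "H \<noteq> 0" and q: "q \<in> U1_part M A f \<xi>"
  obtains W \<gamma> r k m X Y \<theta> \<omega> p a b where "framed (W, \<gamma>) X Y \<theta> \<omega> p a b" "q \<in> W" "W \<subseteq> U1_part M A f \<xi>" "r > 0" "\<gamma> ` W = ball 0 r" "\<gamma> q = 0" "k > 0"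
    "\<And>z. z \<in> ball 0 r \<Longrightarrow> a z = 1" "\<And>z. z \<in> ball 0 r \<Longrightarrow> b z = 0" "\<And>i z. z \<in> ball 0 r \<Longrightarrow> \<theta> i z = (if i = 2 then 1 else 0)"
    "\<And>i z. z \<in> ball 0 r \<Longrightarrow> p i z = - (2 * k * ((exp (k * (z $ 2 + H * z $ 1 + m)) - exp (- (k * (z $ 2 + H * z $ 1 + m))))
        / (exp (k * (z $ 2 + H * z $ 1 + m)) + exp (- (k * (z $ 2 + H * z $ 1 + m)))))) * \<theta> i z"
proof -
  obtain D \<phi> X Y \<theta> \<omega> p a b where fr: "framed (D, \<phi>) X Y \<theta> \<omega> p a b" "q \<in> D" "D \<subseteq> U1_part M A f \<xi>" "convex (\<phi> ` D)"
    and ab: "\<And>z. z \<in> \<phi> ` D \<Longrightarrow> a z = 1" "\<And>z. z \<in> \<phi> ` D \<Longrightarrow> b z = 0"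
    using U1_chart_normalised[OF q] by blast
  define B where "B = \<phi> ` D"
  define z0 where "z0 = \<phi> q"
  have z0: "z0 \<in> B" using fr(2) by (simp add: B_def z0_def)
  interpret null_frame H B "in_chart (D, \<phi>) f" "in_chart (D, \<phi>) \<xi>" X Y \<theta> \<omega> p a b
    using framed_null_frame[OF fr(1)] by (simp add: B_def)
  have conv: "convex B" using fr(4) by (simp add: B_def)
  have ab: "a z = 1" "b z = 0" if "z \<in> B" for z using ab that by (simp_all add: B_def)
  have da: "pd i a z = 0" if "z \<in> B" for i z using pd_cong[OF open_S that, of a "\<lambda>_. 1" i] ab(1) by simp
  have par: "p 1 z * \<theta> 2 z = p 2 z * \<theta> 1 z" if z: "z \<in> B" for z using codazzi_a[OF z] by (simp add: da[OF z] ab[OF z])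
  have closed: "pd 2 (\<theta> 1) z = pd 1 (\<theta> 2) z" if z: "z \<in> B" for z using curl_theta[OF z] par[OF z] by (simp add: mult.commute)
  obtain z2 where z2: "smooth_on B z2" "z2 z0 = 0" "\<And>x. x \<in> B \<Longrightarrow> pd 1 z2 x = \<theta> 1 x" "\<And>x. x \<in> B \<Longrightarrow> pd 2 z2 x = \<theta> 2 x"
    using poincare_convex[OF open_S conv z0 smooth_theta smooth_theta closed] by blast
  define \<Delta> where "\<Delta> = (\<lambda>z. \<theta> 1 z * \<omega> 2 z - \<theta> 2 z * \<omega> 1 z)"
  have \<Delta>: "\<Delta> z \<noteq> 0" if "z \<in> B" for z using coframe[OF that] by (simp add: \<Delta>_def)
  define v where "v = (\<lambda>z. (p 2 z * \<omega> 1 z - p 1 z * \<omega> 2 z) / \<Delta> z)"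
  have s\<Delta>: "smooth_on B \<Delta>" unfolding \<Delta>_def by (intro smooth_intros open_S smooth_data)
  have sv: "smooth_on B v" unfolding v_def by (intro smooth_intros open_S smooth_data s\<Delta> \<Delta>)
  have pv: "p i z = - v z * \<theta> i z" if z: "z \<in> B" for i z
  proof -
    have "p i z * \<Delta> z = - (p 2 z * \<omega> 1 z - p 1 z * \<omega> 2 z) * \<theta> i z"
      using exhaust_2[of i] arg_cong[OF par[OF z], of "\<lambda>x. x * \<omega> 1 z"] arg_cong[OF par[OF z], of "\<lambda>x. x * \<omega> 2 z"]
      by (auto simp: \<Delta>_def algebra_simps)
    then show ?thesis using \<Delta>[OF z] by (simp add: v_def field_simps)
  qed
  have vd': "v differentiable (at z)" if "z \<in> B" for z using sv that smooth_on_differentiable by blast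
  have curl: "pd 1 v z * \<theta> 2 z - pd 2 v z * \<theta> 1 z = - H * \<Delta> z" if z: "z \<in> B" for z
  proof -
    have e: "pd i (p j) z = - (v z * pd i (\<theta> j) z + pd i v z * \<theta> j z)" for i j
    proof -
      have "pd i (p j) z = pd i (\<lambda>z. - (v z * \<theta> j z)) z" by (rule pd_cong[OF open_S z]) (simp add: pv)
      then show ?thesis by (simp add: pd_uminus pd_mult differentiable_mult vd' diffable z)
    qed
    show ?thesis using curl_p[OF z] unfolding e \<Delta>_def[symmetric] using closed[OF z] by (simp add: \<Delta>_def ab[OF z] algebra_simps)
  qed
  \<comment> \<open>large enough that \<open>v\<close> stays below the bound \<open>2k\<close> of \<open>2k tanh\<close> near the given point\<close>
  define k where "k = \<bar>v z0\<bar> / 2 + 1"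
  have k: "k > 0" by (simp add: k_def add_nonneg_pos)
  have oN: "open (B \<inter> v -` {- (2 * k)<..<2 * k})"
    by (intro continuous_open_preimage smooth_on_continuous_on sv open_S open_greaterThanLessThan)
  have qN: "snd (D, \<phi>) q \<in> B \<inter> v -` {- (2 * k)<..<2 * k}" using z0 by (auto simp: z0_def[symmetric] k_def)
  obtain D' where D': "framed (D', \<phi>) X Y \<theta> \<omega> p a b" "q \<in> D'" "D' \<subseteq> D" "\<phi> ` D' \<subseteq> B \<inter> v -` {- (2 * k)<..<2 * k}" "open (\<phi> ` D')"
    by (rule framed_ball[OF fr(1) _ oN qN]) (use fr(2) in auto)
  define B' where "B' = \<phi> ` D'"
  have B': "open B'" "B' \<subseteq> B" "z0 \<in> B'" using D' by (auto simp: B'_def z0_def)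
  have vB: "2 * k + v z > 0" "2 * k - v z > 0" if "z \<in> B'" for z
    using D'(4) that unfolding B'_def by fastforce+
  \<comment> \<open>the inverse of \<open>2k tanh (k x)\<close> at \<open>v\<close>\<close>
  define m where "m = (\<lambda>z. (ln (2 * k + v z) - ln (2 * k - v z)) / (2 * k))"
  define z1 where "z1 = (\<lambda>z. (1 / H) * (m z - z2 z - m z0))"
  have sm: "smooth_on B' m" unfolding m_def
    by (intro smooth_intros B' vB smooth_on_subset[OF sv]) (use k in auto)
  have s1: "smooth_on B' (\<lambda>z. m z - z2 z - m z0)" "smooth_on B' z1" unfolding z1_def
    by (intro smooth_intros B' sm smooth_on_subset[OF z2(1)])+
  have dm: "pd i m z = pd i v z * (2 / ((2 * k + v z) * (2 * k - v z)))" if z: "z \<in> B'" for i z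
  proof -
    have zB: "z \<in> B" using z B' by blast
    have d: "(\<lambda>z. 2 * k + v z) differentiable (at z)" "(\<lambda>z. 2 * k - v z) differentiable (at z)" using vd'[OF zB] by auto
    have d': "(\<lambda>z. ln (2 * k + v z)) differentiable (at z)" "(\<lambda>z. ln (2 * k - v z)) differentiable (at z)"
      by (intro smooth_on_differentiable[OF _ z] smooth_intros B' vB smooth_on_subset[OF sv]; assumption)+
    have "pd i m z = (1 / (2 * k)) * pd i (\<lambda>z. ln (2 * k + v z) - ln (2 * k - v z)) z"
      unfolding m_def using pd_linear[OF bounded_linear_mult_right differentiable_diff[OF d'], of i "1 / (2 * k)"] by simp
    also have "pd i (\<lambda>z. ln (2 * k + v z) - ln (2 * k - v z)) z = pd i v z / (2 * k + v z) + pd i v z / (2 * k - v z)"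
      unfolding pd_diff[OF d'] pd_ln[OF d(1) vB(1)[OF z]] pd_ln[OF d(2) vB(2)[OF z]]
      using vd'[OF zB] by (simp add: pd_add pd_diff)
    finally show ?thesis using vB[OF z] k by (simp add: field_simps)
  qed
  have dz1: "pd i z1 z = (1 / H) * (pd i m z - \<theta> i z)" if z: "z \<in> B'" for i z
  proof -
    have zB: "z \<in> B" using z B' by blast
    have d: "m differentiable (at z)" "z2 differentiable (at z)"
      using smooth_on_differentiable[OF sm z] smooth_on_differentiable[OF z2(1) zB] .
    have "pd i z1 z = (1 / H) * pd i (\<lambda>z. m z - z2 z - m z0) z"
      unfolding z1_def by (rule pd_linear[OF bounded_linear_mult_right smooth_on_differentiable[OF s1(1) z]])
    moreover have "pd i (\<lambda>z. m z - z2 z - m z0) z = pd i m z - pd i z2 z"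
      using d by (simp add: pd_diff differentiable_diff)
    ultimately show ?thesis using z2(3,4)[OF zB] exhaust_2[of i] by auto
  qed
  define G where "G = (\<lambda>z. vector [z1 z, z2 z] :: real^2)"
  have sG: "smooth_on B' G" unfolding G_def by (intro smooth_intros B' s1 smooth_on_subset[OF z2(1)])
  have pG: "pd i G z $ 1 = pd i z1 z" "pd i G z $ 2 = \<theta> i z" if z: "z \<in> B'" for i z
  proof -
    have zB: "z \<in> B" using z B' by blast
    show "pd i G z $ 1 = pd i z1 z" "pd i G z $ 2 = \<theta> i z"
      using pd_nth[OF smooth_on_differentiable[OF sG z], of i 1] pd_nth[OF smooth_on_differentiable[OF sG z], of i 2] z2(3,4)[OF zB] exhaust_2[of i]
      by (auto simp: G_def)
  qed
  have J: "pd 1 G (\<phi> q) $ 1 * pd 2 G (\<phi> q) $ 2 - pd 1 G (\<phi> q) $ 2 * pd 2 G (\<phi> q) $ 1 \<noteq> 0"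
  proof -
    define c where "c = 2 / ((2 * k + v z0) * (2 * k - v z0))"
    have "c \<noteq> 0" using vB[OF B'(3)] by (simp add: c_def)
    moreover have "pd 1 G z0 $ 1 * pd 2 G z0 $ 2 - pd 1 G z0 $ 2 * pd 2 G z0 $ 1 = (c / H) * (pd 1 v z0 * \<theta> 2 z0 - pd 2 v z0 * \<theta> 1 z0)"
      unfolding pG[OF B'(3)] dz1[OF B'(3)] dm[OF B'(3)] c_def[symmetric] by (simp add: algebra_simps)
    ultimately show ?thesis unfolding curl[OF z0] z0_def[symmetric] using H \<Delta>[OF z0] by simp
  qed
  have G0: "G (\<phi> q) = 0" unfolding z0_def[symmetric] by (simp add: G_def z1_def z2(2) vec_eq_iff forall_2)
  obtain W BB g where W: "q \<in> W" "W \<subseteq> D'" "\<exists>r>0. BB = ball (G (\<phi> q)) r" "(G \<circ> \<phi>) ` W = BB" "smooth_on BB g"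
    "\<And>y. y \<in> BB \<Longrightarrow> g y \<in> \<phi> ` D'" "\<And>y. y \<in> BB \<Longrightarrow> G (g y) = y"
    and frW: "framed (W, G \<circ> \<phi>) (\<lambda>z. X (g z)) (\<lambda>z. Y (g z))
    (\<lambda>i z. pd i g z $ 1 * \<theta> 1 (g z) + pd i g z $ 2 * \<theta> 2 (g z)) (\<lambda>i z. pd i g z $ 1 * \<omega> 1 (g z) + pd i g z $ 2 * \<omega> 2 (g z))
    (\<lambda>i z. pd i g z $ 1 * p 1 (g z) + pd i g z $ 2 * p 2 (g z)) (\<lambda>z. a (g z)) (\<lambda>z. b (g z))"
    by (rule framed_new_coords_pair[OF D'(1,2) sG[unfolded B'_def] J open_UNIV UNIV_I]) (rule that; assumption)
  obtain r where r: "r > 0" "BB = ball 0 r" using W(3) G0 by auto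
  note W = W[unfolded r(2), folded B'_def]
  have oB: "open (ball 0 r :: (real^2) set)" by simp
  have gB: "g y \<in> B" if "y \<in> ball 0 r" for y using W(6)[OF that] B' by blast
  have w2: "pd i g y $ 1 * \<theta> 1 (g y) + pd i g y $ 2 * \<theta> 2 (g y) = (if i = 2 then 1 else 0)" if y: "y \<in> ball 0 r" for i y
  proof -
    have "pd i (\<lambda>y. z2 (g y)) y = pd i (\<lambda>y. y $ 2) y"
    proof (rule pd_cong[OF oB y])
      fix y :: "real^2" assume "y \<in> ball 0 r"
      then have "G (g y) $ 2 = y $ 2" using W(7) by simp
      then show "z2 (g y) = y $ 2" by (simp add: G_def)
    qed
    then show ?thesis
      using pd_compose[where g = g and x = y and i = i, OF smooth_on_differentiable[OF z2(1) gB[OF y]] smooth_on_differentiable[OF W(5) y]] z2(3,4)[OF gB[OF y]]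
      by (simp add: pd_coord)
  qed
  have vg: "v (g y) = 2 * k * ((exp (k * (y $ 2 + H * y $ 1 + m z0)) - exp (- (k * (y $ 2 + H * y $ 1 + m z0))))
        / (exp (k * (y $ 2 + H * y $ 1 + m z0)) + exp (- (k * (y $ 2 + H * y $ 1 + m z0)))))" if y: "y \<in> ball 0 r" for y
  proof -
    have e: "z1 (g y) = y $ 1" "z2 (g y) = y $ 2"
      using arg_cong[OF W(7)[OF y], of "\<lambda>v. v $ 1"] arg_cong[OF W(7)[OF y], of "\<lambda>v. v $ 2"] by (simp_all add: G_def)
    have mg: "m (g y) = y $ 2 + H * y $ 1 + m z0" unfolding e[symmetric] z1_def using H by (simp add: field_simps)
    have "2 * (k * m (g y)) = ln (2 * k + v (g y)) - ln (2 * k - v (g y))" using k by (simp add: m_def)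
    then have s: "2 * (k * (y $ 2 + H * y $ 1 + m z0)) = ln (2 * k + v (g y)) - ln (2 * k - v (g y))"
      unfolding mg .
    define E where "E = exp (k * (y $ 2 + H * y $ 1 + m z0))"
    have E: "E > 0" "exp (- (k * (y $ 2 + H * y $ 1 + m z0))) = 1 / E" by (simp_all add: E_def exp_minus inverse_eq_divide)
    note vb = vB[OF W(6)[OF y]]
    have "E * E = exp (2 * (k * (y $ 2 + H * y $ 1 + m z0)))" unfolding mult_2 exp_add E_def ..
    also have "\<dots> = (2 * k + v (g y)) / (2 * k - v (g y))" unfolding s exp_diff using vb by simp
    finally have EE: "E * E * (2 * k - v (g y)) = 2 * k + v (g y)" using vb by (simp add: field_simps)
    have nz: "E * E + 1 > 0" using E by (simp add: add_pos_pos)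
    have "E - 1 / E = (E * E - 1) / E" "E + 1 / E = (E * E + 1) / E" using E(1) by (simp_all add: field_simps)
    moreover have "(c / E) / (d / E) = c / d" for c d using E(1) by (cases "d = 0") (simp_all add: field_simps)
    ultimately have "(E - 1 / E) / (E + 1 / E) = (E * E - 1) / (E * E + 1)" by (simp only:)
    moreover have "v (g y) * (E * E + 1) = 2 * k * (E * E - 1)" using EE by (simp add: algebra_simps)
    then have "v (g y) = 2 * k * ((E * E - 1) / (E * E + 1))" using nz by (simp add: field_simps)
    ultimately show ?thesis unfolding E(2) E_def[symmetric] by simp
  qed
  show thesis
  proof (rule that[OF frW W(1) _ r(1) W(4) _ k, of "m z0"])
    show "(G \<circ> \<phi>) q = 0" using G0 by simp
    show "W \<subseteq> U1_part M A f \<xi>" using W(2) D'(3) fr(3) by blast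
    fix i z assume z: "z \<in> ball (0::real^2) r"
    show "a (g z) = 1" "b (g z) = 0" using ab[OF gB[OF z]] by auto
    show "pd i g z $ 1 * \<theta> 1 (g z) + pd i g z $ 2 * \<theta> 2 (g z) = (if i = 2 then 1 else 0)" by (rule w2[OF z])
    show "pd i g z $ 1 * p 1 (g z) + pd i g z $ 2 * p 2 (g z) = - (2 * k * ((exp (k * (z $ 2 + H * z $ 1 + m z0)) - exp (- (k * (z $ 2 + H * z $ 1 + m z0))))
        / (exp (k * (z $ 2 + H * z $ 1 + m z0)) + exp (- (k * (z $ 2 + H * z $ 1 + m z0)))))) * (pd i g z $ 1 * \<theta> 1 (g z) + pd i g z $ 2 * \<theta> 2 (g z))"
      unfolding vg[OF z, symmetric] pv[OF gB[OF z]] by (simp add: algebra_simps)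
  qed
qed

text \<open>In these coordinates $\partial_1 Y = 0$ and $\partial_2 Y = v Y + \xi$, and $f + \xi/H = c_0$ is constant. Hence
  $f - c_0 = \frac1H (v Y - \partial_2 Y)$, which is the model with $v = \partial_2 u$ and the curve \<open>Y\<close>. The curve is
  continued to the whole line by its differential equation. The determinant of $(X, Y, \xi)$ is 1 or -1, which decides
  whether \<open>f\<close> or \<open>- f\<close> is equivalent to the model.\<close>

lemma U1_proper:
  assumes H: "H \<noteq> 0" and q: "q \<in> U1_part M A f \<xi>"
  shows "\<exists>W \<Omega> g. openin M W \<and> q \<in> W \<and> W \<subseteq> U1_part M A f \<xi> \<and> ruled_proper_model H \<Omega> g \<and>
     equiaff_equiv_or_mirror (subtopology M W) (restrict_atlas A W) f (top_of_set \<Omega>) (std_atlas \<Omega>) g"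
proof -
  obtain W \<gamma> r k m X Y \<theta> \<omega> p a b where fr: "framed (W, \<gamma>) X Y \<theta> \<omega> p a b" "q \<in> W" "W \<subseteq> U1_part M A f \<xi>" "r > 0" "\<gamma> ` W = ball 0 r" "k > 0" and q0: "\<gamma> q = 0"
    and ab: "\<And>z. z \<in> ball 0 r \<Longrightarrow> a z = 1" "\<And>z. z \<in> ball 0 r \<Longrightarrow> b z = 0"
    and th: "\<And>i z. z \<in> ball 0 r \<Longrightarrow> \<theta> i z = (if i = 2 then 1 else 0)"
    and p: "\<And>i z. z \<in> ball 0 r \<Longrightarrow> p i z = - (2 * k * ((exp (k * (z $ 2 + H * z $ 1 + m)) - exp (- (k * (z $ 2 + H * z $ 1 + m))))
        / (exp (k * (z $ 2 + H * z $ 1 + m)) + exp (- (k * (z $ 2 + H * z $ 1 + m)))))) * \<theta> i z"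
    by (rule U1_proper_chart[OF H q]) (rule that; assumption)
  define F N where "F = in_chart (W, \<gamma>) f" and "N = in_chart (W, \<gamma>) \<xi>"
  define B where "B = (ball 0 r :: (real^2) set)"
  interpret null_frame H B F N X Y \<theta> \<omega> p a b
    using framed_null_frame[OF fr(1)] by (simp add: B_def F_def N_def fr(5))
  note th = th[folded B_def] and ab = ab[folded B_def]
  have conv: "convex B" by (simp add: B_def)
  define v where "v = (\<lambda>z::real^2. 2 * k * ((exp (k * (z $ 2 + H * z $ 1 + m)) - exp (- (k * (z $ 2 + H * z $ 1 + m))))
        / (exp (k * (z $ 2 + H * z $ 1 + m)) + exp (- (k * (z $ 2 + H * z $ 1 + m))))))"
  define u where "u = (\<lambda>z::real^2. 2 * ln (exp (k * (z $ 2 + H * z $ 1 + m)) + exp (- (k * (z $ 2 + H * z $ 1 + m)))) - ln (8 * k\<^sup>2))"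
  have su: "smooth_on UNIV u" and sv: "smooth_on UNIV v" and u2: "pd 2 u z = v z" and v1: "pd 1 v z = H * exp (- u z)" for z
    using liouville_potential[OF fr(6), where H = H and m = m] by (simp_all only: u_def v_def)
  have pv: "p i z = (if i = 2 then - v z else 0)" if "z \<in> B" for i z
    using p[of z i] th[OF that, of i] that by (simp add: B_def v_def)
  have Y1: "pd 1 Y z = 0" if z: "z \<in> B" for z by (simp add: dY[OF z] ab[OF z] pv[OF z] th[OF z])
  have d2: "pd 2 Y z = v z *\<^sub>R Y z + N z" "pd 2 N z = - (H *\<^sub>R X z) - (H * \<omega> 2 z) *\<^sub>R Y z"
    "pd 2 X z = - (v z *\<^sub>R X z) + Y z + \<omega> 2 z *\<^sub>R N z" if z: "z \<in> B" for z
    by (simp_all add: dY[OF z] dX[OF z] dxi[OF z] ab[OF z] pv[OF z] th[OF z])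
  define J where "J = {-r<..<r}"
  have oJ: "open J" and J0: "0 \<in> J" using fr(4) by (auto simp: J_def)
  have inB: "vector [0, t] \<in> B" if "t \<in> J" for t
    using that by (auto simp: B_def J_def norm_vec_def L2_set_def sum_2)
  define \<zeta> n x \<rho> w where "\<zeta> = (\<lambda>t. Y (vector [0, t]))" and "n = (\<lambda>t. N (vector [0, t]))" and "x = (\<lambda>t. X (vector [0, t]))"
    and "\<rho> = (\<lambda>t. \<omega> 2 (vector [0, t]))" and "w = (\<lambda>t. v (vector [0, t]))"
  note defs = \<zeta>_def n_def x_def \<rho>_def w_def
  have sl: "smooth_on J \<zeta>" "smooth_on J \<rho>" "smooth_on J w"
    unfolding defs using smooth_on_slice[OF open_S smooth_Y oJ inB] smooth_on_slice[OF open_S smooth_omega oJ inB]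
      smooth_on_slice[OF open_UNIV sv oJ UNIV_I] by blast+
  have d\<zeta>: "(\<zeta> has_vector_derivative w t *\<^sub>R \<zeta> t + n t) (at t)" and dn: "(n has_vector_derivative - (H *\<^sub>R x t) - (H * \<rho> t) *\<^sub>R \<zeta> t) (at t)"
    and dx: "(x has_vector_derivative - (w t *\<^sub>R x t) + \<zeta> t + \<rho> t *\<^sub>R n t) (at t)" if t: "t \<in> J" for t
    using slice_derivative[OF diffable(4)[OF inB[OF t]]] slice_derivative[OF diffable(2)[OF inB[OF t]]] slice_derivative[OF diffable(3)[OF inB[OF t]]]
    unfolding d2[OF inB[OF t]] defs .
  define c where "c = (\<lambda>t. 2 * vd w t + w t * w t - 2 * H * \<rho> t)"
  have ode: "vd \<zeta> t = w t *\<^sub>R \<zeta> t + n t"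
    "vd (vd \<zeta>) t = (vd w t + w t * w t - H * \<rho> t) *\<^sub>R \<zeta> t + w t *\<^sub>R n t - H *\<^sub>R x t"
    "vd (vd (vd \<zeta>)) t = c t *\<^sub>R vd \<zeta> t + ((vd c t - 2 * H) / 2) *\<^sub>R \<zeta> t" if "t \<in> J" for t
    by (rule frame_curve_third_order[OF oJ sl(3,2) d\<zeta> dn dx c_def that]; assumption)+
  have sc: "smooth_on J c" unfolding c_def by (intro smooth_intros oJ sl)
  obtain c' \<zeta>' where ext: "smooth_on UNIV c'" "smooth_on UNIV \<zeta>'" "\<And>t. \<bar>t\<bar> < r / 2 \<Longrightarrow> \<zeta>' t = \<zeta> t"
    "\<And>t. vd (vd (vd \<zeta>')) t = c' t *\<^sub>R vd \<zeta>' t + ((vd c' t - 2 * H) / 2) *\<^sub>R \<zeta>' t"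
    using third_order_extension[OF fr(4) sc[unfolded J_def] sl(1)[unfolded J_def] ode(3)[unfolded J_def]] by blast
  define I where "I = {-(r/2)<..<r/2}"
  have I: "open I" "0 \<in> I" "I \<subseteq> J" using fr(4) by (auto simp: I_def J_def)
  have e0: "\<zeta>' t = \<zeta> t" if "t \<in> I" for t using ext(3)[of t] that by (auto simp: I_def)
  have e1: "vd \<zeta>' t = vd \<zeta> t" if "t \<in> I" for t by (rule vd_cong[OF I(1) that e0])
  have e2: "vd (vd \<zeta>') t = vd (vd \<zeta>) t" if "t \<in> I" for t by (rule vd_cong[OF I(1) that e1])
  \<comment> \<open>at 0 the determinant of \<open>\<zeta>\<close> and its first two derivatives is \<open>\<epsilon> H\<close>, so the sign makes it \<open>H\<close> for \<open>\<eta>\<close>\<close>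
  define \<epsilon> where "\<epsilon> = - det3 (x 0) (\<zeta> 0) (n 0)"
  have \<epsilon>: "\<epsilon> = 1 \<or> \<epsilon> = - 1" using det_frame[OF inB[OF J0]] by (auto simp: \<epsilon>_def defs abs_if split: if_splits)
  then have \<epsilon>2: "\<epsilon> * \<epsilon> = 1" by auto
  define \<eta> where "\<eta> = (\<lambda>t. \<epsilon> *\<^sub>R \<zeta>' t)"
  have s\<eta>: "smooth_on UNIV \<zeta>'" "smooth_on UNIV (vd \<zeta>')" "smooth_on UNIV (vd (vd \<zeta>'))" by (intro smooth_intros open_UNIV ext)+
  have vs: "vd (\<lambda>t. \<epsilon> *\<^sub>R h t) t = \<epsilon> *\<^sub>R vd h t" if "smooth_on UNIV h" for h :: "real \<Rightarrow> real^3" and t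
    by (intro vd_eqI bounded_linear.has_vector_derivative[OF bounded_linear_scaleR_right] has_vector_derivative_vd[OF that UNIV_I])
  have \<eta>1: "vd \<eta> = (\<lambda>t. \<epsilon> *\<^sub>R vd \<zeta>' t)" unfolding \<eta>_def by (rule HOL.ext, rule vs[OF s\<eta>(1)])
  have \<eta>2: "vd (vd \<eta>) = (\<lambda>t. \<epsilon> *\<^sub>R vd (vd \<zeta>') t)" unfolding \<eta>1 by (rule HOL.ext, rule vs[OF s\<eta>(2)])
  have \<eta>3: "vd (vd (vd \<eta>)) = (\<lambda>t. \<epsilon> *\<^sub>R vd (vd (vd \<zeta>')) t)" unfolding \<eta>2 by (rule HOL.ext, rule vs[OF s\<eta>(3)])
  have det0: "det3 (\<eta> 0) (vd \<eta> 0) (vd (vd \<eta>) 0) = H"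
  proof -
    have "det3 (\<eta> 0) (vd \<eta> 0) (vd (vd \<eta>) 0) = \<epsilon> * \<epsilon> * \<epsilon> * det3 (\<zeta> 0) (vd \<zeta> 0) (vd (vd \<zeta>) 0)"
      unfolding \<eta>2 unfolding \<eta>1 unfolding \<eta>_def e0[OF I(2)] e1[OF I(2)] e2[OF I(2)] by (simp add: det3_expand algebra_simps)
    also have "det3 (\<zeta> 0) (vd \<zeta> 0) (vd (vd \<zeta>) 0) = H * \<epsilon>"
      unfolding ode(2)[OF J0] ode(1)[OF J0] \<epsilon>_def by (simp add: det3_expand algebra_simps)
    finally show ?thesis using \<epsilon>2 by (simp add: algebra_simps)
  qed
  define \<Omega> where "\<Omega> = (ball 0 (r / 2) :: (real^2) set)"
  have \<Omega>: "open \<Omega>" "\<Omega> \<subseteq> \<gamma> ` W" "\<Omega> \<subseteq> B" using fr(4,5) by (auto simp: \<Omega>_def B_def)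
  define g where "g = (\<lambda>z. (1 / H) *\<^sub>R (pd 2 u z *\<^sub>R \<eta> (z $ 2) - vd \<eta> (z $ 2)))"
  have "ruled_proper_model H \<Omega> g"
    unfolding ruled_proper_model_def
  proof (rule conjI[OF \<Omega>(1)], rule exI[of _ u], rule exI[of _ \<eta>], rule exI[of _ c'], rule exI[of _ "\<lambda>t. (vd c' t - 2 * H) / 2"],
      intro conjI ballI allI)
    show "smooth_on UNIV (\<lambda>t. (vd c' t - 2 * H) / 2)" by (intro smooth_intros open_UNIV ext) simp
    show "pd 1 (pd 2 u) z = H * exp (- u z)" for z
    proof -
      have "pd 2 u = v" by (rule HOL.ext) (rule u2)
      then show ?thesis using v1[of z] by simp
    qed
    show "vd (vd (vd \<eta>)) t = c' t *\<^sub>R vd \<eta> t + ((vd c' t - 2 * H) / 2) *\<^sub>R \<eta> t" for t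
      unfolding \<eta>3 unfolding \<eta>1 unfolding \<eta>_def ext(4) by (simp add: scaleR_add_right mult.commute)
    show "smooth_on UNIV \<eta>" unfolding \<eta>_def by (intro smooth_intros open_UNIV ext)
    show "vd c' t - 2 * ((vd c' t - 2 * H) / 2) = 2 * H" for t by (simp add: field_simps)
    show "det3 (\<eta> 0) (vd \<eta> 0) (vd (vd \<eta>) 0) = H" by (rule det0)
  qed (use ext(1) smooth_on_subset[OF su] in \<open>auto simp: g_def\<close>)
  moreover have "equiaff_equiv_or_mirror (subtopology M (W \<inter> \<gamma> -` \<Omega>)) (restrict_atlas A (W \<inter> \<gamma> -` \<Omega>)) f (top_of_set \<Omega>) (std_atlas \<Omega>) g"
  proof -
    define c0 where "c0 = F 0 + (1 / H) *\<^sub>R N 0"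
    have B0: "0 \<in> B" using fr(4) by (simp add: B_def)
    have Fc: "F z + (1 / H) *\<^sub>R N z = c0" if z: "z \<in> B" for z
    proof -
      have s: "smooth_on B (\<lambda>z. (1 / H) *\<^sub>R N z)" "smooth_on B (\<lambda>z. F z + (1 / H) *\<^sub>R N z)" by (intro smooth_intros open_S smooth_F smooth_xi)+
      have "pd i (\<lambda>z. F z + (1 / H) *\<^sub>R N z) z = 0" if z: "z \<in> B" for i z
        using H pd_add[OF diffable(1)[OF z] smooth_on_differentiable[OF s(1) z], of i] pd_linear[OF bounded_linear_scaleR_right diffable(2)[OF z], of i "1 / H"]
        by (simp add: dF[OF z] dxi[OF z] algebra_simps)
      then show ?thesis
        unfolding c0_def by (intro constant_on_convex_pd[OF conv open_S _ _ z B0] smooth_on_differentiable[OF s(2)])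
    qed
    have comp: "z $ 2 \<in> J" if "z \<in> B" for z
      using that component_le_norm_cart[of z 2] by (auto simp: B_def J_def abs_if split: if_splits)
    have Y\<zeta>: "Y z = \<zeta> (z $ 2)" if "z \<in> B" for z
      unfolding \<zeta>_def by (rule independent_of_first[OF open_S conv smooth_Y Y1 that inB[OF comp[OF that]]]) simp_all
    have dY\<zeta>: "pd 2 Y z = vd \<zeta> (z $ 2)" if z: "z \<in> B" for z
      using pd_cong[OF open_S z, of Y "\<lambda>z. \<zeta> (z $ 2)" 2] Y\<zeta> pd_real_compose[of \<zeta> "vd \<zeta> (z $ 2)" "\<lambda>z. z $ 2" z 2]
        has_vector_derivative_vd[OF sl(1) comp[OF z]] by (simp add: pd_coord differentiable_nth)
    have gF: "g z = \<epsilon> *\<^sub>R (F z - c0)" if z: "z \<in> \<Omega>" for z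
    proof -
      have zB: "z \<in> B" using z \<Omega> by blast
      have zI: "z $ 2 \<in> I"
        using z component_le_norm_cart[of z 2] by (auto simp: \<Omega>_def I_def abs_if split: if_splits)
      have "g z = (1 / H) *\<^sub>R (v z *\<^sub>R \<epsilon> *\<^sub>R Y z - \<epsilon> *\<^sub>R pd 2 Y z)"
        unfolding g_def \<eta>1 u2 unfolding \<eta>_def by (simp add: e0[OF zI] e1[OF zI] Y\<zeta>[OF zB] dY\<zeta>[OF zB])
      also have "\<dots> = \<epsilon> *\<^sub>R (F z - (F z + (1 / H) *\<^sub>R N z))" unfolding d2(1)[OF zB] by (simp add: algebra_simps)
      finally show ?thesis unfolding Fc[OF zB] .
    qed
    note fr' = framed_restrict[OF fr(1) \<Omega>(1), unfolded fst_conv snd_conv, OF \<Omega>(2)]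
    have lc: "local_chart M A (W \<inter> \<gamma> -` \<Omega>, \<gamma>)" using fr'(1) by (simp add: framed_def)
    have inF: "in_chart (W \<inter> \<gamma> -` \<Omega>, \<gamma>) f z = F z" if z: "z \<in> \<Omega>" for z
    proof -
      have "z \<in> \<gamma> ` (W \<inter> \<gamma> -` \<Omega>)" using z fr'(2) by simp
      then obtain y where y: "y \<in> W" "\<gamma> y \<in> \<Omega>" "z = \<gamma> y" by blast
      show ?thesis
        using in_chart_apply[OF framed_chart[OF fr'(1)], of y f] in_chart_apply[OF framed_chart[OF fr(1)], of y f] y by (simp add: F_def)
    qed
    have inF': "in_chart (W \<inter> \<gamma> -` \<Omega>, \<gamma>) (\<lambda>p. - f p) z = - F z" if "z \<in> \<Omega>" for z
      using inF[OF that] by (simp add: in_chart_def)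
    from \<epsilon> show ?thesis
    proof
      assume 1: "\<epsilon> = 1"
      have "equiaff_equiv (subtopology M (W \<inter> \<gamma> -` \<Omega>)) (restrict_atlas A (W \<inter> \<gamma> -` \<Omega>)) f (top_of_set \<Omega>) (std_atlas \<Omega>) g"
        using equiaff_equiv_chart[OF atlas_chart lc, of "mat 1" g f "- c0"] fr'(2) by (simp add: 1 gF inF)
      then show ?thesis by (simp add: equiaff_equiv_or_mirror_def)
    next
      assume 1: "\<epsilon> = - 1"
      have "equiaff_equiv (subtopology M (W \<inter> \<gamma> -` \<Omega>)) (restrict_atlas A (W \<inter> \<gamma> -` \<Omega>)) (\<lambda>p. - f p) (top_of_set \<Omega>) (std_atlas \<Omega>) g"
        using equiaff_equiv_chart[OF atlas_chart lc, of "mat 1" g "\<lambda>p. - f p" c0] fr'(2) by (simp add: 1 gF inF')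
      then show ?thesis by (simp add: equiaff_equiv_or_mirror_def)
    qed
  qed
  moreover have "openin M (W \<inter> \<gamma> -` \<Omega>)"
    using framed_restrict(1)[OF fr(1) \<Omega>(1)] \<Omega>(2) by (auto simp: framed_def local_chart_def chart_on_def)
  moreover have "q \<in> W \<inter> \<gamma> -` \<Omega>" using fr(2,4) q0 by (simp add: \<Omega>_def)
  ultimately show ?thesis using fr(3) by blast
qed

end

section \<open>The structure of indefinite affine spheres\<close>

theorem theorem3:
  shows
   "(\<forall>(H::real) \<alpha> \<Omega> u.
       \<alpha> \<in> {-1, 1} \<and> open \<Omega> \<and> simply_connected \<Omega> \<and> smooth_on \<Omega> u \<and>
       (\<forall>x\<in>\<Omega>. wave_op u x = exp (- 2 * u x) * (\<alpha> * H + 2 * exp (6 * u x))) \<longrightarrow>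
       (\<exists>f \<xi>. sphere_of H \<alpha> \<Omega> u f \<xi>))
    \<and>
    (\<forall>(H::real) (M :: 'a topology) A f \<xi>.
       affine_sphere H M A f \<xi> \<and> indefinite_surface A f \<xi> \<longrightarrow>
       (\<exists>U V. openin M U \<and> openin M V \<and> U \<inter> V = {} \<and>
          U \<subseteq> {p \<in> topspace M. hCC A f \<xi> p = 0} \<and>
          V = V_part M A f \<xi> \<and>
          topspace M = U \<union> (M closure_of V) \<and>
          (\<forall>x0\<in>V. \<exists>W \<gamma> \<alpha> u.
             x0 \<in> W \<and> local_chart M A (W, \<gamma>) \<and> simply_connected (\<gamma> ` W) \<and>
             \<alpha> = sgn (hCC A f \<xi> x0) \<and> (\<forall>p\<in>W. sgn (hCC A f \<xi> p) = \<alpha>) \<and>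
             u = in_chart (W, \<gamma>) (\<lambda>p. 1/3 * ln (1/4 * sqrt (\<alpha> * hCC A f \<xi> p))) \<and>
             smooth_on (\<gamma> ` W) u \<and>
             (\<forall>x \<in> \<gamma> ` W. wave_op u x = exp (- 2 * u x) * (\<alpha> * H + 2 * exp (6 * u x))) \<and>
             (\<exists>g \<eta>. sphere_of H \<alpha> (\<gamma> ` W) u g \<eta> \<and>
                equiaff_equiv (subtopology M W) (restrict_atlas A W) f
                  (top_of_set (\<gamma> ` W)) (std_atlas (\<gamma> ` W)) g)) \<and>
          (let U0 = U0_part M A f \<xi>; U1 = U1_part M A f \<xi> in
             U0 \<union> U1 \<subseteq> U \<and> U \<subseteq> M closure_of (U0 \<union> U1) \<and>
             nonconvex_quadric (subtopology M U0) (restrict_atlas A U0) f \<xi> \<and>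
             (\<forall>x0\<in>U1. \<exists>W \<Omega> g. openin M W \<and> x0 \<in> W \<and> W \<subseteq> U1 \<and>
                (if H \<noteq> 0 then ruled_proper_model H \<Omega> g else ruled_improper_model \<Omega> g) \<and>
                equiaff_equiv_or_mirror (subtopology M W) (restrict_atlas A W) f
                  (top_of_set \<Omega>) (std_atlas \<Omega>) g))))"
proof (intro conjI allI impI)
  fix H \<alpha> :: real and \<Omega> u
  assume "\<alpha> \<in> {-1, 1} \<and> open \<Omega> \<and> simply_connected \<Omega> \<and> smooth_on \<Omega> u \<and>
       (\<forall>x\<in>\<Omega>. wave_op u x = exp (- 2 * u x) * (\<alpha> * H + 2 * exp (6 * u x)))"
  then show "\<exists>f \<xi>. sphere_of H \<alpha> \<Omega> u f \<xi>" using sphere_of_exists by blast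
next
  fix H :: real and M :: "'a topology" and A :: "'a chart set" and f \<xi> :: "'a \<Rightarrow> real^3"
  assume "affine_sphere H M A f \<xi> \<and> indefinite_surface A f \<xi>"
  then interpret indefinite_sphere H M A f \<xi> by unfold_locales blast+
  note null = interior_of_null_set
  have ruled: "\<exists>W \<Omega> g. openin M W \<and> q \<in> W \<and> W \<subseteq> U1_part M A f \<xi> \<and>
      (if H \<noteq> 0 then ruled_proper_model H \<Omega> g else ruled_improper_model \<Omega> g) \<and>
      equiaff_equiv_or_mirror (subtopology M W) (restrict_atlas A W) f (top_of_set \<Omega>) (std_atlas \<Omega>) g"
    if "q \<in> U1_part M A f \<xi>" for q
    using U1_proper[OF _ that] U1_improper[OF _ that] by (cases "H = 0") simp_all
  show "\<exists>U V. openin M U \<and> openin M V \<and> U \<inter> V = {} \<and>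
          U \<subseteq> {p \<in> topspace M. hCC A f \<xi> p = 0} \<and>
          V = V_part M A f \<xi> \<and>
          topspace M = U \<union> (M closure_of V) \<and>
          (\<forall>x0\<in>V. \<exists>W \<gamma> \<alpha> u.
             x0 \<in> W \<and> local_chart M A (W, \<gamma>) \<and> simply_connected (\<gamma> ` W) \<and>
             \<alpha> = sgn (hCC A f \<xi> x0) \<and> (\<forall>p\<in>W. sgn (hCC A f \<xi> p) = \<alpha>) \<and>
             u = in_chart (W, \<gamma>) (\<lambda>p. 1/3 * ln (1/4 * sqrt (\<alpha> * hCC A f \<xi> p))) \<and>
             smooth_on (\<gamma> ` W) u \<and>
             (\<forall>x \<in> \<gamma> ` W. wave_op u x = exp (- 2 * u x) * (\<alpha> * H + 2 * exp (6 * u x))) \<and>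
             (\<exists>g \<eta>. sphere_of H \<alpha> (\<gamma> ` W) u g \<eta> \<and>
                equiaff_equiv (subtopology M W) (restrict_atlas A W) f
                  (top_of_set (\<gamma> ` W)) (std_atlas (\<gamma> ` W)) g)) \<and>
          (let U0 = U0_part M A f \<xi>; U1 = U1_part M A f \<xi> in
             U0 \<union> U1 \<subseteq> U \<and> U \<subseteq> M closure_of (U0 \<union> U1) \<and>
             nonconvex_quadric (subtopology M U0) (restrict_atlas A U0) f \<xi> \<and>
             (\<forall>x0\<in>U1. \<exists>W \<Omega> g. openin M W \<and> x0 \<in> W \<and> W \<subseteq> U1 \<and>
                (if H \<noteq> 0 then ruled_proper_model H \<Omega> g else ruled_improper_model \<Omega> g) \<and>
                equiaff_equiv_or_mirror (subtopology M W) (restrict_atlas A W) f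
                  (top_of_set \<Omega>) (std_atlas \<Omega>) g))"
    unfolding Let_def
    by (rule exI[of _ "M interior_of {q \<in> topspace M. hCC A f \<xi> q = 0}"], rule exI[of _ "V_part M A f \<xi>"],
        intro conjI ballI null open_V V_chart U0_nonconvex_quadric ruled refl; assumption)
qed

end
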